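(* Let $R$ be a generically Gorenstein unmixed local ring of dimension $d\geq 1$, and let $M$ be a finitely generated $R$-module. Assume $M$ is horizontally linked to $\lambda M$. Then the following statements are equivalent: (i) $\operatorname{Ass}_R(M)\cap \operatorname{Ass}_R(\lambda M)=\emptyset$. (ii) $\operatorname{Ann}_R(M)$ is geometrically linked to $\operatorname{Ann}_R(\lambda M)$. (iii) $\operatorname{Ann}_R(M)$ is linked to $\operatorname{Ann}_R(\lambda M)$ and $\operatorname{Tor}^R_1(M,\lambda M)=0$. (iv) $M$ is free over $R/\operatorname{Ann}_R(M)$ and $\operatorname{Ext}^1_R(M,M)=0$.
   Context: All rings are commutative Noetherian local rings and all modules are finitely generated. $R$ is generically Gorenstein if $R_{\mathfrak p}$ is Gorenstein for all $\mathfrak p\in\operatorname{Ass}(R)$; $R$ is unmixed if $\operatorname{Ass}(R)$ consists of minimal primes of $R$. For a non-zero $R$-module $M$ with minimal free presentation $F_1\xrightarrow{f}F_0\to M\to 0$, put $\Omega M=\operatorname{Im}f$ and let $\operatorname{Tr}M$ be the cokernel of $f^*:\operatorname{Hom}_R(F_0,R)\to\operatorname{Hom}_R(F_1,R)$. Put $\lambda M=\Omega\operatorname{Tr}M$. A non-zero module $M$ is horizontally linked (to $\lambda M$) if $M\cong\lambda(\lambda M)$. Two non-zero proper ideals $I,J$ of $R$ are linked (by the zero ideal) if $I=(0:_RJ)$ and $J=(0:_RI)$; they are geometrically linked if in addition $\operatorname{Ass}_R(R/I)\cap\operatorname{Ass}_R(R/J)=\emptyset$. *)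

theory Defs
  imports
    "HOL-Algebra.Module"
    "HOL-Algebra.QuotRing"
    "HOL-Algebra.Ring_Divisibility"
    "HOL-Library.Extended_Nat"
begin

text \<open>
  Rings and modules are the records of HOL-Algebra. A module record there extends a ring record,
  so each module built below also has to fill the fields \<open>mult\<close> and \<open>one\<close>; the locale
  \<open>module\<close> never refers to them and they are set to \<open>undefined\<close>.
\<close>


section \<open>Local rings, primes, dimension\<close>

definition local_noetherian_ring :: "('a, 'r) ring_scheme \<Rightarrow> bool" where
  "local_noetherian_ring R \<longleftrightarrow>
     cring R \<and> noetherian_ring R \<and> (\<exists>!I. maximalideal I R)"

definition max_ideal :: "('a, 'r) ring_scheme \<Rightarrow> 'a set" where
  "max_ideal R = (THE I. maximalideal I R)"

definition krull_dim :: "('a, 'r) ring_scheme \<Rightarrow> enat" where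
  "krull_dim R =
     (SUP n \<in> {n. \<exists>P :: nat \<Rightarrow> 'a set.
                   (\<forall>i\<le>n. primeideal (P i) R) \<and> (\<forall>i<n. P i \<subset> P (Suc i))}. enat n)"

definition minimal_prime :: "('a, 'r) ring_scheme \<Rightarrow> 'a set \<Rightarrow> bool" where
  "minimal_prime R p \<longleftrightarrow>
     primeideal p R \<and> (\<forall>q. primeideal q R \<and> q \<subseteq> p \<longrightarrow> q = p)"


section \<open>Modules and linear maps\<close>

definition ring_as_module :: "('a, 'r) ring_scheme \<Rightarrow> ('a, 'a) module" where
  "ring_as_module R =
     \<lparr>carrier = carrier R, mult = undefined, one = undefined,
      zero = zero R, add = add R, smult = mult R\<rparr>"

definition fin_gen :: "('a, 'r) ring_scheme \<Rightarrow> ('a, 'b, 'm) module_scheme \<Rightarrow> bool" where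
  "fin_gen R M \<longleftrightarrow>
     (\<exists>X. finite X \<and> X \<subseteq> carrier M \<and> (\<forall>N. submodule N R M \<and> X \<subseteq> N \<longrightarrow> N = carrier M))"

definition zero_module :: "('b, 'm) ring_scheme \<Rightarrow> bool" where
  "zero_module M \<longleftrightarrow> carrier M = {\<zero>\<^bsub>M\<^esub>}"

definition submodule_span ::
    "('a, 'r) ring_scheme \<Rightarrow> ('a, 'b, 'm) module_scheme \<Rightarrow> 'b set \<Rightarrow> 'b set" where
  "submodule_span R M X = \<Inter>{N. submodule N R M \<and> X \<subseteq> N}"

definition ideal_times ::
    "('a, 'r) ring_scheme \<Rightarrow> 'a set \<Rightarrow> ('a, 'b, 'm) module_scheme \<Rightarrow> 'b set" where
  "ideal_times R I M = submodule_span R M {a \<odot>\<^bsub>M\<^esub> x | a x. a \<in> I \<and> x \<in> carrier M}"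

definition lin_maps ::
    "('a, 'r) ring_scheme \<Rightarrow> ('a, 'b, 'm) module_scheme \<Rightarrow> ('a, 'c, 'n) module_scheme
      \<Rightarrow> ('b \<Rightarrow> 'c) set" where
  "lin_maps R M N =
     {f \<in> carrier M \<rightarrow> carrier N.
        (\<forall>x\<in>carrier M. \<forall>y\<in>carrier M. f (x \<oplus>\<^bsub>M\<^esub> y) = f x \<oplus>\<^bsub>N\<^esub> f y) \<and>
        (\<forall>a\<in>carrier R. \<forall>x\<in>carrier M. f (a \<odot>\<^bsub>M\<^esub> x) = a \<odot>\<^bsub>N\<^esub> f x)}"

definition mod_iso ::
    "('a, 'r) ring_scheme \<Rightarrow> ('a, 'b, 'm) module_scheme \<Rightarrow> ('a, 'c, 'n) module_scheme \<Rightarrow> bool" where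
  "mod_iso R M N \<longleftrightarrow> (\<exists>f\<in>lin_maps R M N. bij_betw f (carrier M) (carrier N))"

definition quot_module ::
    "('a, 'r) ring_scheme \<Rightarrow> ('a, 'b, 'm) module_scheme \<Rightarrow> 'b set \<Rightarrow> ('a, 'b set) module" where
  "quot_module R M N =
     \<lparr>carrier = a_rcosets\<^bsub>M\<^esub> N, mult = undefined, one = undefined,
      zero = N, add = set_add M,
      smult = (\<lambda>a X. \<Union>x\<in>X. N +>\<^bsub>M\<^esub> (a \<odot>\<^bsub>M\<^esub> x))\<rparr>"

text \<open>
  The free module on a set of basis indices, as finitely supported extensional functions.
  In particular \<open>free_rank R n\<close> is $R^n$.
\<close>

definition free_module :: "('a, 'r) ring_scheme \<Rightarrow> 's set \<Rightarrow> ('a, 's \<Rightarrow> 'a) module" where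
  "free_module R S =
     \<lparr>carrier = {\<phi> \<in> S \<rightarrow>\<^sub>E carrier R. finite {s\<in>S. \<phi> s \<noteq> \<zero>\<^bsub>R\<^esub>}},
      mult = undefined, one = undefined,
      zero = (\<lambda>s\<in>S. \<zero>\<^bsub>R\<^esub>), add = (\<lambda>\<phi> \<psi>. \<lambda>s\<in>S. \<phi> s \<oplus>\<^bsub>R\<^esub> \<psi> s),
      smult = (\<lambda>a \<phi>. \<lambda>s\<in>S. a \<otimes>\<^bsub>R\<^esub> \<phi> s)\<rparr>"

abbreviation free_rank :: "('a, 'r) ring_scheme \<Rightarrow> nat \<Rightarrow> ('a, nat \<Rightarrow> 'a) module" where
  "free_rank R n \<equiv> free_module R {..<n}"

definition basis_vec :: "('a, 'r) ring_scheme \<Rightarrow> 's set \<Rightarrow> 's \<Rightarrow> 's \<Rightarrow> 'a" where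
  "basis_vec R S s = (\<lambda>t\<in>S. if t = s then \<one>\<^bsub>R\<^esub> else \<zero>\<^bsub>R\<^esub>)"

text \<open>A module is free if it has a basis.\<close>

definition is_free :: "('a, 'r) ring_scheme \<Rightarrow> ('a, 'b, 'm) module_scheme \<Rightarrow> bool" where
  "is_free R M \<longleftrightarrow>
     (\<exists>B \<subseteq> carrier M.
        bij_betw (\<lambda>\<phi>. \<Oplus>\<^bsub>M\<^esub>b\<in>{b\<in>B. \<phi> b \<noteq> \<zero>\<^bsub>R\<^esub>}. \<phi> b \<odot>\<^bsub>M\<^esub> b)
          (carrier (free_module R B)) (carrier M))"

definition hom_module ::
    "('a, 'r) ring_scheme \<Rightarrow> ('a, 'b, 'm) module_scheme \<Rightarrow> ('a, 'c, 'n) module_scheme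
      \<Rightarrow> ('a, 'b \<Rightarrow> 'c) module" where
  "hom_module R M N =
     \<lparr>carrier = lin_maps R M N \<inter> extensional (carrier M), mult = undefined, one = undefined,
      zero = (\<lambda>x\<in>carrier M. \<zero>\<^bsub>N\<^esub>),
      add = (\<lambda>f g. \<lambda>x\<in>carrier M. f x \<oplus>\<^bsub>N\<^esub> g x),
      smult = (\<lambda>a f. \<lambda>x\<in>carrier M. a \<odot>\<^bsub>N\<^esub> f x)\<rparr>"

text \<open>Precomposition with a linear map \<open>f\<close> whose source is \<open>M\<close>.\<close>

definition precomp :: "('b, 'm) ring_scheme \<Rightarrow> ('b \<Rightarrow> 'c) \<Rightarrow> ('c \<Rightarrow> 'd) \<Rightarrow> 'b \<Rightarrow> 'd" where
  "precomp M f g = (\<lambda>x\<in>carrier M. g (f x))"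


section \<open>Annihilators and associated primes\<close>

definition Ann :: "('a, 'r) ring_scheme \<Rightarrow> ('a, 'b, 'm) module_scheme \<Rightarrow> 'a set" where
  "Ann R M = {a \<in> carrier R. \<forall>x\<in>carrier M. a \<odot>\<^bsub>M\<^esub> x = \<zero>\<^bsub>M\<^esub>}"

definition Ass :: "('a, 'r) ring_scheme \<Rightarrow> ('a, 'b, 'm) module_scheme \<Rightarrow> 'a set set" where
  "Ass R M =
     {p. primeideal p R \<and>
         (\<exists>x\<in>carrier M. p = {a \<in> carrier R. a \<odot>\<^bsub>M\<^esub> x = \<zero>\<^bsub>M\<^esub>})}"

definition unmixed :: "('a, 'r) ring_scheme \<Rightarrow> bool" where
  "unmixed R \<longleftrightarrow> (\<forall>p\<in>Ass R (ring_as_module R). minimal_prime R p)"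

text \<open>
  \<open>M\<close> as a module over \<open>R Quot I\<close>, meaningful when \<open>I \<subseteq> Ann R M\<close>: then all representatives
  \<open>a\<close> of a residue class \<open>X\<close> act on \<open>M\<close> in the same way.
\<close>

definition over_quot ::
    "('a, 'r) ring_scheme \<Rightarrow> ('a, 'b, 'm) module_scheme \<Rightarrow> ('a set, 'b) module" where
  "over_quot R M =
     \<lparr>carrier = carrier M, mult = undefined, one = undefined,
      zero = zero M, add = add M,
      smult = (\<lambda>X x. THE y. \<forall>a\<in>X. y = a \<odot>\<^bsub>M\<^esub> x)\<rparr>"


section \<open>Localization and Gorenstein rings\<close>

text \<open>
  \<open>fraction R S a s\<close> is the fraction $a/s$, the class of $(a,s)$ under the usual equivalence relation
  on $R \times S$. The unions defining the operations run over sets that are all equal.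
\<close>

definition fraction :: "('a, 'r) ring_scheme \<Rightarrow> 'a set \<Rightarrow> 'a \<Rightarrow> 'a \<Rightarrow> ('a \<times> 'a) set" where
  "fraction R S a s =
     {(b, t). b \<in> carrier R \<and> t \<in> S \<and>
        (\<exists>u\<in>S. u \<otimes>\<^bsub>R\<^esub> (t \<otimes>\<^bsub>R\<^esub> a \<ominus>\<^bsub>R\<^esub> s \<otimes>\<^bsub>R\<^esub> b) = \<zero>\<^bsub>R\<^esub>)}"

definition frac_ring :: "('a, 'r) ring_scheme \<Rightarrow> 'a set \<Rightarrow> ('a \<times> 'a) set ring" where
  "frac_ring R S =
     \<lparr>carrier = {fraction R S a s | a s. a \<in> carrier R \<and> s \<in> S},
      mult = (\<lambda>X Y. \<Union>(a, s)\<in>X. \<Union>(b, t)\<in>Y. fraction R S (a \<otimes>\<^bsub>R\<^esub> b) (s \<otimes>\<^bsub>R\<^esub> t)),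
      one = fraction R S \<one>\<^bsub>R\<^esub> \<one>\<^bsub>R\<^esub>,
      zero = fraction R S \<zero>\<^bsub>R\<^esub> \<one>\<^bsub>R\<^esub>,
      add = (\<lambda>X Y. \<Union>(a, s)\<in>X. \<Union>(b, t)\<in>Y.
               fraction R S (t \<otimes>\<^bsub>R\<^esub> a \<oplus>\<^bsub>R\<^esub> s \<otimes>\<^bsub>R\<^esub> b) (s \<otimes>\<^bsub>R\<^esub> t))\<rparr>"

definition localization :: "('a, 'r) ring_scheme \<Rightarrow> 'a set \<Rightarrow> ('a \<times> 'a) set ring" where
  "localization R p = frac_ring R (carrier R - p)"

text \<open>
  A local ring is Gorenstein if it has finite injective dimension over itself. Modules have to live
  on a fixed type here, and \<open>nat \<Rightarrow> 'a\<close> is large enough for that to be harmless for a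
  local Noetherian ring \<open>R\<close>.
  For the test modules in \<open>injective_module\<close> this is Baer's criterion, since all ideals of \<open>R\<close>
  have copies inside \<open>free_rank R 1\<close>. For the terms of the resolution, a module of cardinality at
  most $\kappa \geq \max(|R|,\aleph_0)$ over a Noetherian ring embeds into an injective module
  of cardinality at most $\kappa$, so a ring of finite injective dimension has a finite
  injective resolution by modules of cardinality at most $\max(|R|,\aleph_0)$, which is at most
  the cardinality of \<open>nat \<Rightarrow> 'a\<close>.
\<close>

definition injective_module ::
    "('a, 'r) ring_scheme \<Rightarrow> ('a, 'b, 'm) module_scheme \<Rightarrow> bool" where
  "injective_module R E \<longleftrightarrow>
     module R E \<and>
     (\<forall>(A :: ('a, nat \<Rightarrow> 'a) module) (B :: ('a, nat \<Rightarrow> 'a) module) f g.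
        module R A \<and> module R B \<and> f \<in> lin_maps R A B \<and> inj_on f (carrier A) \<and>
        g \<in> lin_maps R A E \<longrightarrow>
        (\<exists>h\<in>lin_maps R B E. \<forall>x\<in>carrier A. h (f x) = g x))"

definition finite_self_injdim :: "('a, 'r) ring_scheme \<Rightarrow> bool" where
  "finite_self_injdim R \<longleftrightarrow>
     (\<exists>(E :: nat \<Rightarrow> ('a, nat \<Rightarrow> 'a) module) \<epsilon> \<delta> n.
        (\<forall>i. injective_module R (E i)) \<and>
        \<epsilon> \<in> lin_maps R (ring_as_module R) (E 0) \<and>
        (\<forall>i. \<delta> i \<in> lin_maps R (E i) (E (Suc i))) \<and>
        inj_on \<epsilon> (carrier R) \<and>
        \<epsilon> ` carrier R = a_kernel (E 0) (E 1) (\<delta> 0) \<and>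
        (\<forall>i. \<delta> i ` carrier (E i) = a_kernel (E (Suc i)) (E (Suc (Suc i))) (\<delta> (Suc i))) \<and>
        (\<forall>i>n. zero_module (E i)))"

definition gorenstein_local_ring :: "('a, 'r) ring_scheme \<Rightarrow> bool" where
  "gorenstein_local_ring R \<longleftrightarrow> local_noetherian_ring R \<and> finite_self_injdim R"

definition generically_gorenstein :: "('a, 'r) ring_scheme \<Rightarrow> bool" where
  "generically_gorenstein R \<longleftrightarrow>
     (\<forall>p\<in>Ass R (ring_as_module R). gorenstein_local_ring (localization R p))"


section \<open>Tensor products\<close>

definition tensor_relations ::
    "('a, 'r) ring_scheme \<Rightarrow> ('a, 'b, 'm) module_scheme \<Rightarrow> ('a, 'c, 'n) module_scheme
      \<Rightarrow> ('b \<times> 'c \<Rightarrow> 'a) set" where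
  "tensor_relations R M N =
     (let S = carrier M \<times> carrier N; P = free_module R S; e = (\<lambda>x y. basis_vec R S (x, y)) in
      {e (x \<oplus>\<^bsub>M\<^esub> x') y \<ominus>\<^bsub>P\<^esub> (e x y \<oplus>\<^bsub>P\<^esub> e x' y)
        | x x' y. x \<in> carrier M \<and> x' \<in> carrier M \<and> y \<in> carrier N} \<union>
      {e x (y \<oplus>\<^bsub>N\<^esub> y') \<ominus>\<^bsub>P\<^esub> (e x y \<oplus>\<^bsub>P\<^esub> e x y')
        | x y y'. x \<in> carrier M \<and> y \<in> carrier N \<and> y' \<in> carrier N} \<union>
      {e (a \<odot>\<^bsub>M\<^esub> x) y \<ominus>\<^bsub>P\<^esub> a \<odot>\<^bsub>P\<^esub> e x y
        | a x y. a \<in> carrier R \<and> x \<in> carrier M \<and> y \<in> carrier N} \<union>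
      {e x (a \<odot>\<^bsub>N\<^esub> y) \<ominus>\<^bsub>P\<^esub> a \<odot>\<^bsub>P\<^esub> e x y
        | a x y. a \<in> carrier R \<and> x \<in> carrier M \<and> y \<in> carrier N})"

definition tensor_submodule ::
    "('a, 'r) ring_scheme \<Rightarrow> ('a, 'b, 'm) module_scheme \<Rightarrow> ('a, 'c, 'n) module_scheme
      \<Rightarrow> ('b \<times> 'c \<Rightarrow> 'a) set" where
  "tensor_submodule R M N =
     submodule_span R (free_module R (carrier M \<times> carrier N)) (tensor_relations R M N)"

definition tensor ::
    "('a, 'r) ring_scheme \<Rightarrow> ('a, 'b, 'm) module_scheme \<Rightarrow> ('a, 'c, 'n) module_scheme
      \<Rightarrow> ('a, ('b \<times> 'c \<Rightarrow> 'a) set) module" where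
  "tensor R M N =
     quot_module R (free_module R (carrier M \<times> carrier N)) (tensor_submodule R M N)"

definition pure_tensor ::
    "('a, 'r) ring_scheme \<Rightarrow> ('a, 'b, 'm) module_scheme \<Rightarrow> ('a, 'c, 'n) module_scheme
      \<Rightarrow> 'b \<Rightarrow> 'c \<Rightarrow> ('b \<times> 'c \<Rightarrow> 'a) set" where
  "pure_tensor R M N x y =
     tensor_submodule R M N +>\<^bsub>free_module R (carrier M \<times> carrier N)\<^esub>
       basis_vec R (carrier M \<times> carrier N) (x, y)"

text \<open>The map \<open>f\<close> \<open>\<otimes>\<close> \<open>N\<close> induced by a linear map \<open>f\<close> from \<open>M\<close> to \<open>M'\<close>.\<close>

definition tensor_map ::
    "('a, 'r) ring_scheme \<Rightarrow> ('a, 'b, 'm) module_scheme \<Rightarrow> ('a, 'd, 'p) module_scheme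
      \<Rightarrow> ('a, 'c, 'n) module_scheme \<Rightarrow> ('b \<Rightarrow> 'd)
      \<Rightarrow> ('b \<times> 'c \<Rightarrow> 'a) set \<Rightarrow> ('d \<times> 'c \<Rightarrow> 'a) set" where
  "tensor_map R M M' N f =
     (THE h. h \<in> carrier (hom_module R (tensor R M N) (tensor R M' N)) \<and>
        (\<forall>x\<in>carrier M. \<forall>y\<in>carrier N.
           h (pure_tensor R M N x y) = pure_tensor R M' N (f x) y))"


section \<open>Ext and Tor\<close>

text \<open>
  A resolution by free modules of finite rank: the term in degree \<open>i\<close> is \<open>free_rank R (r i)\<close>,
  and \<open>d i\<close> goes from degree \<open>i + 1\<close> to degree \<open>i\<close>. Ext and Tor are computed from a chosen one
  and do not depend on it up to isomorphism; one exists if \<open>M\<close> is finitely generated over a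
  Noetherian ring, the only case in which they are used.
\<close>

definition free_resolution ::
    "('a, 'r) ring_scheme \<Rightarrow> ('a, 'b, 'm) module_scheme
      \<Rightarrow> (nat \<Rightarrow> nat) \<Rightarrow> (nat \<Rightarrow> (nat \<Rightarrow> 'a) \<Rightarrow> (nat \<Rightarrow> 'a)) \<Rightarrow> bool" where
  "free_resolution R M r d \<longleftrightarrow>
     (\<forall>i. d i \<in> lin_maps R (free_rank R (r (Suc i))) (free_rank R (r i))) \<and>
     (\<forall>i. d (Suc i) ` carrier (free_rank R (r (Suc (Suc i)))) =
          a_kernel (free_rank R (r (Suc i))) (free_rank R (r i)) (d i)) \<and>
     (\<exists>e \<in> lin_maps R (free_rank R (r 0)) M.
        e ` carrier (free_rank R (r 0)) = carrier M \<and>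
        d 0 ` carrier (free_rank R (r 1)) = a_kernel (free_rank R (r 0)) M e)"

definition some_resolution ::
    "('a, 'r) ring_scheme \<Rightarrow> ('a, 'b, 'm) module_scheme
      \<Rightarrow> (nat \<Rightarrow> nat) \<times> (nat \<Rightarrow> (nat \<Rightarrow> 'a) \<Rightarrow> (nat \<Rightarrow> 'a))" where
  "some_resolution R M = (SOME (r, d). free_resolution R M r d)"

definition Ext ::
    "('a, 'r) ring_scheme \<Rightarrow> nat \<Rightarrow> ('a, 'b, 'm) module_scheme \<Rightarrow> ('a, 'c, 'n) module_scheme
      \<Rightarrow> ('a, ((nat \<Rightarrow> 'a) \<Rightarrow> 'c) set) module" where
  "Ext R i M N =
     (let (r, d) = some_resolution R M;
          C = (\<lambda>j. hom_module R (free_rank R (r j)) N);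
          D = (\<lambda>j. precomp (free_rank R (r (Suc j))) (d j));
          Z = a_kernel (C i) (C (Suc i)) (D i);
          B = (case i of 0 \<Rightarrow> {\<zero>\<^bsub>C 0\<^esub>} | Suc j \<Rightarrow> D j ` carrier (C j))
      in quot_module R ((C i)\<lparr>carrier := Z\<rparr>) B)"

definition Tor ::
    "('a, 'r) ring_scheme \<Rightarrow> nat \<Rightarrow> ('a, 'b, 'm) module_scheme \<Rightarrow> ('a, 'c, 'n) module_scheme
      \<Rightarrow> ('a, ((nat \<Rightarrow> 'a) \<times> 'c \<Rightarrow> 'a) set set) module" where
  "Tor R i M N =
     (let (r, d) = some_resolution R M;
          C = (\<lambda>j. tensor R (free_rank R (r j)) N);
          D = (\<lambda>j. tensor_map R (free_rank R (r (Suc j))) (free_rank R (r j)) N (d j));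
          Z = (case i of 0 \<Rightarrow> carrier (C 0) | Suc j \<Rightarrow> a_kernel (C (Suc j)) (C j) (D j));
          B = D i ` carrier (C (Suc i))
      in quot_module R ((C i)\<lparr>carrier := Z\<rparr>) B)"


section \<open>Horizontal linkage of modules\<close>

text \<open>
  $R^m \to R^n \to M \to 0$ with first map \<open>f\<close>. Minimality says that both \<open>free_rank R n\<close>
  and \<open>free_rank R m\<close> are free covers of minimal rank, of \<open>M\<close> and of the image of \<open>f\<close>.
\<close>

definition minimal_presentation ::
    "('a, 'r) ring_scheme \<Rightarrow> ('a, 'b, 'm) module_scheme
      \<Rightarrow> nat \<Rightarrow> nat \<Rightarrow> ((nat \<Rightarrow> 'a) \<Rightarrow> (nat \<Rightarrow> 'a)) \<Rightarrow> bool" where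
  "minimal_presentation R M m n f \<longleftrightarrow>
     f \<in> lin_maps R (free_rank R m) (free_rank R n) \<and>
     (\<exists>e \<in> lin_maps R (free_rank R n) M.
        e ` carrier (free_rank R n) = carrier M \<and>
        f ` carrier (free_rank R m) = a_kernel (free_rank R n) M e) \<and>
     f ` carrier (free_rank R m) \<subseteq> ideal_times R (max_ideal R) (free_rank R n) \<and>
     a_kernel (free_rank R m) (free_rank R n) f \<subseteq> ideal_times R (max_ideal R) (free_rank R m)"

definition some_presentation ::
    "('a, 'r) ring_scheme \<Rightarrow> ('a, 'b, 'm) module_scheme
      \<Rightarrow> nat \<times> nat \<times> ((nat \<Rightarrow> 'a) \<Rightarrow> (nat \<Rightarrow> 'a))" where
  "some_presentation R M = (SOME (m, n, f). minimal_presentation R M m n f)"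

text \<open>
  Minimal presentations of a finitely generated module over a local Noetherian ring exist and are
  unique up to isomorphism, so the following three modules are well defined up to isomorphism.
  The zero module has the presentation of ranks 0, whence \<open>lambda_mod R M\<close> is zero if \<open>M\<close> is free.
\<close>

definition Omega_mod ::
    "('a, 'r) ring_scheme \<Rightarrow> ('a, 'b, 'm) module_scheme \<Rightarrow> ('a, nat \<Rightarrow> 'a) module" where
  "Omega_mod R M =
     (let (m, n, f) = some_presentation R M
      in (free_rank R n)\<lparr>carrier := f ` carrier (free_rank R m)\<rparr>)"

definition Tr_mod ::
    "('a, 'r) ring_scheme \<Rightarrow> ('a, 'b, 'm) module_scheme
      \<Rightarrow> ('a, ((nat \<Rightarrow> 'a) \<Rightarrow> 'a) set) module" where
  "Tr_mod R M =
     (let (m, n, f) = some_presentation R M;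
          F0_dual = hom_module R (free_rank R n) (ring_as_module R);
          F1_dual = hom_module R (free_rank R m) (ring_as_module R)
      in quot_module R F1_dual (precomp (free_rank R m) f ` carrier F0_dual))"

definition lambda_mod ::
    "('a, 'r) ring_scheme \<Rightarrow> ('a, 'b, 'm) module_scheme \<Rightarrow> ('a, nat \<Rightarrow> 'a) module" where
  "lambda_mod R M = Omega_mod R (Tr_mod R M)"

definition horizontally_linked ::
    "('a, 'r) ring_scheme \<Rightarrow> ('a, 'b, 'm) module_scheme \<Rightarrow> bool" where
  "horizontally_linked R M \<longleftrightarrow>
     \<not> zero_module M \<and> mod_iso R M (lambda_mod R (lambda_mod R M))"


section \<open>Linkage of ideals\<close>

definition zero_colon :: "('a, 'r) ring_scheme \<Rightarrow> 'a set \<Rightarrow> 'a set" where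
  "zero_colon R J = {a \<in> carrier R. \<forall>b\<in>J. a \<otimes>\<^bsub>R\<^esub> b = \<zero>\<^bsub>R\<^esub>}"

definition linked :: "('a, 'r) ring_scheme \<Rightarrow> 'a set \<Rightarrow> 'a set \<Rightarrow> bool" where
  "linked R I J \<longleftrightarrow>
     ideal I R \<and> I \<noteq> {\<zero>\<^bsub>R\<^esub>} \<and> I \<noteq> carrier R \<and>
     ideal J R \<and> J \<noteq> {\<zero>\<^bsub>R\<^esub>} \<and> J \<noteq> carrier R \<and>
     I = zero_colon R J \<and> J = zero_colon R I"

definition geometrically_linked :: "('a, 'r) ring_scheme \<Rightarrow> 'a set \<Rightarrow> 'a set \<Rightarrow> bool" where
  "geometrically_linked R I J \<longleftrightarrow>
     linked R I J \<and>
     Ass R (quot_module R (ring_as_module R) I) \<inter> Ass R (quot_module R (ring_as_module R) J) = {}"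

end

theory Submission
  imports Defs
begin

text \<open>
  Let \<open>e : F \<rightarrow> M\<close> be a minimal free cover with kernel \<open>U\<close>, and let \<open>V\<close> be the annihilator of
  \<open>U\<close> under the dot product on \<open>F\<close>. Then \<open>\<lambda>M\<close> is \<open>F/V\<close>, and if \<open>M\<close> is linked then \<open>U\<close> is
  in turn the annihilator of \<open>V\<close>. Put \<open>I = Ann M\<close> and \<open>J = Ann \<lambda>M\<close>. Every condition of the theorem
  is equivalent to: no associated prime of \<open>R\<close> contains both \<open>I\<close> and \<open>J\<close>.

  If this holds, an element killed by both \<open>I\<close> and \<open>J\<close> is zero. It follows that \<open>I\<close> and \<open>J\<close> are linked
  and that \<open>U\<close> consists of the vectors with all coordinates in \<open>I\<close>, so \<open>M\<close> is free over \<open>R/I\<close>; Tor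
  and Ext vanish because the obstructions are killed by both ideals.

  Conversely let \<open>p\<close> be a minimal prime containing both \<open>I\<close> and \<open>J\<close>. Since \<open>R\<^sub>p\<close> is self-injective,
  functionals on submodules of finite free modules extend after multiplication by some \<open>s\<close> outside
  \<open>p\<close>. Vanishing of Tor thus yields a map \<open>h : F \<rightarrow> U\<close> that is multiplication by \<open>s\<close> on \<open>U\<close>. Its
  matrix entries lie in \<open>p = (J : x)\<close>, hence \<open>x h\<close> has entries in \<open>J\<close> and kills \<open>U\<close>, so \<open>s x\<close> lies
  in \<open>J\<close>, a contradiction. If instead \<open>M\<close> is free over \<open>R/I\<close>, there is a nonzero map from \<open>I\<close> to a
  copy of \<open>R/p\<close> inside \<open>M\<close>. It does not extend to \<open>R\<close>, because \<open>I\<close> kills \<open>M\<close>, and therefore gives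
  a nonzero class in \<open>Ext\<^sup>1(M, M)\<close>.
\<close>

section \<open>Linear maps\<close>

text \<open>The map \<open>h\<close> in the converse for Tor comes from duality. Vanishing of Tor
  says that U tensor N embeds into F tensor N, that is, into n copies of N. The dot product of U
  with F kills V, so it descends to a functional on U tensor N, and up to a multiplier s this
  extends to the n copies of N. Since N = F/V, a functional on them is a list of n vectors
  orthogonal to V, hence in U; these are the columns of \<open>h\<close>, and the extension property
  reads h(u) . w = s u . w.

  Gorenstein means finite injective dimension, not self-injectivity. As p is minimal, every nonzero
  cyclic module over the localization has a nonzero socle, and injectivity passes down a finite
  injective resolution, one cosyzygy at a time, until it reaches the ring.

  Modules are never localized. A statement at p is replaced by one that holds after multiplication
  by an element outside p, and finite generation supplies a single multiplier. Tor and Ext refer to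
  a chosen resolution that need not begin with the minimal cover, so maps have to be carried back
  and forth between two covers.\<close>

lemma lin_mapsI:
  assumes "\<And>x. x \<in> carrier P \<Longrightarrow> h x \<in> carrier Q"
    and "\<And>x y. x \<in> carrier P \<Longrightarrow> y \<in> carrier P \<Longrightarrow> h (x \<oplus>\<^bsub>P\<^esub> y) = h x \<oplus>\<^bsub>Q\<^esub> h y"
    and "\<And>a x. a \<in> carrier R \<Longrightarrow> x \<in> carrier P \<Longrightarrow> h (a \<odot>\<^bsub>P\<^esub> x) = a \<odot>\<^bsub>Q\<^esub> h x"
  shows "h \<in> lin_maps R P Q"
  using assms unfolding lin_maps_def by blast

lemma lin_closed: "h \<in> lin_maps R P Q \<Longrightarrow> x \<in> carrier P \<Longrightarrow> h x \<in> carrier Q"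
  and lin_add: "h \<in> lin_maps R P Q \<Longrightarrow> x \<in> carrier P \<Longrightarrow> y \<in> carrier P \<Longrightarrow>
    h (x \<oplus>\<^bsub>P\<^esub> y) = h x \<oplus>\<^bsub>Q\<^esub> h y"
  and lin_smult: "h \<in> lin_maps R P Q \<Longrightarrow> a \<in> carrier R \<Longrightarrow> x \<in> carrier P \<Longrightarrow>
    h (a \<odot>\<^bsub>P\<^esub> x) = a \<odot>\<^bsub>Q\<^esub> h x"
  unfolding lin_maps_def by auto

lemma lin_comp:
  assumes "h \<in> lin_maps R P Q" and "k \<in> lin_maps R Q T"
  shows "(\<lambda>x. k (h x)) \<in> lin_maps R P T"
  using assms by (auto intro!: lin_mapsI simp: lin_closed lin_add lin_smult)

lemma lin_id: "(\<lambda>x. x) \<in> lin_maps R P P"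
  by (auto intro!: lin_mapsI)

lemma lin_cong:
  assumes "h \<in> lin_maps R P Q" and "\<And>x. x \<in> carrier P \<Longrightarrow> k x = h x" and "module R P"
  shows "k \<in> lin_maps R P Q"
proof -
  interpret P: module R P by fact
  show ?thesis
    using assms(1) by (auto intro!: lin_mapsI simp: lin_closed lin_add lin_smult assms(2))
qed

lemma lin_zero:
  assumes "module R P" and "module R Q" and "h \<in> lin_maps R P Q"
  shows "h \<zero>\<^bsub>P\<^esub> = \<zero>\<^bsub>Q\<^esub>"
proof -
  interpret P: module R P by fact
  interpret Q: module R Q by fact
  have "h (\<zero>\<^bsub>R\<^esub> \<odot>\<^bsub>P\<^esub> \<zero>\<^bsub>P\<^esub>) = \<zero>\<^bsub>R\<^esub> \<odot>\<^bsub>Q\<^esub> h \<zero>\<^bsub>P\<^esub>"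
    using lin_smult[OF assms(3)] P.zero_closed P.R.zero_closed by blast
  then show ?thesis using lin_closed[OF assms(3)] by simp
qed

lemma lin_neg:
  assumes "module R P" and "module R Q" and "h \<in> lin_maps R P Q" and "x \<in> carrier P"
  shows "h (\<ominus>\<^bsub>P\<^esub> x) = \<ominus>\<^bsub>Q\<^esub> h x"
proof -
  interpret P: module R P by fact
  interpret Q: module R Q by fact
  have "h (\<ominus>\<^bsub>P\<^esub> x) \<oplus>\<^bsub>Q\<^esub> h x = \<zero>\<^bsub>Q\<^esub>"
    using assms lin_add[OF assms(3), of "\<ominus>\<^bsub>P\<^esub> x" x] lin_zero[OF assms(1-3)] by (simp add: P.M.l_neg)
  then show ?thesis using lin_closed[OF assms(3)] assms(4)
    by (metis P.M.a_inv_closed Q.M.minus_equality)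
qed

lemma lin_minus:
  assumes "module R P" and "module R Q" and "h \<in> lin_maps R P Q" and "x \<in> carrier P" and "y \<in> carrier P"
  shows "h (x \<ominus>\<^bsub>P\<^esub> y) = h x \<ominus>\<^bsub>Q\<^esub> h y"
proof -
  interpret P: module R P by fact
  show ?thesis using assms by (simp add: a_minus_def lin_add lin_neg)
qed

lemma lin_finsum:
  assumes "module R P" and "module R Q" and "h \<in> lin_maps R P Q" and "f \<in> S \<rightarrow> carrier P"
  shows "h (\<Oplus>\<^bsub>P\<^esub>i\<in>S. f i) = (\<Oplus>\<^bsub>Q\<^esub>i\<in>S. h (f i))"
proof -
  interpret P: module R P by fact
  interpret Q: module R Q by fact
  show ?thesis
  proof (cases "finite S")
    case True
    then show ?thesis using assms(4)
    proof (induction S)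
      case empty
      then show ?case using lin_zero[OF assms(1-3)] by simp
    next
      case (insert s S)
      then have "f \<in> S \<rightarrow> carrier P" "f s \<in> carrier P" by auto
      moreover from this have "(\<lambda>i. h (f i)) \<in> S \<rightarrow> carrier Q" "h (f s) \<in> carrier Q"
        using lin_closed[OF assms(3)] by auto
      ultimately show ?case using insert lin_add[OF assms(3)] by simp
    qed
  next
    case False
    then show ?thesis using lin_zero[OF assms(1-3)] by simp
  qed
qed

lemma lin_plus:
  assumes "module R Q" and "module R P" and "h \<in> lin_maps R P Q" and "k \<in> lin_maps R P Q"
  shows "(\<lambda>x. h x \<oplus>\<^bsub>Q\<^esub> k x) \<in> lin_maps R P Q"
proof -
  interpret P: module R P by fact
  interpret Q: module R Q by fact
  show ?thesis using assms(3,4)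
    by (intro lin_mapsI) (auto simp: lin_closed lin_add lin_smult Q.smult_r_distr Q.M.a_ac)
qed

lemma lin_scale:
  assumes "module R Q" and "module R P" and "h \<in> lin_maps R P Q" and "a \<in> carrier R"
  shows "(\<lambda>x. a \<odot>\<^bsub>Q\<^esub> h x) \<in> lin_maps R P Q"
proof -
  interpret P: module R P by fact
  interpret Q: module R Q by fact
  show ?thesis using assms(3,4)
    by (intro lin_mapsI)
      (auto simp: lin_closed lin_add lin_smult Q.smult_r_distr Q.smult_assoc1[symmetric] P.R.m_comm)
qed

lemma lin_diff:
  assumes "module R Q" and "module R P" and "h \<in> lin_maps R P Q" and "k \<in> lin_maps R P Q"
  shows "(\<lambda>x. h x \<ominus>\<^bsub>Q\<^esub> k x) \<in> lin_maps R P Q"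
proof -
  interpret P: module R P by fact
  interpret Q: module R Q by fact
  show ?thesis using assms(3,4)
    by (intro lin_mapsI)
      (auto simp: lin_closed lin_add lin_smult Q.smult_r_distr Q.M.a_ac a_minus_def
        Q.M.minus_add Q.smult_r_minus)
qed

section \<open>Submodules, kernels, images and spans\<close>

lemma submodule_mem:
  assumes "submodule N R P" and "module R P"
  shows "N \<subseteq> carrier P" and "\<zero>\<^bsub>P\<^esub> \<in> N"
    and "x \<in> N \<Longrightarrow> y \<in> N \<Longrightarrow> x \<oplus>\<^bsub>P\<^esub> y \<in> N"
    and "x \<in> N \<Longrightarrow> \<ominus>\<^bsub>P\<^esub> x \<in> N"
    and "x \<in> N \<Longrightarrow> y \<in> N \<Longrightarrow> x \<ominus>\<^bsub>P\<^esub> y \<in> N"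
    and "a \<in> carrier R \<Longrightarrow> x \<in> N \<Longrightarrow> a \<odot>\<^bsub>P\<^esub> x \<in> N"
proof -
  interpret P: module R P by fact
  note E = P.submoduleE[OF assms(1)]
  show "N \<subseteq> carrier P" "x \<in> N \<Longrightarrow> y \<in> N \<Longrightarrow> x \<oplus>\<^bsub>P\<^esub> y \<in> N" "x \<in> N \<Longrightarrow> \<ominus>\<^bsub>P\<^esub> x \<in> N"
    "a \<in> carrier R \<Longrightarrow> x \<in> N \<Longrightarrow> a \<odot>\<^bsub>P\<^esub> x \<in> N"
    using E by auto
  show "x \<in> N \<Longrightarrow> y \<in> N \<Longrightarrow> x \<ominus>\<^bsub>P\<^esub> y \<in> N" using E by (auto simp: a_minus_def)
  show "\<zero>\<^bsub>P\<^esub> \<in> N" using subgroup.one_closed[OF submodule.axioms(1)[OF assms(1)]] by simp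
qed

text \<open>Negatives come for free as multiples by \<open>\<ominus> \<one>\<close>.\<close>

lemma submoduleI':
  assumes "module R P" and "N \<subseteq> carrier P" and "\<zero>\<^bsub>P\<^esub> \<in> N"
    and "\<And>x y. x \<in> N \<Longrightarrow> y \<in> N \<Longrightarrow> x \<oplus>\<^bsub>P\<^esub> y \<in> N"
    and "\<And>a x. a \<in> carrier R \<Longrightarrow> x \<in> N \<Longrightarrow> a \<odot>\<^bsub>P\<^esub> x \<in> N"
  shows "submodule N R P"
proof -
  interpret P: module R P by fact
  show ?thesis
  proof (rule P.submoduleI)
    fix x assume "x \<in> N"
    then have "(\<ominus>\<^bsub>R\<^esub> \<one>\<^bsub>R\<^esub>) \<odot>\<^bsub>P\<^esub> x \<in> N" "x \<in> carrier P" using assms by auto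
    then show "\<ominus>\<^bsub>P\<^esub> x \<in> N" by (simp add: P.smult_l_minus)
  qed (use assms in auto)
qed

lemma submodule_finsum:
  assumes "submodule N R P" and "module R P" and "\<And>i. i \<in> S \<Longrightarrow> f i \<in> N"
  shows "(\<Oplus>\<^bsub>P\<^esub>i\<in>S. f i) \<in> N"
proof -
  interpret P: module R P by fact
  note E = submodule_mem[OF assms(1,2)]
  show ?thesis
  proof (cases "finite S")
    case True
    then show ?thesis using assms(3)
    proof (induction S)
      case (insert s S)
      then have "f \<in> S \<rightarrow> carrier P" "f s \<in> carrier P" using E(1) by auto
      then show ?case using insert E by auto
    qed (use E in auto)
  qed (use E in auto)
qed

lemma submodule_vimage:
  assumes "module R P" and "module R Q" and "h \<in> lin_maps R P Q" and "submodule N R Q"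
  shows "submodule {x \<in> carrier P. h x \<in> N} R P"
proof -
  interpret P: module R P by fact
  note E = submodule_mem[OF assms(4,2)]
  show ?thesis
    by (rule submoduleI'[OF assms(1)])
      (use E assms(3) lin_zero[OF assms(1-3)] in \<open>auto simp: lin_add lin_smult\<close>)
qed

lemma submodule_zero: "module R P \<Longrightarrow> submodule {\<zero>\<^bsub>P\<^esub>} R P"
  by (rule submoduleI')
    (auto simp: module.smult_r_null abelian_group.r_neg module.axioms abelian_monoid.zero_closed abelian_monoid.l_zero
        abelian_group.axioms)

lemma a_kernel_iff: "x \<in> a_kernel P Q h \<longleftrightarrow> x \<in> carrier P \<and> h x = \<zero>\<^bsub>Q\<^esub>"
  by (simp add: a_kernel_def')

lemma submodule_kernel:
  assumes "module R P" and "module R Q" and "h \<in> lin_maps R P Q"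
  shows "submodule (a_kernel P Q h) R P"
  using submodule_vimage[OF assms submodule_zero[OF assms(2)]]
  by (simp add: a_kernel_def')

lemma submodule_image:
  assumes "module R P" and "module R Q" and "h \<in> lin_maps R P Q" and "submodule N R P"
  shows "submodule (h ` N) R Q"
proof -
  note E = submodule_mem[OF assms(4,1)]
  show ?thesis
  proof (rule submoduleI'[OF assms(2)])
    show "h ` N \<subseteq> carrier Q" using E(1) lin_closed[OF assms(3)] by blast
    show "\<zero>\<^bsub>Q\<^esub> \<in> h ` N" using E(2) lin_zero[OF assms(1-3)] by force
    fix x y a assume "x \<in> h ` N"
    then obtain x' where x': "x = h x'" "x' \<in> N" by blast
    { assume "y \<in> h ` N"
      then obtain y' where y': "y = h y'" "y' \<in> N" by blast
      have "x \<oplus>\<^bsub>Q\<^esub> y = h (x' \<oplus>\<^bsub>P\<^esub> y')"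
        using x' y' E(1) lin_add[OF assms(3), of x' y'] by (simp add: subset_eq)
      then show "x \<oplus>\<^bsub>Q\<^esub> y \<in> h ` N" using E(3) x' y' by blast }
    assume "a \<in> carrier R"
    then have "a \<odot>\<^bsub>Q\<^esub> x = h (a \<odot>\<^bsub>P\<^esub> x')" "a \<odot>\<^bsub>P\<^esub> x' \<in> N"
      using x' E(1) E(6)[of a x'] lin_smult[OF assms(3), of a x'] by (simp_all add: subset_eq)
    then show "a \<odot>\<^bsub>Q\<^esub> x \<in> h ` N" by blast
  qed
qed

lemma submodule_carrier: "module R P \<Longrightarrow> submodule (carrier P) R P"
  by (rule module.carrier_is_submodule)

lemma submodule_Inter:
  assumes "module R P" and "\<And>N. N \<in> \<N> \<Longrightarrow> submodule N R P" and "\<N> \<noteq> {}"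
  shows "submodule (\<Inter>\<N>) R P"
proof (rule submoduleI'[OF assms(1)])
  note E = submodule_mem[OF assms(2) assms(1)]
  show "\<Inter>\<N> \<subseteq> carrier P" using E(1) assms(3) by blast
  show "\<zero>\<^bsub>P\<^esub> \<in> \<Inter>\<N>" using E(2) by blast
  show "x \<oplus>\<^bsub>P\<^esub> y \<in> \<Inter>\<N>" if "x \<in> \<Inter>\<N>" "y \<in> \<Inter>\<N>" for x y using that E(3) by blast
  show "a \<odot>\<^bsub>P\<^esub> x \<in> \<Inter>\<N>" if "a \<in> carrier R" "x \<in> \<Inter>\<N>" for a x using that E(6) by blast
qed

lemma submodule_span_props:
  assumes "module R P" and "X \<subseteq> carrier P"
  shows "submodule (submodule_span R P X) R P"
    and "X \<subseteq> submodule_span R P X"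
proof -
  show "submodule (submodule_span R P X) R P"
    unfolding submodule_span_def using submodule_carrier[OF assms(1)] assms(2)
    by (intro submodule_Inter[OF assms(1)]) auto
  show "X \<subseteq> submodule_span R P X" unfolding submodule_span_def by blast
qed

lemma submodule_span_least:
  "submodule N R P \<Longrightarrow> X \<subseteq> N \<Longrightarrow> submodule_span R P X \<subseteq> N"
  unfolding submodule_span_def by blast

section \<open>Free modules\<close>

lemma ring_as_module_simps [simp]:
  "carrier (ring_as_module R) = carrier R" "\<zero>\<^bsub>ring_as_module R\<^esub> = \<zero>\<^bsub>R\<^esub>"
  "add (ring_as_module R) = add R" "smult (ring_as_module R) = mult R"
  by (simp_all add: ring_as_module_def)

text \<open>Sums, and likewise additive inverses, depend only on the additive monoid, which
  \<open>ring_as_module R\<close> shares with \<open>R\<close>. With these rules a functional is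
  handled as a linear map between modules and still computed in the ring.\<close>

lemma finsum_ring_as_module [simp]: "finsum (ring_as_module R) f S = finsum R f S"
  by (simp add: finsum_def finprod_def)

lemma a_inv_ring_as_module [simp]: "\<ominus>\<^bsub>ring_as_module R\<^esub> x = \<ominus>\<^bsub>R\<^esub> x"
  by (simp add: a_inv_def m_inv_def)

lemma a_minus_ring_as_module [simp]: "x \<ominus>\<^bsub>ring_as_module R\<^esub> y = x \<ominus>\<^bsub>R\<^esub> y"
  by (simp add: a_minus_def)

lemma free_module_mem:
  "\<phi> \<in> carrier (free_module R S) \<longleftrightarrow> \<phi> \<in> S \<rightarrow>\<^sub>E carrier R \<and> finite {s\<in>S. \<phi> s \<noteq> \<zero>\<^bsub>R\<^esub>}"
  by (simp add: free_module_def)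

lemma free_module_ops [simp]:
  "s \<in> S \<Longrightarrow> (\<phi> \<oplus>\<^bsub>free_module R S\<^esub> \<psi>) s = \<phi> s \<oplus>\<^bsub>R\<^esub> \<psi> s"
  "s \<in> S \<Longrightarrow> (a \<odot>\<^bsub>free_module R S\<^esub> \<phi>) s = a \<otimes>\<^bsub>R\<^esub> \<phi> s"
  "s \<in> S \<Longrightarrow> \<zero>\<^bsub>free_module R S\<^esub> s = \<zero>\<^bsub>R\<^esub>"
  by (simp_all add: free_module_def)

lemma free_module_coord: "\<phi> \<in> carrier (free_module R S) \<Longrightarrow> s \<in> S \<Longrightarrow> \<phi> s \<in> carrier R"
  by (auto simp: free_module_mem)

lemma free_module_eqI:
  "\<phi> \<in> carrier (free_module R S) \<Longrightarrow> \<psi> \<in> carrier (free_module R S) \<Longrightarrow>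
   (\<And>s. s \<in> S \<Longrightarrow> \<phi> s = \<psi> s) \<Longrightarrow> \<phi> = \<psi>"
  by (auto simp: free_module_mem intro: PiE_ext)

lemma free_rank_mem: "\<phi> \<in> carrier (free_rank R n) \<longleftrightarrow> \<phi> \<in> {..<n} \<rightarrow>\<^sub>E carrier R"
  by (simp add: free_module_mem)

context cring
begin

lemma ring_module: "module R (ring_as_module R)"
proof (rule moduleI)
  show "abelian_group (ring_as_module R)"
    by (rule abelian_groupI) (auto simp: a_ac intro: l_neg a_inv_closed)
qed (auto simp: l_distr r_distr m_assoc is_cring)

lemma free_module_plus_closed:
  assumes "\<phi> \<in> carrier (free_module R S)" "\<psi> \<in> carrier (free_module R S)"
  shows "\<phi> \<oplus>\<^bsub>free_module R S\<^esub> \<psi> \<in> carrier (free_module R S)"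
proof -
  have "{s\<in>S. (\<phi> \<oplus>\<^bsub>free_module R S\<^esub> \<psi>) s \<noteq> \<zero>} \<subseteq> {s\<in>S. \<phi> s \<noteq> \<zero>} \<union> {s\<in>S. \<psi> s \<noteq> \<zero>}"
    by auto
  then have "finite {s\<in>S. (\<phi> \<oplus>\<^bsub>free_module R S\<^esub> \<psi>) s \<noteq> \<zero>}"
    by (rule finite_subset) (use assms in \<open>simp add: free_module_mem\<close>)
  then show ?thesis using assms
    by (auto simp: free_module_def PiE_def Pi_def extensional_def)
qed

lemma free_module_smult_closed:
  assumes "\<phi> \<in> carrier (free_module R S)" "a \<in> carrier R"
  shows "a \<odot>\<^bsub>free_module R S\<^esub> \<phi> \<in> carrier (free_module R S)"
proof -
  have "{s\<in>S. (a \<odot>\<^bsub>free_module R S\<^esub> \<phi>) s \<noteq> \<zero>} \<subseteq> {s\<in>S. \<phi> s \<noteq> \<zero>}"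
    using assms by (auto simp: free_module_coord)
  then have "finite {s\<in>S. (a \<odot>\<^bsub>free_module R S\<^esub> \<phi>) s \<noteq> \<zero>}"
    by (rule finite_subset) (use assms in \<open>simp add: free_module_mem\<close>)
  then show ?thesis using assms
    by (auto simp: free_module_def PiE_def Pi_def extensional_def)
qed

lemma free_module_is_module: "module R (free_module R S)"
proof (rule moduleI)
  let ?F = "free_module R S"
  note cl = free_module_plus_closed free_module_smult_closed
  have z: "\<zero>\<^bsub>?F\<^esub> \<in> carrier ?F" by (auto simp: free_module_def)
  note eq = free_module_eqI[of _ R S]
  note co = free_module_coord[of _ R S]
  show "abelian_group ?F"
  proof (rule abelian_groupI)
    fix x assume x: "x \<in> carrier ?F"
    have c: "(\<ominus> \<one>) \<odot>\<^bsub>?F\<^esub> x \<in> carrier ?F" using x by (simp add: cl)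
    moreover have "(\<ominus> \<one>) \<odot>\<^bsub>?F\<^esub> x \<oplus>\<^bsub>?F\<^esub> x = \<zero>\<^bsub>?F\<^esub>" using x c
      by (intro eq) (auto simp: cl z co l_minus l_neg)
    ultimately show "\<exists>y\<in>carrier ?F. y \<oplus>\<^bsub>?F\<^esub> x = \<zero>\<^bsub>?F\<^esub>" by blast
  qed (auto intro!: eq simp: cl z co a_ac)
qed (auto intro!: free_module_eqI[of _ R S] simp: is_cring free_module_plus_closed
    free_module_smult_closed free_module_coord[of _ R S] l_distr r_distr m_assoc)

lemma coord_lin: "s \<in> S \<Longrightarrow> (\<lambda>\<phi>. \<phi> s) \<in> lin_maps R (free_module R S) (ring_as_module R)"
  by (rule lin_mapsI) (auto simp: free_module_coord)

lemma free_module_inv [simp]: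
  "s \<in> S \<Longrightarrow> \<phi> \<in> carrier (free_module R S) \<Longrightarrow> (\<ominus>\<^bsub>free_module R S\<^esub> \<phi>) s = \<ominus> \<phi> s"
  using lin_neg[OF free_module_is_module ring_module coord_lin] by simp

lemma free_module_minus [simp]:
  "s \<in> S \<Longrightarrow> \<phi> \<in> carrier (free_module R S) \<Longrightarrow> \<psi> \<in> carrier (free_module R S) \<Longrightarrow>
   (\<phi> \<ominus>\<^bsub>free_module R S\<^esub> \<psi>) s = \<phi> s \<ominus> \<psi> s"
  using lin_minus[OF free_module_is_module ring_module coord_lin] by simp

lemma free_module_finsum:
  "s \<in> S \<Longrightarrow> f \<in> A \<rightarrow> carrier (free_module R S) \<Longrightarrow>
   (\<Oplus>\<^bsub>free_module R S\<^esub>i\<in>A. f i) s = (\<Oplus>i\<in>A. f i s)"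
  using lin_finsum[OF free_module_is_module ring_module coord_lin] by simp

section \<open>Linear maps and bases\<close>

lemma basis_vec_closed: "basis_vec R S s \<in> carrier (free_module R S)"
proof -
  have "finite {t \<in> S. basis_vec R S s t \<noteq> \<zero>}"
    by (rule finite_subset[of _ "{s}"]) (auto simp: basis_vec_def)
  then show ?thesis by (auto simp: free_module_mem basis_vec_def)
qed

text \<open>The linear extension of \<open>b\<close> from the standard basis. The sum is over the
  support of the vector because \<open>S\<close> can be infinite: the free module beneath a tensor
  product has a basis vector for every pair of elements.\<close>

definition flin :: "('a, 'e, 'm) module_scheme \<Rightarrow> 's set \<Rightarrow> ('s \<Rightarrow> 'e) \<Rightarrow> ('s \<Rightarrow> 'a) \<Rightarrow> 'e" where
  "flin P S b \<phi> = (\<Oplus>\<^bsub>P\<^esub>s\<in>{s\<in>S. \<phi> s \<noteq> \<zero>}. \<phi> s \<odot>\<^bsub>P\<^esub> b s)"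

text \<open>Terms with coefficient zero may be added. Two vectors can then be summed over one common
  finite index set, which is how additivity of \<open>flin\<close> is obtained.\<close>

lemma flin_superset:
  assumes "module R P" and "b \<in> S \<rightarrow> carrier P" and "\<phi> \<in> S \<rightarrow> carrier R"
    and "finite T" and "{s\<in>S. \<phi> s \<noteq> \<zero>} \<subseteq> T" and "T \<subseteq> S"
  shows "flin P S b \<phi> = (\<Oplus>\<^bsub>P\<^esub>s\<in>T. \<phi> s \<odot>\<^bsub>P\<^esub> b s)"
proof -
  interpret P: module R P by fact
  show ?thesis unfolding flin_def
    by (rule P.M.add.finprod_mono_neutral_cong_left) (use assms in \<open>auto simp: Pi_iff\<close>)
qed

lemma flin_finite:
  assumes "module R P" and "b \<in> S \<rightarrow> carrier P" and "\<phi> \<in> carrier (free_module R S)" and "finite S"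
  shows "flin P S b \<phi> = (\<Oplus>\<^bsub>P\<^esub>s\<in>S. \<phi> s \<odot>\<^bsub>P\<^esub> b s)"
  using assms by (intro flin_superset) (auto simp: free_module_mem)

lemma flin_lin:
  assumes "module R P" and "b \<in> S \<rightarrow> carrier P"
  shows "flin P S b \<in> lin_maps R (free_module R S) P"
proof (rule lin_mapsI)
  interpret P: module R P by fact
  let ?F = "free_module R S"
  have sm: "(\<lambda>s. \<phi> s \<odot>\<^bsub>P\<^esub> b s) \<in> T \<rightarrow> carrier P" if "\<phi> \<in> carrier ?F" "T \<subseteq> S" for \<phi> T
    using that assms(2) free_module_coord[OF that(1)] by (auto simp: Pi_iff)
  fix x y a assume x: "x \<in> carrier ?F"
  show "flin P S b x \<in> carrier P"
    unfolding flin_def by (rule P.M.finsum_closed[OF sm[OF x]]) auto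
  { assume y: "y \<in> carrier ?F"
    let ?T = "{s\<in>S. x s \<noteq> \<zero>} \<union> {s\<in>S. y s \<noteq> \<zero>}"
    have xy: "x \<oplus>\<^bsub>?F\<^esub> y \<in> carrier ?F" using x y free_module_plus_closed by blast
    have T: "finite ?T" "?T \<subseteq> S" using x y by (auto simp: free_module_mem)
    have "flin P S b (x \<oplus>\<^bsub>?F\<^esub> y) = (\<Oplus>\<^bsub>P\<^esub>s\<in>?T. (x \<oplus>\<^bsub>?F\<^esub> y) s \<odot>\<^bsub>P\<^esub> b s)"
      using x y xy T by (intro flin_superset assms) (auto simp: free_module_coord Pi_iff)
    also have "\<dots> = (\<Oplus>\<^bsub>P\<^esub>s\<in>?T. x s \<odot>\<^bsub>P\<^esub> b s \<oplus>\<^bsub>P\<^esub> y s \<odot>\<^bsub>P\<^esub> b s)"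
      using x y sm[of _ ?T] T(2) assms(2)
      by (intro P.M.finsum_cong') (auto simp: free_module_coord P.smult_l_distr Pi_iff)
    also have "\<dots> = (\<Oplus>\<^bsub>P\<^esub>s\<in>?T. x s \<odot>\<^bsub>P\<^esub> b s) \<oplus>\<^bsub>P\<^esub> (\<Oplus>\<^bsub>P\<^esub>s\<in>?T. y s \<odot>\<^bsub>P\<^esub> b s)"
      by (intro P.M.finsum_addf sm x y T)
    also have "\<dots> = flin P S b x \<oplus>\<^bsub>P\<^esub> flin P S b y"
      using x y T by (intro arg_cong2[of _ _ _ _ "add P"] flin_superset[symmetric] assms)
        (auto simp: free_module_coord Pi_iff)
    finally show "flin P S b (x \<oplus>\<^bsub>?F\<^esub> y) = flin P S b x \<oplus>\<^bsub>P\<^esub> flin P S b y" . }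
  assume a: "a \<in> carrier R"
  let ?T = "{s\<in>S. x s \<noteq> \<zero>}"
  have ax: "a \<odot>\<^bsub>?F\<^esub> x \<in> carrier ?F" using x a free_module_smult_closed by blast
  have T: "finite ?T" "?T \<subseteq> S" using x by (auto simp: free_module_mem)
  have "flin P S b (a \<odot>\<^bsub>?F\<^esub> x) = (\<Oplus>\<^bsub>P\<^esub>s\<in>?T. (a \<odot>\<^bsub>?F\<^esub> x) s \<odot>\<^bsub>P\<^esub> b s)"
    using x a ax T by (intro flin_superset assms) (auto simp: free_module_coord Pi_iff)
  also have "\<dots> = (\<Oplus>\<^bsub>P\<^esub>s\<in>?T. a \<odot>\<^bsub>P\<^esub> (x s \<odot>\<^bsub>P\<^esub> b s))"
    using x a sm[of _ ?T] T(2) assms(2)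
    by (intro P.M.finsum_cong') (auto simp: free_module_coord P.smult_assoc1 Pi_iff)
  also have "\<dots> = a \<odot>\<^bsub>P\<^esub> flin P S b x"
    unfolding flin_def by (intro P.finsum_smult_ldistr[symmetric] T a sm x)
  finally show "flin P S b (a \<odot>\<^bsub>?F\<^esub> x) = a \<odot>\<^bsub>P\<^esub> flin P S b x" .
qed

lemma flin_basis:
  assumes "module R P" and "b \<in> S \<rightarrow> carrier P" and "s \<in> S"
  shows "flin P S b (basis_vec R S s) = b s"
proof -
  interpret P: module R P by fact
  have "flin P S b (basis_vec R S s) = (\<Oplus>\<^bsub>P\<^esub>t\<in>{s}. basis_vec R S s t \<odot>\<^bsub>P\<^esub> b t)"
    using assms by (intro flin_superset) (auto simp: basis_vec_def)
  then show ?thesis using assms by (auto simp: basis_vec_def Pi_iff)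
qed

lemma free_module_expand:
  assumes "\<phi> \<in> carrier (free_module R S)"
  shows "\<phi> = flin (free_module R S) S (basis_vec R S) \<phi>"
proof (rule free_module_eqI)
  let ?F = "free_module R S"
  interpret F: module R ?F by (rule free_module_is_module)
  show "flin ?F S (basis_vec R S) \<phi> \<in> carrier ?F"
    by (rule lin_closed[OF flin_lin assms]) (auto simp: basis_vec_closed F.module_axioms)
  fix s assume s: "s \<in> S"
  let ?T = "{s\<in>S. \<phi> s \<noteq> \<zero>}"
  have T: "finite ?T" using assms by (auto simp: free_module_mem)
  have "flin ?F S (basis_vec R S) \<phi> s = (\<Oplus>t\<in>?T. (\<phi> t \<odot>\<^bsub>?F\<^esub> basis_vec R S t) s)"
    unfolding flin_def using s assms
    by (subst free_module_finsum) (auto simp: basis_vec_closed free_module_coord)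
  also have "\<dots> = (\<Oplus>t\<in>?T. if s = t then \<phi> t else \<zero>)"
    using s assms by (intro finsum_cong') (auto simp: free_module_coord basis_vec_def)
  also have "\<dots> = \<phi> s"
  proof (cases "s \<in> ?T")
    case True
    then show ?thesis using assms T by (subst finsum_singleton) (auto simp: free_module_coord)
  next
    case False
    then have "(\<Oplus>t\<in>?T. if s = t then \<phi> t else \<zero>) = (\<Oplus>t\<in>?T. \<zero>)"
      by (intro finsum_cong') auto
    then show ?thesis using False s by auto
  qed
  finally show "\<phi> s = flin ?F S (basis_vec R S) \<phi> s" by simp
qed (fact assms)

lemma lin_eq_flin:
  assumes "module R P" and "h \<in> lin_maps R (free_module R S) P" and "\<phi> \<in> carrier (free_module R S)"
  shows "h \<phi> = flin P S (\<lambda>s. h (basis_vec R S s)) \<phi>"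
proof -
  let ?F = "free_module R S"
  interpret F: module R ?F by (rule free_module_is_module)
  interpret P: module R P by fact
  have "h \<phi> = h (flin ?F S (basis_vec R S) \<phi>)" using free_module_expand[OF assms(3)] by simp
  also have "\<dots> = flin P S (\<lambda>s. h (basis_vec R S s)) \<phi>"
    unfolding flin_def using assms(3)
    by (subst lin_finsum[OF F.module_axioms assms(1,2)])
      (auto intro!: P.M.finsum_cong' simp: free_module_coord basis_vec_closed lin_smult[OF assms(2)]
        lin_closed[OF assms(2)])
  finally show ?thesis .
qed

lemma lin_expand:
  assumes "module R P" and "h \<in> lin_maps R (free_module R S) P" and "\<phi> \<in> carrier (free_module R S)" "finite S"
  shows "h \<phi> = (\<Oplus>\<^bsub>P\<^esub>s\<in>S. \<phi> s \<odot>\<^bsub>P\<^esub> h (basis_vec R S s))"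
  using lin_eq_flin[OF assms(1-3)] assms
  by (subst (asm) flin_finite) (auto simp: basis_vec_closed lin_closed)

lemma lin_ext:
  assumes "module R P" and "h \<in> lin_maps R (free_module R S) P" and "k \<in> lin_maps R (free_module R S) P"
    and "\<And>s. s \<in> S \<Longrightarrow> h (basis_vec R S s) = k (basis_vec R S s)" and "\<phi> \<in> carrier (free_module R S)"
  shows "h \<phi> = k \<phi>"
proof -
  interpret P: module R P by fact
  have "flin P S (\<lambda>s. h (basis_vec R S s)) \<phi> = flin P S (\<lambda>s. k (basis_vec R S s)) \<phi>"
    unfolding flin_def using assms
    by (intro P.M.finsum_cong') (auto simp: free_module_coord basis_vec_closed lin_closed)
  then show ?thesis using lin_eq_flin assms by metis
qed

text \<open>Serves as an induction principle: applied to a preimage or an image, it reduces a claim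
  about all vectors to the basis vectors.\<close>

lemma submodule_basis:
  assumes "submodule N R (free_module R S)" and "\<And>s. s \<in> S \<Longrightarrow> basis_vec R S s \<in> N"
  shows "N = carrier (free_module R S)"
proof
  show "N \<subseteq> carrier (free_module R S)" using submodule_mem[OF assms(1) free_module_is_module] by simp
  show "carrier (free_module R S) \<subseteq> N"
  proof
    fix \<phi> assume "\<phi> \<in> carrier (free_module R S)"
    then have "flin (free_module R S) S (basis_vec R S) \<phi> \<in> N" unfolding flin_def
      using assms(2) submodule_mem[OF assms(1) free_module_is_module]
      by (intro submodule_finsum[OF assms(1) free_module_is_module]) (auto simp: free_module_coord)
    with \<open>\<phi> \<in> _\<close> show "\<phi> \<in> N" using free_module_expand by metis
  qed
qed

text \<open>Projectivity of free modules. Preimages are chosen for the basis vectors and extended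
  linearly, so \<open>e\<close> has to reach just those values.\<close>

lemma free_lift:
  assumes "module R P" and "module R Q" and "h \<in> lin_maps R (free_module R S) Q"
    and "e \<in> lin_maps R P Q" and "\<And>s. s \<in> S \<Longrightarrow> h (basis_vec R S s) \<in> e ` carrier P"
  obtains g where "g \<in> lin_maps R (free_module R S) P"
    and "\<And>\<phi>. \<phi> \<in> carrier (free_module R S) \<Longrightarrow> e (g \<phi>) = h \<phi>"
proof -
  have "\<forall>s\<in>S. \<exists>x\<in>carrier P. e x = h (basis_vec R S s)" using assms(5) by force
  then obtain b where b: "\<And>s. s \<in> S \<Longrightarrow> b s \<in> carrier P \<and> e (b s) = h (basis_vec R S s)" by metis
  have g: "flin P S b \<in> lin_maps R (free_module R S) P" using b by (intro flin_lin assms) auto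
  moreover have "e (flin P S b \<phi>) = h \<phi>" if "\<phi> \<in> carrier (free_module R S)" for \<phi>
    by (rule lin_ext[OF assms(2) lin_comp[OF g assms(4)] assms(3) _ that])
      (use b in \<open>simp add: flin_basis assms(1)\<close>)
  ultimately show thesis using that by blast
qed

end

section \<open>Quotient modules\<close>

lemma (in abelian_group) minus_eq_zero_iff:
  "x \<in> carrier G \<Longrightarrow> y \<in> carrier G \<Longrightarrow> x \<ominus> y = \<zero> \<longleftrightarrow> x = y"
  by (metis a_minus_def add.inv_closed add.inv_inv minus_equality r_neg)

lemma abelian_group_of_module: "module R P \<Longrightarrow> abelian_group P"
  by (simp add: module_def)

lemma abelian_subgroup_submodule:
  assumes "submodule N R P" and "module R P"
  shows "abelian_subgroup N P"
  using assms abelian_subgroupI3 abelian_group_of_module additive_subgroup.intro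
  by (metis submodule.axioms(1))

context
  fixes R :: "('a, 'r) ring_scheme" and P :: "('a, 'e, 'm) module_scheme" and N :: "'e set"
  assumes P: "module R P" and N: "submodule N R P"
begin

interpretation P: module R P by (rule P)
interpretation N: abelian_subgroup N P by (rule abelian_subgroup_submodule[OF N P])

lemma quot_carrier: "carrier (quot_module R P N) = (\<lambda>x. N +>\<^bsub>P\<^esub> x) ` carrier P"
  by (auto simp: quot_module_def A_RCOSETS_def')

lemma quot_coset_eq_iff:
  assumes "x \<in> carrier P" "y \<in> carrier P"
  shows "N +>\<^bsub>P\<^esub> x = N +>\<^bsub>P\<^esub> y \<longleftrightarrow> x \<ominus>\<^bsub>P\<^esub> y \<in> N"
proof -
  have "N +>\<^bsub>P\<^esub> x = N +>\<^bsub>P\<^esub> y \<longleftrightarrow> x \<in> N +>\<^bsub>P\<^esub> y"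
    using N.a_repr_independence'[OF _ assms(2)] N.a_repr_independenceD[OF assms(1), of y] by metis
  also have "\<dots> \<longleftrightarrow> x \<ominus>\<^bsub>P\<^esub> y \<in> N"
    unfolding a_minus_def by (rule N.a_rcos_module[OF assms(2,1)])
  finally show ?thesis .
qed

lemma quot_coset_zero_iff: "x \<in> carrier P \<Longrightarrow> N +>\<^bsub>P\<^esub> x = N \<longleftrightarrow> x \<in> N"
  using N.a_rcos_const[of x] N.a_rcos_self[of x] by metis

lemma quot_zero: "\<zero>\<^bsub>quot_module R P N\<^esub> = N"
  by (simp add: quot_module_def)

lemma quot_add:
  "x \<in> carrier P \<Longrightarrow> y \<in> carrier P \<Longrightarrow>
   (N +>\<^bsub>P\<^esub> x) \<oplus>\<^bsub>quot_module R P N\<^esub> (N +>\<^bsub>P\<^esub> y) = N +>\<^bsub>P\<^esub> (x \<oplus>\<^bsub>P\<^esub> y)"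
  by (simp add: quot_module_def N.a_rcos_sum)

text \<open>Two representatives of a coset differ by an element of \<open>N\<close>, and
  \<open>N\<close> is stable under \<open>a\<close>. Hence the cosets in the union that defines the
  scalar multiple all coincide.\<close>

lemma quot_smult:
  assumes "a \<in> carrier R" "x \<in> carrier P"
  shows "a \<odot>\<^bsub>quot_module R P N\<^esub> (N +>\<^bsub>P\<^esub> x) = N +>\<^bsub>P\<^esub> (a \<odot>\<^bsub>P\<^esub> x)"
proof -
  have "N +>\<^bsub>P\<^esub> (a \<odot>\<^bsub>P\<^esub> y) = N +>\<^bsub>P\<^esub> (a \<odot>\<^bsub>P\<^esub> x)" if "y \<in> N +>\<^bsub>P\<^esub> x" for y
  proof -
    have y: "y \<in> carrier P" using that assms(2) N.a_elemrcos_carrier by blast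
    have "y \<ominus>\<^bsub>P\<^esub> x \<in> N" 
      using N.a_rcos_module[OF assms(2) y] that by (simp add: a_minus_def)
    then have "a \<odot>\<^bsub>P\<^esub> (y \<ominus>\<^bsub>P\<^esub> x) \<in> N" using submodule_mem(6)[OF N P] assms by blast
    then have "a \<odot>\<^bsub>P\<^esub> y \<ominus>\<^bsub>P\<^esub> a \<odot>\<^bsub>P\<^esub> x \<in> N"
      using assms y by (simp add: a_minus_def P.smult_r_distr P.smult_r_minus)
    then show ?thesis using quot_coset_eq_iff[of "a \<odot>\<^bsub>P\<^esub> y" "a \<odot>\<^bsub>P\<^esub> x"] assms y by simp
  qed
  moreover have "N +>\<^bsub>P\<^esub> x \<noteq> {}" using N.a_rcos_self[OF assms(2)] by blast
  ultimately show ?thesis unfolding quot_module_def by auto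
qed

lemma quot_is_module: "module R (quot_module R P N)"
proof (rule moduleI)
  have z: "\<zero>\<^bsub>quot_module R P N\<^esub> = N +>\<^bsub>P\<^esub> \<zero>\<^bsub>P\<^esub>"
    using quot_coset_zero_iff[of "\<zero>\<^bsub>P\<^esub>"] N.zero_closed by (simp add: quot_zero)
  show "abelian_group (quot_module R P N)"
  proof (rule abelian_groupI)
    fix X assume "X \<in> carrier (quot_module R P N)"
    then obtain x where x: "x \<in> carrier P" "X = N +>\<^bsub>P\<^esub> x" unfolding quot_carrier by blast
    then have "(N +>\<^bsub>P\<^esub> (\<ominus>\<^bsub>P\<^esub> x)) \<oplus>\<^bsub>quot_module R P N\<^esub> X = \<zero>\<^bsub>quot_module R P N\<^esub>"
      by (simp add: quot_add z P.M.l_neg)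
    then show "\<exists>Y\<in>carrier (quot_module R P N). Y \<oplus>\<^bsub>quot_module R P N\<^esub> X = \<zero>\<^bsub>quot_module R P N\<^esub>"
      using x unfolding quot_carrier by blast
  qed (auto simp: quot_carrier quot_add z P.M.a_ac)
qed (auto simp: quot_carrier quot_add quot_smult P.smult_l_distr P.smult_r_distr P.smult_assoc1 P.R.is_cring)

lemma quot_proj: "(\<lambda>x. N +>\<^bsub>P\<^esub> x) \<in> lin_maps R P (quot_module R P N)"
  by (rule lin_mapsI) (auto simp: quot_carrier quot_add quot_smult)

lemma zero_quot_iff: "zero_module (quot_module R P N) \<longleftrightarrow> carrier P \<subseteq> N"
proof -
  have "zero_module (quot_module R P N) \<longleftrightarrow> (\<forall>x\<in>carrier P. N +>\<^bsub>P\<^esub> x = N)"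
    unfolding zero_module_def quot_carrier quot_zero using P.M.zero_closed by blast
  then show ?thesis using quot_coset_zero_iff by blast
qed

end

text \<open>Homology is the quotient of the cycles \<open>Z\<close> by the boundaries
  \<open>B\<close>; this is the form in which the vanishing of Tor and Ext is used.\<close>

lemma zero_subquot_iff:
  assumes "module R C" and "submodule Z R C" and "submodule B R C" and "B \<subseteq> Z"
  shows "zero_module (quot_module R (C\<lparr>carrier := Z\<rparr>) B) \<longleftrightarrow> Z \<subseteq> B"
proof -
  have Z: "module R (C\<lparr>carrier := Z\<rparr>)"
    by (rule submodule.submodule_is_module[OF assms(2,1)])
  have "submodule B R (C\<lparr>carrier := Z\<rparr>)"
    by (rule submoduleI'[OF Z]) (use assms(4) submodule_mem[OF assms(3,1)] in auto)
  from zero_quot_iff[OF Z this] show ?thesis by simp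
qed

text \<open>The homomorphism theorem for an arbitrary surjection \<open>\<pi>\<close> in place of a
  coset projection. It is applied to the projection onto a tensor product, to multiplication by a
  socle element, and to the first differential of a resolution as a map onto its image.\<close>

lemma lin_factor:
  assumes "module R P" and "module R T" and "module R Q"
    and "\<pi> \<in> lin_maps R P T" and "\<pi> ` carrier P = carrier T"
    and "h \<in> lin_maps R P Q" and "\<And>x. x \<in> carrier P \<Longrightarrow> \<pi> x = \<zero>\<^bsub>T\<^esub> \<Longrightarrow> h x = \<zero>\<^bsub>Q\<^esub>"
  obtains k where "k \<in> lin_maps R T Q" and "\<And>x. x \<in> carrier P \<Longrightarrow> k (\<pi> x) = h x"
proof -
  interpret P: module R P by fact
  interpret T: module R T by fact
  interpret Q: module R Q by fact
  have wd: "h x = h y" if "x \<in> carrier P" "y \<in> carrier P" "\<pi> x = \<pi> y" for x y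
  proof -
    have "\<pi> (x \<ominus>\<^bsub>P\<^esub> y) = \<zero>\<^bsub>T\<^esub>"
      using lin_minus[OF assms(1,2,4) that(1,2)] that lin_closed[OF assms(4)] by (simp add: T.M.minus_eq_zero_iff)
    then have "h x \<ominus>\<^bsub>Q\<^esub> h y = \<zero>\<^bsub>Q\<^esub>" using assms(7) that lin_minus[OF assms(1,3,6) that(1,2)] by simp
    then show ?thesis using lin_closed[OF assms(6)] that by (simp add: Q.M.minus_eq_zero_iff)
  qed
  define k where "k = (\<lambda>t. h (SOME x. x \<in> carrier P \<and> \<pi> x = t))"
  have k: "k (\<pi> x) = h x" if "x \<in> carrier P" for x
  proof -
    have "(SOME y. y \<in> carrier P \<and> \<pi> y = \<pi> x) \<in> carrier P \<and> \<pi> (SOME y. y \<in> carrier P \<and> \<pi> y = \<pi> x) = \<pi> x"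
      by (rule someI[of _ x]) (use that in auto)
    then show ?thesis unfolding k_def using wd that by metis
  qed
  have "k \<in> lin_maps R T Q"
  proof (rule lin_mapsI)
    fix s t a assume "s \<in> carrier T"
    then obtain x where x: "x \<in> carrier P" "s = \<pi> x" using assms(5) by blast
    then show "k s \<in> carrier Q" using k lin_closed[OF assms(6)] by simp
    { assume "t \<in> carrier T"
      then obtain y where y: "y \<in> carrier P" "t = \<pi> y" using assms(5) by blast
      have "s \<oplus>\<^bsub>T\<^esub> t = \<pi> (x \<oplus>\<^bsub>P\<^esub> y)" using x y lin_add[OF assms(4)] by simp
      then show "k (s \<oplus>\<^bsub>T\<^esub> t) = k s \<oplus>\<^bsub>Q\<^esub> k t" using x y k lin_add[OF assms(6)] by simp }
    assume a: "a \<in> carrier R"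
    have "a \<odot>\<^bsub>T\<^esub> s = \<pi> (a \<odot>\<^bsub>P\<^esub> x)" using x a lin_smult[OF assms(4)] by simp
    then show "k (a \<odot>\<^bsub>T\<^esub> s) = a \<odot>\<^bsub>Q\<^esub> k s" using x a k lin_smult[OF assms(6)] by simp
  qed
  then show thesis using k that by blast
qed

section \<open>Noetherian rings and finite generation\<close>

text \<open>Zorn's lemma applies because over a Noetherian ring the union of a nonempty chain of
  ideals is a member of the chain.\<close>

lemma (in noetherian_ring) ideal_maximal:
  assumes "S \<noteq> {}" and "\<And>I. I \<in> S \<Longrightarrow> ideal I R"
  obtains M where "M \<in> S" and "\<And>I. I \<in> S \<Longrightarrow> M \<subseteq> I \<Longrightarrow> I = M"
proof -
  have "\<exists>M\<in>S. \<forall>X\<in>S. M \<subseteq> X \<longrightarrow> X = M"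
  proof (rule subset_Zorn)
    fix C assume C: "subset.chain S C"
    show "\<exists>U\<in>S. \<forall>X\<in>C. X \<subseteq> U"
    proof (cases "C = {}")
      case True
      then show ?thesis using assms(1) by blast
    next
      case False
      have "subset.chain {I. ideal I R} C"
        using C assms(2) unfolding pred_on.chain_def by auto
      then have "\<Union>C \<in> C" by (rule ideal_chain_is_trivial[OF False])
      then show ?thesis using C unfolding pred_on.chain_def by (intro bexI[of _ "\<Union>C"]) auto
    qed
  qed
  then show thesis using that by blast
qed

text \<open>Makes images, preimages and sums of submodules available for ideals; most ideals below
  are recognized through \<open>submoduleI'\<close>.\<close>

lemma (in cring) ideal_iff_submodule: "ideal I R \<longleftrightarrow> submodule I R (ring_as_module R)"
proof
  assume "ideal I R"
  then interpret ideal I R .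
  show "submodule I R (ring_as_module R)"
    by (rule submoduleI'[OF ring_module]) (auto simp: a_subset I_l_closed)
next
  assume I: "submodule I R (ring_as_module R)"
  note E = submodule_mem[OF I ring_module, simplified]
  show "ideal I R"
  proof (rule idealI[OF ring_axioms])
    show "subgroup I (add_monoid R)"
    proof (rule add.subgroupI)
      show "I \<subseteq> carrier R" "I \<noteq> {}" using E(1,2) by auto
      show "\<ominus> x \<in> I" if "x \<in> I" for x by (rule E(4)[OF that])
    qed (fact E(3))
    fix a x assume a: "a \<in> I" "x \<in> carrier R"
    show "x \<otimes> a \<in> I" by (rule E(6)[OF a(2,1)])
    moreover have "a \<in> carrier R" using a(1) E(1) by blast
    ultimately show "a \<otimes> x \<in> I" using a(2) m_comm by simp
  qed
qed

text \<open>The basis vectors are sent to an enumeration of \<open>X\<close>. The last two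
  conclusions together determine the image as the submodule generated by \<open>X\<close>.\<close>

lemma finite_span_surj:
  fixes P :: "('a, 'e, 'm) module_scheme"
  assumes "module R P" and "finite X" and "X \<subseteq> carrier P"
  obtains n e where "e \<in> lin_maps R (free_rank R n) P" and "X \<subseteq> e ` carrier (free_rank R n)"
    and "\<And>N. submodule N R P \<Longrightarrow> X \<subseteq> N \<Longrightarrow> e ` carrier (free_rank R n) \<subseteq> N"
proof -
  interpret P: module R P by fact
  obtain b where b: "bij_betw b {..<card X} X"
    using ex_bij_betw_nat_finite[OF assms(2)] by (auto simp: atLeast0LessThan)
  define n where "n = card X"
  have bP: "b \<in> {..<n} \<rightarrow> carrier P" using b assms(3) by (auto simp: bij_betw_def n_def)
  have e: "P.R.flin P {..<n} b \<in> lin_maps R (free_rank R n) P" by (rule P.R.flin_lin[OF assms(1) bP])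
  show thesis
  proof (rule that[OF e])
    show "X \<subseteq> P.R.flin P {..<n} b ` carrier (free_rank R n)"
    proof
      fix x assume "x \<in> X"
      then obtain i where "i < n" "x = b i" using b by (auto simp: bij_betw_def n_def)
      then show "x \<in> P.R.flin P {..<n} b ` carrier (free_rank R n)"
        using P.R.flin_basis[OF assms(1) bP, of i] P.R.basis_vec_closed by (metis image_eqI lessThan_iff)
    qed
    fix N assume N: "submodule N R P" "X \<subseteq> N"
    have "b i \<in> N" if "i < n" for i using b N that by (auto simp: bij_betw_def n_def)
    then have "{x \<in> carrier (free_rank R n). P.R.flin P {..<n} b x \<in> N} = carrier (free_rank R n)"
      using P.R.free_module_is_module
      by (intro P.R.submodule_basis submodule_vimage[OF _ assms(1) e N(1)])
        (auto simp: P.R.flin_basis[OF assms(1) bP] P.R.basis_vec_closed)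
    then show "P.R.flin P {..<n} b ` carrier (free_rank R n) \<subseteq> N" by auto
  qed
qed

lemma fin_gen_surj:
  assumes "module R P" and "fin_gen R P"
  obtains n e where "e \<in> lin_maps R (free_rank R n) P" and "e ` carrier (free_rank R n) = carrier P"
proof -
  interpret P: module R P by fact
  from assms(2) obtain X where X: "finite X" "X \<subseteq> carrier P"
    "\<And>N. submodule N R P \<Longrightarrow> X \<subseteq> N \<Longrightarrow> N = carrier P" unfolding fin_gen_def by blast
  obtain n e where e: "e \<in> lin_maps R (free_rank R n) P" "X \<subseteq> e ` carrier (free_rank R n)"
    by (rule finite_span_surj[OF assms(1) X(1,2)])
  have "submodule (e ` carrier (free_rank R n)) R P"
    by (rule submodule_image[OF P.R.free_module_is_module assms(1) e(1)
          submodule_carrier[OF P.R.free_module_is_module]])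
  then show thesis using that[OF e(1)] e(2) X(3) by metis
qed

lemma fin_gen_of_surj:
  assumes "module R P" and "e \<in> lin_maps R (free_rank R n) P" and "e ` carrier (free_rank R n) = carrier P"
  shows "fin_gen R P"
proof -
  interpret P: module R P by fact
  let ?X = "(\<lambda>i. e (basis_vec R {..<n} i)) ` {..<n}"
  have "N = carrier P" if N: "submodule N R P" "?X \<subseteq> N" for N
  proof -
    have "{x \<in> carrier (free_rank R n). e x \<in> N} = carrier (free_rank R n)"
      using P.R.free_module_is_module N
      by (intro P.R.submodule_basis submodule_vimage[OF _ assms(1,2)]) (auto simp: P.R.basis_vec_closed)
    then have "e ` carrier (free_rank R n) \<subseteq> N" by auto
    then show ?thesis using assms(3) submodule_mem(1)[OF N(1) assms(1)] by simp
  qed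
  moreover have "?X \<subseteq> carrier P" by (auto intro!: lin_closed[OF assms(2)] P.R.basis_vec_closed)
  ultimately show ?thesis unfolding fin_gen_def by blast
qed

lemma submodule_Int:
  "module R P \<Longrightarrow> submodule N R P \<Longrightarrow> submodule K R P \<Longrightarrow> submodule (N \<inter> K) R P"
  using submodule_Inter[of R P "{N, K}"] by auto

section \<open>Submodules of finite free modules over a Noetherian ring\<close>

locale comm_noetherian_ring = cring R + noetherian_ring R for R (structure)
begin

text \<open>Induction on a set \<open>T\<close> of coordinates outside of which \<open>K\<close>
  vanishes. The values at one coordinate form a finitely generated ideal, and the vectors of
  \<open>K\<close> that vanish there fall under the induction hypothesis. Generation is expressed by
  containment in every submodule that contains \<open>X\<close>.\<close>

lemma free_submodule_fin_gen:
  assumes "finite S" and "submodule K R (free_module R S)"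
  shows "\<exists>X. finite X \<and> X \<subseteq> K \<and> (\<forall>N. submodule N R (free_module R S) \<and> X \<subseteq> N \<longrightarrow> K \<subseteq> N)"
proof -
  let ?F = "free_module R S"
  note F = free_module_is_module[of S]
  interpret F: module R ?F by (rule F)
  have "\<exists>X. finite X \<and> X \<subseteq> K \<and> (\<forall>N. submodule N R ?F \<and> X \<subseteq> N \<longrightarrow> K \<subseteq> N)"
    if "finite T" "T \<subseteq> S" "submodule K R ?F" "\<forall>x\<in>K. \<forall>s\<in>S - T. x s = \<zero>" for T K
    using that
  proof (induction T arbitrary: K)
    case empty
    have "K \<subseteq> {\<zero>\<^bsub>?F\<^esub>}"
    proof
      fix x assume x: "x \<in> K"
      then have "x \<in> carrier ?F" using submodule_mem(1)[OF empty(2) F] by blast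
      then have "x = \<zero>\<^bsub>?F\<^esub>"
        using x empty(3) by (intro free_module_eqI[OF _ F.M.zero_closed]) simp_all
      then show "x \<in> {\<zero>\<^bsub>?F\<^esub>}" by simp
    qed
    then have "K \<subseteq> N" if "submodule N R ?F" for N using submodule_mem(2)[OF that F] by auto
    then show ?case by (intro exI[of _ "{}"]) simp
  next
    case (insert t T)
    note K = insert.prems(2)
    note KE = submodule_mem[OF K F]
    have t: "t \<in> S" using insert by simp
    note co = coord_lin[OF t]
    define K0 where "K0 = {x \<in> K. x t = \<zero>}"
    have "submodule K0 R ?F"
    proof (rule submoduleI'[OF F])
      show "K0 \<subseteq> carrier ?F" using KE(1) by (auto simp: K0_def)
      show "\<zero>\<^bsub>?F\<^esub> \<in> K0" using KE(2) t by (simp add: K0_def)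
      show "x \<oplus>\<^bsub>?F\<^esub> y \<in> K0" if "x \<in> K0" "y \<in> K0" for x y using that KE(3)[of x y] t by (simp add: K0_def)
      show "a \<odot>\<^bsub>?F\<^esub> x \<in> K0" if "a \<in> carrier R" "x \<in> K0" for a x using that KE(6)[of a x] t by (simp add: K0_def)
    qed
    moreover have "\<forall>x\<in>K0. \<forall>s\<in>S - T. x s = \<zero>" using insert.prems(3) by (auto simp: K0_def)
    ultimately have "\<exists>X. finite X \<and> X \<subseteq> K0 \<and> (\<forall>N. submodule N R ?F \<and> X \<subseteq> N \<longrightarrow> K0 \<subseteq> N)"
      using insert.prems(1) by (intro insert.IH) auto
    then obtain X0 where X0: "finite X0" "X0 \<subseteq> K0" and
      X0_least: "\<forall>N. submodule N R ?F \<and> X0 \<subseteq> N \<longrightarrow> K0 \<subseteq> N"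
      by (elim exE conjE)
    have "ideal ((\<lambda>x. x t) ` K) R"
      unfolding ideal_iff_submodule by (rule submodule_image[OF F ring_module co K])
    from finetely_gen[OF this] obtain A
      where A: "A \<subseteq> carrier R" "finite A" "(\<lambda>x. x t) ` K = Idl A"
      by (elim exE conjE)
    have "\<forall>a\<in>A. \<exists>x\<in>K. x t = a" 
    proof
      fix a assume "a \<in> A"
      then have "a \<in> (\<lambda>x. x t) ` K" unfolding A(3) using genideal_self[OF A(1)] by blast
      then show "\<exists>x\<in>K. x t = a" by auto
    qed
    then obtain g where g: "\<And>a. a \<in> A \<Longrightarrow> g a \<in> K \<and> g a t = a" by metis
    have sub: "K \<subseteq> N" if N: "submodule N R ?F" "X0 \<union> g ` A \<subseteq> N" for N
    proof
      fix x assume x: "x \<in> K"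
      note NE = submodule_mem[OF N(1) F]
      \<comment> \<open>The values at \<open>t\<close> of vectors in \<open>N \<inter> K\<close>
        already fill the whole ideal, so \<open>x\<close> agrees at \<open>t\<close> with some
        \<open>y\<close> in \<open>N \<inter> K\<close>. The difference lies in \<open>K0\<close>,
        hence in \<open>N\<close>.\<close>
      have NK: "submodule (N \<inter> K) R ?F" by (rule submodule_Int[OF F N(1) K])
      have "ideal ((\<lambda>x. x t) ` (N \<inter> K)) R"
        unfolding ideal_iff_submodule by (rule submodule_image[OF F ring_module co NK])
      moreover have "A \<subseteq> (\<lambda>x. x t) ` (N \<inter> K)" 
      proof
        fix a assume "a \<in> A"
        then show "a \<in> (\<lambda>x. x t) ` (N \<inter> K)" using g[of a] N(2) by (intro image_eqI[of _ _ "g a"]) auto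
      qed
      ultimately have "(\<lambda>x. x t) ` K \<subseteq> (\<lambda>x. x t) ` (N \<inter> K)" unfolding A(3) by (rule genideal_minimal)
      then obtain y where y: "y \<in> N" "y \<in> K" "x t = y t" using x by (auto simp: image_subset_iff)
      have c: "x \<in> carrier ?F" "y \<in> carrier ?F" using x y KE by auto
      have "x \<ominus>\<^bsub>?F\<^esub> y \<in> K0"
        using KE(5)[OF x y(2)] y(3) c t free_module_coord[OF c(2) t] by (simp add: K0_def r_neg a_minus_def)
      moreover have "K0 \<subseteq> N" using X0_least N by simp
      ultimately have "x \<ominus>\<^bsub>?F\<^esub> y \<in> N" by (rule subsetD[rotated])
      then have "(x \<ominus>\<^bsub>?F\<^esub> y) \<oplus>\<^bsub>?F\<^esub> y \<in> N" using NE(3) y(1) by blast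
      then show "x \<in> N" using c by (simp add: a_minus_def F.M.a_assoc F.M.l_neg)
    qed
    have "finite (X0 \<union> g ` A)" "X0 \<union> g ` A \<subseteq> K" using X0(1,2) A(2) g by (auto simp: K0_def)
    then show ?case using sub by (intro exI[of _ "X0 \<union> g ` A"] conjI allI impI) (simp_all del: Un_subset_iff)
  qed
  from this[OF assms(1) subset_refl assms(2)] show ?thesis by simp
qed

lemma free_submodule_surj:
  assumes "finite S" and "submodule K R (free_module R S)"
  obtains m f where "f \<in> lin_maps R (free_rank R m) (free_module R S)"
    and "f ` carrier (free_rank R m) = K"
proof -
  let ?F = "free_module R S"
  from free_submodule_fin_gen[OF assms] obtain X where X: "finite X" "X \<subseteq> K"
    "\<forall>N. submodule N R ?F \<and> X \<subseteq> N \<longrightarrow> K \<subseteq> N"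
    by (elim exE conjE)
  have "X \<subseteq> carrier ?F" using X(2) submodule_mem(1)[OF assms(2) free_module_is_module] by simp
  then obtain m f where f: "f \<in> lin_maps R (free_rank R m) ?F" "X \<subseteq> f ` carrier (free_rank R m)"
    and least: "\<And>N. submodule N R ?F \<Longrightarrow> X \<subseteq> N \<Longrightarrow> f ` carrier (free_rank R m) \<subseteq> N"
    using finite_span_surj[OF free_module_is_module X(1)] by (metis (no_types, lifting))
  have "submodule (f ` carrier (free_rank R m)) R ?F"
    by (rule submodule_image[OF free_module_is_module free_module_is_module f(1)
        submodule_carrier[OF free_module_is_module]])
  then have "f ` carrier (free_rank R m) = K" using least[OF assms(2) X(2)] f(2) X(3) by (intro subset_antisym) auto
  then show thesis by (rule that[OF f(1)])
qed

end

section \<open>Minimal covers over a local ring\<close>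

text \<open>Over a local ring, a surjection from R^n onto a module has its kernel inside mx R^n
  exactly if n is the least number of generators. The condition on the kernel is the one needed when
  two covers are compared.\<close>

definition min_cover ::
    "('a, 'r) ring_scheme \<Rightarrow> ('a, 'b, 'm) module_scheme \<Rightarrow> nat \<Rightarrow> ((nat \<Rightarrow> 'a) \<Rightarrow> 'b) \<Rightarrow> bool" where
  "min_cover R P n e \<longleftrightarrow>
     e \<in> lin_maps R (free_rank R n) P \<and> e ` carrier (free_rank R n) = carrier P \<and>
     (\<forall>x\<in>a_kernel (free_rank R n) P e. \<forall>i<n. x i \<in> max_ideal R)"

lemma min_coverD:
  assumes "min_cover R P n e"
  shows "e \<in> lin_maps R (free_rank R n) P" and "e ` carrier (free_rank R n) = carrier P"
    and "x \<in> carrier (free_rank R n) \<Longrightarrow> e x = \<zero>\<^bsub>P\<^esub> \<Longrightarrow> i < n \<Longrightarrow> x i \<in> max_ideal R"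
  using assms unfolding min_cover_def by (auto simp: a_kernel_iff)

text \<open>The coefficient ideal is a parameter because Nakayama's lemma needs both W + Rx and W +
  mx x. With the whole ring as \<open>I\<close> it also serves to enlarge the domain of a functional
  by one element.\<close>

lemma submodule_adjoin:
  assumes "module R P" and "submodule W R P" and "ideal I R" and "x \<in> carrier P"
  shows "submodule {w \<oplus>\<^bsub>P\<^esub> r \<odot>\<^bsub>P\<^esub> x | w r. w \<in> W \<and> r \<in> I} R P" (is "submodule ?A R P")
proof -
  interpret P: module R P by fact
  interpret I: ideal I R by fact
  note W = submodule_mem[OF assms(2,1)]
  have WP: "w \<in> carrier P" if "w \<in> W" for w using that W(1) by blast
  have IR: "r \<in> carrier R" if "r \<in> I" for r using that by simp
  show ?thesis
  proof (rule submoduleI'[OF assms(1)])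
    show "?A \<subseteq> carrier P" using WP IR assms(4) by auto
    have "\<zero>\<^bsub>P\<^esub> = \<zero>\<^bsub>P\<^esub> \<oplus>\<^bsub>P\<^esub> \<zero>\<^bsub>R\<^esub> \<odot>\<^bsub>P\<^esub> x" using assms(4) by simp
    then show "\<zero>\<^bsub>P\<^esub> \<in> ?A" using W(2) I.zero_closed by blast
  next
    fix y z assume "y \<in> ?A" "z \<in> ?A"
    then obtain w r w' r' where y: "y = w \<oplus>\<^bsub>P\<^esub> r \<odot>\<^bsub>P\<^esub> x" "w \<in> W" "r \<in> I"
      and z: "z = w' \<oplus>\<^bsub>P\<^esub> r' \<odot>\<^bsub>P\<^esub> x" "w' \<in> W" "r' \<in> I" by blast
    have "y \<oplus>\<^bsub>P\<^esub> z = (w \<oplus>\<^bsub>P\<^esub> w') \<oplus>\<^bsub>P\<^esub> (r \<oplus>\<^bsub>R\<^esub> r') \<odot>\<^bsub>P\<^esub> x"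
      using y z WP IR assms(4) by (simp add: P.smult_l_distr P.M.a_ac)
    then show "y \<oplus>\<^bsub>P\<^esub> z \<in> ?A" using W(3)[OF y(2) z(2)] I.a_closed[OF y(3) z(3)] by blast
  next
    fix a y assume a: "a \<in> carrier R" and "y \<in> ?A"
    then obtain w r where y: "y = w \<oplus>\<^bsub>P\<^esub> r \<odot>\<^bsub>P\<^esub> x" "w \<in> W" "r \<in> I" by blast
    have "a \<odot>\<^bsub>P\<^esub> y = a \<odot>\<^bsub>P\<^esub> w \<oplus>\<^bsub>P\<^esub> (a \<otimes>\<^bsub>R\<^esub> r) \<odot>\<^bsub>P\<^esub> x"
      using y WP IR assms(4) a by (simp add: P.smult_r_distr P.smult_assoc1)
    then show "a \<odot>\<^bsub>P\<^esub> y \<in> ?A" using W(6)[OF a y(2)] I.I_l_closed[OF y(3) a] by blast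
  qed
qed

section \<open>Local rings: Nakayama's lemma and the uniqueness of minimal covers\<close>

locale local_noeth = comm_noetherian_ring +
  assumes uniq: "\<exists>!I. maximalideal I R"
begin

abbreviation "mx \<equiv> max_ideal R"

lemma max_maximal: "maximalideal mx R"
  unfolding max_ideal_def by (rule theI'[OF uniq])

sublocale mx: ideal mx R
  using max_maximal by (rule maximalideal.axioms)

lemma one_notin_mx: "\<one> \<notin> mx"
  using mx.one_imp_carrier maximalideal.I_notcarr[OF max_maximal] by metis

text \<open>A nonunit generates a proper ideal. An ideal that is maximal among those containing
  \<open>a\<close> but not \<open>\<one>\<close> is a maximal ideal, so it equals
  \<open>mx\<close>.\<close>

lemma unit_of_notin_mx:
  assumes "a \<in> carrier R" and "a \<notin> mx"
  shows "a \<in> Units R"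
proof (rule ccontr)
  assume nu: "a \<notin> Units R"
  let ?S = "{I. ideal I R \<and> \<one> \<notin> I \<and> a \<in> I}"
  have "\<one> \<notin> PIdl a"
  proof
    assume "\<one> \<in> PIdl a"
    then obtain r where "r \<in> carrier R" "\<one> = r \<otimes> a" unfolding cgenideal_def by blast
    then show False using nu assms(1) m_comm unfolding Units_def by force
  qed
  then have "PIdl a \<in> ?S" using cgenideal_ideal[OF assms(1)] cgenideal_self[OF assms(1)] by simp
  then have ne: "?S \<noteq> {}" by blast
  obtain M where M: "M \<in> ?S" "\<And>I. I \<in> ?S \<Longrightarrow> M \<subseteq> I \<Longrightarrow> I = M"
    by (rule ideal_maximal[OF ne]) auto
  have "maximalideal M R"
  proof (rule maximalidealI)
    show "ideal M R" using M(1) by simp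
    show "carrier R \<noteq> M" using M(1) by auto
    fix J assume J: "ideal J R" "M \<subseteq> J" "J \<subseteq> carrier R"
    show "J = M \<or> J = carrier R"
    proof (cases "\<one> \<in> J")
      case True
      then show ?thesis using ideal.one_imp_carrier[OF J(1)] by simp
    next
      case False
      then show ?thesis using M(2)[of J] J M(1) by auto
    qed
  qed
  then have "M = mx" using uniq max_maximal by blast
  then show False using M(1) assms(2) by simp
qed

lemma unit_one_minus: "c \<in> mx \<Longrightarrow> \<one> \<ominus> c \<in> Units R"
proof (rule unit_of_notin_mx)
  assume c: "c \<in> mx"
  then show "\<one> \<ominus> c \<in> carrier R" by simp
  show "\<one> \<ominus> c \<notin> mx"
  proof
    assume "\<one> \<ominus> c \<in> mx"
    then have "(\<one> \<ominus> c) \<oplus> c \<in> mx" using c mx.a_closed by blast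
    then show False using one_notin_mx c by (simp add: a_minus_def a_assoc l_neg)
  qed
qed

text \<open>The usual hypothesis that a finitely generated module equals its product with
  \<open>mx\<close> modulo \<open>W\<close>, written as explicit equations so that they can be
  eliminated one at a time: solve for the first \<open>k\<close> elements modulo W + R x_k,
  substitute into the last equation, and divide by a unit \<open>\<one> \<ominus> c\<close>.\<close>

lemma nakayama:
  fixes k :: nat
  assumes "module R P" and "submodule W R P" and "\<And>i. i < k \<Longrightarrow> x i \<in> carrier P"
    and "\<And>i. i < k \<Longrightarrow> \<exists>c w. (\<forall>j<k. c j \<in> mx) \<and> w \<in> W \<and>
           x i = w \<oplus>\<^bsub>P\<^esub> (\<Oplus>\<^bsub>P\<^esub>j\<in>{..<k}. c j \<odot>\<^bsub>P\<^esub> x j)"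
  shows "\<forall>i<k. x i \<in> W"
  using assms(2-4)
proof (induction k arbitrary: W)
  case 0
  then show ?case by simp
next
  case (Suc k)
  interpret P: module R P by fact
  note W = submodule_mem[OF Suc.prems(1) assms(1)]
  have WP: "w \<in> carrier P" if "w \<in> W" for w using that W(1) by blast
  have xP: "x i \<in> carrier P" if "i < Suc k" for i using that Suc.prems(2) by simp
  have xk: "x k \<in> carrier P" by (simp add: xP)
  define A where "A I = {w \<oplus>\<^bsub>P\<^esub> r \<odot>\<^bsub>P\<^esub> x k | w r. w \<in> W \<and> r \<in> I}" for I
  have A: "submodule (A I) R P" if "ideal I R" for I
    unfolding A_def by (rule submodule_adjoin[OF assms(1) Suc.prems(1) that xk])
  have split: "\<exists>c w. (\<forall>j<Suc k. c j \<in> mx) \<and> w \<in> W \<and>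
      x i = w \<oplus>\<^bsub>P\<^esub> (c k \<odot>\<^bsub>P\<^esub> x k \<oplus>\<^bsub>P\<^esub> (\<Oplus>\<^bsub>P\<^esub>j\<in>{..<k}. c j \<odot>\<^bsub>P\<^esub> x j))" if i: "i < Suc k" for i
  proof -
    from Suc.prems(3)[OF i] obtain c w where c: "\<forall>j<Suc k. c j \<in> mx" and w: "w \<in> W"
      and x: "x i = w \<oplus>\<^bsub>P\<^esub> (\<Oplus>\<^bsub>P\<^esub>j\<in>{..<Suc k}. c j \<odot>\<^bsub>P\<^esub> x j)" by (elim exE conjE)
    have "(\<Oplus>\<^bsub>P\<^esub>j\<in>{..<Suc k}. c j \<odot>\<^bsub>P\<^esub> x j) = c k \<odot>\<^bsub>P\<^esub> x k \<oplus>\<^bsub>P\<^esub> (\<Oplus>\<^bsub>P\<^esub>j\<in>{..<k}. c j \<odot>\<^bsub>P\<^esub> x j)"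
      unfolding lessThan_Suc using c xP by (subst P.M.finsum_insert) auto
    then show ?thesis using c w x by auto
  qed
  \<comment> \<open>In the equations with \<open>i < k\<close> the term in \<open>x k\<close> is
    absorbed into the enlarged submodule W + R x_k, so that only coefficients with
    \<open>j < k\<close> remain.\<close>
  have one: "\<forall>i<k. x i \<in> A (carrier R)"
  proof (rule Suc.IH[OF A[OF oneideal]])
    fix i assume i: "i < k"
    then show "x i \<in> carrier P" using xP by simp
    from split[of i] i obtain c w where c: "\<forall>j<Suc k. c j \<in> mx" and w: "w \<in> W"
      and x: "x i = w \<oplus>\<^bsub>P\<^esub> (c k \<odot>\<^bsub>P\<^esub> x k \<oplus>\<^bsub>P\<^esub> (\<Oplus>\<^bsub>P\<^esub>j\<in>{..<k}. c j \<odot>\<^bsub>P\<^esub> x j))" by auto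
    have s: "(\<Oplus>\<^bsub>P\<^esub>j\<in>{..<k}. c j \<odot>\<^bsub>P\<^esub> x j) \<in> carrier P"
      using c xP by (intro P.M.finsum_closed) auto
    have "x i = (w \<oplus>\<^bsub>P\<^esub> c k \<odot>\<^bsub>P\<^esub> x k) \<oplus>\<^bsub>P\<^esub> (\<Oplus>\<^bsub>P\<^esub>j\<in>{..<k}. c j \<odot>\<^bsub>P\<^esub> x j)"
      using x s c WP[OF w] xk by (simp add: P.M.a_assoc)
    moreover have "c k \<in> carrier R" using c by simp
    then have "w \<oplus>\<^bsub>P\<^esub> c k \<odot>\<^bsub>P\<^esub> x k \<in> A (carrier R)" using w unfolding A_def by blast
    ultimately show "\<exists>c w. (\<forall>j<k. c j \<in> mx) \<and> w \<in> A (carrier R) \<and>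
        x i = w \<oplus>\<^bsub>P\<^esub> (\<Oplus>\<^bsub>P\<^esub>j\<in>{..<k}. c j \<odot>\<^bsub>P\<^esub> x j)"
      using c by (intro exI[of _ c] exI[of _ "w \<oplus>\<^bsub>P\<^esub> c k \<odot>\<^bsub>P\<^esub> x k"]) auto
  qed
  note Am = A[OF mx.is_ideal] note AmE = submodule_mem[OF Am assms(1)]
  have Wm: "w \<in> A mx" if "w \<in> W" for w
  proof -
    have "w = w \<oplus>\<^bsub>P\<^esub> \<zero> \<odot>\<^bsub>P\<^esub> x k" using WP[OF that] xk by simp
    then show ?thesis unfolding A_def using that mx.zero_closed by blast
  qed
  have rm: "r \<odot>\<^bsub>P\<^esub> x k \<in> A mx" if "r \<in> mx" for r
  proof -
    have "r \<odot>\<^bsub>P\<^esub> x k = \<zero>\<^bsub>P\<^esub> \<oplus>\<^bsub>P\<^esub> r \<odot>\<^bsub>P\<^esub> x k" using that xk by simp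
    then show ?thesis unfolding A_def using that W(2) by blast
  qed
  \<comment> \<open>A coefficient from \<open>mx\<close> turns an element of W + R x_k into one of W
    + mx x_k. This brings the last equation into the form x_k = w + c x_k with \<open>c\<close> in
    \<open>mx\<close>.\<close>
  have cm: "c \<odot>\<^bsub>P\<^esub> x j \<in> A mx" if j: "j < k" and c: "c \<in> mx" for c j
  proof -
    from one j obtain w r where w: "w \<in> W" "r \<in> carrier R" "x j = w \<oplus>\<^bsub>P\<^esub> r \<odot>\<^bsub>P\<^esub> x k"
      unfolding A_def by blast
    have "c \<odot>\<^bsub>P\<^esub> x j = c \<odot>\<^bsub>P\<^esub> w \<oplus>\<^bsub>P\<^esub> (c \<otimes> r) \<odot>\<^bsub>P\<^esub> x k"
      using w WP[OF w(1)] c xk by (simp add: P.smult_r_distr P.smult_assoc1)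
    moreover have "c \<odot>\<^bsub>P\<^esub> w \<in> W" using W(6) c w(1) by simp
    moreover have "c \<otimes> r \<in> mx" by (rule mx.I_r_closed[OF c w(2)])
    ultimately show ?thesis using AmE(3)[OF Wm rm] by simp
  qed
  have "x k \<in> A mx"
  proof -
    from split[of k] obtain c w where c: "\<forall>j<Suc k. c j \<in> mx" and w: "w \<in> W"
      and x: "x k = w \<oplus>\<^bsub>P\<^esub> (c k \<odot>\<^bsub>P\<^esub> x k \<oplus>\<^bsub>P\<^esub> (\<Oplus>\<^bsub>P\<^esub>j\<in>{..<k}. c j \<odot>\<^bsub>P\<^esub> x j))" by auto
    have "(\<Oplus>\<^bsub>P\<^esub>j\<in>{..<k}. c j \<odot>\<^bsub>P\<^esub> x j) \<in> A mx"
      by (rule submodule_finsum[OF Am assms(1)]) (use cm c in auto)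
    moreover have "c k \<odot>\<^bsub>P\<^esub> x k \<in> A mx" using rm c by simp
    ultimately show ?thesis using x AmE(3) Wm[OF w] by metis
  qed
  then obtain w c where w: "w \<in> W" "c \<in> mx" "x k = w \<oplus>\<^bsub>P\<^esub> c \<odot>\<^bsub>P\<^esub> x k" unfolding A_def by blast
  have cR: "c \<in> carrier R" using w(2) by simp
  have "(\<one> \<ominus> c) \<odot>\<^bsub>P\<^esub> x k = x k \<oplus>\<^bsub>P\<^esub> \<ominus>\<^bsub>P\<^esub> (c \<odot>\<^bsub>P\<^esub> x k)"
    using xk cR by (simp add: a_minus_def P.smult_l_distr P.smult_l_minus)
  also have "\<dots> = (w \<oplus>\<^bsub>P\<^esub> c \<odot>\<^bsub>P\<^esub> x k) \<oplus>\<^bsub>P\<^esub> \<ominus>\<^bsub>P\<^esub> (c \<odot>\<^bsub>P\<^esub> x k)" using w(3) by simp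
  also have "\<dots> = w" using WP[OF w(1)] xk cR by (simp add: P.M.a_assoc P.M.r_neg)
  finally have uw: "(\<one> \<ominus> c) \<odot>\<^bsub>P\<^esub> x k = w" .
  have u: "\<one> \<ominus> c \<in> Units R" by (rule unit_one_minus[OF w(2)])
  then have "inv (\<one> \<ominus> c) \<odot>\<^bsub>P\<^esub> w = x k"
    using uw xk P.smult_assoc1[symmetric, of "inv (\<one> \<ominus> c)" "\<one> \<ominus> c" "x k"]
    by (simp add: Units_closed)
  then have xkW: "x k \<in> W" using W(6)[OF _ w(1)] u by (metis Units_inv_closed)
  show ?case
  proof (intro allI impI)
    fix i assume i: "i < Suc k"
    show "x i \<in> W"
    proof (cases "i = k")
      case False
      then have "x i \<in> A (carrier R)" using one i by simp
      then obtain w r where wr: "w \<in> W" "r \<in> carrier R" "x i = w \<oplus>\<^bsub>P\<^esub> r \<odot>\<^bsub>P\<^esub> x k"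
        unfolding A_def by blast
      show ?thesis unfolding wr(3) by (rule W(3)[OF wr(1) W(6)[OF wr(2) xkW]])
    qed (use xkW in simp)
  qed
qed

text \<open>Nakayama's lemma is applied twice in place of a determinant. For injectivity the
  elements are the coordinates of a kernel vector, in the module \<open>R\<close> with
  \<open>W\<close> zero; for surjectivity they are the basis vectors, with \<open>W\<close> the
  image of \<open>h\<close>.\<close>

lemma near_identity_bij:
  assumes h: "h \<in> lin_maps R (free_rank R n) (free_rank R n)"
    and near: "\<And>x i. x \<in> carrier (free_rank R n) \<Longrightarrow> i < n \<Longrightarrow> h x i \<ominus> x i \<in> mx"
  shows "bij_betw h (carrier (free_rank R n)) (carrier (free_rank R n))"
proof -
  let ?F = "free_rank R n" and ?e = "basis_vec R {..<n}"
  note F = free_module_is_module[of "{..<n}"]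
  interpret F: module R ?F by (rule F)
  note cl = lin_closed[OF h] basis_vec_closed free_module_coord
  have ker: "x = \<zero>\<^bsub>?F\<^esub>" if x: "x \<in> carrier ?F" and hx: "h x = \<zero>\<^bsub>?F\<^esub>" for x
  proof -
    have "\<forall>i<n. x i \<in> {\<zero>\<^bsub>ring_as_module R\<^esub>}"
    proof (rule nakayama[OF ring_module submodule_zero[OF ring_module]])
      fix i assume i: "i < n"
      then show "x i \<in> carrier (ring_as_module R)" using free_module_coord[OF x] by simp
      \<comment> \<open>Since h(x) = 0, the i-th coordinate of h(x) - x is -x_i. Expanding it over
        the basis expresses x_i through all the x_j with coefficients from
        \<open>mx\<close>.\<close>
      define c where "c j = \<ominus> (h (?e j) i \<ominus> ?e j i)" for j
      have d: "(\<lambda>x. h x \<ominus>\<^bsub>?F\<^esub> x) \<in> lin_maps R ?F ?F" by (rule lin_diff[OF F F h lin_id])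
      have ei: "?e j \<in> carrier ?F" "h (?e j) \<in> carrier ?F" for j by (simp_all add: cl)
      have hi: "(\<lambda>x. (h x \<ominus>\<^bsub>?F\<^esub> x) i) \<in> lin_maps R ?F (ring_as_module R)"
        by (rule lin_comp[OF d coord_lin]) (use i in simp)
      have "(h x \<ominus>\<^bsub>?F\<^esub> x) i = (\<Oplus>j\<in>{..<n}. x j \<otimes> (h (?e j) \<ominus>\<^bsub>?F\<^esub> ?e j) i)"
        using lin_expand[OF ring_module hi x] by simp
      also have "\<dots> = (\<Oplus>j\<in>{..<n}. \<ominus> (c j \<otimes> x j))"
        using ei x i by (intro finsum_cong')
          (auto simp: c_def free_module_coord[of _ R "{..<n}"] l_minus r_minus m_comm)
      finally have e1: "(h x \<ominus>\<^bsub>?F\<^esub> x) i = (\<Oplus>j\<in>{..<n}. \<ominus> (c j \<otimes> x j))" .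
      have cm: "c j \<in> mx" for j using near[of "?e j" i] i ei unfolding c_def by simp
      have xi: "x j \<in> carrier R" if "j < n" for j using free_module_coord[OF x] that by simp
      have cR: "c j \<in> carrier R" for j using cm by simp
      have "(\<lambda>r. \<ominus> r) \<in> lin_maps R (ring_as_module R) (ring_as_module R)"
        by (rule lin_mapsI) (auto simp: minus_add r_minus)
      from lin_finsum[OF ring_module ring_module this, of "\<lambda>j. c j \<otimes> x j" "{..<n}"]
      have "\<ominus> (\<Oplus>j\<in>{..<n}. c j \<otimes> x j) = (\<Oplus>j\<in>{..<n}. \<ominus> (c j \<otimes> x j))"
        using xi cR by (simp add: Pi_iff)
      moreover have "(h x \<ominus>\<^bsub>?F\<^esub> x) i = \<ominus> x i"
        using hx i x xi by (simp add: a_minus_def free_module_coord)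
      ultimately have "\<ominus> x i = \<ominus> (\<Oplus>j\<in>{..<n}. c j \<otimes> x j)" using e1 by simp
      moreover have "(\<Oplus>j\<in>{..<n}. c j \<otimes> x j) \<in> carrier R" using xi cR by (intro finsum_closed) auto
      ultimately have "x i = (\<Oplus>j\<in>{..<n}. c j \<otimes> x j)" using xi[OF i] by (metis minus_minus)
      then show "\<exists>c w. (\<forall>j<n. c j \<in> mx) \<and> w \<in> {\<zero>\<^bsub>ring_as_module R\<^esub>} \<and>
          x i = w \<oplus>\<^bsub>ring_as_module R\<^esub> (\<Oplus>\<^bsub>ring_as_module R\<^esub>j\<in>{..<n}. c j \<odot>\<^bsub>ring_as_module R\<^esub> x j)"
        using cm xi[OF i] by (intro exI[of _ c] exI[of _ \<zero>]) auto
    qed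
    then show ?thesis using x by (intro free_module_eqI[OF x F.M.zero_closed]) auto
  qed
  have "inj_on h (carrier ?F)"
  proof (rule inj_onI)
    fix x y assume xy: "x \<in> carrier ?F" "y \<in> carrier ?F" "h x = h y"
    then have "h (x \<ominus>\<^bsub>?F\<^esub> y) = \<zero>\<^bsub>?F\<^esub>"
      using lin_minus[OF F F h xy(1,2)] lin_closed[OF h] by (simp add: F.M.minus_eq_zero_iff)
    then show "x = y" using ker[of "x \<ominus>\<^bsub>?F\<^esub> y"] xy by (simp add: F.M.minus_eq_zero_iff)
  qed
  moreover have "h ` carrier ?F = carrier ?F"
  proof (rule submodule_basis)
    show W: "submodule (h ` carrier ?F) R ?F"
      by (rule submodule_image[OF F F h submodule_carrier[OF F]])
    have "\<forall>i<n. ?e i \<in> h ` carrier ?F"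
    proof (rule nakayama[OF F W])
      fix i assume i: "i < n"
      show ei: "?e i \<in> carrier ?F" by (rule basis_vec_closed)
      define y where "y = \<ominus>\<^bsub>?F\<^esub> (h (?e i) \<ominus>\<^bsub>?F\<^esub> ?e i)"
      have he: "h (?e i) \<in> carrier ?F" by (simp add: cl)
      have y: "y \<in> carrier ?F" unfolding y_def using ei he by simp
      have "?e i = h (?e i) \<oplus>\<^bsub>?F\<^esub> y"
        using ei he by (simp add: y_def a_minus_def F.M.minus_add F.M.a_ac F.M.r_neg2 F.M.r_neg)
      moreover have "y = (\<Oplus>\<^bsub>?F\<^esub>j\<in>{..<n}. y j \<odot>\<^bsub>?F\<^esub> ?e j)"
        using lin_expand[OF F lin_id y] by simp
      moreover have "y j \<in> mx" if "j < n" for j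
        using near[OF ei that] ei he that by (simp add: y_def)
      ultimately show "\<exists>c w. (\<forall>j<n. c j \<in> mx) \<and> w \<in> h ` carrier ?F \<and>
          ?e i = w \<oplus>\<^bsub>?F\<^esub> (\<Oplus>\<^bsub>?F\<^esub>j\<in>{..<n}. c j \<odot>\<^bsub>?F\<^esub> ?e j)"
        using ei by (intro exI[of _ y] exI[of _ "h (?e i)"]) auto
    qed
    then show "?e s \<in> h ` carrier ?F" if "s \<in> {..<n}" for s using that by simp
  qed
  ultimately show ?thesis by (simp add: bij_betw_def)
qed

text \<open>Projectivity gives lifts in both directions. Their composite moves a vector by an
  element of the kernel of a minimal cover, whose coordinates lie in \<open>mx\<close>, so both
  composites are bijective.\<close>

lemma min_cover_lift_bij:
  assumes "module R P" and "min_cover R P n e" and "min_cover R P k e'"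
  obtains g where "g \<in> lin_maps R (free_rank R n) (free_rank R k)"
    and "bij_betw g (carrier (free_rank R n)) (carrier (free_rank R k))"
    and "\<And>x. x \<in> carrier (free_rank R n) \<Longrightarrow> e' (g x) = e x"
proof -
  note F = free_module_is_module
  have lift: "\<exists>g. g \<in> lin_maps R (free_rank R n) (free_rank R k) \<and>
      (\<forall>x\<in>carrier (free_rank R n). e' (g x) = e x)"
    if "min_cover R P n e" "min_cover R P k e'" for n e k e'
  proof -
    note c = that[unfolded min_cover_def]
    obtain g where "g \<in> lin_maps R (free_rank R n) (free_rank R k)"
      "\<And>x. x \<in> carrier (free_rank R n) \<Longrightarrow> e' (g x) = e x"
    proof (rule free_lift[OF F assms(1)])
      show "e \<in> lin_maps R (free_rank R n) P" "e' \<in> lin_maps R (free_rank R k) P" using c by simp_all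
      fix s show "e (basis_vec R {..<n} s) \<in> e' ` carrier (free_rank R k)"
        using c lin_closed[of e R _ P, OF _ basis_vec_closed] by simp
    next
      fix g assume "g \<in> lin_maps R (free_rank R n) (free_rank R k)"
        "\<And>x. x \<in> carrier (free_rank R n) \<Longrightarrow> e' (g x) = e x"
      then show thesis by (rule that)
    qed
    then show ?thesis by blast
  qed
  have near: "bij_betw (\<lambda>x. g' (g x)) (carrier (free_rank R n)) (carrier (free_rank R n))"
    if c: "min_cover R P n e" and g: "g \<in> lin_maps R (free_rank R n) (free_rank R k)"
      and g': "g' \<in> lin_maps R (free_rank R k) (free_rank R n)"
      and eg: "\<forall>x\<in>carrier (free_rank R n). e' (g x) = e x"
      and eg': "\<forall>x\<in>carrier (free_rank R k). e (g' x) = e' x" for n e k e' g g'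
  proof (rule near_identity_bij[OF lin_comp[OF g g']])
    fix x i assume x: "x \<in> carrier (free_rank R n)" and i: "i < n"
    interpret P: module R P by fact
    have e: "e \<in> lin_maps R (free_rank R n) P" using c unfolding min_cover_def by simp
    have gx: "g x \<in> carrier (free_rank R k)" by (rule lin_closed[OF g x])
    have ggx: "g' (g x) \<in> carrier (free_rank R n)" by (rule lin_closed[OF g' gx])
    have "e (g' (g x) \<ominus>\<^bsub>free_rank R n\<^esub> x) = \<zero>\<^bsub>P\<^esub>"
      using lin_minus[OF F assms(1) e ggx x] eg eg' x gx lin_closed[OF e x]
      by (simp add: P.M.minus_eq_zero_iff)
    moreover have "g' (g x) \<ominus>\<^bsub>free_rank R n\<^esub> x \<in> carrier (free_rank R n)"
      by (rule submodule_mem(5)[OF submodule_carrier[OF F] F ggx x])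
    ultimately have "(g' (g x) \<ominus>\<^bsub>free_rank R n\<^esub> x) i \<in> mx"
      using min_coverD(3)[OF c _ _ i] by blast
    then show "g' (g x) i \<ominus> x i \<in> mx" using i x ggx by simp
  qed
  obtain g where g: "g \<in> lin_maps R (free_rank R n) (free_rank R k)"
    "\<forall>x\<in>carrier (free_rank R n). e' (g x) = e x" using lift[OF assms(2,3)] by blast
  obtain g' where g': "g' \<in> lin_maps R (free_rank R k) (free_rank R n)"
    "\<forall>x\<in>carrier (free_rank R k). e (g' x) = e' x" using lift[OF assms(3,2)] by blast
  have b: "bij_betw (\<lambda>x. g' (g x)) (carrier (free_rank R n)) (carrier (free_rank R n))"
    by (rule near[OF assms(2) g(1) g'(1) g(2) g'(2)])
  have b': "bij_betw (\<lambda>x. g (g' x)) (carrier (free_rank R k)) (carrier (free_rank R k))"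
    by (rule near[OF assms(3) g'(1) g(1) g'(2) g(2)])
  have "inj_on g (carrier (free_rank R n))"
  proof (rule inj_onI)
    fix x y assume "x \<in> carrier (free_rank R n)" "y \<in> carrier (free_rank R n)" "g x = g y"
    then show "x = y" using b unfolding bij_betw_def inj_on_def by auto
  qed
  moreover have "g ` carrier (free_rank R n) = carrier (free_rank R k)"
  proof
    show "g ` carrier (free_rank R n) \<subseteq> carrier (free_rank R k)" using lin_closed[OF g(1)] by blast
    have "carrier (free_rank R k) = (\<lambda>x. g (g' x)) ` carrier (free_rank R k)"
      using b' by (simp add: bij_betw_def)
    also have "\<dots> \<subseteq> g ` carrier (free_rank R n)" using lin_closed[OF g'(1)] by blast
    finally show "carrier (free_rank R k) \<subseteq> g ` carrier (free_rank R n)" .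
  qed
  ultimately show thesis using that[OF g(1)] g(2) by (simp add: bij_betw_def)
qed

text \<open>A cover of least rank is minimal: a unit coordinate in a kernel vector would express one
  of the generators through the others.\<close>

lemma min_cover_exists:
  assumes "module R P" and "fin_gen R P"
  obtains n e where "min_cover R P n e"
proof -
  interpret P: module R P by fact
  note F = free_module_is_module
  define Q where "Q n \<longleftrightarrow> (\<exists>e. e \<in> lin_maps R (free_rank R n) P \<and> e ` carrier (free_rank R n) = carrier P)" for n
  have "\<exists>n. Q n" unfolding Q_def by (rule fin_gen_surj[OF assms]) blast
  then have Q: "Q (LEAST n. Q n)" by (rule LeastI_ex)
  define n where "n = (LEAST n. Q n)"
  obtain e where e: "e \<in> lin_maps R (free_rank R n) P" "e ` carrier (free_rank R n) = carrier P"
    using Q unfolding n_def[symmetric] unfolding Q_def by blast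
  let ?F = "free_rank R n" and ?e = "basis_vec R {..<n}"
  have "x i \<in> mx" if x: "x \<in> a_kernel ?F P e" and i: "i < n" for x i
  proof (rule ccontr)
    assume nm: "x i \<notin> mx"
    have xF: "x \<in> carrier ?F" and ex: "e x = \<zero>\<^bsub>P\<^esub>" using x by (simp_all add: a_kernel_iff)
    have xR: "x j \<in> carrier R" if "j < n" for j using free_module_coord[OF xF] that by simp
    have u: "x i \<in> Units R" by (rule unit_of_notin_mx[OF xR[OF i] nm])
    \<comment> \<open>Enumerates the indices below \<open>n\<close> other than \<open>i\<close>, for
      a cover of rank \<open>n - 1\<close>.\<close>
    define \<sigma> where "\<sigma> j = (if j < i then j else Suc j)" for j
    have n: "n = Suc (n - 1)" using i by simp
    have \<sigma>_onto: "\<exists>k<n - 1. \<sigma> k = j" if "j < n" "j \<noteq> i" for j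
      using that i by (intro exI[of _ "if j < i then j else j - 1"]) (auto simp: \<sigma>_def)
    have eP: "e (?e j) \<in> carrier P" for j by (rule lin_closed[OF e(1) basis_vec_closed])
    let ?b = "\<lambda>j. e (?e (\<sigma> j))"
    have b: "?b \<in> {..<n - 1} \<rightarrow> carrier P" using eP by simp
    define e' where "e' = flin P {..<n - 1} ?b"
    have e': "e' \<in> lin_maps R (free_rank R (n - 1)) P" unfolding e'_def by (rule flin_lin[OF assms(1) b])
    define W where "W = e' ` carrier (free_rank R (n - 1))"
    have W: "submodule W R P" unfolding W_def by (rule submodule_image[OF F assms(1) e' submodule_carrier[OF F]])
    note WE = submodule_mem[OF W assms(1)]
    have in_W: "e (?e j) \<in> W" if j: "j < n" "j \<noteq> i" for j
    proof -
      obtain k where k: "k < n - 1" "\<sigma> k = j" using \<sigma>_onto[OF j] by blast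
      have "e' (basis_vec R {..<n - 1} k) = e (?e j)"
        unfolding e'_def using flin_basis[OF assms(1) b, of k] k by simp
      then show ?thesis unfolding W_def using basis_vec_closed by (metis image_eqI)
    qed
    have sW: "(\<Oplus>\<^bsub>P\<^esub>j\<in>{..<n} - {i}. x j \<odot>\<^bsub>P\<^esub> e (?e j)) \<in> W" (is "?s \<in> W")
      by (rule submodule_finsum[OF W assms(1)], rule WE(6)) (use xR in_W in auto)
    have "\<zero>\<^bsub>P\<^esub> = (\<Oplus>\<^bsub>P\<^esub>j\<in>{..<n}. x j \<odot>\<^bsub>P\<^esub> e (?e j))"
      using lin_expand[OF assms(1) e(1) xF] ex by simp
    also have "\<dots> = x i \<odot>\<^bsub>P\<^esub> e (?e i) \<oplus>\<^bsub>P\<^esub> ?s"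
    proof -
      have "insert i ({..<n} - {i}) = {..<n}" using i by auto
      then show ?thesis
        using P.M.finsum_insert[of "{..<n} - {i}" i "\<lambda>j. x j \<odot>\<^bsub>P\<^esub> e (?e j)"] xR eP i by simp
    qed
    finally have "x i \<odot>\<^bsub>P\<^esub> e (?e i) = \<ominus>\<^bsub>P\<^esub> ?s"
      using WE(1) sW xR[OF i] eP[of i] by (intro P.M.minus_equality[symmetric]) auto
    then have "x i \<odot>\<^bsub>P\<^esub> e (?e i) \<in> W" using WE(4)[OF sW] by simp
    then have "inv (x i) \<odot>\<^bsub>P\<^esub> (x i \<odot>\<^bsub>P\<^esub> e (?e i)) \<in> W" by (rule WE(6)[OF Units_inv_closed[OF u]])
    moreover have "inv (x i) \<odot>\<^bsub>P\<^esub> (x i \<odot>\<^bsub>P\<^esub> e (?e i)) = e (?e i)"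
      using u eP[of i] by (simp add: P.smult_assoc1[symmetric] Units_closed)
    ultimately have all: "e (?e j) \<in> W" if "j < n" for j using in_W that by (cases "j = i") auto
    have "{y \<in> carrier ?F. e y \<in> W} = carrier ?F"
      by (rule submodule_basis[OF submodule_vimage[OF F assms(1) e(1) W]]) (use all basis_vec_closed in auto)
    then have "e ` carrier ?F \<subseteq> W" by auto
    then have "carrier P \<subseteq> W" using e(2) by simp
    then have "Q (n - 1)" unfolding Q_def using e' WE(1) W_def by (metis subset_antisym)
    then have "n \<le> n - 1" unfolding n_def by (rule Least_le)
    then show False using i by simp
  qed
  then have "min_cover R P n e" unfolding min_cover_def using e by blast
  then show thesis by (rule that)
qed

section \<open>Existence of minimal presentations\<close>

lemma ideal_times_free_iff:
  "x \<in> ideal_times R mx (free_rank R n) \<longleftrightarrow> x \<in> carrier (free_rank R n) \<and> (\<forall>i<n. x i \<in> mx)"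
proof
  let ?F = "free_rank R n" and ?X = "{a \<odot>\<^bsub>free_rank R n\<^esub> x | a x. a \<in> mx \<and> x \<in> carrier (free_rank R n)}"
  note F = free_module_is_module[of "{..<n}"]
  interpret F: module R ?F by (rule F)
  have X: "?X \<subseteq> carrier ?F" by auto
  have sub: "submodule {x \<in> carrier ?F. \<forall>i<n. x i \<in> mx} R ?F"
    by (rule submoduleI'[OF F]) (auto simp: mx.I_l_closed)
  { assume "x \<in> ideal_times R mx ?F"
    moreover have "?X \<subseteq> {x \<in> carrier ?F. \<forall>i<n. x i \<in> mx}"
      by (auto simp: free_module_coord mx.I_r_closed)
    ultimately show "x \<in> carrier ?F \<and> (\<forall>i<n. x i \<in> mx)"
      using submodule_span_least[OF sub] unfolding ideal_times_def by blast }
  assume x: "x \<in> carrier ?F \<and> (\<forall>i<n. x i \<in> mx)"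
  have "(\<Oplus>\<^bsub>?F\<^esub>j\<in>{..<n}. x j \<odot>\<^bsub>?F\<^esub> basis_vec R {..<n} j) \<in> ideal_times R mx ?F"
    unfolding ideal_times_def
  proof (rule submodule_finsum[OF submodule_span_props(1)[OF F X] F])
    fix i assume "i \<in> {..<n}"
    then have "x i \<odot>\<^bsub>?F\<^esub> basis_vec R {..<n} i \<in> ?X" using x basis_vec_closed by fast
    then show "x i \<odot>\<^bsub>?F\<^esub> basis_vec R {..<n} i \<in> submodule_span R ?F ?X"
      by (rule subsetD[OF submodule_span_props(2)[OF F X]])
  qed
  then show "x \<in> ideal_times R mx ?F" using lin_expand[OF F lin_id] x by simp
qed

lemma minimal_presentation_iff:
  "minimal_presentation R P m n f \<longleftrightarrow>
     f \<in> lin_maps R (free_rank R m) (free_rank R n) \<and>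
     (\<forall>x\<in>a_kernel (free_rank R m) (free_rank R n) f. \<forall>i<m. x i \<in> mx) \<and>
     (\<exists>e. min_cover R P n e \<and> f ` carrier (free_rank R m) = a_kernel (free_rank R n) P e)"
proof -
  have 1: "a_kernel (free_rank R n) P e \<subseteq> ideal_times R mx (free_rank R n) \<longleftrightarrow>
      (\<forall>x\<in>a_kernel (free_rank R n) P e. \<forall>i<n. x i \<in> mx)" for e
    by (auto simp: ideal_times_free_iff a_kernel_iff)
  have 2: "a_kernel (free_rank R m) (free_rank R n) f \<subseteq> ideal_times R mx (free_rank R m) \<longleftrightarrow>
      (\<forall>x\<in>a_kernel (free_rank R m) (free_rank R n) f. \<forall>i<m. x i \<in> mx)"
    by (auto simp: ideal_times_free_iff a_kernel_iff)
  show ?thesis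
    unfolding minimal_presentation_def min_cover_def 2 1[symmetric] by auto
qed

text \<open>A minimal cover is followed by a minimal cover of its kernel, which is finitely
  generated because the ring is Noetherian. The kernel is made into a module \<open>K'\<close> of
  its own, so that maps into it are the maps into the free module with image in the kernel.\<close>

lemma minimal_presentation_exists:
  assumes "module R P" and "fin_gen R P"
  shows "\<exists>m n f. minimal_presentation R P m n f"
proof -
  note F = free_module_is_module
  obtain n e where e: "min_cover R P n e" by (rule min_cover_exists[OF assms])
  let ?K = "a_kernel (free_rank R n) P e"
  have "e \<in> lin_maps R (free_rank R n) P" using e by (simp add: min_cover_def)
  then have K: "submodule ?K R (free_rank R n)" by (rule submodule_kernel[OF F assms(1)])
  define K' where "K' = (free_rank R n)\<lparr>carrier := ?K\<rparr>"
  have K': "module R K'" unfolding K'_def by (rule submodule.submodule_is_module[OF K F])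
  have lin: "g \<in> lin_maps R (free_rank R m) K' \<longleftrightarrow>
      g \<in> lin_maps R (free_rank R m) (free_rank R n) \<and> g ` carrier (free_rank R m) \<subseteq> ?K" for g m
    using submodule_mem(1)[OF K F] unfolding lin_maps_def K'_def by auto
  have "fin_gen R K'"
  proof -
    obtain m f where f: "f \<in> lin_maps R (free_rank R m) (free_rank R n)"
      "f ` carrier (free_rank R m) = ?K"
      by (rule free_submodule_surj[OF _ K]) auto
    show ?thesis by (rule fin_gen_of_surj[OF K', of f m]) (use f lin in \<open>auto simp: K'_def\<close>)
  qed
  then obtain m f where f: "min_cover R K' m f" using min_cover_exists[OF K'] by metis
  then have "minimal_presentation R P m n f"
    unfolding minimal_presentation_iff using e lin
    by (auto simp: min_cover_def K'_def a_kernel_iff)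
  then show ?thesis by blast
qed

lemma some_presentation_minimal:
  assumes "module R P" and "fin_gen R P" and "some_presentation R P = (m, n, f)"
  shows "minimal_presentation R P m n f"
proof -
  have "\<exists>t. (\<lambda>(m, n, f). minimal_presentation R P m n f) t"
    using minimal_presentation_exists[OF assms(1,2)] by auto
  from someI_ex[OF this] show ?thesis
    using assms(3) unfolding some_presentation_def by simp
qed

end

section \<open>Duality and the linkage operator\<close>

lemma hom_module_simps [simp]:
  "carrier (hom_module R P Q) = lin_maps R P Q \<inter> extensional (carrier P)"
  "\<zero>\<^bsub>hom_module R P Q\<^esub> = (\<lambda>x\<in>carrier P. \<zero>\<^bsub>Q\<^esub>)"
  "f \<oplus>\<^bsub>hom_module R P Q\<^esub> g = (\<lambda>x\<in>carrier P. f x \<oplus>\<^bsub>Q\<^esub> g x)"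
  "a \<odot>\<^bsub>hom_module R P Q\<^esub> f = (\<lambda>x\<in>carrier P. a \<odot>\<^bsub>Q\<^esub> f x)"
  by (simp_all add: hom_module_def)

lemma lin_restrict:
  assumes "module R P" and "h \<in> lin_maps R P Q"
  shows "(\<lambda>x\<in>carrier P. h x) \<in> lin_maps R P Q \<inter> extensional (carrier P)"
  using lin_cong[OF assms(2) _ assms(1), of "\<lambda>x\<in>carrier P. h x"] by simp

lemma lin_const_zero:
  assumes "module R P" and "module R Q"
  shows "(\<lambda>x. \<zero>\<^bsub>Q\<^esub>) \<in> lin_maps R P Q"
proof -
  interpret Q: module R Q by fact
  show ?thesis by (rule lin_mapsI) simp_all
qed

lemma hom_module_is_module:
  assumes "module R P" and "module R Q"
  shows "module R (hom_module R P Q)"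
proof -
  interpret P: module R P by fact
  interpret Q: module R Q by fact
  let ?H = "hom_module R P Q"
  have cl: "f \<oplus>\<^bsub>?H\<^esub> g \<in> carrier ?H" "a \<odot>\<^bsub>?H\<^esub> f \<in> carrier ?H" "\<zero>\<^bsub>?H\<^esub> \<in> carrier ?H"
    if "f \<in> carrier ?H" "g \<in> carrier ?H" "a \<in> carrier R" for f g a
    using lin_restrict[OF assms(1) lin_plus[OF assms(2,1), of f g]]
      lin_restrict[OF assms(1) lin_scale[OF assms(2,1), of f a]]
      lin_restrict[OF assms(1) lin_const_zero[OF assms]] that by simp_all
  have val: "f x \<in> carrier Q" if "f \<in> carrier ?H" "x \<in> carrier P" for f x
    using lin_closed[of f R P Q] that by simp
  show ?thesis
  proof (rule moduleI)
    show "abelian_group ?H"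
    proof (rule abelian_groupI)
      fix f assume f: "f \<in> carrier ?H"
      have "(\<ominus>\<^bsub>R\<^esub> \<one>\<^bsub>R\<^esub>) \<odot>\<^bsub>?H\<^esub> f \<in> carrier ?H" by (rule cl(2)[OF f f]) simp
      moreover have "(\<ominus>\<^bsub>R\<^esub> \<one>\<^bsub>R\<^esub>) \<odot>\<^bsub>?H\<^esub> f \<oplus>\<^bsub>?H\<^esub> f = \<zero>\<^bsub>?H\<^esub>"
        using val[OF f] by (auto intro!: restrict_ext simp: Q.smult_l_minus Q.M.l_neg)
      ultimately show "\<exists>g\<in>carrier ?H. g \<oplus>\<^bsub>?H\<^esub> f = \<zero>\<^bsub>?H\<^esub>" by blast
    next
      fix f g assume fg: "f \<in> carrier ?H" "g \<in> carrier ?H"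
      show "f \<oplus>\<^bsub>?H\<^esub> g \<in> carrier ?H" by (rule cl(1)[OF fg P.R.zero_closed])
      show "f \<oplus>\<^bsub>?H\<^esub> g = g \<oplus>\<^bsub>?H\<^esub> f"
        using val[OF fg(1)] val[OF fg(2)] by (auto intro!: restrict_ext simp: Q.M.a_comm)
      fix h assume h: "h \<in> carrier ?H"
      show "f \<oplus>\<^bsub>?H\<^esub> g \<oplus>\<^bsub>?H\<^esub> h = f \<oplus>\<^bsub>?H\<^esub> (g \<oplus>\<^bsub>?H\<^esub> h)"
        using val[OF fg(1)] val[OF fg(2)] val[OF h] by (auto intro!: restrict_ext simp: Q.M.a_assoc)
    next
      show "\<zero>\<^bsub>?H\<^esub> \<in> carrier ?H" using lin_restrict[OF assms(1) lin_const_zero[OF assms]] by simp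
    next
      fix f assume f: "f \<in> carrier ?H"
      then show "\<zero>\<^bsub>?H\<^esub> \<oplus>\<^bsub>?H\<^esub> f = f"
        using val[OF f] by (intro extensionalityI[of _ "carrier P"]) auto
    qed
  next
    fix a f assume a: "a \<in> carrier R" and f: "f \<in> carrier ?H"
    show "a \<odot>\<^bsub>?H\<^esub> f \<in> carrier ?H" by (rule cl(2)[OF f f a])
    fix b assume b: "b \<in> carrier R"
    show "(a \<oplus>\<^bsub>R\<^esub> b) \<odot>\<^bsub>?H\<^esub> f = a \<odot>\<^bsub>?H\<^esub> f \<oplus>\<^bsub>?H\<^esub> b \<odot>\<^bsub>?H\<^esub> f"
      "(a \<otimes>\<^bsub>R\<^esub> b) \<odot>\<^bsub>?H\<^esub> f = a \<odot>\<^bsub>?H\<^esub> (b \<odot>\<^bsub>?H\<^esub> f)"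
      using val[OF f] a b by (auto intro!: restrict_ext simp: Q.smult_l_distr Q.smult_assoc1)
  next
    fix a f g assume "a \<in> carrier R" and fg: "f \<in> carrier ?H" "g \<in> carrier ?H"
    then show "a \<odot>\<^bsub>?H\<^esub> (f \<oplus>\<^bsub>?H\<^esub> g) = a \<odot>\<^bsub>?H\<^esub> f \<oplus>\<^bsub>?H\<^esub> a \<odot>\<^bsub>?H\<^esub> g"
      using val[OF fg(1)] val[OF fg(2)] by (auto intro!: restrict_ext simp: Q.smult_r_distr)
  next
    fix f assume f: "f \<in> carrier ?H"
    then show "\<one>\<^bsub>R\<^esub> \<odot>\<^bsub>?H\<^esub> f = f"
      using val[OF f] by (intro extensionalityI[of _ "carrier P"]) auto
  qed (rule P.R.is_cring)
qed

lemma precomp_lin: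
  assumes "module R P" and "module R P'" and "module R Q" and "f \<in> lin_maps R P P'"
  shows "precomp P f \<in> lin_maps R (hom_module R P' Q) (hom_module R P Q)"
proof (rule lin_mapsI)
  fix g assume g: "g \<in> carrier (hom_module R P' Q)"
  then show "precomp P f g \<in> carrier (hom_module R P Q)"
    using lin_restrict[OF assms(1) lin_comp[OF assms(4), of g Q]] by (simp add: precomp_def)
qed (auto simp: precomp_def lin_closed[OF assms(4)] intro!: restrict_ext)

section \<open>Dot product and orthogonal complement\<close>

context cring
begin

definition dot :: "nat \<Rightarrow> (nat \<Rightarrow> 'a) \<Rightarrow> (nat \<Rightarrow> 'a) \<Rightarrow> 'a" where
  "dot n x y = (\<Oplus>i\<in>{..<n}. x i \<otimes> y i)"

text \<open>The dot product identifies the free module with its dual. Then \<open>perp n U\<close>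
  consists of the functionals that vanish on \<open>U\<close>; it is the dual of the quotient by
  \<open>U\<close> if \<open>U\<close> is a submodule.\<close>

definition perp :: "nat \<Rightarrow> (nat \<Rightarrow> 'a) set \<Rightarrow> (nat \<Rightarrow> 'a) set" where
  "perp n U = {v \<in> carrier (free_rank R n). \<forall>u\<in>U. dot n u v = \<zero>}"

lemma dot_lin_left:
  assumes "y \<in> carrier (free_rank R n)"
  shows "(\<lambda>x. dot n x y) \<in> lin_maps R (free_rank R n) (ring_as_module R)"
proof (rule lin_cong[OF flin_lin[OF ring_module, of y] _ free_module_is_module])
  show y: "y \<in> {..<n} \<rightarrow> carrier (ring_as_module R)" using free_module_coord[OF assms] by auto
  fix x assume "x \<in> carrier (free_rank R n)"
  then show "dot n x y = flin (ring_as_module R) {..<n} y x"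
    using flin_finite[OF ring_module y] by (simp add: dot_def)
qed

lemma dot_comm:
  assumes "x \<in> carrier (free_rank R n)" and "y \<in> carrier (free_rank R n)"
  shows "dot n x y = dot n y x"
  unfolding dot_def using free_module_coord[OF assms(1)] free_module_coord[OF assms(2)]
  by (intro finsum_cong') (auto simp: m_comm)

lemma dot_closed:
  assumes "x \<in> carrier (free_rank R n)" and "y \<in> carrier (free_rank R n)"
  shows "dot n x y \<in> carrier R"
  using lin_closed[OF dot_lin_left[OF assms(2)] assms(1)] by simp

lemma dot_lin_right:
  assumes "x \<in> carrier (free_rank R n)"
  shows "(\<lambda>y. dot n x y) \<in> lin_maps R (free_rank R n) (ring_as_module R)"
  by (rule lin_cong[OF dot_lin_left[OF assms] _ free_module_is_module]) (rule dot_comm[OF assms])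

lemma dot_basis_left:
  assumes "y \<in> carrier (free_rank R n)" and "i < n"
  shows "dot n (basis_vec R {..<n} i) y = y i"
proof -
  have y: "y \<in> {..<n} \<rightarrow> carrier (ring_as_module R)" using free_module_coord[OF assms(1)] by auto
  from flin_basis[OF ring_module this] show ?thesis
    using flin_finite[OF ring_module y basis_vec_closed] assms(2) by (simp add: dot_def)
qed

lemma functional_dot:
  assumes "h \<in> lin_maps R (free_rank R n) (ring_as_module R)" and "x \<in> carrier (free_rank R n)"
  shows "h x = dot n x (\<lambda>i\<in>{..<n}. h (basis_vec R {..<n} i))"
proof -
  have "h (basis_vec R {..<n} i) \<in> carrier R" for i using lin_closed[OF assms(1) basis_vec_closed] by simp
  then show ?thesis using lin_expand[OF ring_module assms] free_module_coord[OF assms(2)]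
    by (auto simp: dot_def intro!: finsum_cong')
qed

text \<open>Each coordinate of the composite of \<open>e\<close> and the embedding \<open>j\<close>
  is a functional that vanishes on the kernel, hence the dot product with a vector of the
  complement. A vector orthogonal to the complement is therefore killed by that composite, and so by
  \<open>e\<close>.\<close>

lemma submodule_kernel_torsionless:
  assumes "module R P" and e: "e \<in> lin_maps R (free_rank R n) P"
    and j: "j \<in> lin_maps R P (free_rank R k)" and inj: "inj_on j (carrier P)"
  shows "a_kernel (free_rank R n) P e = perp n (perp n (a_kernel (free_rank R n) P e))"
proof -
  let ?F = "free_rank R n" let ?U = "a_kernel ?F P e"
  note F = free_module_is_module
  interpret P: module R P by fact
  have UF: "?U \<subseteq> carrier ?F" by (auto simp: a_kernel_iff)
  have "x \<in> perp n (perp n ?U)" if "x \<in> ?U" for x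
  proof -
    have xF: "x \<in> carrier ?F" using that UF by blast
    then have "dot n u x = \<zero>" if "u \<in> perp n ?U" for u
      using \<open>x \<in> ?U\<close> that dot_comm[OF _ xF, of u] by (simp add: perp_def)
    then show ?thesis using xF by (simp add: perp_def)
  qed
  moreover have "x \<in> ?U" if x: "x \<in> perp n (perp n ?U)" for x
  proof -
    have xF: "x \<in> carrier ?F" using x by (simp add: perp_def)
    have ex: "e x \<in> carrier P" by (rule lin_closed[OF e xF])
    have "j (e x) i = \<zero>" if i: "i < k" for i
    proof -
      have h: "(\<lambda>y. j (e y) i) \<in> lin_maps R ?F (ring_as_module R)"
        by (rule lin_comp[OF lin_comp[OF e j] coord_lin]) (use i in simp)
      define v where "v = (\<lambda>s\<in>{..<n}. j (e (basis_vec R {..<n} s)) i)"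
      have hv: "j (e y) i = dot n y v" if "y \<in> carrier ?F" for y
        unfolding v_def by (rule functional_dot[OF h that])
      have vF: "v \<in> carrier ?F"
        using lin_closed[OF h basis_vec_closed] by (auto simp: free_rank_mem v_def)
      have "dot n u v = \<zero>" if "u \<in> ?U" for u
        using that hv[of u] lin_zero[OF assms(1) F j] i by (simp add: a_kernel_iff)
      then have "v \<in> perp n ?U" using vF by (simp add: perp_def)
      then have "dot n v x = \<zero>" using x by (simp add: perp_def)
      then show ?thesis using hv[OF xF] dot_comm[OF xF vF] by simp
    qed
    then have "j (e x) = j \<zero>\<^bsub>P\<^esub>"
      using lin_closed[OF j ex] lin_closed[OF j P.M.zero_closed] lin_zero[OF assms(1) F j]
      by (intro free_module_eqI) auto
    then have "e x = \<zero>\<^bsub>P\<^esub>" using inj ex by (auto simp: inj_on_def)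
    then show ?thesis using xF by (simp add: a_kernel_iff)
  qed
  ultimately show ?thesis by blast
qed

end

section \<open>The linkage operator in terms of a minimal cover\<close>

context local_noeth
begin

text \<open>\<open>Tr_mod R X\<close> is the cokernel of the transpose of \<open>f\<close>, so its
  syzygy is the image of that transpose. This image is the quotient of R^n by the vectors orthogonal
  to the image of \<open>f\<close>, which is the kernel of \<open>e\<close>. The inclusion into a
  free module is recorded because it makes \<open>lambda_mod R X\<close> torsionless.\<close>

lemma lambda_structure:
  assumes X: "module R X" and fg: "fin_gen R X"
  obtains n e e2 k where "min_cover R X n e"
    and "e2 \<in> lin_maps R (free_rank R n) (lambda_mod R X)"
    and "e2 ` carrier (free_rank R n) = carrier (lambda_mod R X)"
    and "a_kernel (free_rank R n) (lambda_mod R X) e2 = perp n (a_kernel (free_rank R n) X e)"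
    and "module R (lambda_mod R X)"
    and "(\<lambda>x. x) \<in> lin_maps R (lambda_mod R X) (free_rank R k)"
proof -
  note F = free_module_is_module
  obtain m n f where sp: "some_presentation R X = (m, n, f)" by (metis prod_cases3)
  from some_presentation_minimal[OF X fg sp] obtain e where
    f: "f \<in> lin_maps R (free_rank R m) (free_rank R n)"
    and e: "min_cover R X n e" and fe: "f ` carrier (free_rank R m) = a_kernel (free_rank R n) X e"
    unfolding minimal_presentation_iff by blast
  let ?Fm = "free_rank R m" and ?Fn = "free_rank R n"
  let ?D = "hom_module R ?Fm (ring_as_module R)" and ?C = "hom_module R ?Fn (ring_as_module R)"
  let ?em = "basis_vec R {..<m}"
  define T where "T = precomp ?Fm f ` carrier ?C"
  have D: "module R ?D" by (rule hom_module_is_module[OF F ring_module])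
  have C: "module R ?C" by (rule hom_module_is_module[OF F ring_module])
  have T: "submodule T R ?D" unfolding T_def
    by (rule submodule_image[OF C D precomp_lin[OF F F ring_module f] submodule_carrier[OF C]])
  have Tr: "Tr_mod R X = quot_module R ?D T" by (simp add: Tr_mod_def sp T_def)
  have TrM: "module R (Tr_mod R X)" unfolding Tr by (rule quot_is_module[OF D T])
  have fem: "f (?em j) \<in> carrier ?Fn" for j by (rule lin_closed[OF f basis_vec_closed])
  \<comment> \<open>Identifies a finite free module with its dual, since \<open>Tr_mod\<close> is
    built from functionals.\<close>
  define dual where "dual k c = (\<lambda>x\<in>carrier (free_rank R k). dot k x c)" for k c
  have dual_lin: "dual k \<in> lin_maps R (free_rank R k) (hom_module R (free_rank R k) (ring_as_module R))" for k
  proof (rule lin_mapsI)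
    fix c assume c: "c \<in> carrier (free_rank R k)"
    show "dual k c \<in> carrier (hom_module R (free_rank R k) (ring_as_module R))"
      unfolding dual_def using lin_restrict[OF F dot_lin_left[OF c]] by simp
    fix c' a assume "c' \<in> carrier (free_rank R k)"
    with c show "dual k (c \<oplus>\<^bsub>free_rank R k\<^esub> c') = dual k c \<oplus>\<^bsub>hom_module R (free_rank R k) (ring_as_module R)\<^esub> dual k c'"
      unfolding dual_def using lin_add[OF dot_lin_right] by (auto intro!: restrict_ext)
  next
    fix c a assume "c \<in> carrier (free_rank R k)" "a \<in> carrier R"
    then show "dual k (a \<odot>\<^bsub>free_rank R k\<^esub> c) = a \<odot>\<^bsub>hom_module R (free_rank R k) (ring_as_module R)\<^esub> dual k c"
      unfolding dual_def using lin_smult[OF dot_lin_right] by (auto intro!: restrict_ext)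
  qed
  have dual_surj: "\<exists>c\<in>carrier (free_rank R k). g = dual k c"
    if g: "g \<in> carrier (hom_module R (free_rank R k) (ring_as_module R))" for g k
  proof
    have gl: "g \<in> lin_maps R (free_rank R k) (ring_as_module R)" "g \<in> extensional (carrier (free_rank R k))"
      using g by simp_all
    show "(\<lambda>i\<in>{..<k}. g (basis_vec R {..<k} i)) \<in> carrier (free_rank R k)"
      using lin_closed[OF gl(1) basis_vec_closed] by (auto simp: free_rank_mem)
    show "g = dual k (\<lambda>i\<in>{..<k}. g (basis_vec R {..<k} i))" unfolding dual_def
      using functional_dot[OF gl(1)] gl(2) by (intro extensionalityI[of _ "carrier (free_rank R k)"]) auto
  qed
  have dual_inj: "c = c'" if "c \<in> carrier ?Fm" "c' \<in> carrier ?Fm" "dual m c = dual m c'" for c c'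
  proof (rule free_module_eqI[OF that(1,2)])
    fix s assume s: "s \<in> {..<m}"
    have "dual m c (?em s) = dual m c' (?em s)" using that(3) by simp
    then show "c s = c' s"
      using s dot_basis_left[OF that(1)] dot_basis_left[OF that(2)] basis_vec_closed[of "{..<m}" s]
      by (simp add: dual_def)
  qed
  \<comment> \<open>The transposed matrix of \<open>f\<close>; under \<open>dual\<close> it becomes
    precomposition with \<open>f\<close>.\<close>
  define \<tau> where "\<tau> c = (\<lambda>j\<in>{..<m}. dot n (f (?em j)) c)" for c
  have \<tau>F: "\<tau> c \<in> carrier ?Fm" if "c \<in> carrier ?Fn" for c
    using dot_closed[OF fem that] by (auto simp: free_rank_mem \<tau>_def)
  have \<tau>: "\<tau> \<in> lin_maps R ?Fn ?Fm"
  proof (rule lin_mapsI[OF \<tau>F])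
    interpret Fn: module R ?Fn by (rule F)
    interpret Fm: module R ?Fm by (rule F)
    fix c assume c: "c \<in> carrier ?Fn"
    { fix c' assume c': "c' \<in> carrier ?Fn"
      show "\<tau> (c \<oplus>\<^bsub>?Fn\<^esub> c') = \<tau> c \<oplus>\<^bsub>?Fm\<^esub> \<tau> c'"
        by (rule free_module_eqI[OF \<tau>F Fm.M.a_closed[OF \<tau>F \<tau>F]])
          (use c c' lin_add[OF dot_lin_right[OF fem]] in \<open>auto simp: \<tau>_def\<close>) }
    fix a assume a: "a \<in> carrier R"
    show "\<tau> (a \<odot>\<^bsub>?Fn\<^esub> c) = a \<odot>\<^bsub>?Fm\<^esub> \<tau> c"
      by (rule free_module_eqI[OF \<tau>F Fm.smult_closed[OF a \<tau>F]])
        (use c a lin_smult[OF dot_lin_right[OF fem]] in \<open>auto simp: \<tau>_def\<close>)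
  qed
  have dot\<tau>: "dot n (f x) c = dot m x (\<tau> c)" if c: "c \<in> carrier ?Fn" and x: "x \<in> carrier ?Fm" for c x
  proof (rule lin_ext[OF ring_module lin_comp[OF f dot_lin_left[OF c]] dot_lin_left[OF \<tau>F[OF c]] _ x])
    fix s assume "s \<in> {..<m}"
    then show "dot n (f (?em s)) c = dot m (?em s) (\<tau> c)"
      using dot_basis_left[OF \<tau>F[OF c]] by (simp add: \<tau>_def)
  qed
  have pre: "precomp ?Fm f (dual n c) = dual m (\<tau> c)" if c: "c \<in> carrier ?Fn" for c
    unfolding precomp_def dual_def using lin_closed[OF f] dot\<tau>[OF c] by (auto intro!: restrict_ext)
  define \<pi> where "\<pi> c = T +>\<^bsub>?D\<^esub> dual m c" for c
  have \<pi>: "\<pi> \<in> lin_maps R ?Fm (Tr_mod R X)"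
    unfolding \<pi>_def Tr by (rule lin_comp[OF dual_lin quot_proj[OF D T]])
  have \<pi>_surj: "\<pi> ` carrier ?Fm = carrier (Tr_mod R X)"
  proof
    show "\<pi> ` carrier ?Fm \<subseteq> carrier (Tr_mod R X)" using lin_closed[OF \<pi>] by auto
    show "carrier (Tr_mod R X) \<subseteq> \<pi> ` carrier ?Fm"
    proof
      fix t assume "t \<in> carrier (Tr_mod R X)"
      then obtain g where g: "g \<in> carrier ?D" "t = T +>\<^bsub>?D\<^esub> g" unfolding Tr quot_carrier[OF D T] by blast
      obtain c where c: "c \<in> carrier ?Fm" "g = dual m c" using dual_surj[OF g(1)] by blast
      show "t \<in> \<pi> ` carrier ?Fm" using c g(2) by (auto simp: \<pi>_def)
    qed
  qed
  have \<pi>_ker: "\<pi> c = \<zero>\<^bsub>Tr_mod R X\<^esub> \<longleftrightarrow> c \<in> \<tau> ` carrier ?Fn" if c: "c \<in> carrier ?Fm" for c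
  proof -
    have "\<pi> c = \<zero>\<^bsub>Tr_mod R X\<^esub> \<longleftrightarrow> dual m c \<in> T"
      unfolding \<pi>_def Tr quot_zero[OF D T] by (rule quot_coset_zero_iff[OF D T lin_closed[OF dual_lin c]])
    also have "\<dots> \<longleftrightarrow> (\<exists>c'\<in>carrier ?Fn. dual m c = dual m (\<tau> c'))"
    proof
      assume "dual m c \<in> T"
      then obtain g where g: "g \<in> carrier ?C" "dual m c = precomp ?Fm f g" unfolding T_def by blast
      obtain c' where "c' \<in> carrier ?Fn" "g = dual n c'" using dual_surj[OF g(1)] by blast
      then show "\<exists>c'\<in>carrier ?Fn. dual m c = dual m (\<tau> c')" using g(2) pre by auto
    next
      assume "\<exists>c'\<in>carrier ?Fn. dual m c = dual m (\<tau> c')"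
      then obtain c' where c': "c' \<in> carrier ?Fn" "dual m c = precomp ?Fm f (dual n c')" by (auto simp: pre)
      show "dual m c \<in> T" unfolding T_def c'(2) by (rule imageI[OF lin_closed[OF dual_lin c'(1)]])
    qed
    also have "\<dots> \<longleftrightarrow> c \<in> \<tau> ` carrier ?Fn" using dual_inj[OF c \<tau>F] by auto
    finally show ?thesis .
  qed
  \<comment> \<open>The columns of \<open>f\<close> lie in the kernel of the minimal cover
    \<open>e\<close>, so all matrix entries of \<open>f\<close>, and with them those of
    \<open>\<tau>\<close>, are in \<open>mx\<close>.\<close>
  have cov: "min_cover R (Tr_mod R X) m \<pi>"
    unfolding min_cover_def
  proof (intro conjI ballI allI impI \<pi> \<pi>_surj)
    fix c i assume c: "c \<in> a_kernel ?Fm (Tr_mod R X) \<pi>" and i: "i < m"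
    have "c \<in> \<tau> ` carrier ?Fn" using c \<pi>_ker[of c] by (simp add: a_kernel_iff)
    then obtain c' where c': "c' \<in> carrier ?Fn" "c = \<tau> c'" by (rule imageE)
    have co: "f (?em i) j \<in> mx" if "j < n" for j
    proof -
      have "f (?em i) \<in> a_kernel ?Fn X e" unfolding fe[symmetric] by (rule imageI[OF basis_vec_closed])
      then show ?thesis using min_coverD(3)[OF e _ _ that] by (simp add: a_kernel_iff)
    qed
    have "dot n (f (?em i)) c' \<in> mx"
    proof -
      have "submodule mx R (ring_as_module R)" using mx.is_ideal unfolding ideal_iff_submodule .
      from submodule_finsum[OF this ring_module, of "{..<n}" "\<lambda>j. f (?em i) j \<otimes> c' j"]
      show ?thesis unfolding dot_def
        using co free_module_coord[OF c'(1)] by (simp add: mx.I_r_closed)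
    qed
    then show "c i \<in> mx" unfolding c'(2) \<tau>_def using i by simp
  qed
  have fgT: "fin_gen R (Tr_mod R X)" by (rule fin_gen_of_surj[OF TrM \<pi> \<pi>_surj])
  obtain m' n' f' where sp': "some_presentation R (Tr_mod R X) = (m', n', f')" by (metis prod_cases3)
  from some_presentation_minimal[OF TrM fgT sp'] obtain e' where
    f': "f' \<in> lin_maps R (free_rank R m') (free_rank R n')"
    and e': "min_cover R (Tr_mod R X) n' e'"
    and fe': "f' ` carrier (free_rank R m') = a_kernel (free_rank R n') (Tr_mod R X) e'"
    unfolding minimal_presentation_iff by blast
  let ?K = "a_kernel (free_rank R n') (Tr_mod R X) e'"
  have K: "submodule ?K R (free_rank R n')" by (rule submodule_kernel[OF F TrM min_coverD(1)[OF e']])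
  have lam: "lambda_mod R X = (free_rank R n')\<lparr>carrier := ?K\<rparr>"
    by (simp add: lambda_mod_def Omega_mod_def sp' fe')
  have lamM: "module R (lambda_mod R X)"
    unfolding lam by (rule submodule.submodule_is_module[OF K F])
  \<comment> \<open>The module \<open>lambda_mod R X\<close> is the kernel of the cover
    \<open>e'\<close> that comes with the chosen presentation of \<open>Tr_mod R X\<close>. The
    bijection \<open>g\<close> carries the image of \<open>\<tau>\<close> onto that kernel.\<close>
  obtain g where g: "g \<in> lin_maps R ?Fm (free_rank R n')"
    "bij_betw g (carrier ?Fm) (carrier (free_rank R n'))"
    "\<And>x. x \<in> carrier ?Fm \<Longrightarrow> e' (g x) = \<pi> x"
    using min_cover_lift_bij[OF TrM cov e'] by metis
  define e2 where "e2 c = g (\<tau> c)" for c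
  have gK: "g c \<in> ?K \<longleftrightarrow> c \<in> \<tau> ` carrier ?Fn" if "c \<in> carrier ?Fm" for c
    using g(3)[OF that] \<pi>_ker[OF that] lin_closed[OF g(1) that] by (simp add: a_kernel_iff)
  have e2: "e2 \<in> lin_maps R ?Fn (free_rank R n')" unfolding e2_def by (rule lin_comp[OF \<tau> g(1)])
  have e2K: "e2 c \<in> ?K" if "c \<in> carrier ?Fn" for c unfolding e2_def using gK[OF \<tau>F[OF that]] that by blast
  show thesis
  proof (rule that[OF e])
    show "e2 \<in> lin_maps R ?Fn (lambda_mod R X)"
      unfolding lam by (rule lin_mapsI) (use e2K lin_add[OF e2] lin_smult[OF e2] in auto)
    show "e2 ` carrier ?Fn = carrier (lambda_mod R X)"
    proof
      show "e2 ` carrier ?Fn \<subseteq> carrier (lambda_mod R X)" using e2K by (auto simp: lam)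
      show "carrier (lambda_mod R X) \<subseteq> e2 ` carrier ?Fn"
      proof
        fix t assume t: "t \<in> carrier (lambda_mod R X)"
        then have "t \<in> g ` carrier ?Fm" using g(2) by (simp add: lam bij_betw_def a_kernel_iff)
        then obtain c where c: "c \<in> carrier ?Fm" "t = g c" by blast
        then show "t \<in> e2 ` carrier ?Fn" using gK[OF c(1)] t by (auto simp: lam e2_def)
      qed
    qed
    show "a_kernel ?Fn (lambda_mod R X) e2 = perp n (a_kernel ?Fn X e)"
    proof -
      have "e2 c = \<zero>\<^bsub>lambda_mod R X\<^esub> \<longleftrightarrow> (\<forall>u\<in>a_kernel ?Fn X e. dot n u c = \<zero>)" if c: "c \<in> carrier ?Fn" for c
      proof -
        have "e2 c = \<zero>\<^bsub>lambda_mod R X\<^esub> \<longleftrightarrow> g (\<tau> c) = g \<zero>\<^bsub>?Fm\<^esub>"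
          using lin_zero[OF F F g(1)] by (simp add: lam e2_def)
        also have "\<dots> \<longleftrightarrow> \<tau> c = \<zero>\<^bsub>?Fm\<^esub>"
          using g(2) \<tau>F[OF c] module.carrier_is_submodule[OF F] submodule_mem(2)[OF submodule_carrier[OF F] F]
          unfolding bij_betw_def inj_on_def by metis
        \<comment> \<open>The coordinates of \<open>\<tau> c\<close> are the products of
          \<open>c\<close> with the columns of \<open>f\<close>, and these columns generate the
          image of \<open>f\<close>.\<close>
        also have "\<dots> \<longleftrightarrow> (\<forall>x\<in>carrier ?Fm. dot n (f x) c = \<zero>)"
        proof
          assume z: "\<tau> c = \<zero>\<^bsub>?Fm\<^esub>"
          show "\<forall>x\<in>carrier ?Fm. dot n (f x) c = \<zero>"
            using dot\<tau>[OF c] lin_zero[OF F ring_module dot_lin_right] z by simp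
        next
          assume "\<forall>x\<in>carrier ?Fm. dot n (f x) c = \<zero>"
          then show "\<tau> c = \<zero>\<^bsub>?Fm\<^esub>"
            by (intro free_module_eqI[OF \<tau>F[OF c] submodule_mem(2)[OF submodule_carrier[OF F] F]])
              (simp add: \<tau>_def basis_vec_closed)
        qed
        also have "\<dots> \<longleftrightarrow> (\<forall>u\<in>a_kernel ?Fn X e. dot n u c = \<zero>)" unfolding fe[symmetric] by simp
        finally show ?thesis .
      qed
      then show ?thesis by (auto simp: a_kernel_iff perp_def)
    qed
    show "module R (lambda_mod R X)" by (rule lamM)
    show "(\<lambda>x. x) \<in> lin_maps R (lambda_mod R X) (free_rank R n')"
      unfolding lam using submodule_mem(1)[OF K F] by (intro lin_mapsI) auto
  qed
qed

end

section \<open>Associated and minimal primes\<close>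

lemma (in cring) ideal_colon:
  assumes "ideal I R" and "x \<in> carrier R"
  shows "ideal {r \<in> carrier R. r \<otimes> x \<in> I} R"
proof -
  have "(\<lambda>r. r \<otimes> x) \<in> lin_maps R (ring_as_module R) (ring_as_module R)"
    by (rule lin_mapsI) (use assms(2) in \<open>auto simp: l_distr m_assoc\<close>)
  from submodule_vimage[OF ring_module ring_module this] show ?thesis
    using assms(1) unfolding ideal_iff_submodule by simp
qed

lemma (in cring) mem_Ass_ring:
  "p \<in> Ass R (ring_as_module R) \<longleftrightarrow> primeideal p R \<and> (\<exists>x\<in>carrier R. p = {a \<in> carrier R. a \<otimes> x = \<zero>})"
  by (simp add: Ass_def)

context comm_noetherian_ring
begin

text \<open>Among the ideals (c : x) contained in \<open>p\<close> a maximal one is prime, and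
  minimality of \<open>p\<close> forces it to be \<open>p\<close>. In other words \<open>p\<close>
  is an associated prime of R/c, which is how minimal primes are used throughout.\<close>

lemma minimal_prime_colon:
  assumes p: "minimal_prime R p" and c: "ideal c R" "c \<subseteq> p"
  obtains x where "x \<in> carrier R" and "{r \<in> carrier R. r \<otimes> x \<in> c} = p"
proof -
  define Q where "Q x = {r \<in> carrier R. r \<otimes> x \<in> c}" for x
  interpret c: ideal c R by fact
  have pp: "primeideal p R" using p by (simp add: minimal_prime_def)
  interpret p: primeideal p R by fact
  have Q: "ideal (Q x) R" if "x \<in> carrier R" for x unfolding Q_def by (rule ideal_colon[OF c(1) that])
  have mono: "Q x \<subseteq> Q (s \<otimes> x)" if "x \<in> carrier R" "s \<in> carrier R" for x s
  proof
    fix r assume r: "r \<in> Q x"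
    then have "s \<otimes> (r \<otimes> x) \<in> c" using c.I_l_closed that by (simp add: Q_def)
    then show "r \<in> Q (s \<otimes> x)" using r that by (simp add: Q_def m_lcomm)
  qed
  let ?S = "Q ` {x \<in> carrier R. Q x \<subseteq> p}"
  have "Q \<one> \<subseteq> p" using c(2) by (auto simp: Q_def)
  then have ne: "?S \<noteq> {}" by auto
  obtain M where M: "M \<in> ?S" "\<And>I. I \<in> ?S \<Longrightarrow> M \<subseteq> I \<Longrightarrow> I = M"
    by (rule ideal_maximal[OF ne]) (use Q in auto)
  then obtain y where y: "y \<in> carrier R" "Q y \<subseteq> p" "M = Q y" by auto
  have max: "Q (s \<otimes> y) = Q y" if "s \<in> carrier R" "Q (s \<otimes> y) \<subseteq> p" for s
    using M(2)[of "Q (s \<otimes> y)"] mono[OF y(1) that(1)] that y by auto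
  \<comment> \<open>As \<open>p\<close> is prime, multiplying \<open>y\<close> by an element outside
    \<open>p\<close> keeps (c : sy) inside \<open>p\<close>, and maximality then gives (c : sy) = (c
    : y).\<close>
  have out: "Q (s \<otimes> y) = Q y" if s: "s \<in> carrier R" "s \<notin> p" for s
  proof (rule max[OF s(1)])
    show "Q (s \<otimes> y) \<subseteq> p"
    proof
      fix r assume r: "r \<in> Q (s \<otimes> y)"
      then have "r \<otimes> s \<in> Q y" using s y by (simp add: Q_def m_assoc)
      then have "r \<otimes> s \<in> p" using y(2) by blast
      moreover have "r \<in> carrier R" using r by (simp add: Q_def)
      ultimately show "r \<in> p" using p.I_prime s by blast
    qed
  qed
  have "primeideal (Q y) R"
  proof (rule primeidealI[OF Q[OF y(1)] is_cring])
    show "carrier R \<noteq> Q y"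
    proof
      assume "carrier R = Q y"
      then have "carrier R = p" using y(2) p.a_subset by simp
      then show False using p.I_notcarr by simp
    qed
    \<comment> \<open>Either (c : ay) stays inside \<open>p\<close>, so that it equals (c : y) and
      contains \<open>b\<close>, or some \<open>s\<close> outside \<open>p\<close> multiplies ay
      into \<open>c\<close>, and then \<open>a\<close> lies in (c : sy) = (c : y).\<close>
    fix a b assume ab: "a \<in> carrier R" "b \<in> carrier R" "a \<otimes> b \<in> Q y"
    show "a \<in> Q y \<or> b \<in> Q y"
    proof (cases "Q (a \<otimes> y) \<subseteq> p")
      case True
      have "b \<in> Q (a \<otimes> y)" using ab y(1) by (simp add: Q_def m_assoc m_lcomm)
      then show ?thesis using max[OF ab(1) True] by simp
    next
      case False
      then obtain s where s: "s \<in> Q (a \<otimes> y)" "s \<notin> p" by blast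
      have sR: "s \<in> carrier R" using s(1) by (simp add: Q_def)
      have "a \<in> Q (s \<otimes> y)" using s(1) sR ab(1) y(1) by (simp add: Q_def m_lcomm)
      then show ?thesis using out[OF sR s(2)] by simp
    qed
  qed
  then have "Q y = p" using p y(2) by (simp add: minimal_prime_def)
  then show thesis using that[OF y(1)] by (simp add: Q_def)
qed

text \<open>If \<open>x\<close> were nonzero, a nonzero multiple of \<open>x\<close> with maximal
  annihilator would have an associated prime as its annihilator. An element outside that prime which
  kills \<open>x\<close> also kills the multiple, a contradiction.\<close>

lemma zero_of_locally_zero:
  assumes x: "x \<in> carrier R"
    and loc: "\<And>p. p \<in> Ass R (ring_as_module R) \<Longrightarrow> \<exists>s\<in>carrier R - p. s \<otimes> x = \<zero>"
  shows "x = \<zero>"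
proof (rule ccontr)
  assume nz: "x \<noteq> \<zero>"
  define Q where "Q x = {r \<in> carrier R. r \<otimes> x \<in> {\<zero>}}" for x
  have Q: "ideal (Q x) R" if "x \<in> carrier R" for x unfolding Q_def by (rule ideal_colon[OF zeroideal that])
  let ?S = "Q ` {r \<otimes> x | r. r \<in> carrier R \<and> r \<otimes> x \<noteq> \<zero>}"
  have "\<one> \<otimes> x \<noteq> \<zero>" using nz x by simp
  then have ne: "?S \<noteq> {}" using one_closed by blast
  obtain M where M: "M \<in> ?S" "\<And>I. I \<in> ?S \<Longrightarrow> M \<subseteq> I \<Longrightarrow> I = M"
    by (rule ideal_maximal[OF ne]) (use Q x in auto)
  then obtain r where r: "r \<in> carrier R" "r \<otimes> x \<noteq> \<zero>" "M = Q (r \<otimes> x)" by auto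
  let ?z = "r \<otimes> x"
  have z: "?z \<in> carrier R" using r x by simp
  have "primeideal (Q ?z) R"
  proof (rule primeidealI[OF Q[OF z] is_cring])
    have "\<one> \<notin> Q ?z" using r(2) z by (simp add: Q_def)
    then show "carrier R \<noteq> Q ?z" by auto
    fix a b assume ab: "a \<in> carrier R" "b \<in> carrier R" "a \<otimes> b \<in> Q ?z"
    show "a \<in> Q ?z \<or> b \<in> Q ?z"
    proof (cases "a \<otimes> ?z = \<zero>")
      case True
      then show ?thesis using ab by (simp add: Q_def)
    next
      case False
      have "a \<otimes> ?z = (a \<otimes> r) \<otimes> x" using ab r x by (simp add: m_assoc)
      then have "Q (a \<otimes> ?z) \<in> ?S" using False ab r by auto
      moreover have "Q ?z \<subseteq> Q (a \<otimes> ?z)"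
        using z ab(1) by (auto simp: Q_def m_lcomm[of _ a ?z])
      ultimately have "Q (a \<otimes> ?z) = Q ?z" using M(2) r(3) by simp
      moreover have "b \<in> Q (a \<otimes> ?z)"
        using ab z by (simp add: Q_def m_lcomm[of b a] m_assoc)
      ultimately show ?thesis by simp
    qed
  qed
  then have "Q ?z \<in> Ass R (ring_as_module R)"
    unfolding mem_Ass_ring using z by (auto simp: Q_def intro!: bexI[of _ ?z])
  from loc[OF this] obtain s where s: "s \<in> carrier R" "s \<notin> Q ?z" "s \<otimes> x = \<zero>" by blast
  have "s \<otimes> ?z = \<zero>" using s(1,3) r(1) x by (simp add: m_lcomm)
  then show False using s by (simp add: Q_def)
qed

end

section \<open>Self-injectivity of Gorenstein rings at minimal primes\<close>

definition ideal_module :: "('a, 'r) ring_scheme \<Rightarrow> 'a set \<Rightarrow> ('a, 'a) module" where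
  "ideal_module R I = (ring_as_module R)\<lparr>carrier := I\<rparr>"

lemma ideal_module_simps [simp]:
  "carrier (ideal_module R I) = I" "\<zero>\<^bsub>ideal_module R I\<^esub> = \<zero>\<^bsub>R\<^esub>"
  "add (ideal_module R I) = add R" "smult (ideal_module R I) = mult R"
  by (simp_all add: ideal_module_def)

text \<open>Injectivity in the form of Baer's criterion; an extension of \<open>\<phi>\<close> to
  the whole ring is recorded by its value \<open>c\<close> at \<open>\<one>\<close>.\<close>

definition baer :: "('a, 'r) ring_scheme \<Rightarrow> ('a, 'e, 'm) module_scheme \<Rightarrow> bool" where
  "baer R P \<longleftrightarrow> (\<forall>I \<phi>. ideal I R \<and> \<phi> \<in> lin_maps R (ideal_module R I) P \<longrightarrow>
     (\<exists>c\<in>carrier P. \<forall>r\<in>I. \<phi> r = r \<odot>\<^bsub>P\<^esub> c))"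

lemma baerD:
  assumes "baer R P" and "ideal I R" and "\<phi> \<in> lin_maps R (ideal_module R I) P"
  obtains c where "c \<in> carrier P" and "\<And>r. r \<in> I \<Longrightarrow> \<phi> r = r \<odot>\<^bsub>P\<^esub> c"
  using assms unfolding baer_def by metis

context cring
begin

lemma ideal_module_is_module: "ideal I R \<Longrightarrow> module R (ideal_module R I)"
  unfolding ideal_module_def ideal_iff_submodule by (rule submodule.submodule_is_module[OF _ ring_module])

text \<open>The test modules in \<open>injective_module\<close> have elements of type
  \<open>nat \<Rightarrow> 'a\<close>, so the ideal is replaced by its copy inside
  \<open>free_rank R 1\<close>, cut out by the coordinate at \<open>0\<close>.\<close>

lemma injective_imp_baer:
  fixes E :: "('a, 'e, 'm) module_scheme"
  assumes "injective_module R E"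
  shows "baer R E"
  unfolding baer_def
proof (intro allI impI, elim conjE)
  fix I \<phi> assume I: "ideal I R" and \<phi>: "\<phi> \<in> lin_maps R (ideal_module R I) E"
  let ?B = "free_rank R 1"
  have B: "module R ?B" by (rule free_module_is_module)
  have co: "(\<lambda>x. x 0) \<in> lin_maps R ?B (ring_as_module R)" by (rule coord_lin) simp
  define A where "A = ?B\<lparr>carrier := {x \<in> carrier ?B. x 0 \<in> I}\<rparr>"
  have "submodule {x \<in> carrier ?B. x 0 \<in> I} R ?B"
    using submodule_vimage[OF B ring_module co] I unfolding ideal_iff_submodule by simp
  then have A: "module R A" unfolding A_def by (rule submodule.submodule_is_module[OF _ B])
  have f: "(\<lambda>x. x) \<in> lin_maps R A ?B" by (rule lin_mapsI) (simp_all add: A_def)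
  have g: "(\<lambda>x. \<phi> (x 0)) \<in> lin_maps R A E"
    by (rule lin_mapsI)
      (use lin_closed[OF \<phi>] lin_add[OF \<phi>] lin_smult[OF \<phi>] in \<open>auto simp: A_def\<close>)
  have E: "\<And>(A :: ('a, nat \<Rightarrow> 'a) module) (B :: ('a, nat \<Rightarrow> 'a) module) f g.
        module R A \<and> module R B \<and> f \<in> lin_maps R A B \<and> inj_on f (carrier A) \<and>
        g \<in> lin_maps R A E \<longrightarrow> (\<exists>h\<in>lin_maps R B E. \<forall>x\<in>carrier A. h (f x) = g x)"
    using assms unfolding injective_module_def by blast
  obtain h where h: "h \<in> lin_maps R ?B E" "\<forall>x\<in>carrier A. h x = \<phi> (x 0)"
    using E[of A ?B "\<lambda>x. x" "\<lambda>x. \<phi> (x 0)"] A B f g by auto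
  show "\<exists>c\<in>carrier E. \<forall>r\<in>I. \<phi> r = r \<odot>\<^bsub>E\<^esub> c"
  proof (intro bexI ballI)
    let ?e = "basis_vec R {..<1::nat} 0"
    show "h ?e \<in> carrier E" by (rule lin_closed[OF h(1) basis_vec_closed])
    fix r assume r: "r \<in> I"
    then have rR: "r \<in> carrier R" using ideal.Icarr[OF I] by simp
    let ?x = "r \<odot>\<^bsub>?B\<^esub> ?e"
    have x0: "?x 0 = r" using rR by (simp add: basis_vec_def)
    have "?x \<in> carrier ?B" by (rule module.smult_closed[OF B rR basis_vec_closed])
    then have "h ?x = \<phi> r" using h(2) x0 r by (simp add: A_def del: free_module_ops)
    then show "\<phi> r = r \<odot>\<^bsub>E\<^esub> h ?e" using lin_smult[OF h(1) rR basis_vec_closed] by simp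
  qed
qed

text \<open>The functional and the prescribed value \<open>c\<close> at \<open>x\<close> define a
  map on B + Rx. The assumption \<open>compat\<close> is agreement wherever a multiple of
  \<open>x\<close> falls into \<open>B\<close>, which is what independence of the representation w +
  rx requires.\<close>

lemma extend_by_one:
  assumes C: "module R C" and B: "ideal B R" and \<psi>: "\<psi> \<in> lin_maps R (ideal_module R B) C"
    and x: "x \<in> carrier R" and c: "c \<in> carrier C"
    and compat: "\<And>r. r \<in> carrier R \<Longrightarrow> r \<otimes> x \<in> B \<Longrightarrow> \<psi> (r \<otimes> x) = r \<odot>\<^bsub>C\<^esub> c"
  obtains B' \<psi>' where "ideal B' R" and "B \<subseteq> B'" and "x \<in> B'"
    and "\<psi>' \<in> lin_maps R (ideal_module R B') C" and "\<And>b. b \<in> B \<Longrightarrow> \<psi>' b = \<psi> b"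
proof -
  interpret C: module R C by fact
  interpret B: ideal B R by fact
  define B' where "B' = {w \<oplus>\<^bsub>ring_as_module R\<^esub> r \<odot>\<^bsub>ring_as_module R\<^esub> x | w r. w \<in> B \<and> r \<in> carrier R}"
  have B': "ideal B' R" unfolding B'_def ideal_iff_submodule
    using submodule_adjoin[OF ring_module _ oneideal, of B x] B x unfolding ideal_iff_submodule by simp
  have B'I: "w \<oplus> r \<otimes> x \<in> B'" if "w \<in> B" "r \<in> carrier R" for w r
    unfolding B'_def using that by auto
  have \<psi>C: "\<psi> w \<in> carrier C" if "w \<in> B" for w using lin_closed[OF \<psi>] that by simp
  have wd: "\<psi> w \<oplus>\<^bsub>C\<^esub> r \<odot>\<^bsub>C\<^esub> c = \<psi> w' \<oplus>\<^bsub>C\<^esub> r' \<odot>\<^bsub>C\<^esub> c"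
    if w: "w \<in> B" "w' \<in> B" "r \<in> carrier R" "r' \<in> carrier R" and eq: "w \<oplus> r \<otimes> x = w' \<oplus> r' \<otimes> x" for w w' r r'
  proof -
    have wR: "w \<in> carrier R" "w' \<in> carrier R" using w by simp_all
    have "(r \<oplus> \<ominus> r') \<otimes> x = w' \<oplus> \<ominus> w"
    proof -
      have "(r \<oplus> \<ominus> r') \<otimes> x = \<ominus> w \<oplus> (w \<oplus> r \<otimes> x) \<oplus> \<ominus> (r' \<otimes> x)"
        using wR w x by (simp add: l_distr l_minus a_assoc[symmetric] l_neg)
      also have "\<dots> = w' \<oplus> \<ominus> w" unfolding eq using wR w x by (simp add: a_ac r_neg)
      finally show ?thesis .
    qed
    moreover have m: "w' \<oplus> \<ominus> w \<in> B" using w by simp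
    ultimately have "\<psi> (w' \<oplus> \<ominus> w) = (r \<oplus> \<ominus> r') \<odot>\<^bsub>C\<^esub> c"
      using compat[of "r \<oplus> \<ominus> r'"] w by simp
    moreover have "w' = (w' \<oplus> \<ominus> w) \<oplus> w" using wR by (simp add: a_assoc l_neg)
    ultimately have "\<psi> w' = (r \<oplus> \<ominus> r') \<odot>\<^bsub>C\<^esub> c \<oplus>\<^bsub>C\<^esub> \<psi> w"
      using lin_add[OF \<psi>, of "w' \<oplus> \<ominus> w" w] m w by simp
    moreover have "r' \<odot>\<^bsub>C\<^esub> c \<oplus>\<^bsub>C\<^esub> (r \<odot>\<^bsub>C\<^esub> c \<oplus>\<^bsub>C\<^esub> \<ominus>\<^bsub>C\<^esub> (r' \<odot>\<^bsub>C\<^esub> c)) = r \<odot>\<^bsub>C\<^esub> c"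
      using w c by (simp add: C.M.a_lcomm[of "r' \<odot>\<^bsub>C\<^esub> c" "r \<odot>\<^bsub>C\<^esub> c"] C.M.r_neg)
    ultimately show ?thesis using w c \<psi>C
      by (simp add: C.smult_l_distr C.smult_l_minus C.M.a_ac)
  qed
  define \<psi>' where "\<psi>' y = (SOME z. \<exists>w r. w \<in> B \<and> r \<in> carrier R \<and> y = w \<oplus> r \<otimes> x \<and> z = \<psi> w \<oplus>\<^bsub>C\<^esub> r \<odot>\<^bsub>C\<^esub> c)" for y
  have val: "\<psi>' (w \<oplus> r \<otimes> x) = \<psi> w \<oplus>\<^bsub>C\<^esub> r \<odot>\<^bsub>C\<^esub> c" if "w \<in> B" "r \<in> carrier R" for w r
    unfolding \<psi>'_def
  proof (rule some_equality)
    show "\<exists>w' r'. w' \<in> B \<and> r' \<in> carrier R \<and> w \<oplus> r \<otimes> x = w' \<oplus> r' \<otimes> x \<and>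
      \<psi> w \<oplus>\<^bsub>C\<^esub> r \<odot>\<^bsub>C\<^esub> c = \<psi> w' \<oplus>\<^bsub>C\<^esub> r' \<odot>\<^bsub>C\<^esub> c" using that by blast
    fix z assume "\<exists>w' r'. w' \<in> B \<and> r' \<in> carrier R \<and> w \<oplus> r \<otimes> x = w' \<oplus> r' \<otimes> x \<and>
      z = \<psi> w' \<oplus>\<^bsub>C\<^esub> r' \<odot>\<^bsub>C\<^esub> c"
    then obtain w' r' where "w' \<in> B" "r' \<in> carrier R" "w \<oplus> r \<otimes> x = w' \<oplus> r' \<otimes> x"
      "z = \<psi> w' \<oplus>\<^bsub>C\<^esub> r' \<odot>\<^bsub>C\<^esub> c" by (elim exE conjE)
    then show "z = \<psi> w \<oplus>\<^bsub>C\<^esub> r \<odot>\<^bsub>C\<^esub> c" using wd[OF _ that(1) _ that(2)] by simp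
  qed
  have B'E: "\<exists>w r. w \<in> B \<and> r \<in> carrier R \<and> y = w \<oplus> r \<otimes> x" if "y \<in> B'" for y
    using that unfolding B'_def by auto
  show thesis
  proof (rule that[OF B'])
    show "B \<subseteq> B'"
    proof
      fix b assume b: "b \<in> B"
      then show "b \<in> B'" using B'I[OF b zero_closed] x by simp
    qed
    show "x \<in> B'" using B'I[OF B.zero_closed one_closed] x by simp
    show "\<psi>' b = \<psi> b" if "b \<in> B" for b
      using val[OF that zero_closed] x c that \<psi>C by simp
    show "\<psi>' \<in> lin_maps R (ideal_module R B') C"
    proof (rule lin_mapsI)
      fix y assume "y \<in> carrier (ideal_module R B')"
      then obtain w r where y: "w \<in> B" "r \<in> carrier R" "y = w \<oplus> r \<otimes> x" using B'E[of y] by auto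
      then have wR: "w \<in> carrier R" by simp
      show "\<psi>' y \<in> carrier C" using y val \<psi>C c by simp
      { fix y' assume "y' \<in> carrier (ideal_module R B')"
        then obtain w' r' where y': "w' \<in> B" "r' \<in> carrier R" "y' = w' \<oplus> r' \<otimes> x" using B'E[of y'] by auto
        then have w'R: "w' \<in> carrier R" by simp
        have "y \<oplus> y' = (w \<oplus> w') \<oplus> (r \<oplus> r') \<otimes> x"
          using y y' wR w'R x by (simp add: l_distr a_ac)
        then show "\<psi>' (y \<oplus>\<^bsub>ideal_module R B'\<^esub> y') = \<psi>' y \<oplus>\<^bsub>C\<^esub> \<psi>' y'"
          using val y y' \<psi>C c lin_add[OF \<psi>, of w w'] by (simp add: C.smult_l_distr C.M.a_ac) }
      fix a assume a: "a \<in> carrier R"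
      have "a \<otimes> y = a \<otimes> w \<oplus> (a \<otimes> r) \<otimes> x" using y wR x a by (simp add: r_distr m_assoc)
      then show "\<psi>' (a \<odot>\<^bsub>ideal_module R B'\<^esub> y) = a \<odot>\<^bsub>C\<^esub> \<psi>' y"
        using val y \<psi>C c a lin_smult[OF \<psi> a, of w] B.I_l_closed[OF y(1) a]
        by (simp add: C.smult_r_distr C.smult_assoc1)
    qed
  qed
qed

end

text \<open>\<open>m\<close> plays the role of the maximal ideal of an Artinian local ring. The last assumption
  says that every nonzero cyclic module has a nonzero socle.\<close>

locale socle_ring = comm_noetherian_ring +
  fixes m :: "'a set"
  assumes unit_outside: "r \<in> carrier R \<Longrightarrow> r \<notin> m \<Longrightarrow> r \<in> Units R"
    and m_sub: "m \<subseteq> carrier R"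
    and nontrivial: "\<one> \<noteq> \<zero>"
    and socle: "ideal I R \<Longrightarrow> \<one> \<notin> I \<Longrightarrow> \<exists>x\<in>carrier R. x \<notin> I \<and> (\<forall>r\<in>m. r \<otimes> x \<in> I)"
begin

lemma unit_colon:
  assumes "ideal I R" and "r \<in> carrier R" and "x \<in> carrier R" "r \<otimes> x \<in> I" and "x \<notin> I"
  shows "r \<in> m"
proof (rule ccontr)
  assume "r \<notin> m"
  then have u: "r \<in> Units R" using unit_outside assms by simp
  then have "inv r \<otimes> (r \<otimes> x) \<in> I" using ideal.I_l_closed[OF assms(1,4)] by simp
  then show False using u assms by (simp add: m_assoc[symmetric] Units_closed)
qed

text \<open>This says that \<open>Ext\<^sup>1(R/m, C) = 0\<close>: a map from \<open>R/m\<close> to \<open>C'\<close> extends to \<open>R\<close> along a socle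
  element and then lifts to \<open>E\<close>.\<close>

lemma baer_at_m:
  assumes E: "module R E" "baer R E" and C: "submodule C R E"
    and C': "module R C'" "baer R C'"
    and \<delta>: "\<delta> \<in> lin_maps R E C'" "\<delta> ` carrier E = carrier C'" "\<And>x. x \<in> carrier E \<Longrightarrow> \<delta> x = \<zero>\<^bsub>C'\<^esub> \<longleftrightarrow> x \<in> C"
    and m: "ideal m R" and \<chi>: "\<chi> \<in> lin_maps R (ideal_module R m) (E\<lparr>carrier := C\<rparr>)"
  shows "\<exists>c\<in>C. \<forall>r\<in>m. \<chi> r = r \<odot>\<^bsub>E\<^esub> c"
proof -
  interpret E: module R E by fact
  interpret C': module R C' by fact
  note CE = submodule_mem[OF C E(1)]
  have "\<one> \<notin> {\<zero>}" using nontrivial by simp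
  from socle[OF zeroideal this] obtain z where z: "z \<in> carrier R" "z \<noteq> \<zero>" "\<And>r. r \<in> m \<Longrightarrow> r \<otimes> z = \<zero>"
    by auto
  \<comment> \<open>The annihilator of the socle element \<open>z\<close> is exactly
    \<open>m\<close>, so the principal ideal of \<open>z\<close> is a copy of R/m.\<close>
  have annz: "r \<in> m" if "r \<in> carrier R" "r \<otimes> z = \<zero>" for r
    by (rule unit_colon[OF zeroideal that(1) z(1)]) (use that z in auto)
  have \<chi>C: "\<chi> r \<in> C" if "r \<in> m" for r using lin_closed[OF \<chi>] that by simp
  have \<chi>E: "\<chi> \<in> lin_maps R (ideal_module R m) E"
    by (rule lin_mapsI)
      (use \<chi>C CE(1) lin_add[OF \<chi>] lin_smult[OF \<chi>] in \<open>simp_all add: subset_iff\<close>)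
  obtain e where e: "e \<in> carrier E" "\<And>r. r \<in> m \<Longrightarrow> \<chi> r = r \<odot>\<^bsub>E\<^esub> e"
    by (rule baerD[OF E(2) m \<chi>E]) (rule that)
  have \<delta>e: "\<delta> e \<in> carrier C'" by (rule lin_closed[OF \<delta>(1) e(1)])
  let ?Z = "PIdl z"
  have Z: "ideal ?Z R" by (rule cgenideal_ideal[OF z(1)])
  have zZ: "z \<in> ?Z" by (rule cgenideal_self[OF z(1)])
  have \<pi>: "(\<lambda>r. r \<otimes> z) \<in> lin_maps R (ring_as_module R) (ideal_module R ?Z)"
    by (rule lin_mapsI) (use z(1) in \<open>auto simp: l_distr m_assoc cgenideal_def\<close>)
  have \<pi>_surj: "(\<lambda>r. r \<otimes> z) ` carrier (ring_as_module R) = carrier (ideal_module R ?Z)"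
    by (auto simp: cgenideal_def)
  have h: "(\<lambda>r. r \<odot>\<^bsub>C'\<^esub> \<delta> e) \<in> lin_maps R (ring_as_module R) C'"
    by (rule lin_mapsI) (use \<delta>e in \<open>auto simp: C'.smult_l_distr C'.smult_assoc1\<close>)
  have hz: "r \<odot>\<^bsub>C'\<^esub> \<delta> e = \<zero>\<^bsub>C'\<^esub>"
    if "r \<in> carrier (ring_as_module R)" "r \<otimes> z = \<zero>\<^bsub>ideal_module R ?Z\<^esub>" for r
  proof -
    have r: "r \<in> m" using annz that by simp
    have "r \<odot>\<^bsub>C'\<^esub> \<delta> e = \<delta> (\<chi> r)" using e r lin_smult[OF \<delta>(1) _ e(1)] that by simp
    then show ?thesis using \<delta>(3) \<chi>C[OF r] CE(1) by auto
  qed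
  obtain k where k: "k \<in> lin_maps R (ideal_module R ?Z) C'"
    "\<And>r. r \<in> carrier (ring_as_module R) \<Longrightarrow> k (r \<otimes> z) = r \<odot>\<^bsub>C'\<^esub> \<delta> e"
    by (rule lin_factor[OF ring_module ideal_module_is_module[OF Z] C'(1) \<pi> \<pi>_surj h hz])
      (assumption, assumption, rule that)
  obtain c' where c': "c' \<in> carrier C'" "\<And>r. r \<in> ?Z \<Longrightarrow> k r = r \<odot>\<^bsub>C'\<^esub> c'"
    by (rule baerD[OF C'(2) Z k(1)]) (rule that)
  have \<delta>e': "\<delta> e = z \<odot>\<^bsub>C'\<^esub> c'" using k(2)[of \<one>] c'(2)[OF zZ] z(1) \<delta>e by simp
  obtain e'' where e'': "e'' \<in> carrier E" "c' = \<delta> e''" using c'(1) \<delta>(2) by blast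
  \<comment> \<open>The correction z e'' moves \<open>e\<close> into the kernel \<open>C\<close> of
    \<open>\<delta>\<close>; multiples by elements of \<open>m\<close> are unaffected, since these
    kill \<open>z\<close>.\<close>
  define c where "c = e \<ominus>\<^bsub>E\<^esub> z \<odot>\<^bsub>E\<^esub> e''"
  have cE: "c \<in> carrier E" unfolding c_def using e e'' z by simp
  have "\<delta> c = \<zero>\<^bsub>C'\<^esub>"
    unfolding c_def using lin_minus[OF E(1) C'(1) \<delta>(1), of e "z \<odot>\<^bsub>E\<^esub> e''"]
      e(1) e''(1) z(1) lin_smult[OF \<delta>(1) z(1) e''(1)] \<delta>e' e''(2) \<delta>e
    by (simp add: C'.M.minus_eq_zero_iff)
  then have "c \<in> C" using \<delta>(3)[OF cE] by simp
  moreover have "\<chi> r = r \<odot>\<^bsub>E\<^esub> c" if r: "r \<in> m" for r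
  proof -
    have rR: "r \<in> carrier R" using r m_sub by blast
    have "r \<odot>\<^bsub>E\<^esub> (z \<odot>\<^bsub>E\<^esub> e'') = \<zero>\<^bsub>E\<^esub>"
      using E.smult_assoc1[of r z e''] z r rR e''(1) by simp
    then show ?thesis unfolding c_def using e r rR e'' z
      by (simp add: a_minus_def E.smult_r_distr E.smult_r_minus)
  qed
  ultimately show ?thesis by blast
qed

text \<open>The kernel \<open>C\<close> of a surjection of injective modules is injective once maps
  from \<open>m\<close> to it extend. A map from an ideal is extended to a maximal ideal
  \<open>B\<close>. If \<open>B\<close> were proper, a socle element \<open>x\<close> of R/B would
  satisfy m x \<subseteq> B; composing with multiplication by \<open>x\<close> gives a map from
  \<open>m\<close>, whose extension supplies a value at \<open>x\<close>, and the domain could be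
  enlarged.\<close>

lemma baer_step:
  assumes E: "module R E" "baer R E" and C: "submodule C R E"
    and C': "module R C'" "baer R C'"
    and \<delta>: "\<delta> \<in> lin_maps R E C'" "\<delta> ` carrier E = carrier C'" "\<And>x. x \<in> carrier E \<Longrightarrow> \<delta> x = \<zero>\<^bsub>C'\<^esub> \<longleftrightarrow> x \<in> C"
    and m: "ideal m R"
  shows "baer R (E\<lparr>carrier := C\<rparr>)"
  unfolding baer_def
proof (intro allI impI, elim conjE)
  fix A \<phi> assume A: "ideal A R" and \<phi>: "\<phi> \<in> lin_maps R (ideal_module R A) (E\<lparr>carrier := C\<rparr>)"
  let ?C = "E\<lparr>carrier := C\<rparr>"
  have CM: "module R ?C" by (rule submodule.submodule_is_module[OF C E(1)])
  define S where "S = {B. ideal B R \<and> A \<subseteq> B \<and>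
    (\<exists>\<psi>. \<psi> \<in> lin_maps R (ideal_module R B) ?C \<and> (\<forall>r\<in>A. \<psi> r = \<phi> r))}"
  have "A \<in> S" using A \<phi> by (auto simp: S_def)
  then have ne: "S \<noteq> {}" by blast
  obtain B where B: "B \<in> S" "\<And>I. I \<in> S \<Longrightarrow> B \<subseteq> I \<Longrightarrow> I = B"
    by (rule ideal_maximal[OF ne]) (auto simp: S_def)
  from B(1) obtain \<psi> where BI: "ideal B R" "A \<subseteq> B"
    and \<psi>: "\<psi> \<in> lin_maps R (ideal_module R B) ?C" "\<forall>r\<in>A. \<psi> r = \<phi> r"
    unfolding S_def by blast
  have "\<one> \<in> B"
  proof (rule ccontr)
    assume "\<one> \<notin> B"
    from socle[OF BI(1) this] obtain x where x: "x \<in> carrier R" "x \<notin> B" "\<And>r. r \<in> m \<Longrightarrow> r \<otimes> x \<in> B" by blast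
    have "(\<lambda>r. \<psi> (r \<otimes> x)) \<in> lin_maps R (ideal_module R m) ?C"
      by (rule lin_comp[OF _ \<psi>(1)], rule lin_mapsI) (use x m_sub in \<open>auto simp: l_distr m_assoc subset_iff\<close>)
    from baer_at_m[OF E C C' \<delta> m this] obtain c where
      c: "c \<in> C" "\<And>r. r \<in> m \<Longrightarrow> \<psi> (r \<otimes> x) = r \<odot>\<^bsub>E\<^esub> c" by blast
    obtain B' \<psi>' where B': "ideal B' R" "B \<subseteq> B'" "x \<in> B'" "\<psi>' \<in> lin_maps R (ideal_module R B') ?C"
      "\<And>b. b \<in> B \<Longrightarrow> \<psi>' b = \<psi> b"
    proof (rule extend_by_one[OF CM BI(1) \<psi>(1) x(1)])
      show "c \<in> carrier ?C" using c by simp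
      fix r assume "r \<in> carrier R" "r \<otimes> x \<in> B"
      then have "r \<in> m" using unit_colon[OF BI(1) _ x(1) _ x(2)] by blast
      then show "\<psi> (r \<otimes> x) = r \<odot>\<^bsub>?C\<^esub> c" using c(2) by simp
    next
      fix B' \<psi>' assume "ideal B' R" "B \<subseteq> B'" "x \<in> B'" "\<psi>' \<in> lin_maps R (ideal_module R B') ?C"
        "\<And>b. b \<in> B \<Longrightarrow> \<psi>' b = \<psi> b"
      then show thesis by (rule that)
    qed
    have "\<psi>' r = \<phi> r" if "r \<in> A" for r using that B'(5)[of r] \<psi>(2) BI(2) by auto
    then have "B' \<in> S" unfolding S_def using B' BI(2) by blast
    then have "B' = B" using B(2) B'(2) by blast
    then show False using B'(3) x(2) by simp
  qed
  have "\<psi> \<one> \<in> carrier ?C" using lin_closed[OF \<psi>(1)] \<open>\<one> \<in> B\<close> by simp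
  moreover have "\<phi> r = r \<odot>\<^bsub>?C\<^esub> \<psi> \<one>" if r: "r \<in> A" for r
  proof -
    have rR: "r \<in> carrier R" using ideal.Icarr[OF A r] .
    have "\<psi> (r \<odot>\<^bsub>ideal_module R B\<^esub> \<one>) = r \<odot>\<^bsub>?C\<^esub> \<psi> \<one>"
      by (rule lin_smult[OF \<psi>(1) rR]) (use \<open>\<one> \<in> B\<close> in simp)
    then show ?thesis using \<psi>(2) r rR by simp
  qed
  ultimately show "\<exists>c\<in>carrier ?C. \<forall>r\<in>A. \<phi> r = r \<odot>\<^bsub>?C\<^esub> c" by blast
qed

text \<open>Descent along the resolution: the cosyzygies beyond its length vanish, and
  \<open>baer_step\<close> carries injectivity from \<open>K (Suc i)\<close> to \<open>K i\<close>.
  The module \<open>K 0\<close> is the image of \<open>R\<close> under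
  \<open>\<epsilon>\<close>.\<close>

lemma self_injective:
  assumes m: "ideal m R" and "finite_self_injdim R"
  shows "baer R (ring_as_module R)"
proof -
  from assms(2) obtain E :: "nat \<Rightarrow> ('a, nat \<Rightarrow> 'a) module" and \<epsilon> \<delta> n where
    inj: "\<forall>i. injective_module R (E i)"
    and \<epsilon>: "\<epsilon> \<in> lin_maps R (ring_as_module R) (E 0)"
    and \<delta>: "\<forall>i. \<delta> i \<in> lin_maps R (E i) (E (Suc i))"
    and \<epsilon>i: "inj_on \<epsilon> (carrier R)" and \<epsilon>k: "\<epsilon> ` carrier R = a_kernel (E 0) (E 1) (\<delta> 0)"
    and ex: "\<forall>i. \<delta> i ` carrier (E i) = a_kernel (E (Suc i)) (E (Suc (Suc i))) (\<delta> (Suc i))"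
    and z: "\<forall>i>n. zero_module (E i)"
    unfolding finite_self_injdim_def by (elim exE conjE)
  have EM: "module R (E i)" for i using inj unfolding injective_module_def by blast
  have EB: "baer R (E i)" for i using injective_imp_baer inj by blast
  define K where "K i = a_kernel (E i) (E (Suc i)) (\<delta> i)" for i
  have K: "submodule (K i) R (E i)" for i
    unfolding K_def by (rule submodule_kernel[OF EM EM]) (use \<delta> in blast)
  have KM: "module R ((E i)\<lparr>carrier := K i\<rparr>)" for i by (rule submodule.submodule_is_module[OF K EM])
  have step: "baer R ((E i)\<lparr>carrier := K i\<rparr>)" if "baer R ((E (Suc i))\<lparr>carrier := K (Suc i)\<rparr>)" for i
  proof (rule baer_step[OF EM EB K KM that _ _ _ m])
    have im: "\<delta> i ` carrier (E i) = K (Suc i)" using ex by (simp add: K_def)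
    then show "\<delta> i ` carrier (E i) = carrier ((E (Suc i))\<lparr>carrier := K (Suc i)\<rparr>)" by simp
    show "\<delta> i \<in> lin_maps R (E i) ((E (Suc i))\<lparr>carrier := K (Suc i)\<rparr>)"
    proof (rule lin_mapsI)
      show "\<delta> i x \<in> carrier ((E (Suc i))\<lparr>carrier := K (Suc i)\<rparr>)" if "x \<in> carrier (E i)" for x
        using that im by auto
    qed (simp_all add: lin_add[OF \<delta>[rule_format]] lin_smult[OF \<delta>[rule_format]])
    fix x assume "x \<in> carrier (E i)"
    then show "\<delta> i x = \<zero>\<^bsub>(E (Suc i))\<lparr>carrier := K (Suc i)\<rparr>\<^esub> \<longleftrightarrow> x \<in> K i"
      by (simp add: K_def a_kernel_iff)
  qed
  have top: "baer R ((E (Suc n))\<lparr>carrier := K (Suc n)\<rparr>)"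
    unfolding baer_def
  proof (intro allI impI, elim conjE)
    fix I \<phi> assume I: "ideal I R" and \<phi>: "\<phi> \<in> lin_maps R (ideal_module R I) ((E (Suc n))\<lparr>carrier := K (Suc n)\<rparr>)"
    interpret E: module R "E (Suc n)" by (rule EM)
    have "carrier (E (Suc n)) = {\<zero>\<^bsub>E (Suc n)\<^esub>}" using z by (simp add: zero_module_def)
    then have K0: "K (Suc n) = {\<zero>\<^bsub>E (Suc n)\<^esub>}"
      using submodule_mem(1,2)[OF K EM, of "Suc n"] by auto
    have "\<phi> r = r \<odot>\<^bsub>E (Suc n)\<^esub> \<zero>\<^bsub>E (Suc n)\<^esub>" if "r \<in> I" for r
      using lin_closed[OF \<phi>, of r] that ideal.Icarr[OF I that] by (simp add: K0)
    then show "\<exists>c\<in>carrier ((E (Suc n))\<lparr>carrier := K (Suc n)\<rparr>). \<forall>r\<in>I. \<phi> r = r \<odot>\<^bsub>(E (Suc n))\<lparr>carrier := K (Suc n)\<rparr>\<^esub> c"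
      by (simp add: K0)
  qed
  have "baer R ((E 0)\<lparr>carrier := K 0\<rparr>)"
    by (rule inc_induct[of 0 "Suc n" "\<lambda>i. baer R ((E i)\<lparr>carrier := K i\<rparr>)"]) (use top step in auto)
  note B0 = baerD[OF this]
  show ?thesis unfolding baer_def
  proof (intro allI impI, elim conjE)
    fix I \<phi> assume I: "ideal I R" and \<phi>: "\<phi> \<in> lin_maps R (ideal_module R I) (ring_as_module R)"
    have \<phi>R: "\<phi> r \<in> carrier R" if "r \<in> I" for r using lin_closed[OF \<phi>] that by simp
    have l: "(\<lambda>r. \<epsilon> (\<phi> r)) \<in> lin_maps R (ideal_module R I) (E 0)" by (rule lin_comp[OF \<phi> \<epsilon>])
    have "(\<lambda>r. \<epsilon> (\<phi> r)) \<in> lin_maps R (ideal_module R I) ((E 0)\<lparr>carrier := K 0\<rparr>)"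
      by (rule lin_mapsI) (use \<phi>R \<epsilon>k lin_add[OF l] lin_smult[OF l] in \<open>auto simp: K_def\<close>)
    from B0[OF I this] obtain c where c: "c \<in> K 0" "\<And>r. r \<in> I \<Longrightarrow> \<epsilon> (\<phi> r) = r \<odot>\<^bsub>E 0\<^esub> c" by auto
    obtain c0 where c0: "c0 \<in> carrier R" "c = \<epsilon> c0" using c(1) \<epsilon>k by (auto simp: K_def)
    have "\<phi> r = r \<otimes> c0" if r: "r \<in> I" for r
    proof -
      have rR: "r \<in> carrier R" by (rule ideal.Icarr[OF I r])
      have "\<epsilon> (\<phi> r) = \<epsilon> (r \<otimes> c0)" using c(2)[OF r] c0 lin_smult[OF \<epsilon> rR, of c0] by simp
      then show ?thesis using \<epsilon>i \<phi>R[OF r] rR c0(1) by (auto simp: inj_on_def)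
    qed
    then show "\<exists>c\<in>carrier (ring_as_module R). \<forall>r\<in>I. \<phi> r = r \<odot>\<^bsub>ring_as_module R\<^esub> c" using c0(1) by auto
  qed
qed

end

section \<open>Localization at a prime\<close>

locale at_prime = comm_noetherian_ring +
  fixes p :: "'a set"
  assumes prime: "primeideal p R"
begin

abbreviation "S \<equiv> carrier R - p"
abbreviation "L \<equiv> localization R p"
abbreviation "fr \<equiv> fraction R (carrier R - p)"

interpretation p: primeideal p R by (rule prime)

lemma S_one [simp]: "\<one> \<in> S"
  using p.one_imp_carrier p.I_notcarr by auto

lemma S_mult [simp]: "s \<in> S \<Longrightarrow> t \<in> S \<Longrightarrow> s \<otimes> t \<in> S"
  using p.I_prime by auto

lemma S_carrier: "s \<in> S \<Longrightarrow> s \<in> carrier R" by simp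

lemma mem_fraction:
  assumes "a \<in> carrier R" and "s \<in> S"
  shows "(b, t) \<in> fr a s \<longleftrightarrow> b \<in> carrier R \<and> t \<in> S \<and> (\<exists>u\<in>S. u \<otimes> (t \<otimes> a) = u \<otimes> (s \<otimes> b))"
proof -
  have "u \<otimes> (t \<otimes> a \<ominus> s \<otimes> b) = \<zero> \<longleftrightarrow> u \<otimes> (t \<otimes> a) = u \<otimes> (s \<otimes> b)"
    if "u \<in> carrier R" "b \<in> carrier R" "t \<in> carrier R" for u
  proof -
    have "u \<otimes> (t \<otimes> a \<ominus> s \<otimes> b) = u \<otimes> (t \<otimes> a) \<ominus> u \<otimes> (s \<otimes> b)"
      using that assms by (simp add: a_minus_def r_distr r_minus)
    then show ?thesis using that assms by (simp add: minus_eq_zero_iff)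
  qed
  then show ?thesis unfolding fraction_def by auto
qed

lemma fraction_eq:
  assumes a: "a \<in> carrier R" "s \<in> S" and b: "b \<in> carrier R" "t \<in> S"
  shows "fr a s = fr b t \<longleftrightarrow> (\<exists>u\<in>S. u \<otimes> (t \<otimes> a) = u \<otimes> (s \<otimes> b))"
proof
  assume "fr a s = fr b t"
  moreover have "(b, t) \<in> fr b t" using b mem_fraction[OF b] S_one by blast
  ultimately show "\<exists>u\<in>S. u \<otimes> (t \<otimes> a) = u \<otimes> (s \<otimes> b)" using mem_fraction[OF a] by simp
next
  have sub: "fr b t \<subseteq> fr a s" if ab: "a \<in> carrier R" "s \<in> S" "b \<in> carrier R" "t \<in> S"
    and u: "u \<in> S" "u \<otimes> (t \<otimes> a) = u \<otimes> (s \<otimes> b)" for a s b t u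
  proof (rule subsetI, clarify)
    fix c r assume "(c, r) \<in> fr b t"
    then obtain v where c: "c \<in> carrier R" "r \<in> S" and v: "v \<in> S" "v \<otimes> (r \<otimes> b) = v \<otimes> (t \<otimes> c)"
      unfolding mem_fraction[OF ab(3,4)] by (elim conjE bexE)
    have R: "a \<in> carrier R" "s \<in> carrier R" "b \<in> carrier R" "t \<in> carrier R" "u \<in> carrier R"
      "v \<in> carrier R" "r \<in> carrier R" "c \<in> carrier R"
      using ab u v c by simp_all
    have "(u \<otimes> v \<otimes> t) \<otimes> (r \<otimes> a) = v \<otimes> r \<otimes> (u \<otimes> (t \<otimes> a))" using R by (simp add: m_ac)
    also have "\<dots> = u \<otimes> s \<otimes> (v \<otimes> (r \<otimes> b))" unfolding u(2) using R by (simp add: m_ac)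
    also have "\<dots> = (u \<otimes> v \<otimes> t) \<otimes> (s \<otimes> c)" unfolding v(2) using R by (simp add: m_ac)
    finally have "(u \<otimes> v \<otimes> t) \<otimes> (r \<otimes> a) = (u \<otimes> v \<otimes> t) \<otimes> (s \<otimes> c)" .
    moreover have "u \<otimes> v \<otimes> t \<in> S" using u(1) v(1) ab(4) S_mult by blast
    ultimately show "(c, r) \<in> fr a s" unfolding mem_fraction[OF ab(1,2)] using c by blast
  qed
  assume "\<exists>u\<in>S. u \<otimes> (t \<otimes> a) = u \<otimes> (s \<otimes> b)"
  then obtain u where "u \<in> S" "u \<otimes> (t \<otimes> a) = u \<otimes> (s \<otimes> b)" by blast
  then show "fr a s = fr b t" using sub[OF a b] sub[OF b a, of u] by (metis subset_antisym)
qed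

lemma fraction_self: "a \<in> carrier R \<Longrightarrow> s \<in> S \<Longrightarrow> (a, s) \<in> fr a s"
  using mem_fraction[of a s a s] S_one by blast

lemma mem_fraction_eq:
  assumes "a \<in> carrier R" and "s \<in> S" and "(b, t) \<in> fr a s"
  shows "b \<in> carrier R" and "t \<in> S" and "fr b t = fr a s"
proof -
  have "b \<in> carrier R \<and> t \<in> S \<and> (\<exists>u\<in>S. u \<otimes> (t \<otimes> a) = u \<otimes> (s \<otimes> b))"
    using assms(3) unfolding mem_fraction[OF assms(1,2)] .
  then show "b \<in> carrier R" "t \<in> S" "fr b t = fr a s" using fraction_eq[OF assms(1,2)] by auto
qed

text \<open>Collapses the unions over representatives in the operations of \<open>frac_ring\<close>,
  whose members are all the same fraction.\<close>

lemma union_fraction: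
  assumes "a \<in> carrier R" "s \<in> S" and "\<And>b t. b \<in> carrier R \<Longrightarrow> t \<in> S \<Longrightarrow> fr b t = fr a s \<Longrightarrow> f b t = c"
  shows "(\<Union>(b, t)\<in>fr a s. f b t) = c"
proof -
  have "f b t = c" if "(b, t) \<in> fr a s" for b t using assms(3) mem_fraction_eq[OF assms(1,2) that] by blast
  moreover have "(a, s) \<in> fr a s" by (rule fraction_self[OF assms(1,2)])
  ultimately show ?thesis by fast
qed

lemma loc_carrier: "carrier L = {fr a s | a s. a \<in> carrier R \<and> s \<in> S}"
  by (simp add: localization_def frac_ring_def)

lemma loc_zero_one: "\<zero>\<^bsub>L\<^esub> = fr \<zero> \<one>" "\<one>\<^bsub>L\<^esub> = fr \<one> \<one>"
  by (simp_all add: localization_def frac_ring_def)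

lemma loc_mult:
  assumes a: "a \<in> carrier R" "s \<in> S" and b: "b \<in> carrier R" "t \<in> S"
  shows "fr a s \<otimes>\<^bsub>L\<^esub> fr b t = fr (a \<otimes> b) (s \<otimes> t)"
proof -
  have "fr (a' \<otimes> b') (s' \<otimes> t') = fr (a \<otimes> b) (s \<otimes> t)"
    if a': "a' \<in> carrier R" "s' \<in> S" "fr a' s' = fr a s" and b': "b' \<in> carrier R" "t' \<in> S" "fr b' t' = fr b t" for a' s' b' t'
  proof -
    obtain u where u: "u \<in> S" "u \<otimes> (s \<otimes> a') = u \<otimes> (s' \<otimes> a)" using a'(3) fraction_eq[OF a'(1,2) a] by blast
    obtain v where v: "v \<in> S" "v \<otimes> (t \<otimes> b') = v \<otimes> (t' \<otimes> b)" using b'(3) fraction_eq[OF b'(1,2) b] by blast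
    have R: "a \<in> carrier R" "s \<in> carrier R" "b \<in> carrier R" "t \<in> carrier R" "u \<in> carrier R"
      "v \<in> carrier R" "a' \<in> carrier R" "s' \<in> carrier R" "b' \<in> carrier R" "t' \<in> carrier R"
      using a b u v a' b' by simp_all
    have "u \<otimes> v \<otimes> ((s \<otimes> t) \<otimes> (a' \<otimes> b')) = (u \<otimes> (s \<otimes> a')) \<otimes> (v \<otimes> (t \<otimes> b'))"
      using R by (simp add: m_ac)
    also have "\<dots> = u \<otimes> v \<otimes> ((s' \<otimes> t') \<otimes> (a \<otimes> b))" unfolding u(2) v(2) using R by (simp add: m_ac)
    finally have "u \<otimes> v \<otimes> ((s \<otimes> t) \<otimes> (a' \<otimes> b')) = u \<otimes> v \<otimes> ((s' \<otimes> t') \<otimes> (a \<otimes> b))" .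
    moreover have "u \<otimes> v \<in> S" by (rule S_mult[OF u(1) v(1)])
    ultimately show ?thesis
      using fraction_eq[OF _ S_mult[OF a'(2) b'(2)] _ S_mult[OF a(2) b(2)], of "a' \<otimes> b'" "a \<otimes> b"] R by blast
  qed
  note main = this
  have "(\<Union>(b', t')\<in>fr b t. fr (a' \<otimes> b') (s' \<otimes> t')) = fr (a \<otimes> b) (s \<otimes> t)"
    if "a' \<in> carrier R" "s' \<in> S" "fr a' s' = fr a s" for a' s'
    by (rule union_fraction[OF b]) (rule main[OF that])
  from union_fraction[OF a this]
  have "(\<Union>(a', s')\<in>fr a s. \<Union>(b', t')\<in>fr b t. fr (a' \<otimes> b') (s' \<otimes> t')) = fr (a \<otimes> b) (s \<otimes> t)" .
  then show ?thesis by (simp add: localization_def frac_ring_def)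
qed

lemma loc_add:
  assumes a: "a \<in> carrier R" "s \<in> S" and b: "b \<in> carrier R" "t \<in> S"
  shows "fr a s \<oplus>\<^bsub>L\<^esub> fr b t = fr (t \<otimes> a \<oplus> s \<otimes> b) (s \<otimes> t)"
proof -
  have "fr (t' \<otimes> a' \<oplus> s' \<otimes> b') (s' \<otimes> t') = fr (t \<otimes> a \<oplus> s \<otimes> b) (s \<otimes> t)"
    if a': "a' \<in> carrier R" "s' \<in> S" "fr a' s' = fr a s" and b': "b' \<in> carrier R" "t' \<in> S" "fr b' t' = fr b t" for a' s' b' t'
  proof -
    obtain u where u: "u \<in> S" "u \<otimes> (s \<otimes> a') = u \<otimes> (s' \<otimes> a)" using a'(3) fraction_eq[OF a'(1,2) a] by blast
    obtain v where v: "v \<in> S" "v \<otimes> (t \<otimes> b') = v \<otimes> (t' \<otimes> b)" using b'(3) fraction_eq[OF b'(1,2) b] by blast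
    have R: "a \<in> carrier R" "s \<in> carrier R" "b \<in> carrier R" "t \<in> carrier R" "u \<in> carrier R"
      "v \<in> carrier R" "a' \<in> carrier R" "s' \<in> carrier R" "b' \<in> carrier R" "t' \<in> carrier R"
      using a b u v a' b' by simp_all
    have "u \<otimes> v \<otimes> ((s \<otimes> t) \<otimes> (t' \<otimes> a' \<oplus> s' \<otimes> b'))
        = (u \<otimes> (s \<otimes> a')) \<otimes> (v \<otimes> t \<otimes> t') \<oplus> (v \<otimes> (t \<otimes> b')) \<otimes> (u \<otimes> s \<otimes> s')"
      using R by (simp add: m_ac r_distr)
    also have "\<dots> = u \<otimes> v \<otimes> ((s' \<otimes> t') \<otimes> (t \<otimes> a \<oplus> s \<otimes> b))"
      unfolding u(2) v(2) using R by (simp add: m_ac r_distr)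
    finally have "u \<otimes> v \<otimes> ((s \<otimes> t) \<otimes> (t' \<otimes> a' \<oplus> s' \<otimes> b')) = u \<otimes> v \<otimes> ((s' \<otimes> t') \<otimes> (t \<otimes> a \<oplus> s \<otimes> b))" .
    moreover have "u \<otimes> v \<in> S" by (rule S_mult[OF u(1) v(1)])
    ultimately show ?thesis
      using fraction_eq[OF _ S_mult[OF a'(2) b'(2)] _ S_mult[OF a(2) b(2)],
          of "t' \<otimes> a' \<oplus> s' \<otimes> b'" "t \<otimes> a \<oplus> s \<otimes> b"] R by blast
  qed
  note main = this
  have "(\<Union>(b', t')\<in>fr b t. fr (t' \<otimes> a' \<oplus> s' \<otimes> b') (s' \<otimes> t')) = fr (t \<otimes> a \<oplus> s \<otimes> b) (s \<otimes> t)"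
    if "a' \<in> carrier R" "s' \<in> S" "fr a' s' = fr a s" for a' s'
    by (rule union_fraction[OF b]) (rule main[OF that])
  from union_fraction[OF a this]
  have "(\<Union>(a', s')\<in>fr a s. \<Union>(b', t')\<in>fr b t. fr (t' \<otimes> a' \<oplus> s' \<otimes> b') (s' \<otimes> t')) = fr (t \<otimes> a \<oplus> s \<otimes> b) (s \<otimes> t)" .
  then show ?thesis by (simp add: localization_def frac_ring_def)
qed

text \<open>The product of finitely many multipliers works for all of them. Together with finite
  generation this replaces the localization of modules.\<close>

lemma finite_common_multiplier:
  assumes "finite A" and "\<And>a. a \<in> A \<Longrightarrow> \<exists>w\<in>S. Q a w"
    and "\<And>a w s. a \<in> A \<Longrightarrow> w \<in> S \<Longrightarrow> s \<in> S \<Longrightarrow> Q a w \<Longrightarrow> Q a (s \<otimes> w)"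
  shows "\<exists>w\<in>S. \<forall>a\<in>A. Q a w"
  using assms
proof (induction A)
  case empty
  show ?case using S_one by blast
next
  case (insert a A)
  have "\<exists>w\<in>S. \<forall>a\<in>A. Q a w" by (rule insert.IH) (use insert.prems in auto)
  then obtain w where w: "w \<in> S" "\<forall>a\<in>A. Q a w" by blast
  obtain v where v: "v \<in> S" "Q a v" using insert.prems(1)[of a] by auto
  have "Q a (w \<otimes> v)" using insert.prems(2)[OF _ v(1) w(1) v(2)] by simp
  moreover have "Q b (v \<otimes> w)" if "b \<in> A" for b using insert.prems(2)[OF _ w(1) v(1)] w(2) that by simp
  moreover have "v \<otimes> w = w \<otimes> v" using v w by (simp add: m_comm)
  moreover have "w \<otimes> v \<in> S" by (rule S_mult[OF w(1) v(1)])
  ultimately show ?case by (intro bexI[of _ "w \<otimes> v"]) auto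
qed

text \<open>For the socle condition, a proper ideal of \<open>L\<close> contracts to an ideal
  \<open>c\<close> of \<open>R\<close> inside \<open>p\<close>. By minimality p = (c : x) for some
  \<open>x\<close>, and x/1 is the required socle element.\<close>

lemma loc_socle_ring:
  assumes L: "gorenstein_local_ring L" and min: "minimal_prime R p"
  shows "socle_ring L {fr a s | a s. a \<in> p \<and> s \<in> S}" (is "socle_ring L ?m")
    and "ideal {fr a s | a s. a \<in> p \<and> s \<in> S} L"
proof -
  have pR: "a \<in> carrier R" if "a \<in> p" for a using that by simp
  have "cring L" "noetherian_ring L"
    using L unfolding gorenstein_local_ring_def local_noetherian_ring_def by simp_all
  then interpret L: comm_noetherian_ring L by (simp add: comm_noetherian_ring_def)
  have frL: "fr a s \<in> carrier L" if "a \<in> carrier R" "s \<in> S" for a s using that unfolding loc_carrier by blast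
  have zero_iff: "fr a s = \<zero>\<^bsub>L\<^esub> \<longleftrightarrow> (\<exists>u\<in>S. u \<otimes> a = \<zero>)" if "a \<in> carrier R" "s \<in> S" for a s
    unfolding loc_zero_one using fraction_eq[OF that zero_closed S_one] that by simp
  show "socle_ring L ?m"
  proof (unfold_locales)
    fix \<rho> assume "\<rho> \<in> carrier L" "\<rho> \<notin> ?m"
    then obtain a s where a: "a \<in> carrier R" "s \<in> S" "\<rho> = fr a s" "a \<notin> p" unfolding loc_carrier by blast
    have aS: "a \<in> S" using a by simp
    have "\<rho> \<otimes>\<^bsub>L\<^esub> fr s a = \<one>\<^bsub>L\<^esub>"
      unfolding a(3) loc_mult[OF a(1,2) S_carrier[OF a(2)] aS] loc_zero_one
      using a fraction_eq[of "a \<otimes> s" "s \<otimes> a" \<one> \<one>] S_one S_mult[OF a(2) aS] m_comm[of a s] by auto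
    moreover have "fr s a \<in> carrier L" by (rule frL) (use a aS in auto)
    moreover from this have "fr s a \<otimes>\<^bsub>L\<^esub> \<rho> = \<rho> \<otimes>\<^bsub>L\<^esub> fr s a"
      by (rule L.m_comm) fact
    ultimately show "\<rho> \<in> Units L"
      unfolding Units_def using \<open>\<rho> \<in> carrier L\<close> by auto
  next
    show "?m \<subseteq> carrier L" using frL pR by blast
    show "\<one>\<^bsub>L\<^esub> \<noteq> \<zero>\<^bsub>L\<^esub>"
    proof
      assume "\<one>\<^bsub>L\<^esub> = \<zero>\<^bsub>L\<^esub>"
      then have "fr \<one> \<one> = \<zero>\<^bsub>L\<^esub>" by (simp add: loc_zero_one(2))
      then obtain u where "u \<in> S" "u \<otimes> \<one> = \<zero>" using zero_iff[OF one_closed S_one] by blast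
      then show False using p.zero_closed by simp
    qed
  next
    fix A assume A: "ideal A L" "\<one>\<^bsub>L\<^esub> \<notin> A"
    interpret A: ideal A L by (rule A(1))
    define c where "c = {a \<in> carrier R. fr a \<one> \<in> A}"
    have inA: "fr a s \<in> A" if "a \<in> c" "s \<in> S" for a s
    proof -
      have "fr a s = fr \<one> s \<otimes>\<^bsub>L\<^esub> fr a \<one>"
        using that loc_mult[of \<one> s a \<one>] S_one by (simp add: c_def)
      then show ?thesis using that A.I_l_closed[of "fr a \<one>" "fr \<one> s"] frL[OF one_closed that(2)]
        by (simp add: c_def)
    qed
    have "ideal c R" unfolding ideal_iff_submodule
    proof (rule submoduleI'[OF ring_module])
      show "c \<subseteq> carrier (ring_as_module R)" by (auto simp: c_def)
      show "\<zero>\<^bsub>ring_as_module R\<^esub> \<in> c" using A.zero_closed by (simp add: c_def loc_zero_one)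
      show "x \<oplus>\<^bsub>ring_as_module R\<^esub> y \<in> c" if "x \<in> c" "y \<in> c" for x y
        using that loc_add[of x \<one> y \<one>] S_one A.a_closed[of "fr x \<one>" "fr y \<one>"] by (simp add: c_def)
      show "a \<odot>\<^bsub>ring_as_module R\<^esub> x \<in> c" if "a \<in> carrier R" "x \<in> c" for a x
        using that loc_mult[of a \<one> x \<one>] S_one A.I_l_closed[of "fr x \<one>" "fr a \<one>"] frL[of a \<one>]
        by (simp add: c_def)
    qed
    moreover have "c \<subseteq> p"
    proof (rule ccontr)
      assume "\<not> c \<subseteq> p"
      then obtain s where s: "s \<in> c" "s \<in> S" by (auto simp: c_def)
      have "fr s s = \<one>\<^bsub>L\<^esub>" unfolding loc_zero_one
        using fraction_eq[of s s \<one> \<one>] s S_one by auto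
      then show False using inA[OF s] A(2) by simp
    qed
    ultimately obtain x where x: "x \<in> carrier R" "{r \<in> carrier R. r \<otimes> x \<in> c} = p"
      by (rule minimal_prime_colon[OF min])
    have "\<one> \<notin> p" using S_one by blast
    have "x \<notin> c"
    proof
      assume "x \<in> c"
      then have "\<one> \<in> {r \<in> carrier R. r \<otimes> x \<in> c}" using x(1) by simp
      then show False unfolding x(2) using \<open>\<one> \<notin> p\<close> by simp
    qed
    then have "fr x \<one> \<notin> A" using x(1) by (simp add: c_def)
    moreover have "\<rho> \<otimes>\<^bsub>L\<^esub> fr x \<one> \<in> A" if "\<rho> \<in> ?m" for \<rho>
    proof -
      from that obtain a s where a: "a \<in> p" "s \<in> S" "\<rho> = fr a s" by blast
      have "a \<in> {r \<in> carrier R. r \<otimes> x \<in> c}" unfolding x(2) by (rule a(1))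
      then have "a \<otimes> x \<in> c" by simp
      then have "fr (a \<otimes> x) s \<in> A" using inA a(2) by blast
      then show ?thesis unfolding a(3) using loc_mult[OF pR[OF a(1)] a(2) x(1) S_one] a(2) by simp
    qed
    ultimately show "\<exists>x\<in>carrier L. x \<notin> A \<and> (\<forall>r\<in>?m. r \<otimes>\<^bsub>L\<^esub> x \<in> A)"
      using frL[OF x(1) S_one] by (intro bexI[of _ "fr x \<one>"] conjI ballI)
  qed
  show "ideal ?m L" unfolding L.ideal_iff_submodule
  proof (rule submoduleI'[OF L.ring_module])
    show "?m \<subseteq> carrier (ring_as_module L)" using frL pR by auto
    have "fr \<zero> \<one> \<in> ?m" using p.zero_closed S_one by blast
    then show "\<zero>\<^bsub>ring_as_module L\<^esub> \<in> ?m" by (simp only: ring_as_module_simps loc_zero_one)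
    fix x y assume "x \<in> ?m" "y \<in> ?m"
    then obtain a s b t where ab: "a \<in> p" "s \<in> S" "x = fr a s" "b \<in> p" "t \<in> S" "y = fr b t" by blast
    have "x \<oplus>\<^bsub>L\<^esub> y = fr (t \<otimes> a \<oplus> s \<otimes> b) (s \<otimes> t)" using loc_add ab pR by simp
    moreover have "t \<otimes> a \<oplus> s \<otimes> b \<in> p" using ab by (simp add: p.I_l_closed)
    ultimately show "x \<oplus>\<^bsub>ring_as_module L\<^esub> y \<in> ?m" using S_mult[OF ab(2,5)] by auto
  next
    fix \<rho> x assume "\<rho> \<in> carrier L" "x \<in> ?m"
    then obtain a s b t where ab: "a \<in> p" "s \<in> S" "x = fr a s" "b \<in> carrier R" "t \<in> S" "\<rho> = fr b t"
      unfolding loc_carrier by blast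
    have "\<rho> \<otimes>\<^bsub>L\<^esub> x = fr (b \<otimes> a) (t \<otimes> s)" using loc_mult[of b t a s] ab pR by simp
    moreover have "b \<otimes> a \<in> p" using ab by (simp add: p.I_l_closed)
    ultimately show "\<rho> \<odot>\<^bsub>ring_as_module L\<^esub> x \<in> ?m" using S_mult[OF ab(5,2)] by auto
  qed
qed

text \<open>Functionals are given by their graphs, which are single valued submodules of \<open>R \<times> R\<close>.\<close>

lemma extend_functional_ideal:
  assumes L: "gorenstein_local_ring L" and min: "minimal_prime R p"
    and G: "G \<subseteq> carrier R \<times> carrier R" "(\<zero>, \<zero>) \<in> G"
      "\<And>r b r' b'. (r, b) \<in> G \<Longrightarrow> (r', b') \<in> G \<Longrightarrow> (r \<oplus> r', b \<oplus> b') \<in> G"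
      "\<And>a r b. a \<in> carrier R \<Longrightarrow> (r, b) \<in> G \<Longrightarrow> (a \<otimes> r, a \<otimes> b) \<in> G"
    and single: "\<And>b. (\<zero>, b) \<in> G \<Longrightarrow> b = \<zero>"
  obtains s c where "s \<in> S" and "c \<in> carrier R" and "\<And>r b. (r, b) \<in> G \<Longrightarrow> c \<otimes> r = s \<otimes> b"
proof -
  have GR: "r \<in> carrier R" "b \<in> carrier R" if "(r, b) \<in> G" for r b using G(1) that by auto
  interpret L: socle_ring L "{fr a s | a s. a \<in> p \<and> s \<in> S}" by (rule loc_socle_ring[OF L min])
  have selfinj: "baer L (ring_as_module L)"
    by (rule L.self_injective[OF loc_socle_ring(2)[OF L min]])
      (use L in \<open>simp add: gorenstein_local_ring_def\<close>)
  have frL: "fr a s \<in> carrier L" if "a \<in> carrier R" "s \<in> S" for a s using that unfolding loc_carrier by blast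
  have func: "b = b'" if "(r, b) \<in> G" "(r, b') \<in> G" for r b b'
  proof -
    have "(\<ominus> \<one> \<otimes> r, \<ominus> \<one> \<otimes> b') \<in> G" by (rule G(4)[OF _ that(2)]) simp
    from G(3)[OF that(1) this] have "(\<zero>, b \<ominus> b') \<in> G"
      using GR[OF that(1)] GR[OF that(2)] by (simp add: l_minus r_neg a_minus_def)
    from single[OF this] show ?thesis using GR[OF that(1)] GR[OF that(2)] by (simp add: minus_eq_zero_iff)
  qed
  \<comment> \<open>The localized domain of \<open>G\<close>. The functional on it sends r/u to b/u,
    and single-valuedness of \<open>G\<close> makes this independent of the fraction chosen.\<close>
  define A where "A = {fr r u | r b u. (r, b) \<in> G \<and> u \<in> S}"
  have wd: "fr b u = fr b' u'" if g: "(r, b) \<in> G" "(r', b') \<in> G" "u \<in> S" "u' \<in> S" and eq: "fr r u = fr r' u'"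
    for r b u r' b' u'
  proof -
    note gR = GR[OF g(1)] GR[OF g(2)] S_carrier[OF g(3)] S_carrier[OF g(4)]
    obtain w where w: "w \<in> S" "w \<otimes> (u' \<otimes> r) = w \<otimes> (u \<otimes> r')"
      using eq fraction_eq[OF gR(1) g(3) gR(3) g(4)] by blast
    have wR: "w \<in> carrier R" using w(1) by simp
    have "(w \<otimes> (u' \<otimes> r), w \<otimes> (u' \<otimes> b)) \<in> G" by (rule G(4)[OF wR G(4)[OF gR(6) g(1)]])
    moreover have "(w \<otimes> (u \<otimes> r'), w \<otimes> (u \<otimes> b')) \<in> G" by (rule G(4)[OF wR G(4)[OF gR(5) g(2)]])
    ultimately have "w \<otimes> (u' \<otimes> b) = w \<otimes> (u \<otimes> b')" using func w(2) by simp
    then show ?thesis using fraction_eq[OF gR(2) g(3) gR(4) g(4)] w(1) by blast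
  qed
  define \<phi> where "\<phi> \<rho> = (SOME \<beta>. \<exists>r b u. (r, b) \<in> G \<and> u \<in> S \<and> \<rho> = fr r u \<and> \<beta> = fr b u)" for \<rho>
  have \<phi>: "\<phi> (fr r u) = fr b u" if g: "(r, b) \<in> G" "u \<in> S" for r b u
    unfolding \<phi>_def
  proof (rule some_equality)
    show "\<exists>r' b' u'. (r', b') \<in> G \<and> u' \<in> S \<and> fr r u = fr r' u' \<and> fr b u = fr b' u'" using g by blast
    fix \<beta> assume "\<exists>r' b' u'. (r', b') \<in> G \<and> u' \<in> S \<and> fr r u = fr r' u' \<and> \<beta> = fr b' u'"
    then obtain r' b' u' where "(r', b') \<in> G" "u' \<in> S" "fr r u = fr r' u'" "\<beta> = fr b' u'" by (elim exE conjE)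
    then show "\<beta> = fr b u" using wd[OF g(1) _ g(2)] by simp
  qed
  have AE: "\<exists>r b u. (r, b) \<in> G \<and> u \<in> S \<and> \<rho> = fr r u" if "\<rho> \<in> A" for \<rho> using that unfolding A_def by blast
  have AI: "fr r u \<in> A" if "(r, b) \<in> G" "u \<in> S" for r b u using that unfolding A_def by blast
  have add: "(t \<otimes> r \<oplus> s \<otimes> r', t \<otimes> b \<oplus> s \<otimes> b') \<in> G" if "(r, b) \<in> G" "(r', b') \<in> G" "s \<in> S" "t \<in> S" for r b r' b' s t
    by (intro G(3) G(4)) (use that in auto)
  have A: "ideal A L" unfolding L.ideal_iff_submodule
  proof (rule submoduleI'[OF L.ring_module])
    show "A \<subseteq> carrier (ring_as_module L)" using frL GR by (auto simp: A_def)
    show "\<zero>\<^bsub>ring_as_module L\<^esub> \<in> A" using AI[OF G(2) S_one] by (simp add: loc_zero_one)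
    fix x y assume "x \<in> A" "y \<in> A"
    then obtain r b u r' b' u' where g: "(r, b) \<in> G" "u \<in> S" "x = fr r u" "(r', b') \<in> G" "u' \<in> S" "y = fr r' u'"
      using AE by metis
    show "x \<oplus>\<^bsub>ring_as_module L\<^esub> y \<in> A"
      using AI[OF add[OF g(1,4,2,5)] S_mult[OF g(2,5)]] loc_add[OF GR(1)[OF g(1)] g(2) GR(1)[OF g(4)] g(5)] g
      by simp
  next
    fix \<rho> x assume "\<rho> \<in> carrier L" and "x \<in> A"
    then obtain a s r b u where g: "a \<in> carrier R" "s \<in> S" "\<rho> = fr a s" "(r, b) \<in> G" "u \<in> S" "x = fr r u"
      using AE unfolding loc_carrier by blast
    show "\<rho> \<odot>\<^bsub>ring_as_module L\<^esub> x \<in> A"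
      using AI[OF G(4)[OF g(1,4)] S_mult[OF g(2,5)]] loc_mult[OF g(1,2) GR(1)[OF g(4)] g(5)] g by simp
  qed
  have \<phi>_lin: "\<phi> \<in> lin_maps L (ideal_module L A) (ring_as_module L)"
  proof (rule lin_mapsI)
    fix x assume "x \<in> carrier (ideal_module L A)"
    then obtain r b u where x: "(r, b) \<in> G" "u \<in> S" "x = fr r u" using AE[of x] by auto
    show "\<phi> x \<in> carrier (ring_as_module L)" using \<phi>[OF x(1,2)] x(3) frL[OF GR(2)[OF x(1)] x(2)] by simp
    { fix y assume "y \<in> carrier (ideal_module L A)"
      then obtain r' b' u' where y: "(r', b') \<in> G" "u' \<in> S" "y = fr r' u'" using AE[of y] by auto
      show "\<phi> (x \<oplus>\<^bsub>ideal_module L A\<^esub> y) = \<phi> x \<oplus>\<^bsub>ring_as_module L\<^esub> \<phi> y"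
        using \<phi>[OF x(1,2)] \<phi>[OF y(1,2)] \<phi>[OF add[OF x(1) y(1) x(2) y(2)] S_mult[OF x(2) y(2)]]
          loc_add[OF GR(1)[OF x(1)] x(2) GR(1)[OF y(1)] y(2)] loc_add[OF GR(2)[OF x(1)] x(2) GR(2)[OF y(1)] y(2)]
          x(3) y(3) by simp }
    fix \<rho> assume "\<rho> \<in> carrier L"
    then obtain a s where a: "a \<in> carrier R" "s \<in> S" "\<rho> = fr a s" unfolding loc_carrier by blast
    show "\<phi> (\<rho> \<odot>\<^bsub>ideal_module L A\<^esub> x) = \<rho> \<odot>\<^bsub>ring_as_module L\<^esub> \<phi> x"
      using \<phi>[OF x(1,2)] \<phi>[OF G(4)[OF a(1) x(1)] S_mult[OF a(2) x(2)]]
        loc_mult[OF a(1,2) GR(1)[OF x(1)] x(2)] loc_mult[OF a(1,2) GR(2)[OF x(1)] x(2)] x(3) a(3) by simp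
  qed
  obtain \<gamma> where \<gamma>: "\<gamma> \<in> carrier L" "\<And>\<rho>. \<rho> \<in> A \<Longrightarrow> \<phi> \<rho> = \<rho> \<otimes>\<^bsub>L\<^esub> \<gamma>"
    using baerD[OF selfinj A \<phi>_lin] by (metis ring_as_module_simps(1,4))
  obtain c t where c: "c \<in> carrier R" "t \<in> S" "\<gamma> = fr c t" using \<gamma>(1) unfolding loc_carrier by blast
  have loc: "\<exists>w\<in>S. w \<otimes> (t \<otimes> b) = w \<otimes> (c \<otimes> r)" if g: "(r, b) \<in> G" for r b
  proof -
    have "fr b \<one> = fr (r \<otimes> c) (\<one> \<otimes> t)"
      using \<gamma>(2)[OF AI[OF g S_one]] \<phi>[OF g S_one] loc_mult[OF GR(1)[OF g] S_one c(1,2)] c(3) by simp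
    then have "fr b \<one> = fr (r \<otimes> c) t" using c(2) by simp
    moreover have "r \<otimes> c \<in> carrier R" using GR[OF g] c by simp
    ultimately obtain w where "w \<in> S" "w \<otimes> (t \<otimes> b) = w \<otimes> (\<one> \<otimes> (r \<otimes> c))"
      using fraction_eq[OF GR(2)[OF g] S_one, of "r \<otimes> c" t] c(2) by blast
    then show ?thesis using GR[OF g] c m_comm[of r c] by auto
  qed
  let ?D = "fst ` G"
  \<comment> \<open>The equation between \<open>G\<close> and the fraction \<gamma> = c/t holds only
    after a multiplier that depends on \<open>r\<close>. For fixed \<open>w\<close> the elements
    \<open>r\<close> at which \<open>w\<close> works form an ideal, so it is enough that
    \<open>w\<close> works on finitely many generators of the domain.\<close>
  have domain: "ideal {r. \<exists>b. (r, b) \<in> G \<and> w \<otimes> (t \<otimes> b) = w \<otimes> (c \<otimes> r)} R" if w: "w \<in> carrier R" for w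
    unfolding ideal_iff_submodule
  proof (rule submoduleI'[OF ring_module])
    let ?B = "{r. \<exists>b. (r, b) \<in> G \<and> w \<otimes> (t \<otimes> b) = w \<otimes> (c \<otimes> r)}"
    have tR: "t \<in> carrier R" using c by simp
    show "?B \<subseteq> carrier (ring_as_module R)" using GR by auto
    show "\<zero>\<^bsub>ring_as_module R\<^esub> \<in> ?B" using G(2) w c tR by auto
    show "x \<oplus>\<^bsub>ring_as_module R\<^esub> y \<in> ?B" if xy: "x \<in> ?B" "y \<in> ?B" for x y
    proof -
      obtain b b' where b: "(x, b) \<in> G" "w \<otimes> (t \<otimes> b) = w \<otimes> (c \<otimes> x)"
        "(y, b') \<in> G" "w \<otimes> (t \<otimes> b') = w \<otimes> (c \<otimes> y)" using xy by blast
      have "w \<otimes> (t \<otimes> (b \<oplus> b')) = w \<otimes> (c \<otimes> (x \<oplus> y))"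
        using b w tR c(1) GR[OF b(1)] GR[OF b(3)] by (simp add: r_distr)
      then show ?thesis using G(3)[OF b(1,3)] by auto
    qed
    show "a \<odot>\<^bsub>ring_as_module R\<^esub> x \<in> ?B" if a: "a \<in> carrier R" and "x \<in> ?B" for a x
    proof -
      obtain b where b: "(x, b) \<in> G" "w \<otimes> (t \<otimes> b) = w \<otimes> (c \<otimes> x)" using \<open>x \<in> ?B\<close> by blast
      have "w \<otimes> (t \<otimes> (a \<otimes> b)) = a \<otimes> (w \<otimes> (t \<otimes> b))" using a w tR GR[OF b(1)] by (simp add: m_ac)
      also have "\<dots> = w \<otimes> (c \<otimes> (a \<otimes> x))" unfolding b(2) using a w c GR[OF b(1)] by (simp add: m_ac)
      finally show ?thesis using G(4)[OF a b(1)] by auto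
    qed
  qed
  \<comment> \<open>For \<open>w = \<zero>\<close> the equation is void, and \<open>domain\<close>
    says that the whole domain of \<open>G\<close> is an ideal.\<close>
  have D_eq: "{r. \<exists>b. (r, b) \<in> G \<and> \<zero> \<otimes> (t \<otimes> b) = \<zero> \<otimes> (c \<otimes> r)} = ?D"
  proof (intro subset_antisym subsetI)
    fix r assume "r \<in> {r. \<exists>b. (r, b) \<in> G \<and> \<zero> \<otimes> (t \<otimes> b) = \<zero> \<otimes> (c \<otimes> r)}"
    then obtain b where "(r, b) \<in> G" by blast
    then show "r \<in> ?D" by (rule image_eqI[rotated]) simp
  next
    fix r assume "r \<in> ?D"
    then obtain b where g: "(r, b) \<in> G" by auto
    have "\<zero> \<otimes> (t \<otimes> b) = \<zero> \<otimes> (c \<otimes> r)" using GR[OF g] c by simp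
    then show "r \<in> {r. \<exists>b. (r, b) \<in> G \<and> \<zero> \<otimes> (t \<otimes> b) = \<zero> \<otimes> (c \<otimes> r)}" using g by blast
  qed
  have D: "ideal ?D R" using domain[OF zero_closed] unfolding D_eq .
  from finetely_gen[OF D] obtain X where X: "X \<subseteq> carrier R" "finite X" "?D = Idl X" by (elim exE conjE)
  have XD: "X \<subseteq> ?D" unfolding X(3) by (rule genideal_self[OF X(1)])
  have "\<exists>w\<in>S. \<forall>x\<in>X. \<exists>b. (x, b) \<in> G \<and> w \<otimes> (t \<otimes> b) = w \<otimes> (c \<otimes> x)"
  proof (rule finite_common_multiplier[OF X(2)])
    fix x assume "x \<in> X"
    then obtain b where b: "(x, b) \<in> G" using XD by auto
    then show "\<exists>w\<in>S. \<exists>b. (x, b) \<in> G \<and> w \<otimes> (t \<otimes> b) = w \<otimes> (c \<otimes> x)" using loc[OF b] by blast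
    fix w s assume w: "w \<in> S" "s \<in> S" "\<exists>b. (x, b) \<in> G \<and> w \<otimes> (t \<otimes> b) = w \<otimes> (c \<otimes> x)"
    then obtain b where b: "(x, b) \<in> G" "w \<otimes> (t \<otimes> b) = w \<otimes> (c \<otimes> x)" by blast
    then have "s \<otimes> w \<otimes> (t \<otimes> b) = s \<otimes> w \<otimes> (c \<otimes> x)"
      using w c GR[OF b(1)] by (simp add: m_assoc)
    then show "\<exists>b. (x, b) \<in> G \<and> s \<otimes> w \<otimes> (t \<otimes> b) = s \<otimes> w \<otimes> (c \<otimes> x)" using b(1) by blast
  qed
  then obtain w where w: "w \<in> S" "\<forall>x\<in>X. \<exists>b. (x, b) \<in> G \<and> w \<otimes> (t \<otimes> b) = w \<otimes> (c \<otimes> x)" by blast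
  have wR: "w \<in> carrier R" "t \<in> carrier R" using w c by simp_all
  have "?D \<subseteq> {r. \<exists>b. (r, b) \<in> G \<and> w \<otimes> (t \<otimes> b) = w \<otimes> (c \<otimes> r)}"
    unfolding X(3) by (rule genideal_minimal[OF domain[OF wR(1)]]) (use w(2) in blast)
  note sub = this
  have all: "w \<otimes> (t \<otimes> b) = w \<otimes> (c \<otimes> r)" if g: "(r, b) \<in> G" for r b
  proof -
    have "r \<in> ?D" by (rule image_eqI[OF _ g]) simp
    from subsetD[OF sub this] obtain b' where "(r, b') \<in> G" "w \<otimes> (t \<otimes> b') = w \<otimes> (c \<otimes> r)" by blast
    then show ?thesis using func[OF g] by simp
  qed
  show thesis
  proof (rule that[of "w \<otimes> t" "w \<otimes> c"])
    show "w \<otimes> t \<in> S" by (rule S_mult[OF w(1) c(2)])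
    show "w \<otimes> c \<in> carrier R" using wR c by simp
    show "(w \<otimes> c) \<otimes> r = (w \<otimes> t) \<otimes> b" if "(r, b) \<in> G" for r b
      using all[OF that] wR c(1) GR[OF that] by (simp add: m_assoc)
  qed
qed

text \<open>Induction on the coordinates. The functional is extended on the vectors supported at one
  coordinate \<open>t\<close>; after subtraction of this part, what remains depends on the other
  coordinates only. Each round contributes a factor to the multiplier. The families \<open>x\<close>
  are arbitrary functions of which only the values on \<open>I\<close> matter, and
  \<open>single\<close> ensures that these determine \<open>b\<close>.\<close>

lemma extend_functional:
  fixes I :: "'i set"
  assumes L: "gorenstein_local_ring L" and min: "minimal_prime R p" and "finite I"
    and G: "\<And>x b. (x, b) \<in> G \<Longrightarrow> x \<in> I \<rightarrow> carrier R \<and> b \<in> carrier R" "((\<lambda>_. \<zero>), \<zero>) \<in> G"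
      "\<And>x b x' b'. (x, b) \<in> G \<Longrightarrow> (x', b') \<in> G \<Longrightarrow> ((\<lambda>i. x i \<oplus> x' i), b \<oplus> b') \<in> G"
      "\<And>a x b. a \<in> carrier R \<Longrightarrow> (x, b) \<in> G \<Longrightarrow> ((\<lambda>i. a \<otimes> x i), a \<otimes> b) \<in> G"
    and single: "\<And>x b. (x, b) \<in> G \<Longrightarrow> (\<forall>i\<in>I. x i = \<zero>) \<Longrightarrow> b = \<zero>"
  shows "\<exists>s c. s \<in> S \<and> c \<in> I \<rightarrow> carrier R \<and> (\<forall>x b. (x, b) \<in> G \<longrightarrow> (\<Oplus>i\<in>I. c i \<otimes> x i) = s \<otimes> b)"
  using assms(3) G single
proof (induction I arbitrary: G)
  case empty
  have b0: "b = \<zero>" if "(x, b) \<in> G" for x b using empty.prems(5)[OF that] by simp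
  have "(\<Oplus>i\<in>{}. \<zero> \<otimes> x i) = \<one> \<otimes> b" if "(x, b) \<in> G" for x b using b0[OF that] by simp
  then show ?case using S_one by (intro exI[of _ \<one>] exI[of _ "\<lambda>_. \<zero>"]) blast
next
  case (insert t I)
  note G = insert.prems(1-4) and single = insert.prems(5)
  have xR: "x i \<in> carrier R" if "(x, b) \<in> G" "i \<in> insert t I" for x b i using G(1)[OF that(1)] that(2) by auto
  have bR: "b \<in> carrier R" if "(x, b) \<in> G" for x b using G(1)[OF that] by simp
  \<comment> \<open>The restriction to vectors vanishing on \<open>I\<close>, a functional of the
    single coordinate \<open>t\<close>.\<close>
  define G0 where "G0 = {(x t, b) | x b. (x, b) \<in> G \<and> (\<forall>i\<in>I. x i = \<zero>)}"
  obtain s0 c0 where s0: "s0 \<in> S" "c0 \<in> carrier R" "\<And>r b. (r, b) \<in> G0 \<Longrightarrow> c0 \<otimes> r = s0 \<otimes> b"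
  proof (rule extend_functional_ideal[OF L min])
    show "G0 \<subseteq> carrier R \<times> carrier R" using xR bR unfolding G0_def by auto
    show "(\<zero>, \<zero>) \<in> G0" unfolding G0_def using G(2) by force
    show "(r \<oplus> r', b \<oplus> b') \<in> G0" if g: "(r, b) \<in> G0" "(r', b') \<in> G0" for r b r' b'
    proof -
      obtain x x' where x: "r = x t" "(x, b) \<in> G" "\<forall>i\<in>I. x i = \<zero>" "r' = x' t" "(x', b') \<in> G" "\<forall>i\<in>I. x' i = \<zero>"
        using g unfolding G0_def by blast
      then show ?thesis unfolding G0_def using G(3)[OF x(2,5)]
        by (intro CollectI exI[of _ "\<lambda>i. x i \<oplus> x' i"] exI[of _ "b \<oplus> b'"]) simp
    qed
    show "(a \<otimes> r, a \<otimes> b) \<in> G0" if a: "a \<in> carrier R" and g: "(r, b) \<in> G0" for a r b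
    proof -
      obtain x where x: "r = x t" "(x, b) \<in> G" "\<forall>i\<in>I. x i = \<zero>" using g unfolding G0_def by blast
      then show ?thesis unfolding G0_def using G(4)[OF a x(2)] a
        by (intro CollectI exI[of _ "\<lambda>i. a \<otimes> x i"] exI[of _ "a \<otimes> b"]) simp
    qed
    show "b = \<zero>" if g: "(\<zero>, b) \<in> G0" for b
    proof -
      obtain x where x: "x t = \<zero>" "(x, b) \<in> G" "\<forall>i\<in>I. x i = \<zero>" using g unfolding G0_def by force
      then show ?thesis using single[OF x(2)] by simp
    qed
  next
    fix s c assume "s \<in> S" "c \<in> carrier R" "\<And>r b. (r, b) \<in> G0 \<Longrightarrow> c \<otimes> r = s \<otimes> b"
    then show thesis by (rule that)
  qed
  have s0R: "s0 \<in> carrier R" using s0(1) by simp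
  \<comment> \<open>The functional scaled by \<open>s0\<close>, minus the part already extended. By
    the choice of \<open>c0\<close> it vanishes on vectors supported at \<open>t\<close>, so it is a
    functional of the coordinates in \<open>I\<close>.\<close>
  define G' where "G' = {(x, s0 \<otimes> b \<ominus> c0 \<otimes> x t) | x b. (x, b) \<in> G}"
  have G'I: "(x, s0 \<otimes> b \<ominus> c0 \<otimes> x t) \<in> G'" if "(x, b) \<in> G" for x b using that unfolding G'_def by blast
  have G'E: "\<exists>b. (x, b) \<in> G \<and> d = s0 \<otimes> b \<ominus> c0 \<otimes> x t" if "(x, d) \<in> G'" for x d
    using that unfolding G'_def by blast
  have "\<exists>s c. s \<in> S \<and> c \<in> I \<rightarrow> carrier R \<and> (\<forall>x b. (x, b) \<in> G' \<longrightarrow> (\<Oplus>i\<in>I. c i \<otimes> x i) = s \<otimes> b)"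
  proof (rule insert.IH)
    show "x \<in> I \<rightarrow> carrier R \<and> d \<in> carrier R" if g: "(x, d) \<in> G'" for x d
      using G'E[OF g] xR bR s0 by force
    show "((\<lambda>_. \<zero>), \<zero>) \<in> G'" using G'I[OF G(2)] s0 by (simp add: a_minus_def)
    show "((\<lambda>i. x i \<oplus> x' i), d \<oplus> d') \<in> G'" if g: "(x, d) \<in> G'" "(x', d') \<in> G'" for x d x' d'
    proof -
      obtain b b' where b: "(x, b) \<in> G" "d = s0 \<otimes> b \<ominus> c0 \<otimes> x t" "(x', b') \<in> G" "d' = s0 \<otimes> b' \<ominus> c0 \<otimes> x' t"
        using G'E[OF g(1)] G'E[OF g(2)] by blast
      have R: "x t \<in> carrier R" "x' t \<in> carrier R" "b \<in> carrier R" "b' \<in> carrier R"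
        using xR b bR by auto
      have "d \<oplus> d' = s0 \<otimes> (b \<oplus> b') \<ominus> c0 \<otimes> (x t \<oplus> x' t)"
        unfolding b using R s0R s0(2) by (simp add: a_minus_def r_distr minus_add a_ac)
      then show ?thesis using G'I[OF G(3)[OF b(1,3)]] by simp
    qed
    show "((\<lambda>i. a \<otimes> x i), a \<otimes> d) \<in> G'" if a: "a \<in> carrier R" and g: "(x, d) \<in> G'" for a x d
    proof -
      obtain b where b: "(x, b) \<in> G" "d = s0 \<otimes> b \<ominus> c0 \<otimes> x t" using G'E[OF g] by blast
      have R: "x t \<in> carrier R" "b \<in> carrier R" using xR b bR by auto
      have "a \<otimes> d = s0 \<otimes> (a \<otimes> b) \<ominus> c0 \<otimes> (a \<otimes> x t)"
        unfolding b using R s0R s0(2) a by (simp add: a_minus_def r_distr r_minus m_lcomm)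
      then show ?thesis using G'I[OF G(4)[OF a b(1)]] by simp
    qed
    show "d = \<zero>" if g: "(x, d) \<in> G'" and z: "\<forall>i\<in>I. x i = \<zero>" for x d
    proof -
      obtain b where b: "(x, b) \<in> G" "d = s0 \<otimes> b \<ominus> c0 \<otimes> x t" using G'E[OF g] by blast
      have "(x t, b) \<in> G0" unfolding G0_def using b(1) z by blast
      then have "c0 \<otimes> x t = s0 \<otimes> b" by (rule s0(3))
      then show ?thesis unfolding b(2) using bR[OF b(1)] s0R by (simp add: a_minus_def r_neg)
    qed
  qed
  then obtain s1 c where s1: "s1 \<in> S" "c \<in> I \<rightarrow> carrier R"
    "\<And>x b. (x, b) \<in> G' \<Longrightarrow> (\<Oplus>i\<in>I. c i \<otimes> x i) = s1 \<otimes> b" by blast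
  \<comment> \<open>Adding back the subtracted part, now scaled by the multiplier \<open>s1\<close>,
    gives the coefficient at \<open>t\<close>.\<close>
  define c' where "c' = c(t := s1 \<otimes> c0)"
  have s1R: "s1 \<in> carrier R" using s1(1) by simp
  have "(\<Oplus>i\<in>insert t I. c' i \<otimes> x i) = (s1 \<otimes> s0) \<otimes> b" if g: "(x, b) \<in> G" for x b
  proof -
    have xi: "x i \<in> carrier R" if "i \<in> insert t I" for i by (rule xR[OF g that])
    have ci: "c i \<in> carrier R" if "i \<in> I" for i using s1(2) that by auto
    have tI: "t \<notin> I" by fact
    have "(\<Oplus>i\<in>insert t I. c' i \<otimes> x i) = c' t \<otimes> x t \<oplus> (\<Oplus>i\<in>I. c' i \<otimes> x i)"
      using insert.hyps xi ci s1R s0(2) by (intro finsum_insert) (auto simp: c'_def)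
    also have "(\<Oplus>i\<in>I. c' i \<otimes> x i) = (\<Oplus>i\<in>I. c i \<otimes> x i)"
      using tI xi ci by (intro finsum_cong') (auto simp: c'_def)
    also have "\<dots> = s1 \<otimes> (s0 \<otimes> b \<ominus> c0 \<otimes> x t)" by (rule s1(3)[OF G'I[OF g]])
    also have "c' t \<otimes> x t \<oplus> \<dots> = (s1 \<otimes> s0) \<otimes> b"
      using s1R s0R s0(2) bR[OF g] xi[of t]
      by (simp add: c'_def a_minus_def r_distr r_minus m_assoc a_lcomm r_neg)
    finally show ?thesis .
  qed
  moreover have "c' \<in> insert t I \<rightarrow> carrier R" using s1(2) s1R s0(2) by (auto simp: c'_def)
  ultimately show ?case using S_mult[OF s1(1) s0(1)] by blast
qed

end

section \<open>Tensor products and the first Tor and Ext\<close>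

lemma (in abelian_monoid) finsum_swap:
  assumes "finite A" and "\<And>a b. a \<in> A \<Longrightarrow> b \<in> B \<Longrightarrow> g a b \<in> carrier G"
  shows "(\<Oplus>a\<in>A. \<Oplus>b\<in>B. g a b) = (\<Oplus>b\<in>B. \<Oplus>a\<in>A. g a b)"
  using assms
proof (induction A)
  case (insert x A)
  have "(\<Oplus>b\<in>B. \<Oplus>a\<in>insert x A. g a b) = (\<Oplus>b\<in>B. g x b \<oplus> (\<Oplus>a\<in>A. g a b))"
    by (rule finsum_cong'[OF refl]) (use insert in \<open>auto intro!: finsum_insert finsum_closed\<close>)
  also have "\<dots> = (\<Oplus>b\<in>B. g x b) \<oplus> (\<Oplus>b\<in>B. \<Oplus>a\<in>A. g a b)"
    by (rule finsum_addf) (use insert in \<open>auto intro!: finsum_closed\<close>)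
  finally show ?case using insert by (simp add: finsum_insert finsum_closed Pi_iff)
qed simp

section \<open>Universal property of the tensor product and induced maps\<close>

context cring
begin

context
  fixes M :: "('a, 'c, 'm) module_scheme" and N :: "('a, 'd, 'n) module_scheme"
  assumes M: "module R M" and N: "module R N"
begin

interpretation M: module R M by (rule M)
interpretation N: module R N by (rule N)

lemma tensor_relations_closed: "tensor_relations R M N \<subseteq> carrier (free_module R (carrier M \<times> carrier N))"
proof -
  interpret P: module R "free_module R (carrier M \<times> carrier N)" by (rule free_module_is_module)
  show ?thesis unfolding tensor_relations_def Let_def by (auto intro!: basis_vec_closed)
qed

lemma tensor_submodule_is_submodule:
  "submodule (tensor_submodule R M N) R (free_module R (carrier M \<times> carrier N))"
  unfolding tensor_submodule_def by (rule submodule_span_props(1)[OF free_module_is_module tensor_relations_closed])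

lemma tensor_module: "module R (tensor R M N)"
  unfolding tensor_def by (rule quot_is_module[OF free_module_is_module tensor_submodule_is_submodule])

lemma pure_tensor_closed: "pure_tensor R M N x y \<in> carrier (tensor R M N)"
  unfolding pure_tensor_def tensor_def quot_carrier[OF free_module_is_module tensor_submodule_is_submodule]
  by (rule imageI[OF basis_vec_closed])

lemma tensor_relationI:
  assumes "u \<ominus>\<^bsub>free_module R (carrier M \<times> carrier N)\<^esub> v \<in> tensor_relations R M N"
    and "u \<in> carrier (free_module R (carrier M \<times> carrier N))"
    and "v \<in> carrier (free_module R (carrier M \<times> carrier N))"
  shows "tensor_submodule R M N +>\<^bsub>free_module R (carrier M \<times> carrier N)\<^esub> u
    = tensor_submodule R M N +>\<^bsub>free_module R (carrier M \<times> carrier N)\<^esub> v"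
proof -
  have "u \<ominus>\<^bsub>free_module R (carrier M \<times> carrier N)\<^esub> v \<in> tensor_submodule R M N"
    unfolding tensor_submodule_def
    by (rule subsetD[OF submodule_span_props(2)[OF free_module_is_module tensor_relations_closed] assms(1)])
  then show ?thesis
    using quot_coset_eq_iff[OF free_module_is_module tensor_submodule_is_submodule assms(2,3)] by simp
qed

lemma pure_tensor_bilinear:
  assumes "x \<in> carrier M" "y \<in> carrier N"
  shows "x' \<in> carrier M \<Longrightarrow> pure_tensor R M N (x \<oplus>\<^bsub>M\<^esub> x') y =
      pure_tensor R M N x y \<oplus>\<^bsub>tensor R M N\<^esub> pure_tensor R M N x' y"
    and "y' \<in> carrier N \<Longrightarrow> pure_tensor R M N x (y \<oplus>\<^bsub>N\<^esub> y') =
      pure_tensor R M N x y \<oplus>\<^bsub>tensor R M N\<^esub> pure_tensor R M N x y'"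
    and "a \<in> carrier R \<Longrightarrow> pure_tensor R M N (a \<odot>\<^bsub>M\<^esub> x) y = a \<odot>\<^bsub>tensor R M N\<^esub> pure_tensor R M N x y"
    and "a \<in> carrier R \<Longrightarrow> pure_tensor R M N x (a \<odot>\<^bsub>N\<^esub> y) = a \<odot>\<^bsub>tensor R M N\<^esub> pure_tensor R M N x y"
proof -
  let ?S = "carrier M \<times> carrier N" let ?P = "free_module R ?S"
  let ?e = "\<lambda>x y. basis_vec R ?S (x, y)"
  interpret P: module R ?P by (rule free_module_is_module)
  note A = quot_add[OF free_module_is_module tensor_submodule_is_submodule basis_vec_closed basis_vec_closed]
  note B = quot_smult[OF free_module_is_module tensor_submodule_is_submodule _ basis_vec_closed]
  note c = basis_vec_closed P.M.a_closed[OF basis_vec_closed basis_vec_closed] P.smult_closed[OF _ basis_vec_closed]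
  { assume x': "x' \<in> carrier M"
    show "pure_tensor R M N (x \<oplus>\<^bsub>M\<^esub> x') y = pure_tensor R M N x y \<oplus>\<^bsub>tensor R M N\<^esub> pure_tensor R M N x' y"
      unfolding pure_tensor_def tensor_def A
      by (rule tensor_relationI[OF _ c(1,2)]) (use assms x' in \<open>unfold tensor_relations_def Let_def, blast\<close>) }
  { assume y': "y' \<in> carrier N"
    show "pure_tensor R M N x (y \<oplus>\<^bsub>N\<^esub> y') = pure_tensor R M N x y \<oplus>\<^bsub>tensor R M N\<^esub> pure_tensor R M N x y'"
      unfolding pure_tensor_def tensor_def A
      by (rule tensor_relationI[OF _ c(1,2)]) (use assms y' in \<open>unfold tensor_relations_def Let_def, blast\<close>) }
  assume a: "a \<in> carrier R"
  show "pure_tensor R M N (a \<odot>\<^bsub>M\<^esub> x) y = a \<odot>\<^bsub>tensor R M N\<^esub> pure_tensor R M N x y"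
    unfolding pure_tensor_def tensor_def B[OF a]
    by (rule tensor_relationI[OF _ c(1) c(3)[OF a]]) (use assms a in \<open>unfold tensor_relations_def Let_def, blast\<close>)
  show "pure_tensor R M N x (a \<odot>\<^bsub>N\<^esub> y) = a \<odot>\<^bsub>tensor R M N\<^esub> pure_tensor R M N x y"
    unfolding pure_tensor_def tensor_def B[OF a]
    by (rule tensor_relationI[OF _ c(1) c(3)[OF a]]) (use assms a in \<open>unfold tensor_relations_def Let_def, blast\<close>)
qed

lemma tensor_proj:
  "(\<lambda>u. tensor_submodule R M N +>\<^bsub>free_module R (carrier M \<times> carrier N)\<^esub> u)
     \<in> lin_maps R (free_module R (carrier M \<times> carrier N)) (tensor R M N)"
  unfolding tensor_def by (rule quot_proj[OF free_module_is_module tensor_submodule_is_submodule])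

text \<open>The map is extended linearly to the free module on all pairs; each of the four kinds of
  defining relations is killed by one of the four bilinearity conditions.\<close>

lemma tensor_lift:
  fixes Q :: "('a, 'e, 'q) module_scheme"
  assumes Q: "module R Q"
    and cl: "\<And>x y. x \<in> carrier M \<Longrightarrow> y \<in> carrier N \<Longrightarrow> \<beta> x y \<in> carrier Q"
    and addl: "\<And>x x' y. x \<in> carrier M \<Longrightarrow> x' \<in> carrier M \<Longrightarrow> y \<in> carrier N \<Longrightarrow> \<beta> (x \<oplus>\<^bsub>M\<^esub> x') y = \<beta> x y \<oplus>\<^bsub>Q\<^esub> \<beta> x' y"
    and addr: "\<And>x y y'. x \<in> carrier M \<Longrightarrow> y \<in> carrier N \<Longrightarrow> y' \<in> carrier N \<Longrightarrow> \<beta> x (y \<oplus>\<^bsub>N\<^esub> y') = \<beta> x y \<oplus>\<^bsub>Q\<^esub> \<beta> x y'"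
    and sml: "\<And>a x y. a \<in> carrier R \<Longrightarrow> x \<in> carrier M \<Longrightarrow> y \<in> carrier N \<Longrightarrow> \<beta> (a \<odot>\<^bsub>M\<^esub> x) y = a \<odot>\<^bsub>Q\<^esub> \<beta> x y"
    and smr: "\<And>a x y. a \<in> carrier R \<Longrightarrow> x \<in> carrier M \<Longrightarrow> y \<in> carrier N \<Longrightarrow> \<beta> x (a \<odot>\<^bsub>N\<^esub> y) = a \<odot>\<^bsub>Q\<^esub> \<beta> x y"
  obtains h where "h \<in> lin_maps R (tensor R M N) Q"
    and "\<And>x y. x \<in> carrier M \<Longrightarrow> y \<in> carrier N \<Longrightarrow> h (pure_tensor R M N x y) = \<beta> x y"
proof -
  let ?S = "carrier M \<times> carrier N" let ?P = "free_module R ?S"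
  let ?e = "\<lambda>x y. basis_vec R ?S (x, y)"
  interpret P: module R ?P by (rule free_module_is_module)
  interpret Q: module R Q by (rule Q)
  have \<beta>: "(\<lambda>(x, y). \<beta> x y) \<in> ?S \<rightarrow> carrier Q" using cl by auto
  define H where "H = flin Q ?S (\<lambda>(x, y). \<beta> x y)"
  have H: "H \<in> lin_maps R ?P Q" unfolding H_def by (rule flin_lin[OF Q \<beta>])
  have He: "H (?e x y) = \<beta> x y" if "x \<in> carrier M" "y \<in> carrier N" for x y
    unfolding H_def using flin_basis[OF Q \<beta>, of "(x, y)"] that by simp
  note mi = lin_minus[OF P.module_axioms Q H]
  have "tensor_relations R M N \<subseteq> a_kernel ?P Q H"
    unfolding tensor_relations_def Let_def
    by (auto simp: a_kernel_iff basis_vec_closed mi He lin_add[OF H] lin_smult[OF H]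
        addl addr sml smr cl Q.M.minus_eq_zero_iff)
  then have "tensor_submodule R M N \<subseteq> a_kernel ?P Q H"
    unfolding tensor_submodule_def by (rule submodule_span_least[OF submodule_kernel[OF P.module_axioms Q H]])
  then have ker: "H u = \<zero>\<^bsub>Q\<^esub>"
    if "u \<in> carrier ?P" "tensor_submodule R M N +>\<^bsub>?P\<^esub> u = \<zero>\<^bsub>tensor R M N\<^esub>" for u
    using that quot_coset_zero_iff[OF P.module_axioms tensor_submodule_is_submodule that(1)]
    by (auto simp: tensor_def quot_zero[OF P.module_axioms tensor_submodule_is_submodule] a_kernel_iff)
  obtain h where h: "h \<in> lin_maps R (tensor R M N) Q"
    "\<And>u. u \<in> carrier ?P \<Longrightarrow> h (tensor_submodule R M N +>\<^bsub>?P\<^esub> u) = H u"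
  proof (rule lin_factor[OF P.module_axioms tensor_module Q tensor_proj _ H ker])
    show "(\<lambda>u. tensor_submodule R M N +>\<^bsub>?P\<^esub> u) ` carrier ?P = carrier (tensor R M N)"
      unfolding tensor_def quot_carrier[OF P.module_axioms tensor_submodule_is_submodule] ..
  next
    fix k assume "k \<in> lin_maps R (tensor R M N) Q"
      "\<And>u. u \<in> carrier ?P \<Longrightarrow> k (tensor_submodule R M N +>\<^bsub>?P\<^esub> u) = H u"
    then show thesis by (rule that)
  qed
  show thesis by (rule that[OF h(1)]) (simp add: pure_tensor_def h(2) basis_vec_closed He)
qed

lemma tensor_spanned:
  assumes K: "submodule K R (tensor R M N)"
    and pure: "\<And>x y. x \<in> carrier M \<Longrightarrow> y \<in> carrier N \<Longrightarrow> pure_tensor R M N x y \<in> K"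
  shows "K = carrier (tensor R M N)"
proof
  let ?S = "carrier M \<times> carrier N" let ?P = "free_module R ?S"
  let ?\<pi> = "\<lambda>u. tensor_submodule R M N +>\<^bsub>?P\<^esub> u"
  show "K \<subseteq> carrier (tensor R M N)" by (rule submodule_mem(1)[OF K tensor_module])
  have "{u \<in> carrier ?P. ?\<pi> u \<in> K} = carrier ?P"
    by (rule submodule_basis[OF submodule_vimage[OF free_module_is_module tensor_module tensor_proj K]])
      (use pure in \<open>auto simp: pure_tensor_def basis_vec_closed\<close>)
  then have "?\<pi> ` carrier ?P \<subseteq> K" by auto
  then show "carrier (tensor R M N) \<subseteq> K"
    unfolding tensor_def quot_carrier[OF free_module_is_module tensor_submodule_is_submodule] .
qed

lemma tensor_lin_ext:
  assumes "module R Q" and "h \<in> lin_maps R (tensor R M N) Q" and "k \<in> lin_maps R (tensor R M N) Q"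
    and "\<And>x y. x \<in> carrier M \<Longrightarrow> y \<in> carrier N \<Longrightarrow> h (pure_tensor R M N x y) = k (pure_tensor R M N x y)"
    and "t \<in> carrier (tensor R M N)"
  shows "h t = k t"
proof -
  interpret Q: module R Q by fact
  have "submodule (a_kernel (tensor R M N) Q (\<lambda>t. h t \<ominus>\<^bsub>Q\<^esub> k t)) R (tensor R M N)"
    by (rule submodule_kernel[OF tensor_module assms(1) lin_diff[OF assms(1) tensor_module assms(2,3)]])
  then have "a_kernel (tensor R M N) Q (\<lambda>t. h t \<ominus>\<^bsub>Q\<^esub> k t) = carrier (tensor R M N)"
    by (rule tensor_spanned)
      (use assms(4) lin_closed[OF assms(3)] in \<open>simp add: a_kernel_iff pure_tensor_closed Q.M.minus_eq_zero_iff\<close>)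
  then have "h t \<ominus>\<^bsub>Q\<^esub> k t = \<zero>\<^bsub>Q\<^esub>" using assms(5) by (auto simp: a_kernel_iff)
  then show ?thesis using lin_closed[OF assms(2,5)] lin_closed[OF assms(3,5)] by (simp add: Q.M.minus_eq_zero_iff)
qed

end

text \<open>The description of \<open>tensor_map\<close> is legitimate: existence is the universal
  property, and uniqueness holds because pure tensors span and the members of
  \<open>hom_module\<close> are extensional.\<close>

lemma tensor_map_props:
  assumes M: "module R M" and M': "module R M'" and N: "module R N" and f: "f \<in> lin_maps R M M'"
  shows "tensor_map R M M' N f \<in> lin_maps R (tensor R M N) (tensor R M' N)"
    and "x \<in> carrier M \<Longrightarrow> y \<in> carrier N \<Longrightarrow>
      tensor_map R M M' N f (pure_tensor R M N x y) = pure_tensor R M' N (f x) y"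
proof -
  note T = tensor_module[OF M N] and T' = tensor_module[OF M' N]
  obtain h where h: "h \<in> lin_maps R (tensor R M N) (tensor R M' N)"
    "\<And>x y. x \<in> carrier M \<Longrightarrow> y \<in> carrier N \<Longrightarrow> h (pure_tensor R M N x y) = pure_tensor R M' N (f x) y"
  proof (rule tensor_lift[OF M N T', where \<beta> = "\<lambda>x y. pure_tensor R M' N (f x) y"])
    fix h assume "h \<in> lin_maps R (tensor R M N) (tensor R M' N)"
      "\<And>x y. x \<in> carrier M \<Longrightarrow> y \<in> carrier N \<Longrightarrow> h (pure_tensor R M N x y) = pure_tensor R M' N (f x) y"
    then show thesis by (rule that)
  qed (simp_all add: pure_tensor_closed[OF M' N] lin_add[OF f] lin_smult[OF f]
      pure_tensor_bilinear[OF M' N] lin_closed[OF f])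
  let ?D = "\<lambda>h. h \<in> carrier (hom_module R (tensor R M N) (tensor R M' N)) \<and>
        (\<forall>x\<in>carrier M. \<forall>y\<in>carrier N. h (pure_tensor R M N x y) = pure_tensor R M' N (f x) y)"
  have ex: "?D (\<lambda>t\<in>carrier (tensor R M N). h t)"
    using lin_restrict[OF T h(1)] h(2) by (simp add: pure_tensor_closed[OF M N])
  have "?D (tensor_map R M M' N f)"
    unfolding tensor_map_def
  proof (rule theI[of ?D, OF ex])
    fix k assume k: "?D k"
    show "k = (\<lambda>t\<in>carrier (tensor R M N). h t)"
    proof (rule extensionalityI[of _ "carrier (tensor R M N)"])
      show "k \<in> extensional (carrier (tensor R M N))" using k by simp
      fix t assume t: "t \<in> carrier (tensor R M N)"
      have "k t = h t" by (rule tensor_lin_ext[OF M N T' _ h(1) _ t]) (use k h(2) in auto)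
      then show "k t = (\<lambda>t\<in>carrier (tensor R M N). h t) t" using t by simp
    qed simp
  qed
  then show "tensor_map R M M' N f \<in> lin_maps R (tensor R M N) (tensor R M' N)"
    "x \<in> carrier M \<Longrightarrow> y \<in> carrier N \<Longrightarrow>
      tensor_map R M M' N f (pure_tensor R M N x y) = pure_tensor R M' N (f x) y" by simp_all
qed

section \<open>Coordinates on the tensor product of a finite free module with a module\<close>

definition free_tensor :: "nat \<Rightarrow> ('a, 'd, 'n) module_scheme \<Rightarrow> (nat \<Rightarrow> 'd) \<Rightarrow> ((nat \<Rightarrow> 'a) \<times> 'd \<Rightarrow> 'a) set" where
  "free_tensor r N y = (\<Oplus>\<^bsub>tensor R (free_rank R r) N\<^esub>j\<in>{..<r}. pure_tensor R (free_rank R r) N (basis_vec R {..<r} j) (y j))"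

lemma pure_tensor_lin_left:
  assumes "module R M" and "module R N" and "y \<in> carrier N"
  shows "(\<lambda>x. pure_tensor R M N x y) \<in> lin_maps R M (tensor R M N)"
  by (rule lin_mapsI) (simp_all add: assms pure_tensor_closed pure_tensor_bilinear)

lemma pure_tensor_lin_right:
  assumes "module R M" and "module R N" and "x \<in> carrier M"
  shows "(\<lambda>y. pure_tensor R M N x y) \<in> lin_maps R N (tensor R M N)"
  by (rule lin_mapsI) (simp_all add: assms pure_tensor_closed pure_tensor_bilinear)

context
  fixes N :: "('a, 'd, 'n) module_scheme"
  assumes N: "module R N"
begin

interpretation N: module R N by (rule N)

text \<open>The coordinate functions of R^r tensored with \<open>N\<close>. They recover the tuple
  \<open>y\<close> from \<open>free_tensor r N y\<close>, so that R^r tensored with \<open>N\<close>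
  becomes r copies of \<open>N\<close>.\<close>

lemma free_tensor_coords:
  obtains \<Psi> where "\<And>i. i < r \<Longrightarrow> \<Psi> i \<in> lin_maps R (tensor R (free_rank R r) N) N"
    and "\<And>i x y. i < r \<Longrightarrow> x \<in> carrier (free_rank R r) \<Longrightarrow> y \<in> carrier N \<Longrightarrow>
      \<Psi> i (pure_tensor R (free_rank R r) N x y) = x i \<odot>\<^bsub>N\<^esub> y"
proof -
  have "\<exists>h. h \<in> lin_maps R (tensor R (free_rank R r) N) N \<and>
      (\<forall>x\<in>carrier (free_rank R r). \<forall>y\<in>carrier N. h (pure_tensor R (free_rank R r) N x y) = x i \<odot>\<^bsub>N\<^esub> y)"
    if i: "i < r" for i
  proof -
    have co: "x i \<in> carrier R" if "x \<in> carrier (free_rank R r)" for x using free_module_coord[OF that] i by simp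
    obtain h where "h \<in> lin_maps R (tensor R (free_rank R r) N) N"
      "\<And>x y. x \<in> carrier (free_rank R r) \<Longrightarrow> y \<in> carrier N \<Longrightarrow> h (pure_tensor R (free_rank R r) N x y) = x i \<odot>\<^bsub>N\<^esub> y"
    proof (rule tensor_lift[OF free_module_is_module N N, where \<beta> = "\<lambda>x y. x i \<odot>\<^bsub>N\<^esub> y"])
      fix h assume "h \<in> lin_maps R (tensor R (free_rank R r) N) N"
        "\<And>x y. x \<in> carrier (free_rank R r) \<Longrightarrow> y \<in> carrier N \<Longrightarrow> h (pure_tensor R (free_rank R r) N x y) = x i \<odot>\<^bsub>N\<^esub> y"
      then show thesis by (rule that)
    qed (use i in \<open>simp_all add: co N.smult_l_distr N.smult_r_distr N.smult_assoc1[symmetric] m_comm\<close>)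
    then show ?thesis by blast
  qed
  then have "\<forall>i. \<exists>h. i < r \<longrightarrow> h \<in> lin_maps R (tensor R (free_rank R r) N) N \<and>
      (\<forall>x\<in>carrier (free_rank R r). \<forall>y\<in>carrier N. h (pure_tensor R (free_rank R r) N x y) = x i \<odot>\<^bsub>N\<^esub> y)"
    by blast
  from choice[OF this] obtain \<Psi> where "\<forall>i. i < r \<longrightarrow> \<Psi> i \<in> lin_maps R (tensor R (free_rank R r) N) N \<and>
      (\<forall>x\<in>carrier (free_rank R r). \<forall>y\<in>carrier N. \<Psi> i (pure_tensor R (free_rank R r) N x y) = x i \<odot>\<^bsub>N\<^esub> y)"
    by (rule exE)
  then show thesis by (intro that[of \<Psi>]) simp_all
qed

lemma free_tensor_closed:
  assumes "\<And>j. j < r \<Longrightarrow> y j \<in> carrier N"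
  shows "free_tensor r N y \<in> carrier (tensor R (free_rank R r) N)"
proof -
  interpret T: module R "tensor R (free_rank R r) N" by (rule tensor_module[OF free_module_is_module N])
  show ?thesis unfolding free_tensor_def
    by (rule T.M.finsum_closed) (simp add: pure_tensor_closed[OF free_module_is_module N])
qed

lemma free_tensor_surj:
  assumes t: "t \<in> carrier (tensor R (free_rank R r) N)"
  obtains y where "\<And>j. j < r \<Longrightarrow> y j \<in> carrier N" and "t = free_tensor r N y"
proof -
  let ?F = "free_rank R r" let ?T = "tensor R ?F N" let ?e = "basis_vec R {..<r}"
  note F = free_module_is_module[of "{..<r}"]
  interpret T: module R ?T by (rule tensor_module[OF F N])
  note pc = pure_tensor_closed[OF F N]
  note bil = pure_tensor_bilinear[OF F N basis_vec_closed]
  let ?K = "{free_tensor r N y | y. \<forall>j<r. y j \<in> carrier N}"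
  have "submodule ?K R ?T"
  proof (rule submoduleI'[OF T.module_axioms])
    show "?K \<subseteq> carrier ?T" using free_tensor_closed by auto
    have z: "pure_tensor R ?F N (?e j) \<zero>\<^bsub>N\<^esub> = \<zero>\<^bsub>?T\<^esub>" for j
      using lin_zero[OF N T.module_axioms pure_tensor_lin_right[OF F N basis_vec_closed]] .
    have "free_tensor r N (\<lambda>_. \<zero>\<^bsub>N\<^esub>) = \<zero>\<^bsub>?T\<^esub>" unfolding free_tensor_def z by simp
    then show "\<zero>\<^bsub>?T\<^esub> \<in> ?K" by (intro CollectI exI[of _ "\<lambda>_. \<zero>\<^bsub>N\<^esub>"]) simp
    fix s t assume "s \<in> ?K" "t \<in> ?K"
    then obtain y y' where y: "s = free_tensor r N y" "\<forall>j<r. y j \<in> carrier N"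
      and y': "t = free_tensor r N y'" "\<forall>j<r. y' j \<in> carrier N" by blast
    have "free_tensor r N (\<lambda>j. y j \<oplus>\<^bsub>N\<^esub> y' j) =
        (\<Oplus>\<^bsub>?T\<^esub>j\<in>{..<r}. pure_tensor R ?F N (?e j) (y j) \<oplus>\<^bsub>?T\<^esub> pure_tensor R ?F N (?e j) (y' j))"
      unfolding free_tensor_def using y(2) y'(2) pc by (intro T.M.finsum_cong') (auto simp: bil(2))
    also have "\<dots> = s \<oplus>\<^bsub>?T\<^esub> t" unfolding y y' free_tensor_def using pc by (intro T.M.finsum_addf) auto
    finally show "s \<oplus>\<^bsub>?T\<^esub> t \<in> ?K" using y(2) y'(2)
      by (intro CollectI exI[of _ "\<lambda>j. y j \<oplus>\<^bsub>N\<^esub> y' j"]) simp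
  next
    fix a s assume a: "a \<in> carrier R" and "s \<in> ?K"
    then obtain y where y: "s = free_tensor r N y" "\<forall>j<r. y j \<in> carrier N" by blast
    have "free_tensor r N (\<lambda>j. a \<odot>\<^bsub>N\<^esub> y j) = (\<Oplus>\<^bsub>?T\<^esub>j\<in>{..<r}. a \<odot>\<^bsub>?T\<^esub> pure_tensor R ?F N (?e j) (y j))"
      unfolding free_tensor_def using y(2) a pc by (intro T.M.finsum_cong') (auto simp: bil(4))
    also have "\<dots> = a \<odot>\<^bsub>?T\<^esub> s" unfolding y free_tensor_def using a pc
      by (intro T.finsum_smult_ldistr[symmetric]) auto
    finally show "a \<odot>\<^bsub>?T\<^esub> s \<in> ?K" using y(2) a by (intro CollectI exI[of _ "\<lambda>j. a \<odot>\<^bsub>N\<^esub> y j"]) simp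
  qed
  then have "?K = carrier ?T"
  proof (rule tensor_spanned[OF F N])
    fix x n assume x: "x \<in> carrier ?F" and n: "n \<in> carrier N"
    have co: "x j \<in> carrier R" if "j < r" for j using free_module_coord[OF x] that by simp
    have "pure_tensor R ?F N x n = (\<Oplus>\<^bsub>?T\<^esub>j\<in>{..<r}. x j \<odot>\<^bsub>?T\<^esub> pure_tensor R ?F N (?e j) n)"
      by (rule lin_expand[OF T.module_axioms pure_tensor_lin_left[OF F N n] x]) simp
    also have "\<dots> = free_tensor r N (\<lambda>j. x j \<odot>\<^bsub>N\<^esub> n)"
      unfolding free_tensor_def using co n pc by (intro T.M.finsum_cong') (auto simp: bil(4))
    finally show "pure_tensor R ?F N x n \<in> ?K" using co n
      by (intro CollectI exI[of _ "\<lambda>j. x j \<odot>\<^bsub>N\<^esub> n"]) simp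
  qed
  then obtain y where "t = free_tensor r N y" "\<forall>j<r. y j \<in> carrier N" using t by blast
  then show thesis using that by blast
qed

lemma free_tensor_eq_iff:
  assumes "\<And>j. j < r \<Longrightarrow> y j \<in> carrier N" and "\<And>j. j < r \<Longrightarrow> y' j \<in> carrier N"
  shows "free_tensor r N y = free_tensor r N y' \<longleftrightarrow> (\<forall>j<r. y j = y' j)"
proof
  let ?F = "free_rank R r" let ?T = "tensor R ?F N" let ?e = "basis_vec R {..<r}"
  note F = free_module_is_module[of "{..<r}"]
  note T = tensor_module[OF F N]
  interpret T: module R ?T by (rule T)
  obtain \<Psi> where \<Psi>: "\<And>i. i < r \<Longrightarrow> \<Psi> i \<in> lin_maps R ?T N"
    "\<And>i x y. i < r \<Longrightarrow> x \<in> carrier ?F \<Longrightarrow> y \<in> carrier N \<Longrightarrow> \<Psi> i (pure_tensor R ?F N x y) = x i \<odot>\<^bsub>N\<^esub> y"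
    by (rule free_tensor_coords[of r]) (rule that)
  have val: "\<Psi> i (free_tensor r N y) = y i" if i: "i < r" and y: "\<And>j. j < r \<Longrightarrow> y j \<in> carrier N" for i y
  proof -
    have "\<Psi> i (free_tensor r N y) = (\<Oplus>\<^bsub>N\<^esub>j\<in>{..<r}. \<Psi> i (pure_tensor R ?F N (?e j) (y j)))"
      unfolding free_tensor_def
      by (rule lin_finsum[OF T N \<Psi>(1)[OF i]]) (simp add: pure_tensor_closed[OF F N])
    also have "\<dots> = (\<Oplus>\<^bsub>N\<^esub>j\<in>{..<r}. if i = j then y j else \<zero>\<^bsub>N\<^esub>)"
    proof (rule N.M.finsum_cong'[OF refl])
      show "(\<lambda>j. if i = j then y j else \<zero>\<^bsub>N\<^esub>) \<in> {..<r} \<rightarrow> carrier N" using y by auto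
      fix j assume "j \<in> {..<r}"
      then show "\<Psi> i (pure_tensor R ?F N (?e j) (y j)) = (if i = j then y j else \<zero>\<^bsub>N\<^esub>)"
        using \<Psi>(2)[OF i basis_vec_closed y] y i by (simp add: basis_vec_def)
    qed
    also have "\<dots> = y i" using i y by (subst N.M.finsum_singleton) auto
    finally show ?thesis .
  qed
  show "\<forall>j<r. y j = y' j" if "free_tensor r N y = free_tensor r N y'"
    using that val assms by metis
  show "free_tensor r N y = free_tensor r N y'" if "\<forall>j<r. y j = y' j"
    unfolding free_tensor_def using that pure_tensor_closed[OF F N] by (intro T.M.finsum_cong') auto
qed

text \<open>In coordinates the induced map is the matrix of \<open>f\<close> acting on tuples of
  elements of \<open>N\<close>. This removes tensor products from the computation of Tor.\<close>

lemma tensor_map_free: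
  assumes f: "f \<in> lin_maps R (free_rank R r) (free_rank R q)" and y: "\<And>j. j < r \<Longrightarrow> y j \<in> carrier N"
  shows "tensor_map R (free_rank R r) (free_rank R q) N f (free_tensor r N y) =
    free_tensor q N (\<lambda>i. \<Oplus>\<^bsub>N\<^esub>j\<in>{..<r}. f (basis_vec R {..<r} j) i \<odot>\<^bsub>N\<^esub> y j)"
proof -
  let ?F = "free_rank R r" and ?G = "free_rank R q"
  let ?T = "tensor R ?F N" and ?T' = "tensor R ?G N" and ?e = "basis_vec R {..<r}" and ?e' = "basis_vec R {..<q}"
  let ?tm = "tensor_map R ?F ?G N f"
  note F = free_module_is_module
  note T = tensor_module[OF F N]
  interpret T': module R ?T' by (rule T)
  note pc = pure_tensor_closed[OF F N]
  have fe: "f (?e j) \<in> carrier ?G" for j by (rule lin_closed[OF f basis_vec_closed])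
  have co: "f (?e j) i \<in> carrier R" if "i < q" for i j using free_module_coord[OF fe] that by simp
  have "?tm (free_tensor r N y) = (\<Oplus>\<^bsub>?T'\<^esub>j\<in>{..<r}. ?tm (pure_tensor R ?F N (?e j) (y j)))"
    unfolding free_tensor_def by (rule lin_finsum[OF T T tensor_map_props(1)[OF F F N f]]) (simp add: pc)
  also have "\<dots> = (\<Oplus>\<^bsub>?T'\<^esub>j\<in>{..<r}. \<Oplus>\<^bsub>?T'\<^esub>i\<in>{..<q}. pure_tensor R ?G N (?e' i) (f (?e j) i \<odot>\<^bsub>N\<^esub> y j))"
  proof (rule T'.M.finsum_cong'[OF refl])
    show "(\<lambda>j. \<Oplus>\<^bsub>?T'\<^esub>i\<in>{..<q}. pure_tensor R ?G N (?e' i) (f (?e j) i \<odot>\<^bsub>N\<^esub> y j)) \<in> {..<r} \<rightarrow> carrier ?T'"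
      by (auto intro!: T'.M.finsum_closed simp: pc)
    fix j assume j: "j \<in> {..<r}"
    have "?tm (pure_tensor R ?F N (?e j) (y j)) = pure_tensor R ?G N (f (?e j)) (y j)"
      using tensor_map_props(2)[OF F F N f basis_vec_closed] y j by simp
    also have "\<dots> = (\<Oplus>\<^bsub>?T'\<^esub>i\<in>{..<q}. f (?e j) i \<odot>\<^bsub>?T'\<^esub> pure_tensor R ?G N (?e' i) (y j))"
      using lin_expand[OF T pure_tensor_lin_left[OF F N] fe] y j by simp
    also have "\<dots> = (\<Oplus>\<^bsub>?T'\<^esub>i\<in>{..<q}. pure_tensor R ?G N (?e' i) (f (?e j) i \<odot>\<^bsub>N\<^esub> y j))"
      using y j co by (intro T'.M.finsum_cong') (auto simp: pc pure_tensor_bilinear(4)[OF F N basis_vec_closed])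
    finally show "?tm (pure_tensor R ?F N (?e j) (y j)) =
      (\<Oplus>\<^bsub>?T'\<^esub>i\<in>{..<q}. pure_tensor R ?G N (?e' i) (f (?e j) i \<odot>\<^bsub>N\<^esub> y j))" .
  qed
  also have "\<dots> = (\<Oplus>\<^bsub>?T'\<^esub>i\<in>{..<q}. \<Oplus>\<^bsub>?T'\<^esub>j\<in>{..<r}. pure_tensor R ?G N (?e' i) (f (?e j) i \<odot>\<^bsub>N\<^esub> y j))"
    by (rule T'.M.finsum_swap[OF finite_lessThan]) (rule pc)
  also have "\<dots> = free_tensor q N (\<lambda>i. \<Oplus>\<^bsub>N\<^esub>j\<in>{..<r}. f (?e j) i \<odot>\<^bsub>N\<^esub> y j)"
    unfolding free_tensor_def using y co
    by (intro T'.M.finsum_cong'[OF refl])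
      (auto simp: pc intro!: lin_finsum[OF N T pure_tensor_lin_right[OF F N basis_vec_closed], symmetric])
  finally show ?thesis .
qed

end

end

section \<open>Resolutions, and the first Tor and Ext in concrete terms\<close>

lemma free_resolutionD:
  assumes "free_resolution R M r d"
  shows "d i \<in> lin_maps R (free_rank R (r (Suc i))) (free_rank R (r i))"
    and "d (Suc i) ` carrier (free_rank R (r (Suc (Suc i)))) = a_kernel (free_rank R (r (Suc i))) (free_rank R (r i)) (d i)"
    and "\<exists>e. e \<in> lin_maps R (free_rank R (r 0)) M \<and> e ` carrier (free_rank R (r 0)) = carrier M \<and>
      d 0 ` carrier (free_rank R (r 1)) = a_kernel (free_rank R (r 0)) M e"
proof -
  note c = assms[unfolded free_resolution_def]
  show "d i \<in> lin_maps R (free_rank R (r (Suc i))) (free_rank R (r i))"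
    using c[THEN conjunct1] by (rule spec)
  show "d (Suc i) ` carrier (free_rank R (r (Suc (Suc i)))) = a_kernel (free_rank R (r (Suc i))) (free_rank R (r i)) (d i)"
    using c[THEN conjunct2, THEN conjunct1] by (rule spec)
  show "\<exists>e. e \<in> lin_maps R (free_rank R (r 0)) M \<and> e ` carrier (free_rank R (r 0)) = carrier M \<and>
      d 0 ` carrier (free_rank R (r 1)) = a_kernel (free_rank R (r 0)) M e"
    using c[THEN conjunct2, THEN conjunct2] by (simp only: Bex_def)
qed

lemma (in comm_noetherian_ring) free_resolution_exists:
  assumes M: "module R M" and fg: "fin_gen R M"
  shows "\<exists>r d. free_resolution R M r d"
proof -
  note F = free_module_is_module
  obtain n e where e: "e \<in> lin_maps R (free_rank R n) M" "e ` carrier (free_rank R n) = carrier M"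
    by (rule fin_gen_surj[OF M fg])
  have next_map: "\<exists>m f. f \<in> lin_maps R (free_rank R m) (free_rank R k) \<and> f ` carrier (free_rank R m) = K"
    if "submodule K R (free_rank R k)" for k K
    by (rule free_submodule_surj[OF _ that]) auto
  \<comment> \<open>A triple holds the rank of the target, the rank of the source and a map between
    them; dependent choice attaches to each map another one onto its kernel.\<close>
  define P :: "nat \<Rightarrow> nat \<times> nat \<times> ((nat \<Rightarrow> 'a) \<Rightarrow> (nat \<Rightarrow> 'a)) \<Rightarrow> bool" where
    "P i t = (case t of (a, b, f) \<Rightarrow> f \<in> lin_maps R (free_rank R b) (free_rank R a) \<and>
      (i = 0 \<longrightarrow> a = n \<and> f ` carrier (free_rank R b) = a_kernel (free_rank R n) M e))" for i t
  define Q :: "nat \<Rightarrow> nat \<times> nat \<times> ((nat \<Rightarrow> 'a) \<Rightarrow> (nat \<Rightarrow> 'a)) \<Rightarrow> nat \<times> nat \<times> ((nat \<Rightarrow> 'a) \<Rightarrow> (nat \<Rightarrow> 'a)) \<Rightarrow> bool" where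
    "Q i t t' = (case t of (a, b, f) \<Rightarrow> case t' of (a', b', f') \<Rightarrow>
      a' = b \<and> f' ` carrier (free_rank R b') = a_kernel (free_rank R b) (free_rank R a) f)" for i t t'
  have "\<exists>s. \<forall>i. P i (s i) \<and> Q i (s i) (s (Suc i))"
  proof (rule dependent_nat_choice)
    obtain m f where "f \<in> lin_maps R (free_rank R m) (free_rank R n)"
      "f ` carrier (free_rank R m) = a_kernel (free_rank R n) M e"
      using next_map[OF submodule_kernel[OF F M e(1)]] by blast
    then have "P 0 (n, m, f)" by (simp add: P_def)
    then show "\<exists>t. P 0 t" ..
  next
    fix t i assume "P i t"
    then obtain a b f where t: "t = (a, b, f)" "f \<in> lin_maps R (free_rank R b) (free_rank R a)"
      unfolding P_def by (cases t) auto
    obtain m g where "g \<in> lin_maps R (free_rank R m) (free_rank R b)"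
      "g ` carrier (free_rank R m) = a_kernel (free_rank R b) (free_rank R a) f"
      using next_map[OF submodule_kernel[OF F F t(2)]] by blast
    then have "P (Suc i) (b, m, g) \<and> Q i t (b, m, g)" by (simp add: P_def Q_def t)
    then show "\<exists>t'. P (Suc i) t' \<and> Q i t t'" ..
  qed
  then obtain s where s: "\<And>i. P i (s i)" "\<And>i. Q i (s i) (s (Suc i))" by blast
  define r where "r i = fst (s i)" for i
  define d where "d i = snd (snd (s i))" for i
  have r1: "fst (snd (s i)) = r (Suc i)" for i
    using s(2)[of i] by (simp add: Q_def r_def split: prod.splits)
  have s_eq: "s i = (r i, r (Suc i), d i)" for i
    unfolding r1[symmetric] by (simp add: r_def d_def)
  have "free_resolution R M r d"
    unfolding free_resolution_def
  proof (intro conjI allI)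
    fix i
    show "d i \<in> lin_maps R (free_rank R (r (Suc i))) (free_rank R (r i))"
      using s(1)[of i] unfolding s_eq by (simp add: P_def)
    show "d (Suc i) ` carrier (free_rank R (r (Suc (Suc i)))) = a_kernel (free_rank R (r (Suc i))) (free_rank R (r i)) (d i)"
      using s(2)[of i] unfolding s_eq by (simp add: Q_def)
  next
    show "\<exists>e\<in>lin_maps R (free_rank R (r 0)) M. e ` carrier (free_rank R (r 0)) = carrier M \<and>
        d 0 ` carrier (free_rank R (r 1)) = a_kernel (free_rank R (r 0)) M e"
      using s(1)[of 0] e unfolding s_eq by (intro bexI[of _ e]) (simp_all add: P_def)
  qed
  then show ?thesis by blast
qed

lemma (in comm_noetherian_ring) some_resolution_free:
  assumes "module R M" and "fin_gen R M" and "some_resolution R M = (r, d)"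
  shows "free_resolution R M r d"
proof -
  have "\<exists>t. (\<lambda>(r, d). free_resolution R M r d) t" using free_resolution_exists[OF assms(1,2)] by auto
  from someI_ex[OF this] show ?thesis using assms(3) unfolding some_resolution_def by simp
qed

text \<open>Through \<open>free_tensor\<close> the tensored resolution turns into tuples over
  \<open>N\<close> with the matrices of \<open>d 0\<close> and \<open>d 1\<close> acting on them.
  The later arguments about Tor deal with such tuples only.\<close>

lemma (in cring) zero_Tor_iff:
  assumes res: "some_resolution R M = (r, d)" "free_resolution R M r d" and N: "module R N"
  shows "zero_module (Tor R 1 M N) \<longleftrightarrow>
    (\<forall>y. (\<forall>j<r 1. y j \<in> carrier N) \<and>
         (\<forall>i<r 0. (\<Oplus>\<^bsub>N\<^esub>j\<in>{..<r 1}. d 0 (basis_vec R {..<r 1} j) i \<odot>\<^bsub>N\<^esub> y j) = \<zero>\<^bsub>N\<^esub>) \<longrightarrow>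
      (\<exists>z. (\<forall>l<r 2. z l \<in> carrier N) \<and>
         (\<forall>j<r 1. y j = (\<Oplus>\<^bsub>N\<^esub>l\<in>{..<r 2}. d 1 (basis_vec R {..<r 2} l) j \<odot>\<^bsub>N\<^esub> z l))))"
proof -
  interpret N: module R N by (rule N)
  note F = free_module_is_module
  note d = free_resolutionD(1)[OF res(2)]
  have d0: "d 0 \<in> lin_maps R (free_rank R (r 1)) (free_rank R (r 0))" using d[of 0] by simp
  have d1: "d 1 \<in> lin_maps R (free_rank R (r 2)) (free_rank R (r 1))" using d[of 1] by (simp add: numeral_2_eq_2)
  let ?C = "\<lambda>j. tensor R (free_rank R (r j)) N"
  let ?D0 = "tensor_map R (free_rank R (r 1)) (free_rank R (r 0)) N (d 0)"
  let ?D1 = "tensor_map R (free_rank R (r 2)) (free_rank R (r 1)) N (d 1)"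
  let ?Z = "a_kernel (?C 1) (?C 0) ?D0" and ?B = "?D1 ` carrier (?C 2)"
  let ?t0 = "\<lambda>y i. \<Oplus>\<^bsub>N\<^esub>j\<in>{..<r 1}. d 0 (basis_vec R {..<r 1} j) i \<odot>\<^bsub>N\<^esub> y j"
  let ?t1 = "\<lambda>z j. \<Oplus>\<^bsub>N\<^esub>l\<in>{..<r 2}. d 1 (basis_vec R {..<r 2} l) j \<odot>\<^bsub>N\<^esub> z l"
  have C: "module R (?C j)" for j by (rule tensor_module[OF F N])
  note D0 = tensor_map_props(1)[OF F F N d0] and D1 = tensor_map_props(1)[OF F F N d1]
  have Z: "submodule ?Z R (?C 1)" by (rule submodule_kernel[OF C C D0])
  have B: "submodule ?B R (?C 1)" by (rule submodule_image[OF C C D1 submodule_carrier[OF C]])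
  have t0: "?t0 y i \<in> carrier N" if "\<forall>j<r 1. y j \<in> carrier N" "i < r 0" for y i
    using that free_module_coord[OF lin_closed[OF d0 basis_vec_closed]] by (intro N.M.finsum_closed) auto
  have t1: "?t1 z j \<in> carrier N" if "\<forall>l<r 2. z l \<in> carrier N" "j < r 1" for z j
    using that free_module_coord[OF lin_closed[OF d1 basis_vec_closed]] by (intro N.M.finsum_closed) auto
  have zero: "free_tensor (r 0) N (\<lambda>_. \<zero>\<^bsub>N\<^esub>) = \<zero>\<^bsub>?C 0\<^esub>"
  proof -
    interpret C0: module R "?C 0" by (rule C)
    have "pure_tensor R (free_rank R (r 0)) N (basis_vec R {..<r 0} j) \<zero>\<^bsub>N\<^esub> = \<zero>\<^bsub>?C 0\<^esub>" for j
      using lin_zero[OF N C pure_tensor_lin_right[OF F N basis_vec_closed]] .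
    then show ?thesis unfolding free_tensor_def by simp
  qed
  have inZ: "free_tensor (r 1) N y \<in> ?Z \<longleftrightarrow> (\<forall>i<r 0. ?t0 y i = \<zero>\<^bsub>N\<^esub>)"
    if y: "\<forall>j<r 1. y j \<in> carrier N" for y
  proof -
    have tm: "?D0 (free_tensor (r 1) N y) = free_tensor (r 0) N (?t0 y)"
      by (rule tensor_map_free[OF N d0]) (simp add: y)
    have "free_tensor (r 1) N y \<in> carrier (?C 1)" by (rule free_tensor_closed[OF N]) (simp add: y)
    then have "free_tensor (r 1) N y \<in> ?Z \<longleftrightarrow> free_tensor (r 0) N (?t0 y) = free_tensor (r 0) N (\<lambda>_. \<zero>\<^bsub>N\<^esub>)"
      unfolding tm[symmetric] zero by (simp only: a_kernel_iff simp_thms)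
    also have "\<dots> \<longleftrightarrow> (\<forall>i<r 0. ?t0 y i = \<zero>\<^bsub>N\<^esub>)"
      by (rule free_tensor_eq_iff[OF N]) (rule t0[OF y], assumption, rule N.M.zero_closed)
    finally show ?thesis .
  qed
  have inB: "free_tensor (r 1) N y \<in> ?B \<longleftrightarrow> (\<exists>z. (\<forall>l<r 2. z l \<in> carrier N) \<and> (\<forall>j<r 1. y j = ?t1 z j))"
    if y: "\<forall>j<r 1. y j \<in> carrier N" for y
  proof -
    have tm: "?D1 (free_tensor (r 2) N z) = free_tensor (r 1) N (?t1 z)" if "\<forall>l<r 2. z l \<in> carrier N" for z
      by (rule tensor_map_free[OF N d1]) (simp add: that)
    have eq: "free_tensor (r 1) N y = free_tensor (r 1) N (?t1 z) \<longleftrightarrow> (\<forall>j<r 1. y j = ?t1 z j)"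
      if z: "\<forall>l<r 2. z l \<in> carrier N" for z
      by (rule free_tensor_eq_iff[OF N]) (use y in blast, rule t1[OF z], assumption)
    show ?thesis
    proof
      assume "free_tensor (r 1) N y \<in> ?B"
      then obtain t where t: "t \<in> carrier (?C 2)" "free_tensor (r 1) N y = ?D1 t" by (elim imageE)
      obtain z where z: "\<And>l. l < r 2 \<Longrightarrow> z l \<in> carrier N" "t = free_tensor (r 2) N z"
        by (rule free_tensor_surj[OF N t(1)]) (rule that)
      have z': "\<forall>l<r 2. z l \<in> carrier N" using z(1) by blast
      have "\<forall>j<r 1. y j = ?t1 z j" using t(2) unfolding z(2) tm[OF z'] eq[OF z'] .
      then show "\<exists>z. (\<forall>l<r 2. z l \<in> carrier N) \<and> (\<forall>j<r 1. y j = ?t1 z j)"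
        using z' by (intro exI[of _ z] conjI)
    next
      assume "\<exists>z. (\<forall>l<r 2. z l \<in> carrier N) \<and> (\<forall>j<r 1. y j = ?t1 z j)"
      then obtain z where z: "\<forall>l<r 2. z l \<in> carrier N" "\<forall>j<r 1. y j = ?t1 z j" by (elim exE conjE)
      have "free_tensor (r 1) N y = ?D1 (free_tensor (r 2) N z)" unfolding tm[OF z(1)] eq[OF z(1)] by (rule z(2))
      moreover have "free_tensor (r 2) N z \<in> carrier (?C 2)"
        by (rule free_tensor_closed[OF N]) (simp add: z(1))
      ultimately show "free_tensor (r 1) N y \<in> ?B" by (rule image_eqI)
    qed
  qed
  have BZ: "?B \<subseteq> ?Z"
  proof
    fix b assume "b \<in> ?B"
    then obtain t where t: "t \<in> carrier (?C 2)" "b = ?D1 t" by blast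
    have dd: "d 0 (d 1 x) = \<zero>\<^bsub>free_rank R (r 0)\<^esub>" if "x \<in> carrier (free_rank R (r 2))" for x
    proof -
      have "d 1 x \<in> d (Suc 0) ` carrier (free_rank R (r (Suc (Suc 0))))"
        using that by (simp add: numeral_2_eq_2)
      then show ?thesis unfolding free_resolutionD(2)[OF res(2)] by (simp add: a_kernel_iff)
    qed
    have "?D0 (?D1 t) = (\<lambda>_. \<zero>\<^bsub>?C 0\<^esub>) t"
    proof (rule tensor_lin_ext[OF F N C lin_comp[OF D1 D0] lin_const_zero[OF C C] _ t(1)])
      fix x y assume x: "x \<in> carrier (free_rank R (r 2))" and y: "y \<in> carrier N"
      show "?D0 (?D1 (pure_tensor R (free_rank R (r 2)) N x y)) = \<zero>\<^bsub>?C 0\<^esub>"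
        using tensor_map_props(2)[OF F F N d1 x y] tensor_map_props(2)[OF F F N d0 lin_closed[OF d1 x] y]
          dd[OF x] lin_zero[OF F C pure_tensor_lin_left[OF F N y]] by simp
    qed
    then show "b \<in> ?Z" using lin_closed[OF D1 t(1)] t(2) by (simp add: a_kernel_iff)
  qed
  have "Tor R 1 M N = quot_module R ((?C 1)\<lparr>carrier := ?Z\<rparr>) ?B"
    by (simp add: Tor_def res(1) numeral_2_eq_2 Let_def)
  then have "zero_module (Tor R 1 M N) \<longleftrightarrow> ?Z \<subseteq> ?B" using zero_subquot_iff[OF C Z B BZ] by simp
  also have "\<dots> \<longleftrightarrow> (\<forall>y. (\<forall>j<r 1. y j \<in> carrier N) \<and> (\<forall>i<r 0. ?t0 y i = \<zero>\<^bsub>N\<^esub>) \<longrightarrow>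
      (\<exists>z. (\<forall>l<r 2. z l \<in> carrier N) \<and> (\<forall>j<r 1. y j = ?t1 z j)))" (is "_ \<longleftrightarrow> ?rhs")
  proof
    assume ZB: "?Z \<subseteq> ?B"
    show ?rhs
    proof (intro allI impI, elim conjE)
      fix y assume y: "\<forall>j<r 1. y j \<in> carrier N" and y0: "\<forall>i<r 0. ?t0 y i = \<zero>\<^bsub>N\<^esub>"
      have "free_tensor (r 1) N y \<in> ?Z" unfolding inZ[OF y] by (rule y0)
      from subsetD[OF ZB this]
      show "\<exists>z. (\<forall>l<r 2. z l \<in> carrier N) \<and> (\<forall>j<r 1. y j = ?t1 z j)" unfolding inB[OF y] .
    qed
  next
    assume rhs: ?rhs
    show "?Z \<subseteq> ?B"
    proof
      fix t assume t: "t \<in> ?Z"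
      then have "t \<in> carrier (?C 1)" by (simp add: a_kernel_iff)
      from free_tensor_surj[OF N this] obtain y where
        y: "\<And>j. j < r 1 \<Longrightarrow> y j \<in> carrier N" "t = free_tensor (r 1) N y" by metis
      have y': "\<forall>j<r 1. y j \<in> carrier N" using y(1) by blast
      have "\<forall>i<r 0. ?t0 y i = \<zero>\<^bsub>N\<^esub>" using t unfolding y(2) inZ[OF y'] .
      then have "\<exists>z. (\<forall>l<r 2. z l \<in> carrier N) \<and> (\<forall>j<r 1. y j = ?t1 z j)"
        by (intro rhs[rule_format, of y] conjI) (use y' in auto)
      then show "t \<in> ?B" unfolding y(2) inB[OF y'] .
    qed
  qed
  finally show ?thesis .
qed

text \<open>A cocycle is a map on \<open>free_rank R (r 1)\<close> that vanishes on the kernel of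
  \<open>d 0\<close>, hence a map on the image of \<open>d 0\<close>, the syzygy of
  \<open>M\<close>. It is a coboundary if that map extends to the free cover.\<close>

lemma (in cring) zero_Ext_iff:
  assumes M: "module R M" and res: "some_resolution R M = (r, d)" "free_resolution R M r d" and Y: "module R Y"
    and e: "e \<in> lin_maps R (free_rank R (r 0)) M"
    and ker: "d 0 ` carrier (free_rank R (r 1)) = a_kernel (free_rank R (r 0)) M e"
  shows "zero_module (Ext R 1 M Y) \<longleftrightarrow>
    (\<forall>\<psi>\<in>lin_maps R ((free_rank R (r 0))\<lparr>carrier := a_kernel (free_rank R (r 0)) M e\<rparr>) Y.
      \<exists>\<theta>\<in>lin_maps R (free_rank R (r 0)) Y. \<forall>x\<in>a_kernel (free_rank R (r 0)) M e. \<theta> x = \<psi> x)"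
proof -
  interpret Y: module R Y by (rule Y)
  note F = free_module_is_module
  note d = free_resolutionD(1)[OF res(2)]
  let ?F0 = "free_rank R (r 0)" and ?F1 = "free_rank R (r 1)" and ?F2 = "free_rank R (r 2)"
  let ?U = "a_kernel ?F0 M e" let ?UM = "?F0\<lparr>carrier := ?U\<rparr>"
  have d0: "d 0 \<in> lin_maps R ?F1 ?F0" using d[of 0] by simp
  have d1: "d 1 \<in> lin_maps R ?F2 ?F1" using d[of 1] by (simp add: numeral_2_eq_2)
  have ex: "d 1 ` carrier ?F2 = a_kernel ?F1 ?F0 (d 0)"
    using free_resolutionD(2)[OF res(2), of 0] by (simp add: numeral_2_eq_2)
  let ?C = "\<lambda>j. hom_module R (free_rank R (r j)) Y"
  have C: "module R (?C j)" for j by (rule hom_module_is_module[OF F Y])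
  let ?D0 = "precomp ?F1 (d 0)" and ?D1 = "precomp ?F2 (d 1)"
  let ?Z = "a_kernel (?C 1) (?C 2) ?D1" and ?B = "?D0 ` carrier (?C 0)"
  have D0: "?D0 \<in> lin_maps R (?C 0) (?C 1)" by (rule precomp_lin[OF F F Y d0])
  have D1: "?D1 \<in> lin_maps R (?C 1) (?C 2)" by (rule precomp_lin[OF F F Y d1])
  have Z: "submodule ?Z R (?C 1)" by (rule submodule_kernel[OF C C D1])
  have B: "submodule ?B R (?C 1)" by (rule submodule_image[OF C C D0 submodule_carrier[OF C]])
  have U: "submodule ?U R ?F0" by (rule submodule_kernel[OF F M e])
  have UM: "module R ?UM" by (rule submodule.submodule_is_module[OF U F])
  have d0U: "d 0 \<in> lin_maps R ?F1 ?UM"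
    by (rule lin_mapsI) (use ker lin_add[OF d0] lin_smult[OF d0] in auto)
  have inZ: "g \<in> ?Z \<longleftrightarrow> g \<in> carrier (?C 1) \<and> (\<forall>x\<in>a_kernel ?F1 ?F0 (d 0). g x = \<zero>\<^bsub>Y\<^esub>)" for g
  proof -
    have "precomp ?F2 (d 1) g = (\<lambda>x\<in>carrier ?F2. \<zero>\<^bsub>Y\<^esub>) \<longleftrightarrow> (\<forall>x\<in>carrier ?F2. g (d 1 x) = \<zero>\<^bsub>Y\<^esub>)"
    proof
      assume eq: "precomp ?F2 (d 1) g = (\<lambda>x\<in>carrier ?F2. \<zero>\<^bsub>Y\<^esub>)"
      show "\<forall>x\<in>carrier ?F2. g (d 1 x) = \<zero>\<^bsub>Y\<^esub>"
      proof
        fix x assume "x \<in> carrier ?F2"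
        then show "g (d 1 x) = \<zero>\<^bsub>Y\<^esub>" using fun_cong[OF eq, of x] by (simp add: precomp_def)
      qed
    qed (auto simp: precomp_def intro!: restrict_ext)
    then show ?thesis unfolding ex[symmetric] by (auto simp: a_kernel_iff)
  qed
  have BZ: "?B \<subseteq> ?Z"
  proof
    fix g assume "g \<in> ?B"
    then obtain h where h: "h \<in> carrier (?C 0)" "g = ?D0 h" by blast
    have hl: "h \<in> lin_maps R ?F0 Y" using h(1) by simp
    have "g x = \<zero>\<^bsub>Y\<^esub>" if "x \<in> a_kernel ?F1 ?F0 (d 0)" for x
      using that lin_zero[OF F Y hl] by (simp add: h(2) precomp_def a_kernel_iff)
    then show "g \<in> ?Z" using inZ lin_closed[OF D0 h(1)] h(2) by blast
  qed
  have "Ext R 1 M Y = quot_module R ((?C 1)\<lparr>carrier := ?Z\<rparr>) ?B"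
    by (simp add: Ext_def res(1) numeral_2_eq_2 Let_def)
  then have "zero_module (Ext R 1 M Y) \<longleftrightarrow> ?Z \<subseteq> ?B" using zero_subquot_iff[OF C Z B BZ] by simp
  also have "\<dots> \<longleftrightarrow> (\<forall>\<psi>\<in>lin_maps R ?UM Y. \<exists>\<theta>\<in>lin_maps R ?F0 Y. \<forall>x\<in>?U. \<theta> x = \<psi> x)"
  proof
    assume ZB: "?Z \<subseteq> ?B"
    show "\<forall>\<psi>\<in>lin_maps R ?UM Y. \<exists>\<theta>\<in>lin_maps R ?F0 Y. \<forall>x\<in>?U. \<theta> x = \<psi> x"
    proof
      fix \<psi> assume \<psi>: "\<psi> \<in> lin_maps R ?UM Y"
      define g where "g = (\<lambda>x\<in>carrier ?F1. \<psi> (d 0 x))"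
      have "g \<in> carrier (?C 1)" unfolding g_def using lin_restrict[OF F lin_comp[OF d0U \<psi>]] by simp
      moreover have "g x = \<zero>\<^bsub>Y\<^esub>" if "x \<in> a_kernel ?F1 ?F0 (d 0)" for x
        using that lin_zero[OF UM Y \<psi>] by (simp add: g_def a_kernel_iff)
      ultimately have "g \<in> ?Z" using inZ by blast
      then have "g \<in> ?B" by (rule subsetD[OF ZB])
      then obtain h where h: "h \<in> carrier (?C 0)" "g = ?D0 h" by blast
      have "h x = \<psi> x" if x: "x \<in> ?U" for x
      proof -
        obtain w where w: "w \<in> carrier ?F1" "x = d 0 w" using x unfolding ker[symmetric] by blast
        show ?thesis using fun_cong[OF h(2), of w] w by (simp add: g_def precomp_def)
      qed
      then show "\<exists>\<theta>\<in>lin_maps R ?F0 Y. \<forall>x\<in>?U. \<theta> x = \<psi> x" using h(1) by auto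
    qed
  next
    assume ext: "\<forall>\<psi>\<in>lin_maps R ?UM Y. \<exists>\<theta>\<in>lin_maps R ?F0 Y. \<forall>x\<in>?U. \<theta> x = \<psi> x"
    show "?Z \<subseteq> ?B"
    proof
      fix g assume g: "g \<in> ?Z"
      have gl: "g \<in> lin_maps R ?F1 Y" "g \<in> extensional (carrier ?F1)" using g inZ by auto
      have surj: "d 0 ` carrier ?F1 = carrier ?UM" using ker by simp
      have gz: "g x = \<zero>\<^bsub>Y\<^esub>" if "x \<in> carrier ?F1" "d 0 x = \<zero>\<^bsub>?UM\<^esub>" for x
        using g inZ that by (simp add: a_kernel_iff)
      obtain \<psi> where \<psi>: "\<psi> \<in> lin_maps R ?UM Y" "\<And>x. x \<in> carrier ?F1 \<Longrightarrow> \<psi> (d 0 x) = g x"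
        by (rule lin_factor[OF F UM Y d0U surj gl(1) gz]) (assumption, assumption, rule that)
      obtain \<theta> where \<theta>: "\<theta> \<in> lin_maps R ?F0 Y" "\<forall>x\<in>?U. \<theta> x = \<psi> x" using ext \<psi>(1) by blast
      have "g = ?D0 (\<lambda>x\<in>carrier ?F0. \<theta> x)"
      proof (rule extensionalityI[OF gl(2)])
        show "?D0 (\<lambda>x\<in>carrier ?F0. \<theta> x) \<in> extensional (carrier ?F1)" by (simp add: precomp_def)
        fix x assume x: "x \<in> carrier ?F1"
        have "d 0 x \<in> ?U" unfolding ker[symmetric] using x by blast
        then show "g x = ?D0 (\<lambda>x\<in>carrier ?F0. \<theta> x) x"
          using \<theta>(2) \<psi>(2)[OF x] x lin_closed[OF d0 x] by (simp add: precomp_def)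
      qed
      moreover have "(\<lambda>x\<in>carrier ?F0. \<theta> x) \<in> carrier (?C 0)" using lin_restrict[OF F \<theta>(1)] by simp
      ultimately show "g \<in> ?B" by blast
    qed
  qed
  finally show ?thesis .
qed

section \<open>Associated primes of linked modules\<close>

lemma (in cring) mem_Ass_quot:
  assumes I: "ideal I R"
  shows "p \<in> Ass R (quot_module R (ring_as_module R) I) \<longleftrightarrow>
    primeideal p R \<and> (\<exists>x\<in>carrier R. p = {r \<in> carrier R. r \<otimes> x \<in> I})"
proof -
  have sI: "submodule I R (ring_as_module R)" using I unfolding ideal_iff_submodule .
  note q = quot_carrier[OF ring_module sI] quot_zero[OF ring_module sI]
  have "r \<odot>\<^bsub>quot_module R (ring_as_module R) I\<^esub> (I +>\<^bsub>ring_as_module R\<^esub> x) = I \<longleftrightarrow> r \<otimes> x \<in> I"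
    if "r \<in> carrier R" "x \<in> carrier R" for r x
    using that quot_smult[OF ring_module sI, of r x] quot_coset_zero_iff[OF ring_module sI, of "r \<otimes> x"] by simp
  then have eq: "{r \<in> carrier R. r \<odot>\<^bsub>quot_module R (ring_as_module R) I\<^esub> (I +>\<^bsub>ring_as_module R\<^esub> x) = I}
      = {r \<in> carrier R. r \<otimes> x \<in> I}" if "x \<in> carrier R" for x using that by blast
  show ?thesis unfolding Ass_def q by (simp add: eq)
qed

text \<open>If no generator had its annihilator inside \<open>p\<close>, a product of elements
  outside \<open>p\<close> would kill all generators, contrary to
  \<open>Ann R M \<subseteq> p\<close>. For a generator whose annihilator lies in \<open>p\<close>,
  \<open>minimal_prime_colon\<close> yields a multiple with annihilator \<open>p\<close>.\<close>

lemma (in comm_noetherian_ring) minimal_prime_in_Ass: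
  assumes M: "module R M" and e: "e \<in> lin_maps R (free_rank R n) M" "e ` carrier (free_rank R n) = carrier M"
    and p: "minimal_prime R p" and sub: "Ann R M \<subseteq> p"
  shows "p \<in> Ass R M"
proof -
  interpret M: module R M by (rule M)
  have pp: "primeideal p R" using p by (simp add: minimal_prime_def)
  interpret at_prime R p
    by (rule at_prime.intro[OF comm_noetherian_ring_axioms at_prime_axioms.intro[OF pp]])
  let ?e = "\<lambda>i. e (basis_vec R {..<n} i)"
  have eM: "?e i \<in> carrier M" for i by (rule lin_closed[OF e(1) basis_vec_closed])
  have "\<exists>i<n. {a \<in> carrier R. a \<odot>\<^bsub>M\<^esub> ?e i = \<zero>\<^bsub>M\<^esub>} \<subseteq> p"
  proof (rule ccontr)
    assume no: "\<not> ?thesis"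
    have "\<exists>w\<in>S. \<forall>i\<in>{..<n}. w \<odot>\<^bsub>M\<^esub> ?e i = \<zero>\<^bsub>M\<^esub>"
    proof (rule finite_common_multiplier)
      fix i assume "i \<in> {..<n}"
      then show "\<exists>w\<in>S. w \<odot>\<^bsub>M\<^esub> ?e i = \<zero>\<^bsub>M\<^esub>" using no by auto
    next
      fix i w s assume "w \<in> S" "s \<in> S" "w \<odot>\<^bsub>M\<^esub> ?e i = \<zero>\<^bsub>M\<^esub>"
      then show "(s \<otimes> w) \<odot>\<^bsub>M\<^esub> ?e i = \<zero>\<^bsub>M\<^esub>" using eM by (simp add: M.smult_assoc1)
    qed simp
    then obtain w where w: "w \<in> S" "\<And>i. i < n \<Longrightarrow> w \<odot>\<^bsub>M\<^esub> ?e i = \<zero>\<^bsub>M\<^esub>" by auto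
    have wR: "w \<in> carrier R" using w(1) by simp
    have "w \<odot>\<^bsub>M\<^esub> e x = \<zero>\<^bsub>M\<^esub>" if "x \<in> carrier (free_rank R n)" for x
      by (rule lin_ext[OF M lin_scale[OF M free_module_is_module e(1) wR]
            lin_const_zero[OF free_module_is_module M] _ that]) (simp add: w(2))
    then have "w \<odot>\<^bsub>M\<^esub> y = \<zero>\<^bsub>M\<^esub>" if "y \<in> carrier M" for y using that unfolding e(2)[symmetric] by auto
    then have "w \<in> Ann R M" using wR by (simp add: Ann_def)
    then have "w \<in> p" by (rule subsetD[OF sub])
    then show False using w(1) by simp
  qed
  then obtain i where i: "{a \<in> carrier R. a \<odot>\<^bsub>M\<^esub> ?e i = \<zero>\<^bsub>M\<^esub>} \<subseteq> p" (is "?c \<subseteq> p") by blast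
  have "(\<lambda>a. a \<odot>\<^bsub>M\<^esub> ?e i) \<in> lin_maps R (ring_as_module R) M"
    by (rule lin_mapsI) (use eM in \<open>simp_all add: M.smult_l_distr M.smult_assoc1\<close>)
  from submodule_kernel[OF ring_module M this] have c: "ideal ?c R"
    unfolding ideal_iff_submodule by (simp add: a_kernel_def')
  obtain x where x: "x \<in> carrier R" "{r \<in> carrier R. r \<otimes> x \<in> ?c} = p"
    by (rule minimal_prime_colon[OF p c i]) (rule that)
  have "p = {r \<in> carrier R. r \<odot>\<^bsub>M\<^esub> (x \<odot>\<^bsub>M\<^esub> ?e i) = \<zero>\<^bsub>M\<^esub>}"
    unfolding x(2)[symmetric] using x(1) eM by (auto simp: M.smult_assoc1)
  moreover have "x \<odot>\<^bsub>M\<^esub> ?e i \<in> carrier M" using x(1) eM by simp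
  ultimately show ?thesis unfolding Ass_def using pp by (intro CollectI conjI bexI)
qed

text \<open>The assumptions are symmetric in the two modules, so each fact about \<open>M\<close>,
  \<open>U\<close> and \<open>I\<close> yields through \<open>swap\<close> the one about
  \<open>N\<close>, \<open>V\<close> and \<open>J\<close>.\<close>

locale linked_pair = local_noeth +
  fixes n :: nat and M :: "('a, 'c, 'm) module_scheme" and N :: "('a, 'd, 'n) module_scheme"
    and e :: "(nat \<Rightarrow> 'a) \<Rightarrow> 'c" and f :: "(nat \<Rightarrow> 'a) \<Rightarrow> 'd"
  assumes M: "module R M" and N: "module R N"
    and e: "e \<in> lin_maps R (free_rank R n) M" "e ` carrier (free_rank R n) = carrier M"
    and f: "f \<in> lin_maps R (free_rank R n) N" "f ` carrier (free_rank R n) = carrier N"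
    and V_perp: "a_kernel (free_rank R n) N f = perp n (a_kernel (free_rank R n) M e)"
    and U_perp: "a_kernel (free_rank R n) M e = perp n (a_kernel (free_rank R n) N f)"
    and M_nz: "\<not> zero_module M" and N_nz: "\<not> zero_module N"
    and unmixed: "unmixed R"
begin

abbreviation "F \<equiv> free_rank R n"
abbreviation "U \<equiv> a_kernel F M e"
abbreviation "V \<equiv> a_kernel F N f"
abbreviation "I \<equiv> Ann R M"
abbreviation "J \<equiv> Ann R N"
abbreviation "bv \<equiv> basis_vec R {..<n}"

lemma swap: "linked_pair R n N M f e"
  by (rule linked_pair.intro[OF local_noeth_axioms linked_pair_axioms.intro[OF N M f e U_perp V_perp N_nz M_nz unmixed]])

interpretation M: module R M by (rule M)
interpretation N: module R N by (rule N)
interpretation F: module R "free_rank R n" by (rule free_module_is_module)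

lemma U_sub: "submodule U R F" by (rule submodule_kernel[OF F.module_axioms M e(1)])

lemma Ann_smult: "a \<in> I \<Longrightarrow> x \<in> carrier F \<Longrightarrow> a \<odot>\<^bsub>F\<^esub> x \<in> U"
  using lin_smult[OF e(1)] lin_closed[OF e(1)] by (simp add: Ann_def a_kernel_iff)

lemma AnnI:
  assumes "a \<in> carrier R" and "\<And>x. x \<in> carrier F \<Longrightarrow> a \<odot>\<^bsub>F\<^esub> x \<in> U"
  shows "a \<in> I"
proof -
  have "a \<odot>\<^bsub>M\<^esub> m = \<zero>\<^bsub>M\<^esub>" if m: "m \<in> carrier M" for m
  proof -
    obtain x where x: "x \<in> carrier F" "m = e x" using m unfolding e(2)[symmetric] by blast
    then show ?thesis using assms(2)[OF x(1)] lin_smult[OF e(1) assms(1) x(1)] by (simp add: a_kernel_iff)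
  qed
  then show ?thesis using assms(1) by (simp add: Ann_def)
qed

lemma I_carrier: "a \<in> I \<Longrightarrow> a \<in> carrier R" by (simp add: Ann_def)

lemma I_ideal: "ideal I R"
  unfolding ideal_iff_submodule
  by (rule submoduleI'[OF ring_module]) (auto simp: Ann_def M.smult_l_distr M.smult_assoc1)

lemma one_notin_I: "\<one> \<notin> I"
proof
  assume "\<one> \<in> I"
  then have "carrier M = {\<zero>\<^bsub>M\<^esub>}" by (auto simp: Ann_def)
  then show False using M_nz by (simp add: zero_module_def)
qed

lemma n_pos: "0 < n"
proof (rule ccontr)
  assume "\<not> 0 < n"
  then have "x \<in> U" if "x \<in> carrier F" for x
    using that free_module_eqI[OF that F.M.zero_closed] submodule_mem(2)[OF U_sub F.module_axioms] by simp
  then have "\<one> \<in> I" by (intro AnnI) simp_all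
  then show False using one_notin_I by simp
qed

lemma UF: "u \<in> U \<Longrightarrow> u \<in> carrier F" by (simp add: a_kernel_iff)
lemma VF: "v \<in> V \<Longrightarrow> v \<in> carrier F" by (simp add: a_kernel_iff)

lemma U_coord: "u \<in> U \<Longrightarrow> i < n \<Longrightarrow> u i \<in> carrier R"
  using free_module_coord[OF UF] by simp

lemma dot_UV: "u \<in> U \<Longrightarrow> v \<in> V \<Longrightarrow> dot n u v = \<zero>"
  unfolding V_perp by (simp add: perp_def)

lemma dot_smult_basis:
  assumes x: "x \<in> carrier F" and a: "a \<in> carrier R" and i: "i < n"
  shows "dot n x (a \<odot>\<^bsub>F\<^esub> bv i) = a \<otimes> x i"
  using lin_smult[OF dot_lin_right[OF x] a basis_vec_closed[of "{..<n}" i]]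
    dot_comm[OF x basis_vec_closed] dot_basis_left[OF x i] by simp

text \<open>The vector b e_i lies in \<open>V\<close>, and its dot product with \<open>u\<close> is
  b u_i.\<close>

lemma J_kills_U:
  assumes b: "b \<in> J" and u: "u \<in> U" and i: "i < n"
  shows "b \<otimes> u i = \<zero>"
proof -
  have bR: "b \<in> carrier R" using b by (simp add: Ann_def)
  have "b \<odot>\<^bsub>F\<^esub> bv i \<in> V" by (rule linked_pair.Ann_smult[OF swap b basis_vec_closed])
  from dot_UV[OF u this] show ?thesis using dot_smult_basis[OF UF[OF u] bR i] by simp
qed

lemma I_kills_V: "a \<in> I \<Longrightarrow> v \<in> V \<Longrightarrow> i < n \<Longrightarrow> a \<otimes> v i = \<zero>"
  by (rule linked_pair.J_kills_U[OF swap])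

text \<open>Membership in \<open>V\<close> is tested by dot products with \<open>U\<close>. Together
  with \<open>J_kills_U\<close> this describes \<open>J\<close> as the annihilator of the ideal
  generated by all coordinates of vectors in \<open>U\<close>.\<close>

lemma J_iff:
  assumes b: "b \<in> carrier R" and kill: "\<And>u i. u \<in> U \<Longrightarrow> i < n \<Longrightarrow> b \<otimes> u i = \<zero>"
  shows "b \<in> J"
proof (rule linked_pair.AnnI[OF swap b])
  fix x assume x: "x \<in> carrier F"
  have bx: "b \<odot>\<^bsub>F\<^esub> x \<in> carrier F" using b x by simp
  have "dot n u (b \<odot>\<^bsub>F\<^esub> x) = \<zero>" if u: "u \<in> U" for u
  proof -
    have "dot n u (b \<odot>\<^bsub>F\<^esub> x) = (\<Oplus>i\<in>{..<n}. \<zero>)"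
      unfolding dot_def
    proof (rule finsum_cong'[OF refl])
      fix i assume "i \<in> {..<n}"
      then have i: "i < n" by simp
      have R: "u i \<in> carrier R" "x i \<in> carrier R" using U_coord[OF u i] free_module_coord[OF x] i by auto
      have "u i \<otimes> (b \<odot>\<^bsub>F\<^esub> x) i = (b \<otimes> u i) \<otimes> x i" using R b i by (simp add: m_ac)
      then show "u i \<otimes> (b \<odot>\<^bsub>F\<^esub> x) i = \<zero>" using kill[OF u i] R by simp
    qed simp
    then show ?thesis by simp
  qed
  then show "b \<odot>\<^bsub>F\<^esub> x \<in> V" unfolding V_perp using bx by (simp add: perp_def)
qed

text \<open>The vector a e_0 lies in \<open>U\<close> and has \<open>a\<close> as a coordinate, and
  \<open>J\<close> kills the coordinates of \<open>U\<close>.\<close>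

lemma I_mult_J:
  assumes a: "a \<in> I" and b: "b \<in> J"
  shows "a \<otimes> b = \<zero>"
proof -
  have "a \<odot>\<^bsub>F\<^esub> bv 0 \<in> U" by (rule Ann_smult[OF a basis_vec_closed])
  from J_kills_U[OF b this n_pos] show ?thesis
    using n_pos I_carrier[OF a] linked_pair.I_carrier[OF swap b] by (simp add: basis_vec_def m_comm)
qed

text \<open>By prime avoidance, the condition that I + J contains a nonzerodivisor.\<close>

definition separated :: bool where
  "separated \<longleftrightarrow> (\<forall>p\<in>Ass R (ring_as_module R). \<not> I \<subseteq> p \<or> \<not> J \<subseteq> p)"

lemma separated_swap: "linked_pair.separated R N M \<longleftrightarrow> separated"
  unfolding separated_def linked_pair.separated_def[OF swap] by blast

lemma minimal_of_Ass: "p \<in> Ass R (ring_as_module R) \<Longrightarrow> minimal_prime R p"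
  using unmixed by (simp add: unmixed_def)

lemma separatedI:
  assumes "\<And>p. p \<in> Ass R (ring_as_module R) \<Longrightarrow> minimal_prime R p \<Longrightarrow> primeideal p R \<Longrightarrow> I \<subseteq> p \<Longrightarrow> J \<subseteq> p \<Longrightarrow> False"
  shows separated
  unfolding separated_def using assms minimal_of_Ass by (auto simp: Ass_def)

text \<open>At each associated prime one of the two ideals has an element outside it, and that
  element kills \<open>x\<close>.\<close>

lemma zero_of_killed:
  assumes separated and x: "x \<in> carrier R" and I: "\<And>a. a \<in> I \<Longrightarrow> a \<otimes> x = \<zero>" and J: "\<And>b. b \<in> J \<Longrightarrow> b \<otimes> x = \<zero>"
  shows "x = \<zero>"
proof (rule zero_of_locally_zero[OF x])
  fix p assume p: "p \<in> Ass R (ring_as_module R)"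
  then have "\<not> I \<subseteq> p \<or> \<not> J \<subseteq> p" using assms(1) unfolding separated_def by blast
  then show "\<exists>s\<in>carrier R - p. s \<otimes> x = \<zero>"
    using I J I_carrier linked_pair.I_carrier[OF swap] by blast
qed

lemma zero_of_inter: "separated \<Longrightarrow> x \<in> I \<Longrightarrow> x \<in> J \<Longrightarrow> x = \<zero>"
  by (rule zero_of_killed) (auto simp: I_carrier I_mult_J m_comm[of _ x] linked_pair.I_carrier[OF swap])

text \<open>By \<open>J_iff\<close> with the modules exchanged, \<open>a\<close> has to kill the
  coordinates of \<open>V\<close>. The product a v_i is killed by \<open>J\<close> by assumption and
  by \<open>I\<close> because \<open>I\<close> kills the coordinates of \<open>V\<close>; so it is
  zero.\<close>

lemma colon_J_sub:
  assumes separated and a: "a \<in> carrier R" and kill: "\<And>b. b \<in> J \<Longrightarrow> b \<otimes> a = \<zero>"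
  shows "a \<in> I"
proof (rule linked_pair.J_iff[OF swap a])
  fix v i assume v: "v \<in> V" and i: "i < n"
  have vR: "v i \<in> carrier R" by (rule linked_pair.U_coord[OF swap v i])
  show "a \<otimes> v i = \<zero>"
  proof (rule zero_of_killed[OF assms(1)])
    show "a \<otimes> v i \<in> carrier R" using a vR by simp
    show "a' \<otimes> (a \<otimes> v i) = \<zero>" if "a' \<in> I" for a'
      using I_kills_V[OF that v i] a vR I_carrier[OF that] by (simp add: m_lcomm[of a'])
    show "b \<otimes> (a \<otimes> v i) = \<zero>" if "b \<in> J" for b
      using kill[OF that] a vR linked_pair.I_carrier[OF swap that] by (simp add: m_assoc[symmetric])
  qed
qed

text \<open>The coordinates of vectors in \<open>U\<close> are killed by \<open>J\<close>, hence lie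
  in \<open>I\<close>; the inclusion I F \<subseteq> U is clear. Thus \<open>M\<close> is a direct
  sum of n copies of R/I.\<close>

lemma U_iff:
  assumes separated and x: "x \<in> carrier F"
  shows "x \<in> U \<longleftrightarrow> (\<forall>i<n. x i \<in> I)"
proof (intro iffI allI impI)
  fix i assume u: "x \<in> U" and i: "i < n"
  show "x i \<in> I"
    by (rule colon_J_sub[OF assms(1) U_coord[OF u i]]) (rule J_kills_U[OF _ u i])
next
  assume I: "\<forall>i<n. x i \<in> I"
  have "(\<Oplus>\<^bsub>F\<^esub>i\<in>{..<n}. x i \<odot>\<^bsub>F\<^esub> bv i) \<in> U"
    by (rule submodule_finsum[OF U_sub F.module_axioms], rule Ann_smult) (use I basis_vec_closed in auto)
  then show "x \<in> U" using lin_expand[OF F.module_axioms lin_id x] by simp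
qed

text \<open>In terms of \<open>M\<close>: no nonzero element is killed by \<open>J\<close>. The
  products b x_i lie in \<open>I\<close> and in \<open>J\<close>, hence vanish, so that x_i is
  killed by \<open>J\<close> and belongs to \<open>I\<close>.\<close>

lemma in_U_of_colon:
  assumes separated and x: "x \<in> carrier F" and k: "\<And>b. b \<in> J \<Longrightarrow> b \<odot>\<^bsub>F\<^esub> x \<in> U"
  shows "x \<in> U"
  unfolding U_iff[OF assms(1,2)]
proof (intro allI impI)
  fix i assume i: "i < n"
  have xR: "x i \<in> carrier R" using free_module_coord[OF x] i by simp
  show "x i \<in> I"
  proof (rule colon_J_sub[OF assms(1) xR])
    fix b assume b: "b \<in> J"
    have bR: "b \<in> carrier R" by (rule linked_pair.I_carrier[OF swap b])
    have "b \<odot>\<^bsub>F\<^esub> x \<in> carrier F" using bR x by simp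
    then have "(b \<odot>\<^bsub>F\<^esub> x) i \<in> I" using k[OF b] U_iff[OF assms(1)] i by blast
    then have "b \<otimes> x i \<in> I" using i by simp
    moreover have "b \<otimes> x i \<in> J" by (rule ideal.I_r_closed[OF linked_pair.I_ideal[OF swap] b xR])
    ultimately show "b \<otimes> x i = \<zero>" by (rule zero_of_inter[OF assms(1)])
  qed
qed

lemma separated_colon:
  assumes separated
  shows "I = zero_colon R J"
proof (intro subset_antisym subsetI)
  fix a assume "a \<in> I"
  then show "a \<in> zero_colon R J" unfolding zero_colon_def using I_carrier I_mult_J by simp
next
  fix a assume "a \<in> zero_colon R J"
  then have a: "a \<in> carrier R" "\<And>b. b \<in> J \<Longrightarrow> a \<otimes> b = \<zero>" unfolding zero_colon_def by auto
  show "a \<in> I"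
  proof (rule colon_J_sub[OF assms a(1)])
    fix b assume b: "b \<in> J"
    then show "b \<otimes> a = \<zero>" using a(2)[OF b] m_comm[OF linked_pair.I_carrier[OF swap b] a(1)] by simp
  qed
qed

lemma separated_linked: "separated \<Longrightarrow> linked R I J"
proof -
  assume s: separated
  have s': "linked_pair.separated R N M" using s separated_swap by simp
  note oI = one_notin_I and oJ = linked_pair.one_notin_I[OF swap]
  note zI = separated_colon[OF s] and zJ = linked_pair.separated_colon[OF swap s']
  have z: "\<one> \<in> zero_colon R {\<zero>}" unfolding zero_colon_def by simp
  have "I \<noteq> {\<zero>}"
  proof
    assume "I = {\<zero>}"
    then have "J = zero_colon R {\<zero>}" by (subst zJ) simp
    then show False using z oJ by simp
  qed
  moreover have "J \<noteq> {\<zero>}"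
  proof
    assume "J = {\<zero>}"
    then have "I = zero_colon R {\<zero>}" by (subst zI) simp
    then show False using z oI by simp
  qed
  moreover have "I \<noteq> carrier R" "J \<noteq> carrier R" using oI oJ by (metis one_closed)+
  ultimately show "linked R I J"
    unfolding linked_def by (intro conjI I_ideal linked_pair.I_ideal[OF swap] zI zJ)
qed

section \<open>Associated primes and geometric linkage\<close>

lemma separated_iff_Ass: "Ass R M \<inter> Ass R N = {} \<longleftrightarrow> separated"
proof
  assume disj: "Ass R M \<inter> Ass R N = {}"
  show separated
  proof (rule separatedI)
    fix p assume "minimal_prime R p" "I \<subseteq> p" "J \<subseteq> p"
    then have "p \<in> Ass R M" "p \<in> Ass R N"
      using minimal_prime_in_Ass[OF M e] minimal_prime_in_Ass[OF N f] by blast+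
    then show False using disj by blast
  qed
next
  assume s: separated
  show "Ass R M \<inter> Ass R N = {}"
  proof (rule ccontr)
    assume "Ass R M \<inter> Ass R N \<noteq> {}"
    then obtain p m m' where pp: "primeideal p R"
      and m: "m \<in> carrier M" "p = {a \<in> carrier R. a \<odot>\<^bsub>M\<^esub> m = \<zero>\<^bsub>M\<^esub>}"
      and m': "m' \<in> carrier N" "p = {a \<in> carrier R. a \<odot>\<^bsub>N\<^esub> m' = \<zero>\<^bsub>N\<^esub>}"
      unfolding Ass_def by blast
    obtain x where x: "x \<in> carrier F" "m = e x" using m(1) unfolding e(2)[symmetric] by blast
    \<comment> \<open>The common prime contains \<open>J\<close>, because it is the annihilator of
      an element of \<open>N\<close>. So \<open>J\<close> kills \<open>m\<close>, and
      \<open>m\<close> is zero.\<close>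
    have "x \<in> U"
    proof (rule in_U_of_colon[OF s x(1)])
      fix b assume b: "b \<in> J"
      then have bR: "b \<in> carrier R" "b \<in> p" using m' by (auto simp: Ann_def)
      have "b \<odot>\<^bsub>M\<^esub> m = \<zero>\<^bsub>M\<^esub>" using bR(2) unfolding m(2) by simp
      then show "b \<odot>\<^bsub>F\<^esub> x \<in> U" using lin_smult[OF e(1) bR(1) x(1)] bR(1) x by (simp add: a_kernel_iff)
    qed
    then have "\<one> \<in> p" unfolding m(2) using x by (simp add: a_kernel_iff)
    then show False
      using ideal.one_imp_carrier[OF primeideal.axioms(1)[OF pp]] primeideal.I_notcarr[OF pp] by simp
  qed
qed

lemma separated_iff_geometrically_linked: "geometrically_linked R I J \<longleftrightarrow> separated"
proof
  assume g: "geometrically_linked R I J"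
  show separated
  proof (rule separatedI)
    fix p assume p: "minimal_prime R p" "primeideal p R" "I \<subseteq> p" "J \<subseteq> p"
    obtain x where x: "x \<in> carrier R" "{r \<in> carrier R. r \<otimes> x \<in> I} = p"
      by (rule minimal_prime_colon[OF p(1) I_ideal p(3)]) (rule that)
    obtain y where y: "y \<in> carrier R" "{r \<in> carrier R. r \<otimes> y \<in> J} = p"
      by (rule minimal_prime_colon[OF p(1) linked_pair.I_ideal[OF swap] p(4)]) (rule that)
    have "p \<in> Ass R (quot_module R (ring_as_module R) I)" "p \<in> Ass R (quot_module R (ring_as_module R) J)"
      unfolding mem_Ass_quot[OF I_ideal] mem_Ass_quot[OF linked_pair.I_ideal[OF swap]] using p(2) x y by metis+
    then show False using g unfolding geometrically_linked_def by blast
  qed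
next
  assume s: separated
  have "Ass R (quot_module R (ring_as_module R) I) \<inter> Ass R (quot_module R (ring_as_module R) J) = {}"
  proof (rule ccontr)
    assume "\<not> ?thesis"
    then obtain p where "p \<in> Ass R (quot_module R (ring_as_module R) I)"
      "p \<in> Ass R (quot_module R (ring_as_module R) J)" by blast
    then obtain x y where pp: "primeideal p R" and x: "x \<in> carrier R" "p = {r \<in> carrier R. r \<otimes> x \<in> I}"
      and y: "y \<in> carrier R" "p = {r \<in> carrier R. r \<otimes> y \<in> J}"
      unfolding mem_Ass_quot[OF I_ideal] mem_Ass_quot[OF linked_pair.I_ideal[OF swap]] by blast
    \<comment> \<open>The common prime contains \<open>J\<close>, because J y \<subseteq> J. So J x
      lies in both \<open>I\<close> and \<open>J\<close> and is zero.\<close>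
    have "x \<in> I"
    proof (rule colon_J_sub[OF s x(1)])
      fix b assume b: "b \<in> J"
      have bR: "b \<in> carrier R" by (rule linked_pair.I_carrier[OF swap b])
      have "b \<otimes> y \<in> J" by (rule ideal.I_r_closed[OF linked_pair.I_ideal[OF swap] b y(1)])
      then have "b \<in> p" unfolding y(2) using bR by simp
      then have "b \<otimes> x \<in> I" unfolding x(2) by simp
      moreover have "b \<otimes> x \<in> J" by (rule ideal.I_r_closed[OF linked_pair.I_ideal[OF swap] b x(1)])
      ultimately show "b \<otimes> x = \<zero>" by (rule zero_of_inter[OF s])
    qed
    then have "\<one> \<in> p" unfolding x(2) using x(1) by simp
    then show False
      using ideal.one_imp_carrier[OF primeideal.axioms(1)[OF pp]] primeideal.I_notcarr[OF pp] by simp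
  qed
  then show "geometrically_linked R I J" unfolding geometrically_linked_def using separated_linked[OF s] by simp
qed

text \<open>A resolution of \<open>M\<close> begins with a cover other than \<open>e\<close>; the two covers are compared by
  lifting the identity of \<open>M\<close> both ways.\<close>

lemma compare_cover:
  assumes c: "c \<in> lin_maps R (free_rank R k) M" "c ` carrier (free_rank R k) = carrier M"
  obtains g h where "g \<in> lin_maps R (free_rank R k) F" and "h \<in> lin_maps R F (free_rank R k)"
    and "\<And>x. x \<in> carrier (free_rank R k) \<Longrightarrow> e (g x) = c x"
    and "\<And>x. x \<in> carrier F \<Longrightarrow> c (h x) = e x"
proof -
  have A: "c (basis_vec R {..<k} s) \<in> e ` carrier F" for s
    unfolding e(2) by (rule lin_closed[OF c(1) basis_vec_closed])
  have B: "e (bv s) \<in> c ` carrier (free_rank R k)" for s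
    unfolding c(2) by (rule lin_closed[OF e(1) basis_vec_closed])
  obtain g where g: "g \<in> lin_maps R (free_rank R k) F" "\<And>x. x \<in> carrier (free_rank R k) \<Longrightarrow> e (g x) = c x"
    by (rule free_lift[OF F.module_axioms M c(1) e(1) A]) (rule that)
  obtain h where h: "h \<in> lin_maps R F (free_rank R k)" "\<And>x. x \<in> carrier F \<Longrightarrow> c (h x) = e x"
    by (rule free_lift[OF free_module_is_module M e(1) c(1) B]) (rule that)
  show thesis by (rule that[OF g(1) h(1) g(2) h(2)])
qed

text \<open>\<open>J\<close> kills \<open>U\<close> while no nonzero element of \<open>M\<close> is
  killed by \<open>J\<close>, so every map from \<open>U\<close> to \<open>M\<close> is zero. The
  lifts \<open>g\<close> and \<open>h\<close> transfer this to the syzygy of the chosen resolution,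
  where \<open>\<psi>\<close> is extended by its composite with \<open>\<rho>\<close>.\<close>

lemma separated_Ext:
  assumes s: separated and fg: "fin_gen R M"
  shows "zero_module (Ext R 1 M M)"
proof -
  obtain r d where sr: "some_resolution R M = (r, d)" by (metis prod.exhaust)
  note res = some_resolution_free[OF M fg sr]
  from free_resolutionD(3)[OF res] obtain c where c: "c \<in> lin_maps R (free_rank R (r 0)) M"
    "c ` carrier (free_rank R (r 0)) = carrier M"
    and ker: "d 0 ` carrier (free_rank R (r 1)) = a_kernel (free_rank R (r 0)) M c" by (elim exE conjE)
  let ?F' = "free_rank R (r 0)" let ?U' = "a_kernel ?F' M c"
  note F' = free_module_is_module[of "{..<r 0}"]
  interpret F': module R ?F' by (rule F')
  have U': "submodule ?U' R ?F'" by (rule submodule_kernel[OF F' M c(1)])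
  have U'M: "module R (?F'\<lparr>carrier := ?U'\<rparr>)" by (rule submodule.submodule_is_module[OF U' F'])
  obtain g h where g: "g \<in> lin_maps R ?F' F" and h: "h \<in> lin_maps R F ?F'"
    and eg: "\<And>x. x \<in> carrier ?F' \<Longrightarrow> e (g x) = c x" and ch: "\<And>x. x \<in> carrier F \<Longrightarrow> c (h x) = e x"
    by (rule compare_cover[OF c]) (rule that)
  have hg: "(\<lambda>x. h (g x)) \<in> lin_maps R ?F' ?F'" by (rule lin_comp[OF g h])
  \<comment> \<open>The identity and the composite of \<open>g\<close> and \<open>h\<close> both
    lift the identity of \<open>M\<close>, so their difference maps into the syzygy. On the syzygy
    it differs from the identity only by values of \<open>h\<close> on \<open>U\<close>, which
    \<open>\<psi>\<close> will turn out to kill.\<close>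
  define \<rho> where "\<rho> x = x \<ominus>\<^bsub>?F'\<^esub> h (g x)" for x
  have \<rho>: "\<rho> \<in> lin_maps R ?F' ?F'" unfolding \<rho>_def by (rule lin_diff[OF F' F' lin_id hg])
  have \<rho>U: "\<rho> x \<in> ?U'" if x: "x \<in> carrier ?F'" for x
    using lin_minus[OF F' M c(1) x lin_closed[OF hg x]] lin_closed[OF \<rho> x] ch[OF lin_closed[OF g x]] eg[OF x]
      lin_closed[OF c(1) x]
    by (simp add: a_kernel_iff M.M.minus_eq_zero_iff \<rho>_def)
  have \<rho>': "\<rho> \<in> lin_maps R ?F' (?F'\<lparr>carrier := ?U'\<rparr>)"
    by (rule lin_mapsI) (simp_all add: \<rho>U lin_add[OF \<rho>] lin_smult[OF \<rho>])
  show ?thesis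
    unfolding zero_Ext_iff[OF M sr res M c(1) ker]
  proof
    fix \<psi> assume \<psi>: "\<psi> \<in> lin_maps R (?F'\<lparr>carrier := ?U'\<rparr>) M"
    have hU: "h u \<in> ?U'" if "u \<in> U" for u
      using ch[OF UF[OF that]] lin_closed[OF h UF[OF that]] that by (simp add: a_kernel_iff)
    have \<psi>0: "\<psi> (h u) = \<zero>\<^bsub>M\<^esub>" if u: "u \<in> U" for u
    proof -
      have m: "\<psi> (h u) \<in> carrier M" using lin_closed[OF \<psi>] hU[OF u] by simp
      obtain x where x: "x \<in> carrier F" "\<psi> (h u) = e x" using m unfolding e(2)[symmetric] by blast
      have "x \<in> U"
      proof (rule in_U_of_colon[OF s x(1)])
        fix b assume b: "b \<in> J"
        have bR: "b \<in> carrier R" by (rule linked_pair.I_carrier[OF swap b])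
        have "b \<odot>\<^bsub>F\<^esub> u = \<zero>\<^bsub>F\<^esub>"
          by (rule free_module_eqI[OF F.smult_closed[OF bR UF[OF u]] F.M.zero_closed])
            (simp add: J_kills_U[OF b u])
        then have "h (b \<odot>\<^bsub>F\<^esub> u) = \<zero>\<^bsub>?F'\<^esub>" using lin_zero[OF F.module_axioms F' h] by simp
        then have "b \<odot>\<^bsub>?F'\<^esub> h u = \<zero>\<^bsub>?F'\<^esub>" using lin_smult[OF h bR UF[OF u]] by simp
        moreover have "\<psi> (b \<odot>\<^bsub>?F'\<^esub> h u) = b \<odot>\<^bsub>M\<^esub> \<psi> (h u)"
          using lin_smult[OF \<psi> bR, of "h u"] hU[OF u] by simp
        moreover have "\<psi> \<zero>\<^bsub>?F'\<^esub> = \<zero>\<^bsub>M\<^esub>" using lin_zero[OF U'M M \<psi>] by simp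
        ultimately have "b \<odot>\<^bsub>M\<^esub> e x = \<zero>\<^bsub>M\<^esub>" using x(2) by simp
        then show "b \<odot>\<^bsub>F\<^esub> x \<in> U" using lin_smult[OF e(1) bR x(1)] bR x(1) by (simp add: a_kernel_iff)
      qed
      then show ?thesis using x(2) by (simp add: a_kernel_iff)
    qed
    have "(\<lambda>x. \<psi> (\<rho> x)) \<in> lin_maps R ?F' M" by (rule lin_comp[OF \<rho>' \<psi>])
    moreover have "\<psi> (\<rho> x) = \<psi> x" if x: "x \<in> ?U'" for x
    proof -
      have xF: "x \<in> carrier ?F'" using x by (simp add: a_kernel_iff)
      have gx: "g x \<in> U" using eg[OF xF] lin_closed[OF g xF] x by (simp add: a_kernel_iff)
      have sum: "\<rho> x \<oplus>\<^bsub>?F'\<^esub> h (g x) = x"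
        using xF lin_closed[OF hg xF] by (simp add: \<rho>_def a_minus_def F'.M.a_assoc F'.M.l_neg)
      have \<rho>x: "\<rho> x \<in> ?U'" by (rule \<rho>U[OF xF])
      have "\<psi> (\<rho> x) \<in> carrier M" using lin_closed[OF \<psi>, of "\<rho> x"] \<rho>x by simp
      then have "\<psi> (\<rho> x) = \<psi> (\<rho> x) \<oplus>\<^bsub>M\<^esub> \<psi> (h (g x))" using \<psi>0[OF gx] by simp
      also have "\<dots> = \<psi> (\<rho> x \<oplus>\<^bsub>?F'\<^esub> h (g x))"
        using lin_add[OF \<psi>, of "\<rho> x" "h (g x)"] \<rho>x hU[OF gx] by simp
      finally show ?thesis unfolding sum .
    qed
    ultimately show "\<exists>\<theta>\<in>lin_maps R ?F' M. \<forall>x\<in>?U'. \<theta> x = \<psi> x"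
      by (intro bexI[of _ "\<lambda>x. \<psi> (\<rho> x)"] ballI)
  qed
qed

end

section \<open>Vanishing of Tor\<close>

context linked_pair
begin

interpretation M: module R M by (rule M)
interpretation N: module R N by (rule N)
interpretation F: module R "free_rank R n" by (rule free_module_is_module)

text \<open>As \<open>N\<close> is a direct sum of copies of R/J, the point is that a syzygy vector
  with coordinates in \<open>J\<close> is the image of a vector with coordinates in
  \<open>J\<close>. Its image under \<open>g\<close> lies in I F and in J F, hence is zero; so the
  vector is fixed by \<open>\<rho>\<close>, and \<open>\<rho>\<close> factors through
  \<open>d 0\<close>.\<close>

lemma separated_Tor:
  assumes s: separated and fg: "fin_gen R M"
  shows "zero_module (Tor R 1 M N)"
proof -
  have s': "linked_pair.separated R N M" using s separated_swap by simp
  interpret J: ideal J R by (rule linked_pair.I_ideal[OF swap])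
  obtain r d where sr: "some_resolution R M = (r, d)" by (metis prod.exhaust)
  note res = some_resolution_free[OF M fg sr]
  from free_resolutionD(3)[OF res] obtain c where c: "c \<in> lin_maps R (free_rank R (r 0)) M"
    "c ` carrier (free_rank R (r 0)) = carrier M"
    and ker: "d 0 ` carrier (free_rank R (r 1)) = a_kernel (free_rank R (r 0)) M c" by (elim exE conjE)
  let ?F0 = "free_rank R (r 0)" and ?F1 = "free_rank R (r 1)" and ?F2 = "free_rank R (r 2)"
  let ?b0 = "basis_vec R {..<r 0}" and ?b1 = "basis_vec R {..<r 1}" and ?b2 = "basis_vec R {..<r 2}"
  have d0: "d 0 \<in> lin_maps R ?F1 ?F0" using free_resolutionD(1)[OF res, of 0] by simp
  have d1: "d 1 \<in> lin_maps R ?F2 ?F1" using free_resolutionD(1)[OF res, of 1] by (simp add: numeral_2_eq_2)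
  have ex: "d 1 ` carrier ?F2 = a_kernel ?F1 ?F0 (d 0)"
    using free_resolutionD(2)[OF res, of 0] by (simp add: numeral_2_eq_2)
  note FF = free_module_is_module
  interpret F0: module R ?F0 by (rule FF)
  interpret F1: module R ?F1 by (rule FF)
  obtain g h where g: "g \<in> lin_maps R ?F0 F" and h: "h \<in> lin_maps R F ?F0"
    and eg: "\<And>x. x \<in> carrier ?F0 \<Longrightarrow> e (g x) = c x" and ch: "\<And>x. x \<in> carrier F \<Longrightarrow> c (h x) = e x"
    by (rule compare_cover[OF c]) (rule that)
  have hg: "(\<lambda>x. h (g x)) \<in> lin_maps R ?F0 ?F0" by (rule lin_comp[OF g h])
  define \<rho> where "\<rho> x = x \<ominus>\<^bsub>?F0\<^esub> h (g x)" for x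
  have \<rho>: "\<rho> \<in> lin_maps R ?F0 ?F0" unfolding \<rho>_def by (rule lin_diff[OF FF FF lin_id hg])
  have "\<exists>q\<in>carrier ?F1. d 0 q = \<rho> x" if x: "x \<in> carrier ?F0" for x
  proof -
    have "\<rho> x \<in> a_kernel ?F0 M c"
      using lin_minus[OF FF M c(1) x lin_closed[OF hg x]] lin_closed[OF \<rho> x] ch[OF lin_closed[OF g x]] eg[OF x]
        lin_closed[OF c(1) x]
      by (simp add: a_kernel_iff M.M.minus_eq_zero_iff \<rho>_def)
    then show ?thesis unfolding ker[symmetric] by auto
  qed
  \<comment> \<open>Preimages under \<open>d 0\<close> of the values of \<open>\<rho>\<close> at the
    basis vectors. The linear map \<open>Q\<close> built from them factors \<open>\<rho>\<close>
    through \<open>d 0\<close>.\<close>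
  then have "\<forall>k. \<exists>q. q \<in> carrier ?F1 \<and> d 0 q = \<rho> (?b0 k)" using basis_vec_closed[of "{..<r 0}"] by blast
  from choice[OF this] obtain q where q: "\<And>k. q k \<in> carrier ?F1" "\<And>k. d 0 (q k) = \<rho> (?b0 k)" by blast
  have lin_J: "k x i \<in> J"
    if k: "k \<in> lin_maps R (free_rank R a) (free_rank R b)" and x: "x \<in> carrier (free_rank R a)"
      and xJ: "\<And>j. j < a \<Longrightarrow> x j \<in> J" and i: "i < b" for k a b x i
  proof -
    have l: "(\<lambda>x. k x i) \<in> lin_maps R (free_rank R a) (ring_as_module R)"
      by (rule lin_comp[OF k coord_lin]) (use i in simp)
    have "(\<Oplus>j\<in>{..<a}. x j \<otimes> k (basis_vec R {..<a} j) i) \<in> J"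
    proof -
      have "submodule J R (ring_as_module R)" using J.is_ideal unfolding ideal_iff_submodule .
      from submodule_finsum[OF this ring_module, of "{..<a}" "\<lambda>j. x j \<otimes> k (basis_vec R {..<a} j) i"]
      show ?thesis using xJ lin_closed[OF l basis_vec_closed] by (simp add: J.I_r_closed)
    qed
    then show ?thesis using lin_expand[OF ring_module l x] by simp
  qed
  have key: "\<exists>v\<in>carrier ?F1. d 0 v = w \<and> (\<forall>j<r 1. v j \<in> J)"
    if w: "w \<in> a_kernel ?F0 M c" and wJ: "\<And>i. i < r 0 \<Longrightarrow> w i \<in> J" for w
  proof -
    have wF: "w \<in> carrier ?F0" using w by (simp add: a_kernel_iff)
    have gwF: "g w \<in> carrier F" by (rule lin_closed[OF g wF])
    have gwU: "g w \<in> U" using eg[OF wF] gwF w by (simp add: a_kernel_iff)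
    have "g w = \<zero>\<^bsub>F\<^esub>"
    proof (rule free_module_eqI[OF gwF F.M.zero_closed])
      fix i assume i: "i \<in> {..<n}"
      have "g w i \<in> I" using gwU U_iff[OF s gwF] i by simp
      moreover have "g w i \<in> J" by (rule lin_J[OF g wF wJ]) (use i in auto)
      ultimately show "g w i = \<zero>\<^bsub>F\<^esub> i" using zero_of_inter[OF s] i by simp
    qed
    then have "\<rho> w = w" unfolding \<rho>_def using lin_zero[OF FF FF h] wF by (simp add: a_minus_def)
    define Q where "Q = flin ?F1 {..<r 0} q"
    have Q: "Q \<in> lin_maps R ?F0 ?F1" unfolding Q_def by (rule flin_lin[OF FF]) (use q in auto)
    have "d 0 (Q w) = \<rho> w"
    proof (rule lin_ext[OF FF lin_comp[OF Q d0] \<rho> _ wF])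
      fix k assume k: "k \<in> {..<r 0}"
      have "Q (?b0 k) = q k" unfolding Q_def by (rule flin_basis[OF FF _ k]) (use q in auto)
      then show "d 0 (Q (?b0 k)) = \<rho> (?b0 k)" using q(2) by simp
    qed
    moreover have "Q w j \<in> J" if "j < r 1" for j by (rule lin_J[OF Q wF wJ that])
    ultimately show ?thesis using lin_closed[OF Q wF] \<open>\<rho> w = w\<close> by (intro bexI[of _ "Q w"]) auto
  qed
  show ?thesis
    unfolding zero_Tor_iff[OF sr res N]
  proof (intro allI impI, elim conjE)
    fix y assume y: "\<forall>j<r 1. y j \<in> carrier N"
      and y0: "\<forall>i<r 0. (\<Oplus>\<^bsub>N\<^esub>j\<in>{..<r 1}. d 0 (?b1 j) i \<odot>\<^bsub>N\<^esub> y j) = \<zero>\<^bsub>N\<^esub>"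
    have "\<forall>j. \<exists>x. j < r 1 \<longrightarrow> x \<in> carrier F \<and> f x = y j"
    proof
      fix j
      show "\<exists>x. j < r 1 \<longrightarrow> x \<in> carrier F \<and> f x = y j"
        proof (cases "j < r 1")
          case True
          then have "y j \<in> f ` carrier F" using y f(2) by simp
          then obtain x where "x \<in> carrier F" "y j = f x" by (rule imageE)
          then show ?thesis by (intro exI[of _ x]) simp
        qed simp
    qed
    from choice[OF this] obtain Y where Y: "\<And>j. j < r 1 \<Longrightarrow> Y j \<in> carrier F" "\<And>j. j < r 1 \<Longrightarrow> f (Y j) = y j"
      by blast
    have co0: "d 0 (?b1 j) i \<in> carrier R" if "i < r 0" for i j
      using free_module_coord[OF lin_closed[OF d0 basis_vec_closed]] that by simp
    have co1: "d 1 (?b2 j) i \<in> carrier R" if "i < r 1" for i j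
      using free_module_coord[OF lin_closed[OF d1 basis_vec_closed]] that by simp
    have Yc: "Y j k \<in> carrier R" if "j < r 1" "k < n" for j k using free_module_coord[OF Y(1)[OF that(1)]] that by simp
    \<comment> \<open>The k-th coordinates of all lifts form a vector of the resolution. Since V = J
      F, the equations on the tuple \<open>y\<close> say that \<open>d 0\<close> sends this vector
      to one with coordinates in \<open>J\<close>.\<close>
    define C where "C k = (\<lambda>j\<in>{..<r 1}. Y j k)" for k
    have CF: "C k \<in> carrier ?F1" if "k < n" for k using Yc that by (auto simp: free_rank_mem C_def)
    have CJ: "d 0 (C k) i \<in> J" if k: "k < n" and i: "i < r 0" for k i
    proof -
      define W where "W = (\<Oplus>\<^bsub>F\<^esub>j\<in>{..<r 1}. d 0 (?b1 j) i \<odot>\<^bsub>F\<^esub> Y j)"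
      have WF: "W \<in> carrier F" unfolding W_def by (rule F.M.finsum_closed) (use Y co0[OF i] in auto)
      have "f W = (\<Oplus>\<^bsub>N\<^esub>j\<in>{..<r 1}. f (d 0 (?b1 j) i \<odot>\<^bsub>F\<^esub> Y j))"
        unfolding W_def by (rule lin_finsum[OF FF N f(1)]) (use Y co0[OF i] in auto)
      also have "\<dots> = (\<Oplus>\<^bsub>N\<^esub>j\<in>{..<r 1}. d 0 (?b1 j) i \<odot>\<^bsub>N\<^esub> y j)"
        by (rule N.M.finsum_cong'[OF refl])
          (use Y y co0[OF i] in \<open>auto simp: lin_smult[OF f(1)]\<close>)
      finally have "f W = \<zero>\<^bsub>N\<^esub>" using y0 i by simp
      then have "W \<in> V" using WF by (simp add: a_kernel_iff)
      then have "W k \<in> J" using linked_pair.U_iff[OF swap s' WF] k by simp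
      moreover have "W k = (\<Oplus>j\<in>{..<r 1}. (d 0 (?b1 j) i \<odot>\<^bsub>F\<^esub> Y j) k)"
        unfolding W_def by (rule free_module_finsum) (use k Y co0[OF i] in auto)
      moreover have "\<dots> = (\<Oplus>j\<in>{..<r 1}. C k j \<otimes> d 0 (?b1 j) i)"
        by (rule finsum_cong'[OF refl]) (use k Yc co0[OF i] in \<open>auto simp: C_def m_comm\<close>)
      moreover have "d 0 (C k) i = (\<Oplus>j\<in>{..<r 1}. C k j \<otimes> d 0 (?b1 j) i)"
        using lin_expand[OF ring_module lin_comp[OF d0 coord_lin] CF[OF k], of i] i by simp
      ultimately show ?thesis by simp
    qed
    \<comment> \<open>Subtracting a vector \<open>v\<close> with coordinates in \<open>J\<close> and
      the same image turns \<open>C k\<close> into a cycle, hence into a boundary; the error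
      \<open>v\<close> disappears modulo \<open>V\<close>.\<close>
    have "\<exists>z. k < n \<longrightarrow> z \<in> carrier ?F2 \<and> (\<forall>j<r 1. Y j k \<ominus> d 1 z j \<in> J)" for k
    proof (cases "k < n")
      case k: True
      have "d 0 (C k) \<in> a_kernel ?F0 M c" unfolding ker[symmetric] using CF[OF k] by blast
      from key[OF this CJ[OF k]] obtain v where v: "v \<in> carrier ?F1" "d 0 v = d 0 (C k)" "\<forall>j<r 1. v j \<in> J" by blast
      have "C k \<ominus>\<^bsub>?F1\<^esub> v \<in> carrier ?F1" by (rule F1.M.minus_closed[OF CF[OF k] v(1)])
      then have "C k \<ominus>\<^bsub>?F1\<^esub> v \<in> a_kernel ?F1 ?F0 (d 0)"
        using lin_minus[OF FF FF d0 CF[OF k] v(1)] v(1,2) CF[OF k] lin_closed[OF d0 CF[OF k]]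
        by (simp add: a_kernel_iff F0.M.minus_eq_zero_iff)
      then obtain z where z: "z \<in> carrier ?F2" "C k \<ominus>\<^bsub>?F1\<^esub> v = d 1 z" unfolding ex[symmetric] by (elim imageE)
      have "Y j k \<ominus> d 1 z j \<in> J" if j: "j < r 1" for j
      proof -
        have vj: "v j \<in> carrier R" using v(3) j by simp
        have "d 1 z j = Y j k \<ominus> v j" unfolding z(2)[symmetric] using j v(1) CF[OF k] by (simp add: C_def)
        then have "Y j k \<ominus> d 1 z j = v j"
          using vj Yc[OF j k] by (simp add: a_minus_def minus_add a_assoc[symmetric] r_neg)
        then show ?thesis using v(3) j by simp
      qed
      then show ?thesis using z(1) by blast
    qed simp
    then have "\<forall>k. \<exists>z. k < n \<longrightarrow> z \<in> carrier ?F2 \<and> (\<forall>j<r 1. Y j k \<ominus> d 1 z j \<in> J)" by blast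
    from choice[OF this] obtain z where z: "\<And>k. k < n \<Longrightarrow> z k \<in> carrier ?F2"
      "\<And>k j. k < n \<Longrightarrow> j < r 1 \<Longrightarrow> Y j k \<ominus> d 1 (z k) j \<in> J" by blast
    have zc: "z k l \<in> carrier R" if "k < n" "l < r 2" for k l using free_module_coord[OF z(1)[OF that(1)]] that by simp
    \<comment> \<open>Reassembles the solutions: the l-th entries of the n vectors
      \<open>z k\<close> form one vector of \<open>F\<close>, whose image under \<open>f\<close> is
      the l-th element of \<open>N\<close> sought.\<close>
    define Z where "Z l = (\<lambda>k\<in>{..<n}. z k l)" for l
    have ZF: "Z l \<in> carrier F" if "l < r 2" for l using zc that by (auto simp: free_rank_mem Z_def)
    have "y j = (\<Oplus>\<^bsub>N\<^esub>l\<in>{..<r 2}. d 1 (?b2 l) j \<odot>\<^bsub>N\<^esub> f (Z l))" if j: "j < r 1" for j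
    proof -
      define W where "W = (\<Oplus>\<^bsub>F\<^esub>l\<in>{..<r 2}. d 1 (?b2 l) j \<odot>\<^bsub>F\<^esub> Z l)"
      have WF: "W \<in> carrier F" unfolding W_def by (rule F.M.finsum_closed) (use ZF co1[OF j] in auto)
      have Wk: "W k = d 1 (z k) j" if k: "k < n" for k
      proof -
        have "W k = (\<Oplus>l\<in>{..<r 2}. (d 1 (?b2 l) j \<odot>\<^bsub>F\<^esub> Z l) k)"
          unfolding W_def by (rule free_module_finsum) (use k ZF co1[OF j] in auto)
        also have "\<dots> = (\<Oplus>l\<in>{..<r 2}. z k l \<otimes> d 1 (?b2 l) j)"
          by (rule finsum_cong'[OF refl]) (use k zc co1[OF j] in \<open>auto simp: Z_def m_comm\<close>)
        also have "\<dots> = d 1 (z k) j"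
          using lin_expand[OF ring_module lin_comp[OF d1 coord_lin] z(1)[OF k], of j] j by simp
        finally show ?thesis .
      qed
      have dF: "Y j \<ominus>\<^bsub>F\<^esub> W \<in> carrier F" using Y(1)[OF j] WF by simp
      have "Y j \<ominus>\<^bsub>F\<^esub> W \<in> V"
        unfolding linked_pair.U_iff[OF swap s' dF] using z(2)[OF _ j] Wk Y(1)[OF j] WF by simp
      then have "f (Y j) = f W"
        using lin_minus[OF FF N f(1) Y(1)[OF j] WF] lin_closed[OF f(1)] Y(1)[OF j] WF
        by (simp add: a_kernel_iff N.M.minus_eq_zero_iff)
      also have "f W = (\<Oplus>\<^bsub>N\<^esub>l\<in>{..<r 2}. f (d 1 (?b2 l) j \<odot>\<^bsub>F\<^esub> Z l))"
        unfolding W_def by (rule lin_finsum[OF FF N f(1)]) (use ZF co1[OF j] in auto)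
      also have "\<dots> = (\<Oplus>\<^bsub>N\<^esub>l\<in>{..<r 2}. d 1 (?b2 l) j \<odot>\<^bsub>N\<^esub> f (Z l))"
        by (rule N.M.finsum_cong'[OF refl])
          (use ZF co1[OF j] lin_closed[OF f(1)] in \<open>auto simp: lin_smult[OF f(1)]\<close>)
      finally show ?thesis using Y(2)[OF j] by simp
    qed
    moreover have "f (Z l) \<in> carrier N" if "l < r 2" for l by (rule lin_closed[OF f(1) ZF[OF that]])
    ultimately show "\<exists>z. (\<forall>l<r 2. z l \<in> carrier N) \<and>
        (\<forall>j<r 1. y j = (\<Oplus>\<^bsub>N\<^esub>l\<in>{..<r 2}. d 1 (?b2 l) j \<odot>\<^bsub>N\<^esub> z l))"
      by (intro exI[of _ "\<lambda>l. f (Z l)"]) blast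
  qed
qed

text \<open>Up to an element outside \<open>p\<close>, \<open>h\<close> retracts \<open>F\<close> onto \<open>U\<close>.\<close>

lemma Tor_splitting:
  assumes tor: "zero_module (Tor R 1 M N)" and fg: "fin_gen R M"
    and p: "primeideal p R" "minimal_prime R p" and gor: "gorenstein_local_ring (localization R p)"
  obtains s h where "s \<in> carrier R - p" and "h \<in> lin_maps R F F"
    and "\<And>x. x \<in> carrier F \<Longrightarrow> h x \<in> U" and "\<And>u. u \<in> U \<Longrightarrow> h u = s \<odot>\<^bsub>F\<^esub> u"
proof -
  interpret p: at_prime R p
    by (rule at_prime.intro[OF comm_noetherian_ring_axioms at_prime_axioms.intro[OF p(1)]])
  obtain r d where sr: "some_resolution R M = (r, d)" by (metis prod.exhaust)
  note res = some_resolution_free[OF M fg sr]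
  from free_resolutionD(3)[OF res] obtain c where c: "c \<in> lin_maps R (free_rank R (r 0)) M"
    "c ` carrier (free_rank R (r 0)) = carrier M"
    and ker: "d 0 ` carrier (free_rank R (r 1)) = a_kernel (free_rank R (r 0)) M c" by (elim exE conjE)
  let ?F0 = "free_rank R (r 0)" and ?F1 = "free_rank R (r 1)" and ?F2 = "free_rank R (r 2)"
  let ?b0 = "basis_vec R {..<r 0}" and ?b1 = "basis_vec R {..<r 1}" and ?b2 = "basis_vec R {..<r 2}"
  have d0: "d 0 \<in> lin_maps R ?F1 ?F0" using free_resolutionD(1)[OF res, of 0] by simp
  have d1: "d 1 \<in> lin_maps R ?F2 ?F1" using free_resolutionD(1)[OF res, of 1] by (simp add: numeral_2_eq_2)
  have ex: "d 1 ` carrier ?F2 = a_kernel ?F1 ?F0 (d 0)"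
    using free_resolutionD(2)[OF res, of 0] by (simp add: numeral_2_eq_2)
  note FF = free_module_is_module
  interpret F0: module R ?F0 by (rule FF)
  interpret F1: module R ?F1 by (rule FF)
  obtain g h where g: "g \<in> lin_maps R ?F0 F" and h: "h \<in> lin_maps R F ?F0"
    and eg: "\<And>x. x \<in> carrier ?F0 \<Longrightarrow> e (g x) = c x" and ch: "\<And>x. x \<in> carrier F \<Longrightarrow> c (h x) = e x"
    by (rule compare_cover[OF c]) (rule that)
  \<comment> \<open>The first differential carried into \<open>U\<close> by the comparison
    map.\<close>
  define u where "u x = g (d 0 x)" for x
  have u: "u \<in> lin_maps R ?F1 F" unfolding u_def by (rule lin_comp[OF d0 g])
  have uU: "u x \<in> U" if x: "x \<in> carrier ?F1" for x
  proof -
    have "d 0 x \<in> a_kernel ?F0 M c" unfolding ker[symmetric] using x by blast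
    then show ?thesis using eg[OF lin_closed[OF d0 x]] lin_closed[OF u x] by (simp add: a_kernel_iff u_def)
  qed
  have co0: "d 0 (?b1 j) i \<in> carrier R" if "i < r 0" for i j
    using free_module_coord[OF lin_closed[OF d0 basis_vec_closed]] that by simp
  have co1: "d 1 (?b2 j) i \<in> carrier R" if "i < r 1" for i j
    using free_module_coord[OF lin_closed[OF d1 basis_vec_closed]] that by simp
  \<comment> \<open>A tuple \<open>Y\<close> over \<open>F\<close> represents r 1 elements of
    \<open>N\<close>, an element of the tensored resolution in degree one. Its image in r 0 copies
    of \<open>N\<close> is represented by \<open>X Y\<close>, and the summand \<open>v\<close> in
    \<open>G\<close> accounts for the ambiguity modulo \<open>V\<close>. The value
    \<open>B Y\<close> is the pairing of U with N applied to the element, so \<open>G\<close> is to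
    be the graph of the functional taking the image to that value.\<close>
  define X :: "(nat \<Rightarrow> nat \<Rightarrow> 'a) \<Rightarrow> nat \<Rightarrow> nat \<Rightarrow> 'a" where "X Y i = (\<Oplus>\<^bsub>F\<^esub>j\<in>{..<r 1}. d 0 (?b1 j) i \<odot>\<^bsub>F\<^esub> Y j)" for Y i
  define B :: "(nat \<Rightarrow> nat \<Rightarrow> 'a) \<Rightarrow> 'a" where "B Y = (\<Oplus>j\<in>{..<r 1}. dot n (u (?b1 j)) (Y j))" for Y
  define ok :: "(nat \<Rightarrow> nat \<Rightarrow> 'a) \<Rightarrow> (nat \<Rightarrow> nat \<Rightarrow> 'a) \<Rightarrow> bool" where "ok Y v \<longleftrightarrow> (\<forall>j. Y j \<in> carrier F) \<and> (\<forall>i. v i \<in> V)" for Y v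
  define G where "G = {(\<lambda>(i, k). X Y i k \<oplus> v i k, B Y) | Y v. ok Y v}"
  have okD: "Y j \<in> carrier F" "v i \<in> V" "v i \<in> carrier F" if "ok Y v" for Y v i j
    using that VF by (auto simp: ok_def)
  have V_sub: "submodule V R F" by (rule linked_pair.U_sub[OF swap])
  note VE = submodule_mem[OF V_sub F.module_axioms]
  have XF: "X Y i \<in> carrier F" if "i < r 0" "\<And>j. Y j \<in> carrier F" for Y i
    unfolding X_def by (rule F.M.finsum_closed) (use that co0 in auto)
  have uF: "u (?b1 j) \<in> carrier F" for j by (rule lin_closed[OF u basis_vec_closed])
  have dotR: "dot n (u (?b1 j)) y \<in> carrier R" if "y \<in> carrier F" for j y by (rule dot_closed[OF uF that])
  have BR: "B Y \<in> carrier R" if "\<And>j. Y j \<in> carrier F" for Y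
    unfolding B_def by (rule finsum_closed) (use that dotR in auto)
  have X_add: "X (\<lambda>j. Y j \<oplus>\<^bsub>F\<^esub> Y' j) i = X Y i \<oplus>\<^bsub>F\<^esub> X Y' i"
    if i: "i < r 0" and Y: "\<And>j. Y j \<in> carrier F" "\<And>j. Y' j \<in> carrier F" for Y Y' i
  proof -
    have "X (\<lambda>j. Y j \<oplus>\<^bsub>F\<^esub> Y' j) i = (\<Oplus>\<^bsub>F\<^esub>j\<in>{..<r 1}. d 0 (?b1 j) i \<odot>\<^bsub>F\<^esub> Y j \<oplus>\<^bsub>F\<^esub> d 0 (?b1 j) i \<odot>\<^bsub>F\<^esub> Y' j)"
      unfolding X_def by (rule F.M.finsum_cong'[OF refl]) (use Y co0[OF i] in \<open>auto simp: F.smult_r_distr\<close>)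
    also have "\<dots> = X Y i \<oplus>\<^bsub>F\<^esub> X Y' i" unfolding X_def by (rule F.M.finsum_addf) (use Y co0[OF i] in auto)
    finally show ?thesis .
  qed
  have X_smult: "X (\<lambda>j. a \<odot>\<^bsub>F\<^esub> Y j) i = a \<odot>\<^bsub>F\<^esub> X Y i"
    if i: "i < r 0" and Y: "\<And>j. Y j \<in> carrier F" and a: "a \<in> carrier R" for Y a i
  proof -
    have "X (\<lambda>j. a \<odot>\<^bsub>F\<^esub> Y j) i = (\<Oplus>\<^bsub>F\<^esub>j\<in>{..<r 1}. a \<odot>\<^bsub>F\<^esub> (d 0 (?b1 j) i \<odot>\<^bsub>F\<^esub> Y j))"
      unfolding X_def by (rule F.M.finsum_cong'[OF refl])
        (use Y co0[OF i] a in \<open>auto simp: F.smult_assoc1[symmetric] m_comm\<close>)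
    also have "\<dots> = a \<odot>\<^bsub>F\<^esub> X Y i"
      unfolding X_def by (rule F.finsum_smult_ldistr[symmetric]) (use Y a co0[OF i] in auto)
    finally show ?thesis .
  qed
  have B_add: "B (\<lambda>j. Y j \<oplus>\<^bsub>F\<^esub> Y' j) = B Y \<oplus> B Y'"
    if Y: "\<And>j. Y j \<in> carrier F" "\<And>j. Y' j \<in> carrier F" for Y Y'
  proof -
    have "B (\<lambda>j. Y j \<oplus>\<^bsub>F\<^esub> Y' j) = (\<Oplus>j\<in>{..<r 1}. dot n (u (?b1 j)) (Y j) \<oplus> dot n (u (?b1 j)) (Y' j))"
      unfolding B_def by (rule finsum_cong'[OF refl]) (use Y dotR lin_add[OF dot_lin_right[OF uF]] in auto)
    also have "\<dots> = B Y \<oplus> B Y'" unfolding B_def by (rule finsum_addf) (use Y dotR in auto)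
    finally show ?thesis .
  qed
  have B_smult: "B (\<lambda>j. a \<odot>\<^bsub>F\<^esub> Y j) = a \<otimes> B Y"
    if Y: "\<And>j. Y j \<in> carrier F" and a: "a \<in> carrier R" for Y a
  proof -
    have "B (\<lambda>j. a \<odot>\<^bsub>F\<^esub> Y j) = (\<Oplus>j\<in>{..<r 1}. a \<otimes> dot n (u (?b1 j)) (Y j))"
      unfolding B_def by (rule finsum_cong'[OF refl]) (use Y a dotR lin_smult[OF dot_lin_right[OF uF] a] in auto)
    also have "\<dots> = a \<otimes> B Y" unfolding B_def by (rule finsum_rdistr[symmetric]) (use Y a dotR in auto)
    finally show ?thesis .
  qed
  have B_V: "B Y = \<zero>" if Y: "\<And>j. Y j \<in> V" for Y
  proof -
    have "B Y = (\<Oplus>j\<in>{..<r 1}. \<zero>)" unfolding B_def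
      by (rule finsum_cong'[OF refl]) (use dot_UV[OF uU[OF basis_vec_closed] Y] in auto)
    then show ?thesis by simp
  qed
  \<comment> \<open>Here the vanishing of Tor enters: if the image of \<open>Y\<close> is zero
    modulo \<open>V\<close>, then \<open>Y\<close> is a boundary modulo \<open>V\<close>, and
    \<open>B\<close> kills boundaries because \<open>d 0\<close> after \<open>d 1\<close> is zero.
    So the image alone determines \<open>B Y\<close>.\<close>
  have single: "B Y = \<zero>" if ok: "ok Y v" and z: "\<And>i k. i < r 0 \<Longrightarrow> k < n \<Longrightarrow> X Y i k \<oplus> v i k = \<zero>" for Y v
  proof -
    have YF: "Y j \<in> carrier F" and vV: "v i \<in> V" and vF: "v i \<in> carrier F" for i j using okD[OF ok] by simp_all
    define y where "y j = f (Y j)" for j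
    have yN: "y j \<in> carrier N" for j unfolding y_def by (rule lin_closed[OF f(1) YF])
    have "(\<Oplus>\<^bsub>N\<^esub>j\<in>{..<r 1}. d 0 (?b1 j) i \<odot>\<^bsub>N\<^esub> y j) = \<zero>\<^bsub>N\<^esub>" if i: "i < r 0" for i
    proof -
      have xF: "X Y i \<in> carrier F" by (rule XF[OF i YF])
      have "X Y i \<oplus>\<^bsub>F\<^esub> v i = \<zero>\<^bsub>F\<^esub>"
        by (rule free_module_eqI[OF F.M.a_closed[OF xF vF] F.M.zero_closed]) (simp add: z[OF i])
      then have "X Y i = \<ominus>\<^bsub>F\<^esub> v i" using xF vF[of i] by (metis F.M.minus_equality)
      then have "X Y i \<in> V" using VE(4)[OF vV] by simp
      then have "f (X Y i) = \<zero>\<^bsub>N\<^esub>" by (simp add: a_kernel_iff)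
      moreover have "f (X Y i) = (\<Oplus>\<^bsub>N\<^esub>j\<in>{..<r 1}. f (d 0 (?b1 j) i \<odot>\<^bsub>F\<^esub> Y j))"
        unfolding X_def by (rule lin_finsum[OF FF N f(1)]) (use YF co0[OF i] in auto)
      moreover have "\<dots> = (\<Oplus>\<^bsub>N\<^esub>j\<in>{..<r 1}. d 0 (?b1 j) i \<odot>\<^bsub>N\<^esub> y j)"
        by (rule N.M.finsum_cong'[OF refl])
          (use YF yN co0[OF i] in \<open>auto simp: lin_smult[OF f(1)] y_def\<close>)
      ultimately show ?thesis by simp
    qed
    then have "\<exists>z. (\<forall>l<r 2. z l \<in> carrier N) \<and> (\<forall>j<r 1. y j = (\<Oplus>\<^bsub>N\<^esub>l\<in>{..<r 2}. d 1 (?b2 l) j \<odot>\<^bsub>N\<^esub> z l))"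
      using yN by (intro tor[unfolded zero_Tor_iff[OF sr res N], rule_format, of y]) simp
    then obtain z where zN: "\<forall>l<r 2. z l \<in> carrier N"
      and yz: "\<forall>j<r 1. y j = (\<Oplus>\<^bsub>N\<^esub>l\<in>{..<r 2}. d 1 (?b2 l) j \<odot>\<^bsub>N\<^esub> z l)" by (elim exE conjE)
    have "\<forall>l. \<exists>x. l < r 2 \<longrightarrow> x \<in> carrier F \<and> f x = z l"
    proof
      fix l
      show "\<exists>x. l < r 2 \<longrightarrow> x \<in> carrier F \<and> f x = z l"
        proof (cases "l < r 2")
          case True
          then have "z l \<in> f ` carrier F" using zN f(2) by simp
          then obtain x where "x \<in> carrier F" "z l = f x" by (rule imageE)
          then show ?thesis by (intro exI[of _ x]) simp
        qed simp
    qed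
    from choice[OF this] obtain Z where Z: "\<And>l. l < r 2 \<Longrightarrow> Z l \<in> carrier F" "\<And>l. l < r 2 \<Longrightarrow> f (Z l) = z l"
      by blast
    define W where "W j = (\<Oplus>\<^bsub>F\<^esub>l\<in>{..<r 2}. d 1 (?b2 l) j \<odot>\<^bsub>F\<^esub> Z l)" for j
    have WF: "W j \<in> carrier F" if "j < r 1" for j unfolding W_def
      by (rule F.M.finsum_closed) (use Z co1[OF that] in auto)
    have WV: "Y j \<ominus>\<^bsub>F\<^esub> W j \<in> V" if j: "j < r 1" for j
    proof -
      have "f (W j) = (\<Oplus>\<^bsub>N\<^esub>l\<in>{..<r 2}. f (d 1 (?b2 l) j \<odot>\<^bsub>F\<^esub> Z l))"
        unfolding W_def by (rule lin_finsum[OF FF N f(1)]) (use Z co1[OF j] in auto)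
      also have "\<dots> = (\<Oplus>\<^bsub>N\<^esub>l\<in>{..<r 2}. d 1 (?b2 l) j \<odot>\<^bsub>N\<^esub> z l)"
        by (rule N.M.finsum_cong'[OF refl]) (use Z zN co1[OF j] in \<open>auto simp: lin_smult[OF f(1)]\<close>)
      finally have "f (W j) = f (Y j)" using yz j by (simp add: y_def)
      then show ?thesis
        using lin_minus[OF FF N f(1) YF WF[OF j]] YF[of j] WF[OF j] lin_closed[OF f(1) YF]
        by (simp add: a_kernel_iff N.M.minus_eq_zero_iff)
    qed
    have BYW: "dot n (u (?b1 j)) (Y j) = dot n (u (?b1 j)) (W j)" if j: "j < r 1" for j
      using lin_minus[OF FF ring_module dot_lin_right[OF uF] YF WF[OF j]]
        dot_UV[OF uU[OF basis_vec_closed] WV[OF j]] dotR[OF YF] dotR[OF WF[OF j]]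
      by (simp add: minus_eq_zero_iff)
    have duz: "(\<Oplus>j\<in>{..<r 1}. d 1 (?b2 l) j \<otimes> dot n (u (?b1 j)) (Z l)) = \<zero>" if l: "l < r 2" for l
    proof -
      have "d 1 (?b2 l) \<in> a_kernel ?F1 ?F0 (d 0)" unfolding ex[symmetric] by (rule imageI[OF basis_vec_closed])
      then have dd: "d 1 (?b2 l) \<in> carrier ?F1" "d 0 (d 1 (?b2 l)) = \<zero>\<^bsub>?F0\<^esub>" by (simp_all add: a_kernel_iff)
      have lin: "(\<lambda>x. dot n (u x) (Z l)) \<in> lin_maps R ?F1 (ring_as_module R)"
        by (rule lin_comp[OF u dot_lin_left[OF Z(1)[OF l]]])
      have "dot n (u (d 1 (?b2 l))) (Z l) = \<zero>"
        using dd(2) lin_zero[OF FF FF g] lin_zero[OF FF ring_module dot_lin_left[OF Z(1)[OF l]]]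
        by (simp add: u_def)
      then show ?thesis using lin_expand[OF ring_module lin dd(1)] by simp
    qed
    have "B Y = (\<Oplus>j\<in>{..<r 1}. \<Oplus>l\<in>{..<r 2}. d 1 (?b2 l) j \<otimes> dot n (u (?b1 j)) (Z l))"
      unfolding B_def
    proof (rule finsum_cong'[OF refl])
      show "(\<lambda>j. \<Oplus>l\<in>{..<r 2}. d 1 (?b2 l) j \<otimes> dot n (u (?b1 j)) (Z l)) \<in> {..<r 1} \<rightarrow> carrier R"
        using Z co1 dotR by (auto intro!: finsum_closed)
      fix j assume "j \<in> {..<r 1}"
      then have j: "j < r 1" by simp
      have "dot n (u (?b1 j)) (W j) = (\<Oplus>l\<in>{..<r 2}. dot n (u (?b1 j)) (d 1 (?b2 l) j \<odot>\<^bsub>F\<^esub> Z l))"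
        unfolding W_def using lin_finsum[OF FF ring_module dot_lin_right[OF uF], of "\<lambda>l. d 1 (?b2 l) j \<odot>\<^bsub>F\<^esub> Z l" "{..<r 2}"]
          Z co1[OF j] by (simp add: Pi_iff)
      also have "\<dots> = (\<Oplus>l\<in>{..<r 2}. d 1 (?b2 l) j \<otimes> dot n (u (?b1 j)) (Z l))"
        by (rule finsum_cong'[OF refl])
          (use Z co1[OF j] dotR lin_smult[OF dot_lin_right[OF uF]] in auto)
      finally show "dot n (u (?b1 j)) (Y j) = (\<Oplus>l\<in>{..<r 2}. d 1 (?b2 l) j \<otimes> dot n (u (?b1 j)) (Z l))"
        using BYW[OF j] by simp
    qed
    also have "\<dots> = (\<Oplus>l\<in>{..<r 2}. \<Oplus>j\<in>{..<r 1}. d 1 (?b2 l) j \<otimes> dot n (u (?b1 j)) (Z l))"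
      by (rule finsum_swap) (use Z co1 dotR in auto)
    also have "\<dots> = (\<Oplus>l\<in>{..<r 2}. \<zero>)" by (rule finsum_cong'[OF refl]) (use duz in auto)
    finally show ?thesis by simp
  qed
  let ?Idx = "{..<r 0} \<times> {..<n}"
  have GI: "(\<lambda>(i, k). X Y i k \<oplus> v i k, B Y) \<in> G" if "ok Y v" for Y v unfolding G_def using that by blast
  have VR: "x k \<in> carrier R" if "x \<in> carrier F" "k < n" for x k using free_module_coord[OF that(1)] that(2) by simp
  text \<open>Off the index set the graph is unconstrained, so pairs are only determined up to the
    following closure.\<close>
  define G' where "G' = {(x, b). (\<exists>x'. (x', b) \<in> G \<and> (\<forall>t\<in>?Idx. x t = x' t))}"
  have G'E: "\<exists>Y v. ok Y v \<and> b = B Y \<and> (\<forall>i<r 0. \<forall>k<n. x (i, k) = X Y i k \<oplus> v i k)" if "(x, b) \<in> G'" for x b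
  proof -
    obtain x' where "(x', b) \<in> G" "\<forall>t\<in>?Idx. x t = x' t" using \<open>(x, b) \<in> G'\<close> unfolding G'_def by blast
    then obtain Y v where "ok Y v" "b = B Y" "x' = (\<lambda>(i, k). X Y i k \<oplus> v i k)" unfolding G_def by blast
    then show ?thesis using \<open>\<forall>t\<in>?Idx. x t = x' t\<close> by auto
  qed
  have G'I: "(x, B Y) \<in> G'" if "ok Y v" "\<And>i k. i < r 0 \<Longrightarrow> k < n \<Longrightarrow> x (i, k) = X Y i k \<oplus> v i k" for x Y v
    unfolding G'_def using GI[OF that(1)] that(2)
    by (intro CollectI case_prodI exI[of _ "\<lambda>(i, k). X Y i k \<oplus> v i k"]) auto
  have "\<exists>s a. s \<in> carrier R - p \<and> a \<in> ?Idx \<rightarrow> carrier R \<and>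
      (\<forall>x b. (x, b) \<in> G' \<longrightarrow> (\<Oplus>t\<in>?Idx. a t \<otimes> x t) = s \<otimes> b)"
  proof (rule p.extend_functional[OF gor p(2)])
    show "finite ?Idx" by simp
    show "x \<in> ?Idx \<rightarrow> carrier R \<and> b \<in> carrier R" if G: "(x, b) \<in> G'" for x b
    proof -
      obtain Y v where Y: "ok Y v" "b = B Y" "\<forall>i<r 0. \<forall>k<n. x (i, k) = X Y i k \<oplus> v i k" using G'E[OF G] by blast
      have "x (i, k) \<in> carrier R" if "i < r 0" "k < n" for i k
        using Y(3) that VR[OF XF[OF that(1) okD(1)[OF Y(1)]] that(2)] VR[OF okD(3)[OF Y(1)] that(2)] by simp
      then show ?thesis using BR[OF okD(1)[OF Y(1)]] Y(2) by auto
    qed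
    show "((\<lambda>_. \<zero>), \<zero>) \<in> G'"
    proof -
      have ok0: "ok (\<lambda>_. \<zero>\<^bsub>F\<^esub>) (\<lambda>_. \<zero>\<^bsub>F\<^esub>)" using VE(2) by (simp add: ok_def)
      have "X (\<lambda>_. \<zero>\<^bsub>F\<^esub>) i = \<zero>\<^bsub>F\<^esub>" if "i < r 0" for i unfolding X_def
        using F.M.add.finprod_one_eqI[of "{..<r 1}" "\<lambda>j. d 0 (?b1 j) i \<odot>\<^bsub>F\<^esub> \<zero>\<^bsub>F\<^esub>"] co0[OF that] by simp
      moreover have "B (\<lambda>_. \<zero>\<^bsub>F\<^esub>) = \<zero>" by (rule B_V) (rule VE(2))
      ultimately show ?thesis using G'I[OF ok0, of "\<lambda>_. \<zero>"] by simp
    qed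
    show "((\<lambda>t. x t \<oplus> x' t), b \<oplus> b') \<in> G'" if G: "(x, b) \<in> G'" "(x', b') \<in> G'" for x b x' b'
    proof -
      obtain Y v where Y: "ok Y v" "b = B Y" "\<forall>i<r 0. \<forall>k<n. x (i, k) = X Y i k \<oplus> v i k" using G'E[OF G(1)] by blast
      obtain Y' v' where Y': "ok Y' v'" "b' = B Y'" "\<forall>i<r 0. \<forall>k<n. x' (i, k) = X Y' i k \<oplus> v' i k" using G'E[OF G(2)] by blast
      note YF = okD(1)[OF Y(1)] okD(1)[OF Y'(1)] and vF = okD(3)[OF Y(1)] okD(3)[OF Y'(1)]
      have ok2: "ok (\<lambda>j. Y j \<oplus>\<^bsub>F\<^esub> Y' j) (\<lambda>i. v i \<oplus>\<^bsub>F\<^esub> v' i)"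
        using Y(1) Y'(1) VE(3) unfolding ok_def by simp
      have "b \<oplus> b' = B (\<lambda>j. Y j \<oplus>\<^bsub>F\<^esub> Y' j)" unfolding Y(2) Y'(2) by (rule B_add[OF YF, symmetric])
      moreover have "((\<lambda>t. x t \<oplus> x' t), B (\<lambda>j. Y j \<oplus>\<^bsub>F\<^esub> Y' j)) \<in> G'"
      proof (rule G'I[OF ok2])
        fix i k assume ik: "i < r 0" "k < n"
        note R = VR[OF XF[OF ik(1) YF(1)] ik(2)] VR[OF XF[OF ik(1) YF(2)] ik(2)] VR[OF vF(1) ik(2)] VR[OF vF(2) ik(2)]
        show "x (i, k) \<oplus> x' (i, k) = X (\<lambda>j. Y j \<oplus>\<^bsub>F\<^esub> Y' j) i k \<oplus> (v i \<oplus>\<^bsub>F\<^esub> v' i) k"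
          unfolding X_add[OF ik(1) YF] using Y(3) Y'(3) ik R by (simp add: a_ac)
      qed
      ultimately show ?thesis by simp
    qed
    show "((\<lambda>t. a \<otimes> x t), a \<otimes> b) \<in> G'" if a: "a \<in> carrier R" and G: "(x, b) \<in> G'" for a x b
    proof -
      obtain Y v where Y: "ok Y v" "b = B Y" "\<forall>i<r 0. \<forall>k<n. x (i, k) = X Y i k \<oplus> v i k" using G'E[OF G] by blast
      note YF = okD(1)[OF Y(1)] and vF = okD(3)[OF Y(1)]
      have ok2: "ok (\<lambda>j. a \<odot>\<^bsub>F\<^esub> Y j) (\<lambda>i. a \<odot>\<^bsub>F\<^esub> v i)"
        using Y(1) VE(6) a unfolding ok_def by simp
      have "a \<otimes> b = B (\<lambda>j. a \<odot>\<^bsub>F\<^esub> Y j)" unfolding Y(2) by (rule B_smult[OF YF a, symmetric])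
      moreover have "((\<lambda>t. a \<otimes> x t), B (\<lambda>j. a \<odot>\<^bsub>F\<^esub> Y j)) \<in> G'"
      proof (rule G'I[OF ok2])
        fix i k assume ik: "i < r 0" "k < n"
        note R = VR[OF XF[OF ik(1) YF(1)] ik(2)] VR[OF vF(1) ik(2)]
        show "a \<otimes> x (i, k) = X (\<lambda>j. a \<odot>\<^bsub>F\<^esub> Y j) i k \<oplus> (a \<odot>\<^bsub>F\<^esub> v i) k"
          unfolding X_smult[OF ik(1) YF a] using Y(3) ik R a by (simp add: r_distr)
      qed
      ultimately show ?thesis by simp
    qed
    show "b = \<zero>" if G: "(x, b) \<in> G'" and z: "\<forall>t\<in>?Idx. x t = \<zero>" for x b
    proof -
      obtain Y v where Y: "ok Y v" "b = B Y" "\<forall>i<r 0. \<forall>k<n. x (i, k) = X Y i k \<oplus> v i k" using G'E[OF G] by blast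
      show ?thesis unfolding Y(2)
      proof (rule single[OF Y(1)])
        fix i k assume "i < r 0" "k < n"
        then show "X Y i k \<oplus> v i k = \<zero>" using Y(3) z by force
      qed
    qed
  qed
  then obtain s a where s: "s \<in> carrier R - p" and a: "a \<in> ?Idx \<rightarrow> carrier R"
    and sa: "\<And>x b. (x, b) \<in> G' \<Longrightarrow> (\<Oplus>t\<in>?Idx. a t \<otimes> x t) = s \<otimes> b" by blast
  have sR: "s \<in> carrier R" using s by simp
  \<comment> \<open>The coefficients of the extended functional, arranged as vectors of
    \<open>F\<close>. They will be the values of a map \<open>h'\<close> on the cover of the
    resolution.\<close>
  define H where "H i = (\<lambda>k\<in>{..<n}. if i < r 0 then a (i, k) else \<zero>)" for i
  have HF: "H i \<in> carrier F" for i using a by (auto simp: free_rank_mem H_def)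
  have ext: "(\<Oplus>i\<in>{..<r 0}. dot n (H i) (X Y i \<oplus>\<^bsub>F\<^esub> v i)) = s \<otimes> B Y" if ok: "ok Y v" for Y v
  proof -
    note YF = okD(1)[OF ok] and vF = okD(3)[OF ok]
    have xR: "(X Y i \<oplus>\<^bsub>F\<^esub> v i) k \<in> carrier R" if "i < r 0" "k < n" for i k
      using VR[OF F.M.a_closed[OF XF[OF that(1) YF] vF] that(2)] .
    have aR: "a (i, k) \<in> carrier R" if "i < r 0" "k < n" for i k using a that by auto
    have double: "(\<Oplus>t\<in>A \<times> {..<n}. q t) = (\<Oplus>i\<in>A. \<Oplus>k\<in>{..<n}. q (i, k))"
      if "finite A" "\<And>i k. i \<in> A \<Longrightarrow> k < n \<Longrightarrow> q (i, k) \<in> carrier R" for A :: "nat set" and q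
      using that
    proof (induction A)
      case (insert b A)
      have "insert b A \<times> {..<n} = (Pair b ` {..<n}) \<union> (A \<times> {..<n})" by auto
      moreover have "(\<Oplus>t\<in>(Pair b ` {..<n}) \<union> (A \<times> {..<n}). q t) =
          (\<Oplus>t\<in>Pair b ` {..<n}. q t) \<oplus> (\<Oplus>t\<in>A \<times> {..<n}. q t)"
        by (rule finsum_Un_disjoint) (use insert in auto)
      moreover have "(\<Oplus>t\<in>Pair b ` {..<n}. q t) = (\<Oplus>k\<in>{..<n}. q (b, k))"
        by (rule finsum_reindex) (use insert in \<open>auto simp: inj_on_def\<close>)
      ultimately show ?case using insert by (simp add: finsum_closed Pi_iff)
    qed simp
    have "(\<lambda>(i, k). X Y i k \<oplus> v i k, B Y) \<in> G'" by (rule G'I[OF ok]) simp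
    from sa[OF this] have "s \<otimes> B Y = (\<Oplus>t\<in>?Idx. a t \<otimes> (case t of (i, k) \<Rightarrow> X Y i k \<oplus> v i k))" by simp
    also have "\<dots> = (\<Oplus>i\<in>{..<r 0}. \<Oplus>k\<in>{..<n}. a (i, k) \<otimes> (X Y i k \<oplus> v i k))"
      by (subst double) (use aR xR in auto)
    also have "\<dots> = (\<Oplus>i\<in>{..<r 0}. dot n (H i) (X Y i \<oplus>\<^bsub>F\<^esub> v i))"
    proof (rule finsum_cong'[OF refl])
      show "(\<lambda>i. dot n (H i) (X Y i \<oplus>\<^bsub>F\<^esub> v i)) \<in> {..<r 0} \<rightarrow> carrier R"
        using dot_closed[OF HF F.M.a_closed[OF XF[OF _ YF] vF]] by simp
      fix i assume "i \<in> {..<r 0}"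
      then have i: "i < r 0" by simp
      show "(\<Oplus>k\<in>{..<n}. a (i, k) \<otimes> (X Y i k \<oplus> v i k)) = dot n (H i) (X Y i \<oplus>\<^bsub>F\<^esub> v i)"
        unfolding dot_def by (rule finsum_cong'[OF refl]) (use i aR xR in \<open>auto simp: H_def\<close>)
    qed
    finally show ?thesis by simp
  qed
  \<comment> \<open>With \<open>Y\<close> zero and one entry \<open>w\<close> from \<open>V\<close>,
    the extension formula has value zero; so \<open>H i\<close> is orthogonal to \<open>V\<close>
    and lies in \<open>U\<close>.\<close>
  have HU: "H i \<in> U" if i: "i < r 0" for i
  proof -
    have "dot n (H i) w = \<zero>" if w: "w \<in> V" for w
    proof -
      define v where "v k = (if k = i then w else \<zero>\<^bsub>F\<^esub>)" for k
      have ok: "ok (\<lambda>_. \<zero>\<^bsub>F\<^esub>) v" using VE(2) w by (simp add: ok_def v_def)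
      have X0: "X (\<lambda>_. \<zero>\<^bsub>F\<^esub>) k = \<zero>\<^bsub>F\<^esub>" if "k < r 0" for k unfolding X_def
        using F.M.add.finprod_one_eqI[of "{..<r 1}" "\<lambda>j. d 0 (?b1 j) k \<odot>\<^bsub>F\<^esub> \<zero>\<^bsub>F\<^esub>"] co0[OF that] by simp
      have "(\<Oplus>k\<in>{..<r 0}. dot n (H k) (X (\<lambda>_. \<zero>\<^bsub>F\<^esub>) k \<oplus>\<^bsub>F\<^esub> v k)) = (\<Oplus>k\<in>{..<r 0}. if i = k then dot n (H k) w else \<zero>)"
        by (rule finsum_cong'[OF refl])
          (use X0 VF[OF w] dot_closed[OF HF VF[OF w]] lin_zero[OF FF ring_module dot_lin_right[OF HF]]
            in \<open>auto simp: v_def\<close>)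
      also have "\<dots> = dot n (H i) w"
        by (rule finsum_singleton) (use i dot_closed[OF HF VF[OF w]] in auto)
      finally have "dot n (H i) w = s \<otimes> B (\<lambda>_. \<zero>\<^bsub>F\<^esub>)" using ext[OF ok] by simp
      moreover have "B (\<lambda>_. \<zero>\<^bsub>F\<^esub>) = \<zero>" by (rule B_V) (rule VE(2))
      ultimately show ?thesis using sR by simp
    qed
    then show ?thesis unfolding U_perp perp_def using HF dot_comm[OF HF VF] by auto
  qed
  define h' where "h' = flin F {..<r 0} H"
  have HFun: "H \<in> {..<r 0} \<rightarrow> carrier F" using HF by simp
  have h': "h' \<in> lin_maps R ?F0 F" unfolding h'_def by (rule flin_lin[OF FF HFun])
  have h'b: "h' (?b0 i) = H i" if "i < r 0" for i
    unfolding h'_def using flin_basis[OF FF HFun] that by simp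
  have h'U: "h' x \<in> U" if x: "x \<in> carrier ?F0" for x
  proof -
    have "(\<Oplus>\<^bsub>F\<^esub>i\<in>{..<r 0}. x i \<odot>\<^bsub>F\<^esub> h' (?b0 i)) \<in> U"
      by (rule submodule_finsum[OF U_sub FF], rule submodule_mem(6)[OF U_sub FF])
        (use free_module_coord[OF x] h'b HU in auto)
    then show ?thesis using lin_expand[OF FF h' x] by simp
  qed
  \<comment> \<open>With a single entry \<open>w\<close> in \<open>Y\<close>, the extension formula
    says that both sides have the same dot product with \<open>w\<close>. As \<open>w\<close> is
    arbitrary, they agree.\<close>
  have main: "h' (d 0 x) = s \<odot>\<^bsub>F\<^esub> u x" if x: "x \<in> carrier ?F1" for x
  proof (rule lin_ext[OF FF lin_comp[OF d0 h'] lin_scale[OF FF FF u sR] _ x])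
    fix j assume "j \<in> {..<r 1}"
    then have j: "j < r 1" by simp
    let ?dj = "d 0 (?b1 j)"
    have djF: "?dj \<in> carrier ?F0" by (rule lin_closed[OF d0 basis_vec_closed])
    have hF: "h' ?dj \<in> carrier F" by (rule lin_closed[OF h' djF])
    have eq: "dot n (h' ?dj) w = dot n (s \<odot>\<^bsub>F\<^esub> u (?b1 j)) w" if w: "w \<in> carrier F" for w
    proof -
      define Y where "Y k = (if k = j then w else \<zero>\<^bsub>F\<^esub>)" for k
      have ok: "ok Y (\<lambda>_. \<zero>\<^bsub>F\<^esub>)" using VE(2) w by (simp add: ok_def Y_def)
      have XY: "X Y i = ?dj i \<odot>\<^bsub>F\<^esub> w" if i: "i < r 0" for i
      proof -
        have "X Y i = (\<Oplus>\<^bsub>F\<^esub>k\<in>{..<r 1}. if j = k then d 0 (?b1 k) i \<odot>\<^bsub>F\<^esub> w else \<zero>\<^bsub>F\<^esub>)"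
          unfolding X_def by (rule F.M.finsum_cong'[OF refl]) (use w co0[OF i] in \<open>auto simp: Y_def\<close>)
        also have "\<dots> = ?dj i \<odot>\<^bsub>F\<^esub> w" by (rule F.M.finsum_singleton) (use j w co0[OF i] in auto)
        finally show ?thesis .
      qed
      have BY: "B Y = dot n (u (?b1 j)) w"
      proof -
        have "B Y = (\<Oplus>k\<in>{..<r 1}. if j = k then dot n (u (?b1 k)) w else \<zero>)"
          unfolding B_def by (rule finsum_cong'[OF refl])
            (use dotR[OF w] lin_zero[OF FF ring_module dot_lin_right[OF uF]] in \<open>auto simp: Y_def\<close>)
        also have "\<dots> = dot n (u (?b1 j)) w" by (rule finsum_singleton) (use j dotR[OF w] in auto)
        finally show ?thesis .
      qed
      have lin: "(\<lambda>x. dot n (h' x) w) \<in> lin_maps R ?F0 (ring_as_module R)"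
        by (rule lin_comp[OF h' dot_lin_left[OF w]])
      have "dot n (h' ?dj) w = (\<Oplus>i\<in>{..<r 0}. ?dj i \<otimes> dot n (h' (?b0 i)) w)"
        using lin_expand[OF ring_module lin djF] by simp
      also have "\<dots> = (\<Oplus>i\<in>{..<r 0}. dot n (H i) (X Y i \<oplus>\<^bsub>F\<^esub> \<zero>\<^bsub>F\<^esub>))"
        by (rule finsum_cong'[OF refl])
          (use h'b XY w co0 dot_closed[OF HF] lin_smult[OF dot_lin_right[OF HF]] in auto)
      also have "\<dots> = s \<otimes> dot n (u (?b1 j)) w" using ext[OF ok] BY by simp
      also have "\<dots> = dot n (s \<odot>\<^bsub>F\<^esub> u (?b1 j)) w"
        using lin_smult[OF dot_lin_left[OF w] sR uF] by simp
      finally show ?thesis .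
    qed
    show "h' ?dj = s \<odot>\<^bsub>F\<^esub> u (?b1 j)"
    proof (rule free_module_eqI[OF hF F.smult_closed[OF sR uF]])
      fix i assume i: "i \<in> {..<n}"
      have "dot n (bv i) (h' ?dj) = dot n (bv i) (s \<odot>\<^bsub>F\<^esub> u (?b1 j))"
        using eq[OF basis_vec_closed] dot_comm[OF basis_vec_closed hF] dot_comm[OF basis_vec_closed F.smult_closed[OF sR uF]]
        by simp
      then show "h' ?dj i = (s \<odot>\<^bsub>F\<^esub> u (?b1 j)) i"
        using dot_basis_left[OF hF] dot_basis_left[OF F.smult_closed[OF sR uF]] i by (simp del: free_module_ops)
    qed
  qed
  \<comment> \<open>On \<open>U\<close> the composite of \<open>h\<close> and \<open>h'\<close> is s
    times the composite of \<open>h\<close> and \<open>g\<close>, not s times the identity. The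
    discrepancy \<open>D\<close> has values in \<open>U\<close>, so s D can be subtracted without
    leaving \<open>U\<close>.\<close>
  define D where "D x = g (h x) \<ominus>\<^bsub>F\<^esub> x" for x
  have gh: "(\<lambda>x. g (h x)) \<in> lin_maps R F F" by (rule lin_comp[OF h g])
  have D: "D \<in> lin_maps R F F" unfolding D_def by (rule lin_diff[OF FF FF gh lin_id])
  have DU: "D x \<in> U" if x: "x \<in> carrier F" for x
    using lin_minus[OF FF M e(1) lin_closed[OF gh x] x] lin_closed[OF D x] eg[OF lin_closed[OF h x]] ch[OF x]
      lin_closed[OF e(1) x]
    by (simp add: a_kernel_iff D_def M.M.minus_eq_zero_iff)
  have hh': "(\<lambda>x. h' (h x)) \<in> lin_maps R F F" by (rule lin_comp[OF h h'])
  show thesis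
  proof (rule that[OF s])
    show "(\<lambda>x. h' (h x) \<ominus>\<^bsub>F\<^esub> s \<odot>\<^bsub>F\<^esub> D x) \<in> lin_maps R F F"
      by (rule lin_diff[OF FF FF hh' lin_scale[OF FF FF D sR]])
    show "h' (h x) \<ominus>\<^bsub>F\<^esub> s \<odot>\<^bsub>F\<^esub> D x \<in> U" if x: "x \<in> carrier F" for x
      by (rule submodule_mem(5)[OF U_sub FF h'U[OF lin_closed[OF h x]] submodule_mem(6)[OF U_sub FF sR DU[OF x]]])
    fix w assume w: "w \<in> U"
    have wF: "w \<in> carrier F" by (rule UF[OF w])
    have "h w \<in> a_kernel ?F0 M c" using ch[OF wF] lin_closed[OF h wF] w by (simp add: a_kernel_iff)
    then obtain x where x: "x \<in> carrier ?F1" "h w = d 0 x" unfolding ker[symmetric] by blast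
    have ghw: "g (h w) \<in> carrier F" by (rule lin_closed[OF gh wF])
    have "h' (h w) = s \<odot>\<^bsub>F\<^esub> g (h w)" using main[OF x(1)] x(2) by (simp add: u_def)
    then have "h' (h w) \<ominus>\<^bsub>F\<^esub> s \<odot>\<^bsub>F\<^esub> D w = s \<odot>\<^bsub>F\<^esub> (g (h w) \<ominus>\<^bsub>F\<^esub> D w)"
      using ghw wF lin_closed[OF D wF] sR by (simp add: a_minus_def F.smult_r_distr F.smult_r_minus)
    also have "g (h w) \<ominus>\<^bsub>F\<^esub> D w = w"
      using ghw wF by (simp add: D_def a_minus_def F.M.minus_add F.M.a_assoc[symmetric] F.M.r_neg)
    finally show "h' (h w) \<ominus>\<^bsub>F\<^esub> s \<odot>\<^bsub>F\<^esub> D w = s \<odot>\<^bsub>F\<^esub> w" .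
  qed
qed

lemma Tor_separated:
  assumes gor: "generically_gorenstein R" and fg: "fin_gen R M"
    and lnk: "linked R I J" and tor: "zero_module (Tor R 1 M N)"
  shows separated
proof (rule separatedI)
  fix p assume pA: "p \<in> Ass R (ring_as_module R)" and p: "minimal_prime R p" "primeideal p R"
    and IJ: "I \<subseteq> p" "J \<subseteq> p"
  have "gorenstein_local_ring (localization R p)" using gor pA by (simp add: generically_gorenstein_def)
  from Tor_splitting[OF tor fg p(2,1) this] obtain s h where s: "s \<in> carrier R - p"
    and h: "h \<in> lin_maps R F F" "\<And>x. x \<in> carrier F \<Longrightarrow> h x \<in> U" "\<And>u. u \<in> U \<Longrightarrow> h u = s \<odot>\<^bsub>F\<^esub> u" by metis
  have sR: "s \<in> carrier R" using s by simp
  have hU: "h (bv j) \<in> U" for j by (rule h(2)[OF basis_vec_closed])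
  have hp: "h (bv j) i \<in> p" if i: "i < n" for i j
  proof -
    have hR: "h (bv j) i \<in> carrier R" by (rule U_coord[OF hU i])
    \<comment> \<open>Linkage enters here: the entries of \<open>h\<close> are coordinates of
      vectors in \<open>U\<close>, hence killed by \<open>J\<close>, and (0 : J) = I is contained in
      \<open>p\<close>.\<close>
    have "h (bv j) i \<in> zero_colon R J"
      unfolding zero_colon_def
      using J_kills_U[OF _ hU i] hR m_comm[OF hR] linked_pair.I_carrier[OF swap] by auto
    then show ?thesis using lnk IJ(1) unfolding linked_def by blast
  qed
  obtain x where x: "x \<in> carrier R" "{r \<in> carrier R. r \<otimes> x \<in> J} = p"
    by (rule minimal_prime_colon[OF p(1) linked_pair.I_ideal[OF swap] IJ(2)]) (rule that)
  have hxJ: "h (bv j) i \<otimes> x \<in> J" if "i < n" for i j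
  proof -
    have "h (bv j) i \<in> {r \<in> carrier R. r \<otimes> x \<in> J}" unfolding x(2) by (rule hp[OF that])
    then show ?thesis by simp
  qed
  have "s \<otimes> x \<in> J"
  proof (rule J_iff)
    show "s \<otimes> x \<in> carrier R" using sR x by simp
    fix u i assume u: "u \<in> U" and i: "i < n"
    have uR: "u j \<in> carrier R" if "j < n" for j by (rule U_coord[OF u that])
    have hR: "h (bv j) i \<in> carrier R" for j by (rule U_coord[OF hU i])
    have hl: "(\<lambda>u. h u i) \<in> lin_maps R F (ring_as_module R)"
      by (rule lin_comp[OF h(1) coord_lin]) (use i in simp)
    have "s \<otimes> u i = h u i" using h(3)[OF u] i by simp
    also have "\<dots> = (\<Oplus>j\<in>{..<n}. u j \<otimes> h (bv j) i)" using lin_expand[OF ring_module hl UF[OF u]] by simp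
    finally have "x \<otimes> (s \<otimes> u i) = x \<otimes> (\<Oplus>j\<in>{..<n}. u j \<otimes> h (bv j) i)" by simp
    also have "\<dots> = (\<Oplus>j\<in>{..<n}. x \<otimes> (u j \<otimes> h (bv j) i))"
      by (rule finsum_rdistr) (use uR hR x in auto)
    also have "\<dots> = (\<Oplus>j\<in>{..<n}. \<zero>)"
    proof (rule finsum_cong'[OF refl])
      fix j assume "j \<in> {..<n}"
      then have j: "j < n" by simp
      have "x \<otimes> (u j \<otimes> h (bv j) i) = (h (bv j) i \<otimes> x) \<otimes> u j" using uR[OF j] hR x(1) by (simp add: m_ac)
      then show "x \<otimes> (u j \<otimes> h (bv j) i) = \<zero>" using J_kills_U[OF hxJ[OF i] u j] by simp
    qed simp
    finally show "(s \<otimes> x) \<otimes> u i = \<zero>" using sR x(1) uR[OF i] by (simp add: m_ac)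
  qed
  then have "s \<in> {r \<in> carrier R. r \<otimes> x \<in> J}" using sR by simp
  then show False unfolding x(2) using s by simp
qed

end

section \<open>Freeness over the quotient ring and vanishing of Ext\<close>

text \<open>Localized at \<open>p\<close>, the ideal \<open>K\<close> is a nonzero finitely
  generated module and has a maximal submodule. Its contraction is a maximal \<open>W\<close> among
  the proper subideals of \<open>K\<close> saturated with respect to elements outside
  \<open>p\<close>. An element \<open>b\<close> of \<open>K\<close> outside \<open>W\<close>
  generates \<open>K\<close> modulo \<open>W\<close> up to a multiplier \<open>s\<close>. If s a = w
  + r b, then \<open>a\<close> is sent to r m, which is well defined because (W : b) \<subseteq> p
  and \<open>p\<close> kills \<open>m\<close>.\<close>

lemma (in comm_noetherian_ring) nonzero_hom_to_prime_quotient: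
  assumes p: "minimal_prime R p" and K: "ideal K R" and M: "module R M" and m: "m \<in> carrier M"
    and ann: "p = {a \<in> carrier R. a \<odot>\<^bsub>M\<^esub> m = \<zero>\<^bsub>M\<^esub>}"
    and nz: "\<And>s. s \<in> carrier R - p \<Longrightarrow> \<exists>a\<in>K. s \<otimes> a \<noteq> \<zero>"
  obtains \<phi> a where "\<phi> \<in> lin_maps R (ideal_module R K) M" and "a \<in> K" and "\<phi> a \<noteq> \<zero>\<^bsub>M\<^esub>"
proof -
  interpret M: module R M by (rule M)
  have pp: "primeideal p R" using p by (simp add: minimal_prime_def)
  interpret p: primeideal p R by (rule pp)
  interpret P: at_prime R p
    by (rule at_prime.intro[OF comm_noetherian_ring_axioms at_prime_axioms.intro[OF pp]])
  interpret K: ideal K R by (rule K)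
  let ?S = "carrier R - p"
  from finetely_gen[OF K] obtain A where A: "A \<subseteq> carrier R" "finite A" "K = Idl A" by (elim exE conjE)
  have AK: "A \<subseteq> K" unfolding A(3) by (rule genideal_self[OF A(1)])
  \<comment> \<open>Finite generation of \<open>K\<close> replaces multipliers that depend on the
    element by a single one.\<close>
  have generate: "\<exists>s\<in>?S. \<forall>a\<in>K. s \<otimes> a \<in> W" if W: "ideal W R" and loc: "\<And>a. a \<in> K \<Longrightarrow> \<exists>s\<in>?S. s \<otimes> a \<in> W" for W
  proof -
    have "\<exists>s\<in>?S. \<forall>a\<in>A. s \<otimes> a \<in> W"
    proof (rule P.finite_common_multiplier[OF A(2)])
      show "\<exists>s\<in>?S. s \<otimes> a \<in> W" if "a \<in> A" for a using loc AK that by blast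
      fix a w s assume "a \<in> A" and w: "w \<in> ?S" "s \<in> ?S" "w \<otimes> a \<in> W"
      then have aR: "a \<in> carrier R" using A(1) by blast
      have "s \<otimes> (w \<otimes> a) \<in> W" by (rule ideal.I_l_closed[OF W w(3)]) (use w(2) in simp)
      then show "s \<otimes> w \<otimes> a \<in> W" using w aR by (simp add: m_assoc)
    qed
    then obtain s where s: "s \<in> ?S" "\<forall>a\<in>A. s \<otimes> a \<in> W" by blast
    have sR: "s \<in> carrier R" using s(1) by simp
    have "Idl A \<subseteq> {r \<in> carrier R. r \<otimes> s \<in> W}"
    proof (rule genideal_minimal[OF ideal_colon[OF W sR]])
      show "A \<subseteq> {r \<in> carrier R. r \<otimes> s \<in> W}"
      proof
        fix x assume "x \<in> A"
        moreover from this have "x \<in> carrier R" using A(1) by blast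
        ultimately show "x \<in> {r \<in> carrier R. r \<otimes> s \<in> W}" using s(2) m_comm[of x s] sR by simp
      qed
    qed
    then have "s \<otimes> a \<in> W" if "a \<in> K" for a using that sR m_comm[of a s] unfolding A(3) by auto
    then show ?thesis using s(1) by blast
  qed
  define closed where "closed W \<longleftrightarrow> ideal W R \<and> W \<subseteq> K \<and> W \<noteq> K \<and> (\<forall>a\<in>K. \<forall>s\<in>?S. s \<otimes> a \<in> W \<longrightarrow> a \<in> W)" for W
  \<comment> \<open>The contraction to \<open>K\<close> of the localization of \<open>W\<close> at
    \<open>p\<close>.\<close>
  define sat where "sat W = {a \<in> K. \<exists>s\<in>?S. s \<otimes> a \<in> W}" for W
  have sat_ideal: "ideal (sat W) R" if W: "ideal W R" for W
    unfolding ideal_iff_submodule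
  proof (rule submoduleI'[OF ring_module])
    show "sat W \<subseteq> carrier (ring_as_module R)" using K.a_subset by (auto simp: sat_def)
    show "\<zero>\<^bsub>ring_as_module R\<^esub> \<in> sat W"
      using K.zero_closed additive_subgroup.zero_closed[OF ideal.axioms(1)[OF W]] P.S_one
      unfolding sat_def by (auto intro!: bexI[of _ \<one>])
    show "x \<oplus>\<^bsub>ring_as_module R\<^esub> y \<in> sat W" if xy: "x \<in> sat W" "y \<in> sat W" for x y
    proof -
      obtain s t where s: "x \<in> K" "s \<in> ?S" "s \<otimes> x \<in> W" and t: "y \<in> K" "t \<in> ?S" "t \<otimes> y \<in> W"
        using xy unfolding sat_def by blast
      have R: "x \<in> carrier R" "y \<in> carrier R" "s \<in> carrier R" "t \<in> carrier R" using s t by simp_all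
      have "t \<otimes> (s \<otimes> x) \<oplus> s \<otimes> (t \<otimes> y) \<in> W"
        by (intro additive_subgroup.a_closed[OF ideal.axioms(1)[OF W]] ideal.I_l_closed[OF W] s(3) t(3) R)
      then have "(s \<otimes> t) \<otimes> (x \<oplus> y) \<in> W" using R by (simp add: r_distr m_ac)
      then show ?thesis using P.S_mult[OF s(2) t(2)] s(1) t(1) unfolding sat_def by auto
    qed
    show "a \<odot>\<^bsub>ring_as_module R\<^esub> x \<in> sat W" if a: "a \<in> carrier R" and x: "x \<in> sat W" for a x
    proof -
      obtain s where s: "x \<in> K" "s \<in> ?S" "s \<otimes> x \<in> W" using x unfolding sat_def by blast
      have "a \<otimes> (s \<otimes> x) \<in> W" by (rule ideal.I_l_closed[OF W s(3) a])
      then have "s \<otimes> (a \<otimes> x) \<in> W" using a s by (simp add: m_lcomm)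
      then show ?thesis using s a K.I_l_closed[OF s(1) a] unfolding sat_def by auto
    qed
  qed
  have sat_closed: "a \<in> sat W" if a: "a \<in> K" "s \<in> ?S" "s \<otimes> a \<in> sat W" for a s W
  proof -
    obtain t where t: "t \<in> ?S" "t \<otimes> (s \<otimes> a) \<in> W" using a(3) unfolding sat_def by blast
    then have "(t \<otimes> s) \<otimes> a \<in> W" using a by (simp add: m_assoc)
    then show ?thesis using P.S_mult[OF t(1) a(2)] a(1) unfolding sat_def by blast
  qed
  have closedI: "closed (sat W)" if "ideal W R" "sat W \<noteq> K" for W
    unfolding closed_def
    using sat_ideal[OF that(1)] that(2) sat_closed by (intro conjI ballI impI) (auto simp: sat_def)
  \<comment> \<open>The assumption \<open>nz\<close> says that \<open>K\<close> does not vanish at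
    \<open>p\<close>; it provides a first candidate for \<open>W\<close>.\<close>
  have "sat {\<zero>} \<noteq> K"
  proof
    assume eq: "sat {\<zero>} = K"
    have "\<exists>s\<in>?S. \<forall>a\<in>K. s \<otimes> a \<in> {\<zero>}"
      by (rule generate[OF zeroideal]) (use eq in \<open>auto simp: sat_def\<close>)
    then show False using nz by auto
  qed
  then have ne: "{W. closed W} \<noteq> {}" using closedI[OF zeroideal] by blast
  obtain W where W: "W \<in> {W. closed W}" "\<And>X. X \<in> {W. closed W} \<Longrightarrow> W \<subseteq> X \<Longrightarrow> X = W"
    by (rule ideal_maximal[OF ne]) (auto simp: closed_def)
  have WI: "ideal W R" and WK: "W \<subseteq> K" "W \<noteq> K"
    and Wc: "\<And>a s. a \<in> K \<Longrightarrow> s \<in> ?S \<Longrightarrow> s \<otimes> a \<in> W \<Longrightarrow> a \<in> W"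
    using W(1) unfolding closed_def by blast+
  interpret W: ideal W R by (rule WI)
  obtain b where b: "b \<in> K" "b \<notin> W" using WK by blast
  have bR: "b \<in> carrier R" using b(1) by simp
  define WB where "WB = {w \<oplus>\<^bsub>ring_as_module R\<^esub> r \<odot>\<^bsub>ring_as_module R\<^esub> b | w r. w \<in> W \<and> r \<in> carrier R}"
  have WB: "ideal WB R" unfolding WB_def ideal_iff_submodule
    using submodule_adjoin[OF ring_module _ oneideal, of W b] WI bR unfolding ideal_iff_submodule by simp
  have WBE: "\<exists>w r. w \<in> W \<and> r \<in> carrier R \<and> x = w \<oplus> r \<otimes> b" if "x \<in> WB" for x using that unfolding WB_def by auto
  have WBI: "w \<oplus> r \<otimes> b \<in> WB" if "w \<in> W" "r \<in> carrier R" for w r using that unfolding WB_def by auto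
  \<comment> \<open>Otherwise the saturation of W + Rb would be a larger candidate.\<close>
  have "sat WB = K"
  proof (rule ccontr)
    assume "sat WB \<noteq> K"
    then have cl: "sat WB \<in> {W. closed W}" using closedI[OF WB] by simp
    have W_sub: "w \<in> WB" if "w \<in> W" for w using WBI[OF that zero_closed] bR that by simp
    have bWB: "b \<in> WB" using WBI[OF W.zero_closed one_closed] bR by simp
    have one: "x \<in> sat WB" if "x \<in> K" "x \<in> WB" for x
      unfolding sat_def using that P.S_one by (auto intro!: bexI[of _ \<one>])
    have "W \<subseteq> sat WB" using one W_sub WK(1) by blast
    then have "sat WB = W" by (rule W(2)[OF cl])
    then show False using one[OF b(1) bWB] b(2) by simp
  qed
  then have "\<exists>s\<in>?S. \<forall>a\<in>K. s \<otimes> a \<in> WB" by (intro generate[OF WB]) (auto simp: sat_def)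
  then obtain s where s: "s \<in> ?S" "\<And>a. a \<in> K \<Longrightarrow> s \<otimes> a \<in> WB" by blast
  have sR: "s \<in> carrier R" using s(1) by simp
  have pm: "r \<odot>\<^bsub>M\<^esub> m = r' \<odot>\<^bsub>M\<^esub> m"
    if r: "r \<in> carrier R" "r' \<in> carrier R" "w \<in> W" "w' \<in> W" "w \<oplus> r \<otimes> b = w' \<oplus> r' \<otimes> b" for r r' w w'
  proof -
    have wR: "w \<in> carrier R" "w' \<in> carrier R" using r by simp_all
    have "(r \<ominus> r') \<otimes> b = (\<ominus> w \<oplus> (w \<oplus> r \<otimes> b)) \<oplus> \<ominus> (r' \<otimes> b)"
      using r(1-4) wR bR by (simp add: a_minus_def l_distr l_minus a_assoc[symmetric] l_neg)
    also have "\<dots> = w' \<ominus> w" unfolding r(5) using r(1-4) wR bR by (simp add: a_minus_def a_ac r_neg)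
    finally have "(r \<ominus> r') \<otimes> b \<in> W" using r(3,4) by (simp add: a_minus_def)
    then have "r \<ominus> r' \<in> p" using Wc[OF b(1), of "r \<ominus> r'"] b(2) r by auto
    then have "(r \<ominus> r') \<odot>\<^bsub>M\<^esub> m = \<zero>\<^bsub>M\<^esub>" unfolding ann by simp
    then have "r \<odot>\<^bsub>M\<^esub> m \<ominus>\<^bsub>M\<^esub> r' \<odot>\<^bsub>M\<^esub> m = \<zero>\<^bsub>M\<^esub>"
      using r m by (simp add: a_minus_def M.smult_l_distr M.smult_l_minus)
    then show ?thesis using r m by (simp add: M.M.minus_eq_zero_iff)
  qed
  define \<phi> where "\<phi> a = (SOME z. \<exists>w r. w \<in> W \<and> r \<in> carrier R \<and> s \<otimes> a = w \<oplus> r \<otimes> b \<and> z = r \<odot>\<^bsub>M\<^esub> m)" for a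
  have \<phi>: "\<phi> a = r \<odot>\<^bsub>M\<^esub> m" if "w \<in> W" "r \<in> carrier R" "s \<otimes> a = w \<oplus> r \<otimes> b" for a w r
    unfolding \<phi>_def
  proof (rule some_equality)
    show "\<exists>w' r'. w' \<in> W \<and> r' \<in> carrier R \<and> s \<otimes> a = w' \<oplus> r' \<otimes> b \<and> r \<odot>\<^bsub>M\<^esub> m = r' \<odot>\<^bsub>M\<^esub> m" using that by blast
    fix z assume "\<exists>w' r'. w' \<in> W \<and> r' \<in> carrier R \<and> s \<otimes> a = w' \<oplus> r' \<otimes> b \<and> z = r' \<odot>\<^bsub>M\<^esub> m"
    then obtain w' r' where w': "w' \<in> W" "r' \<in> carrier R" "s \<otimes> a = w' \<oplus> r' \<otimes> b" "z = r' \<odot>\<^bsub>M\<^esub> m" by (elim exE conjE)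
    have "w' \<oplus> r' \<otimes> b = w \<oplus> r \<otimes> b" using w'(3) that(3) by simp
    from pm[OF w'(2) that(2) w'(1) that(1) this] show "z = r \<odot>\<^bsub>M\<^esub> m" using w'(4) by simp
  qed
  have "\<phi> \<in> lin_maps R (ideal_module R K) M"
  proof (rule lin_mapsI)
    fix x assume "x \<in> carrier (ideal_module R K)"
    then have x: "x \<in> K" "x \<in> carrier R" by simp_all
    obtain w r where w: "w \<in> W" "r \<in> carrier R" "s \<otimes> x = w \<oplus> r \<otimes> b" using WBE[OF s(2)[OF x(1)]] by blast
    have wR: "w \<in> carrier R" using w(1) by simp
    show "\<phi> x \<in> carrier M" using \<phi>[OF w] w(2) m by simp
    { fix y assume "y \<in> carrier (ideal_module R K)"
      then have y: "y \<in> K" "y \<in> carrier R" by simp_all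
      obtain w' r' where w': "w' \<in> W" "r' \<in> carrier R" "s \<otimes> y = w' \<oplus> r' \<otimes> b" using WBE[OF s(2)[OF y(1)]] by blast
      have w'R: "w' \<in> carrier R" using w'(1) by simp
      have "s \<otimes> (x \<oplus> y) = (w \<oplus> w') \<oplus> (r \<oplus> r') \<otimes> b"
        using x y sR w(3) w'(3) w(2) w'(2) wR w'R bR by (simp add: r_distr l_distr a_ac)
      from \<phi>[OF W.a_closed[OF w(1) w'(1)] a_closed[OF w(2) w'(2)] this]
      show "\<phi> (x \<oplus>\<^bsub>ideal_module R K\<^esub> y) = \<phi> x \<oplus>\<^bsub>M\<^esub> \<phi> y"
        using \<phi>[OF w] \<phi>[OF w'] w(2) w'(2) m by (simp add: M.smult_l_distr) }
    fix a assume a: "a \<in> carrier R"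
    have "s \<otimes> (a \<otimes> x) = a \<otimes> (s \<otimes> x)" using a sR x(2) by (simp add: m_lcomm)
    also have "\<dots> = a \<otimes> w \<oplus> (a \<otimes> r) \<otimes> b" unfolding w(3) using a wR w(2) bR by (simp add: r_distr m_assoc)
    finally have "s \<otimes> (a \<otimes> x) = a \<otimes> w \<oplus> (a \<otimes> r) \<otimes> b" .
    from \<phi>[OF W.I_l_closed[OF w(1) a] m_closed[OF a w(2)] this]
    show "\<phi> (a \<odot>\<^bsub>ideal_module R K\<^esub> x) = a \<odot>\<^bsub>M\<^esub> \<phi> x"
      using \<phi>[OF w] w(2) a m by (simp add: M.smult_assoc1)
  qed
  moreover have "\<phi> b \<noteq> \<zero>\<^bsub>M\<^esub>"
  proof -
    have "\<phi> b = s \<odot>\<^bsub>M\<^esub> m" by (rule \<phi>[OF W.zero_closed sR]) (use sR bR in simp)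
    moreover have "s \<odot>\<^bsub>M\<^esub> m \<noteq> \<zero>\<^bsub>M\<^esub>" using s(1) unfolding ann by simp
    ultimately show ?thesis by simp
  qed
  ultimately show thesis using that b(1) by blast
qed

section \<open>Bases over the residue ring, by representatives in the ring\<close>

lemma finsum_over_quot: "finsum (over_quot R M) g A = finsum M g A"
  by (simp add: finsum_def finprod_def over_quot_def)

context linked_pair
begin

interpretation M: module R M by (rule M)
interpretation F: module R "free_rank R n" by (rule free_module_is_module)
interpretation I: ideal I R by (rule I_ideal)

text \<open>The evaluation map from \<open>is_free\<close> for \<open>M\<close> over the residue
  ring, named so that residue classes can be traded for representatives.\<close>

definition quot_sum :: "('c \<Rightarrow> 'a set) \<Rightarrow> 'c set \<Rightarrow> 'c" where
  "quot_sum \<phi> B = (\<Oplus>\<^bsub>over_quot R M\<^esub>b\<in>{b\<in>B. \<phi> b \<noteq> \<zero>\<^bsub>R Quot I\<^esub>}. \<phi> b \<odot>\<^bsub>over_quot R M\<^esub> b)"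

lemma quot_ring_simps: "carrier (R Quot I) = {I +> a | a. a \<in> carrier R}" "\<zero>\<^bsub>R Quot I\<^esub> = I"
  by (auto simp: FactRing_def A_RCOSETS_def')

lemma coset_eq_iff: "a \<in> carrier R \<Longrightarrow> b \<in> carrier R \<Longrightarrow> I +> a = I +> b \<longleftrightarrow> a \<ominus> b \<in> I"
  using quotient_eq_iff_same_a_r_cos[OF I_ideal] by blast

lemma coset_zero_iff: "a \<in> carrier R \<Longrightarrow> I +> a = I \<longleftrightarrow> a \<in> I"
  using I.a_rcos_const I.rcos_const_imp_mem by blast

lemma I_smult: "i \<in> I \<Longrightarrow> x \<in> carrier M \<Longrightarrow> i \<odot>\<^bsub>M\<^esub> x = \<zero>\<^bsub>M\<^esub>"
  unfolding Ann_def by (elim CollectE conjE) (erule bspec)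

text \<open>Representatives of a residue class differ by elements of \<open>I\<close>, and these
  kill \<open>M\<close>; so the description in \<open>over_quot\<close> has a solution.\<close>

lemma over_quot_smult:
  assumes a: "a \<in> carrier R" and x: "x \<in> carrier M"
  shows "(I +> a) \<odot>\<^bsub>over_quot R M\<^esub> x = a \<odot>\<^bsub>M\<^esub> x"
proof -
  have eq: "\<forall>b\<in>I +> a. a \<odot>\<^bsub>M\<^esub> x = b \<odot>\<^bsub>M\<^esub> x"
  proof
    fix b assume "b \<in> I +> a"
    then have "b \<in> (\<Union>h\<in>I. {h \<oplus> a})" unfolding a_r_coset_def' .
    then obtain i where i: "i \<in> I" "b = i \<oplus> a" by (elim UN_E singletonE) (rule that)
    show "a \<odot>\<^bsub>M\<^esub> x = b \<odot>\<^bsub>M\<^esub> x"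
      unfolding i(2) M.smult_l_distr[OF I_carrier[OF i(1)] a x] I_smult[OF i(1) x]
      using M.smult_closed[OF a x] by simp
  qed
  have "a \<in> I +> a" by (rule I.a_rcos_self[OF a])
  with eq have "(THE y. \<forall>b\<in>I +> a. y = b \<odot>\<^bsub>M\<^esub> x) = a \<odot>\<^bsub>M\<^esub> x"
    by (intro the_equality) (assumption, erule bspec)
  then show ?thesis unfolding over_quot_def by simp
qed

text \<open>Representatives of the zero class lie in \<open>I\<close> and kill \<open>M\<close>, so
  the index set may be any finite part of \<open>B\<close> that contains the support.\<close>

lemma quot_sum_eq:
  assumes "finite T" and T: "{b\<in>B. \<phi> b \<noteq> I} \<subseteq> T" "T \<subseteq> B" and B: "B \<subseteq> carrier M"
    and \<alpha>: "\<And>b. b \<in> T \<Longrightarrow> \<alpha> b \<in> carrier R" "\<And>b. b \<in> T \<Longrightarrow> \<phi> b = I +> \<alpha> b"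
  shows "quot_sum \<phi> B = (\<Oplus>\<^bsub>M\<^esub>b\<in>T. \<alpha> b \<odot>\<^bsub>M\<^esub> b)"
  unfolding quot_sum_def quot_ring_simps finsum_over_quot
proof (rule M.M.add.finprod_mono_neutral_cong_left[OF assms(1) T(1)])
  show "\<alpha> b \<odot>\<^bsub>M\<^esub> b = \<zero>\<^bsub>M\<^esub>" if b: "b \<in> T - {b \<in> B. \<phi> b \<noteq> I}" for b
  proof -
    have "I +> \<alpha> b = I" using \<alpha>(2)[of b] b T(2) by auto
    then have "\<alpha> b \<in> I" using coset_zero_iff \<alpha>(1) b by blast
    then show "\<alpha> b \<odot>\<^bsub>M\<^esub> b = \<zero>\<^bsub>M\<^esub>" using I_smult b T(2) B by auto
  qed
  show "\<phi> b \<odot>\<^bsub>over_quot R M\<^esub> b = \<alpha> b \<odot>\<^bsub>M\<^esub> b" if "b \<in> {b \<in> B. \<phi> b \<noteq> I}" for b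
  proof -
    have "b \<in> T" "b \<in> carrier M" using that T(1) B by auto
    then show ?thesis using \<alpha> over_quot_smult by simp
  qed
  show "(\<lambda>b. \<alpha> b \<odot>\<^bsub>M\<^esub> b) \<in> T \<rightarrow> carrier M" using \<alpha>(1) T(2) B by auto
qed

lemma is_free_iff_quot_sum:
  "is_free (R Quot I) (over_quot R M) \<longleftrightarrow>
    (\<exists>B\<subseteq>carrier M. bij_betw (\<lambda>\<phi>. quot_sum \<phi> B) (carrier (free_module (R Quot I) B)) (carrier M))"
  unfolding is_free_def quot_sum_def by (simp add: over_quot_def)

lemma quot_free_mem:
  "\<phi> \<in> carrier (free_module (R Quot I) B) \<longleftrightarrow>
    \<phi> \<in> extensional B \<and> (\<forall>b\<in>B. \<exists>a\<in>carrier R. \<phi> b = I +> a) \<and> finite {b\<in>B. \<phi> b \<noteq> I}"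
  unfolding free_module_mem quot_ring_simps by (auto simp: PiE_def Pi_def)

lemma separated_free:
  assumes s: separated
  shows "is_free (R Quot I) (over_quot R M)"
proof -
  define \<beta> where "\<beta> i = e (bv i)" for i
  have \<beta>M: "\<beta> i \<in> carrier M" for i unfolding \<beta>_def by (rule lin_closed[OF e(1) basis_vec_closed])
  define B where "B = \<beta> ` {..<n}"
  have B: "finite B" "B \<subseteq> carrier M" using \<beta>M by (auto simp: B_def)
  \<comment> \<open>A basis in the sense of \<open>is_free\<close> is a set of elements, so the
    images of the basis vectors have to be distinct. Two equal ones would put \<open>\<one>\<close>
    into \<open>I\<close>.\<close>
  have inj: "inj_on \<beta> {..<n}"
  proof (rule inj_onI, rule ccontr)
    fix i j assume i: "i \<in> {..<n}" and j: "j \<in> {..<n}" and eq: "\<beta> i = \<beta> j" and ne: "i \<noteq> j"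
    let ?x = "bv i \<ominus>\<^bsub>F\<^esub> bv j"
    have xF: "?x \<in> carrier F" by (simp add: basis_vec_closed)
    have "?x \<in> U"
      using lin_minus[OF F.module_axioms M e(1) basis_vec_closed basis_vec_closed, of i j] eq \<beta>M xF
      by (simp add: a_kernel_iff \<beta>_def M.M.minus_eq_zero_iff)
    then have "?x i \<in> I" using U_iff[OF s xF] i by simp
    moreover have "?x i = bv i i \<ominus> bv j i" using i by (simp add: basis_vec_closed)
    moreover have "bv i i = \<one>" "bv j i = \<zero>" using i ne by (simp_all add: basis_vec_def)
    ultimately show False using one_notin_I by (simp add: a_minus_def)
  qed
  define \<gamma> where "\<gamma> = the_inv_into {..<n} \<beta>"
  have \<gamma>: "\<gamma> (\<beta> i) = i" if "i < n" for i unfolding \<gamma>_def using the_inv_into_f_f[OF inj] that by simp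
  have sum_B: "(\<Oplus>\<^bsub>M\<^esub>b\<in>B. \<alpha> b \<odot>\<^bsub>M\<^esub> b) = e (\<lambda>i\<in>{..<n}. \<alpha> (\<beta> i))"
    if \<alpha>: "\<And>b. b \<in> B \<Longrightarrow> \<alpha> b \<in> carrier R" for \<alpha>
  proof -
    have xF: "(\<lambda>i\<in>{..<n}. \<alpha> (\<beta> i)) \<in> carrier F" using \<alpha> by (auto simp: free_rank_mem B_def)
    have "(\<Oplus>\<^bsub>M\<^esub>b\<in>B. \<alpha> b \<odot>\<^bsub>M\<^esub> b) = (\<Oplus>\<^bsub>M\<^esub>i\<in>{..<n}. \<alpha> (\<beta> i) \<odot>\<^bsub>M\<^esub> \<beta> i)"
      unfolding B_def by (rule M.M.finsum_reindex[OF _ inj]) (use \<alpha> \<beta>M in \<open>auto simp: B_def\<close>)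
    also have "\<dots> = (\<Oplus>\<^bsub>M\<^esub>i\<in>{..<n}. (\<lambda>i\<in>{..<n}. \<alpha> (\<beta> i)) i \<odot>\<^bsub>M\<^esub> e (bv i))"
      by (rule M.M.finsum_cong'[OF refl]) (use \<alpha> \<beta>M in \<open>auto simp: B_def \<beta>_def\<close>)
    also have "\<dots> = e (\<lambda>i\<in>{..<n}. \<alpha> (\<beta> i))" using lin_expand[OF M e(1) xF] by simp
    finally show ?thesis .
  qed
  have qs: "quot_sum \<phi> B = e (\<lambda>i\<in>{..<n}. \<alpha> (\<beta> i))"
    if "\<And>b. b \<in> B \<Longrightarrow> \<alpha> b \<in> carrier R" "\<And>b. b \<in> B \<Longrightarrow> \<phi> b = I +> \<alpha> b" for \<phi> \<alpha>
  proof -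
    have "quot_sum \<phi> B = (\<Oplus>\<^bsub>M\<^esub>b\<in>B. \<alpha> b \<odot>\<^bsub>M\<^esub> b)"
      by (rule quot_sum_eq[OF B(1) _ subset_refl B(2)]) (use that in auto)
    also have "\<dots> = e (\<lambda>i\<in>{..<n}. \<alpha> (\<beta> i))" by (rule sum_B) (rule that(1))
    finally show ?thesis .
  qed
  have rep: "\<exists>\<alpha>. (\<forall>b\<in>B. \<alpha> b \<in> carrier R \<and> \<phi> b = I +> \<alpha> b)" if "\<phi> \<in> carrier (free_module (R Quot I) B)" for \<phi>
    using that unfolding quot_free_mem by (intro bchoice) auto
  have "bij_betw (\<lambda>\<phi>. quot_sum \<phi> B) (carrier (free_module (R Quot I) B)) (carrier M)"
    unfolding bij_betw_def
  proof
    show "inj_on (\<lambda>\<phi>. quot_sum \<phi> B) (carrier (free_module (R Quot I) B))"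
    proof (rule inj_onI)
      fix \<phi> \<phi>' assume \<phi>: "\<phi> \<in> carrier (free_module (R Quot I) B)" "\<phi>' \<in> carrier (free_module (R Quot I) B)"
        and eq: "quot_sum \<phi> B = quot_sum \<phi>' B"
      obtain \<alpha> where \<alpha>: "\<And>b. b \<in> B \<Longrightarrow> \<alpha> b \<in> carrier R" "\<And>b. b \<in> B \<Longrightarrow> \<phi> b = I +> \<alpha> b" using rep[OF \<phi>(1)] by blast
      obtain \<alpha>' where \<alpha>': "\<And>b. b \<in> B \<Longrightarrow> \<alpha>' b \<in> carrier R" "\<And>b. b \<in> B \<Longrightarrow> \<phi>' b = I +> \<alpha>' b" using rep[OF \<phi>(2)] by blast
      let ?x = "\<lambda>i\<in>{..<n}. \<alpha> (\<beta> i)" and ?y = "\<lambda>i\<in>{..<n}. \<alpha>' (\<beta> i)"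
      have xF: "?x \<in> carrier F" and yF: "?y \<in> carrier F" using \<alpha>(1) \<alpha>'(1) by (auto simp: free_rank_mem B_def)
      have dF: "?x \<ominus>\<^bsub>F\<^esub> ?y \<in> carrier F" using xF yF by simp
      have "quot_sum \<phi> B = e ?x" by (rule qs) (use \<alpha> in auto)
      moreover have "quot_sum \<phi>' B = e ?y" by (rule qs) (use \<alpha>' in auto)
      ultimately have "e ?x = e ?y" using eq by simp
      then have "?x \<ominus>\<^bsub>F\<^esub> ?y \<in> U"
        using lin_minus[OF F.module_axioms M e(1) xF yF] lin_closed[OF e(1) yF] dF
        by (simp add: a_kernel_iff M.M.minus_eq_zero_iff)
      then have d: "\<alpha> (\<beta> i) \<ominus> \<alpha>' (\<beta> i) \<in> I" if "i < n" for i
        using U_iff[OF s dF] that xF yF by auto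
      have "\<phi> b = \<phi>' b" if b: "b \<in> B" for b
      proof -
        obtain i where i: "i < n" "b = \<beta> i" using b by (auto simp: B_def)
        show ?thesis using d[OF i(1)] \<alpha>[OF b] \<alpha>'[OF b] coset_eq_iff i(2) by simp
      qed
      then show "\<phi> = \<phi>'" using \<phi> unfolding quot_free_mem by (intro extensionalityI[of _ B]) auto
    qed
    show "(\<lambda>\<phi>. quot_sum \<phi> B) ` carrier (free_module (R Quot I) B) = carrier M"
    proof
      show "(\<lambda>\<phi>. quot_sum \<phi> B) ` carrier (free_module (R Quot I) B) \<subseteq> carrier M"
      proof
        fix m assume "m \<in> (\<lambda>\<phi>. quot_sum \<phi> B) ` carrier (free_module (R Quot I) B)"
        then obtain \<phi> where \<phi>: "\<phi> \<in> carrier (free_module (R Quot I) B)" "m = quot_sum \<phi> B" by blast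
        obtain \<alpha> where \<alpha>: "\<And>b. b \<in> B \<Longrightarrow> \<alpha> b \<in> carrier R" "\<And>b. b \<in> B \<Longrightarrow> \<phi> b = I +> \<alpha> b" using rep[OF \<phi>(1)] by blast
        have "(\<lambda>i\<in>{..<n}. \<alpha> (\<beta> i)) \<in> carrier F" using \<alpha>(1) by (auto simp: free_rank_mem B_def)
        moreover have "m = e (\<lambda>i\<in>{..<n}. \<alpha> (\<beta> i))" unfolding \<phi>(2) by (rule qs) (use \<alpha> in auto)
        ultimately show "m \<in> carrier M" using lin_closed[OF e(1)] by simp
      qed
      show "carrier M \<subseteq> (\<lambda>\<phi>. quot_sum \<phi> B) ` carrier (free_module (R Quot I) B)"
      proof
        fix m assume "m \<in> carrier M"
        then obtain x where x: "x \<in> carrier F" "m = e x" unfolding e(2)[symmetric] by blast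
        have xR: "x i \<in> carrier R" if "i < n" for i using free_module_coord[OF x(1)] that by simp
        define \<alpha> where "\<alpha> b = x (\<gamma> b)" for b
        have \<alpha>R: "\<alpha> b \<in> carrier R" if b: "b \<in> B" for b using b xR by (auto simp: B_def \<alpha>_def \<gamma>)
        let ?\<phi> = "\<lambda>b\<in>B. I +> \<alpha> b"
        have "?\<phi> \<in> carrier (free_module (R Quot I) B)" unfolding quot_free_mem using \<alpha>R B(1) by auto
        moreover have "quot_sum ?\<phi> B = e (\<lambda>i\<in>{..<n}. \<alpha> (\<beta> i))" by (rule qs) (use \<alpha>R in auto)
        moreover have "(\<lambda>i\<in>{..<n}. \<alpha> (\<beta> i)) = x"
          by (rule free_module_eqI[of _ R "{..<n}"]) (use xR x(1) in \<open>auto simp: free_rank_mem \<alpha>_def \<gamma>\<close>)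
        ultimately show "m \<in> (\<lambda>\<phi>. quot_sum \<phi> B) ` carrier (free_module (R Quot I) B)"
          using x(2) by (intro image_eqI[of _ _ ?\<phi>]) simp_all
      qed
    qed
  qed
  then show ?thesis unfolding is_free_iff_quot_sum using B(2) by blast
qed

text \<open>The given basis is a set not known to be finite. The expansions of finitely many
  generators involve a finite part \<open>T\<close> of it, which therefore spans \<open>M\<close>.
  Independence is inherited, since coefficients on \<open>T\<close> extend by the zero class to the
  whole basis.\<close>

lemma free_basis:
  assumes fr: "is_free (R Quot I) (over_quot R M)" and fg: "fin_gen R M"
  obtains k c where "c \<in> lin_maps R (free_rank R k) M" and "c ` carrier (free_rank R k) = carrier M"
    and "\<And>x i. x \<in> carrier (free_rank R k) \<Longrightarrow> c x = \<zero>\<^bsub>M\<^esub> \<Longrightarrow> i < k \<Longrightarrow> x i \<in> I"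
proof -
  obtain B where B: "B \<subseteq> carrier M"
    and bij: "bij_betw (\<lambda>\<phi>. quot_sum \<phi> B) (carrier (free_module (R Quot I) B)) (carrier M)"
    using fr unfolding is_free_iff_quot_sum by blast
  from fg obtain X where X: "finite X" "X \<subseteq> carrier M"
    "\<And>N. submodule N R M \<Longrightarrow> X \<subseteq> N \<Longrightarrow> N = carrier M" unfolding fin_gen_def by blast
  have "\<forall>x\<in>X. \<exists>\<phi>. \<phi> \<in> carrier (free_module (R Quot I) B) \<and> quot_sum \<phi> B = x"
  proof
    fix x assume "x \<in> X"
    then have "x \<in> (\<lambda>\<phi>. quot_sum \<phi> B) ` carrier (free_module (R Quot I) B)"
      using bij X(2) unfolding bij_betw_def by auto
    then show "\<exists>\<phi>. \<phi> \<in> carrier (free_module (R Quot I) B) \<and> quot_sum \<phi> B = x" by blast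
  qed
  from bchoice[OF this] obtain \<Phi> where \<Phi>: "\<And>x. x \<in> X \<Longrightarrow> \<Phi> x \<in> carrier (free_module (R Quot I) B)"
    "\<And>x. x \<in> X \<Longrightarrow> quot_sum (\<Phi> x) B = x" by blast
  define T where "T = (\<Union>x\<in>X. {b\<in>B. \<Phi> x b \<noteq> I})"
  have T: "finite T" "T \<subseteq> B" using X(1) \<Phi>(1) unfolding T_def quot_free_mem by auto
  obtain \<beta> where "bij_betw \<beta> {0..<card T} T" using ex_bij_betw_nat_finite[OF T(1)] by blast
  then have \<beta>: "inj_on \<beta> {..<card T}" "\<beta> ` {..<card T} = T" by (simp_all add: bij_betw_def atLeast0LessThan)
  let ?k = "card T"
  have \<beta>T: "\<beta> i \<in> T" if "i < ?k" for i using \<beta>(2) that by auto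
  have \<beta>M: "\<beta> \<in> {..<?k} \<rightarrow> carrier M" using \<beta>T T(2) B by auto
  define c where "c = flin M {..<?k} \<beta>"
  have c: "c \<in> lin_maps R (free_rank R ?k) M" unfolding c_def by (rule flin_lin[OF M \<beta>M])
  have c_sum: "c x = (\<Oplus>\<^bsub>M\<^esub>i\<in>{..<?k}. x i \<odot>\<^bsub>M\<^esub> \<beta> i)" if "x \<in> carrier (free_rank R ?k)" for x
    unfolding c_def by (rule flin_finite[OF M \<beta>M that]) simp
  have sum_T: "(\<Oplus>\<^bsub>M\<^esub>b\<in>T. \<alpha> b \<odot>\<^bsub>M\<^esub> b) = c (\<lambda>i\<in>{..<?k}. \<alpha> (\<beta> i))"
    if \<alpha>: "\<And>b. b \<in> T \<Longrightarrow> \<alpha> b \<in> carrier R" for \<alpha>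
  proof -
    have xF: "(\<lambda>i\<in>{..<?k}. \<alpha> (\<beta> i)) \<in> carrier (free_rank R ?k)" using \<alpha> \<beta>T by (auto simp: free_rank_mem)
    have "(\<Oplus>\<^bsub>M\<^esub>b\<in>T. \<alpha> b \<odot>\<^bsub>M\<^esub> b) = (\<Oplus>\<^bsub>M\<^esub>b\<in>\<beta> ` {..<?k}. \<alpha> b \<odot>\<^bsub>M\<^esub> b)" unfolding \<beta>(2) ..
    also have "\<dots> = (\<Oplus>\<^bsub>M\<^esub>i\<in>{..<?k}. \<alpha> (\<beta> i) \<odot>\<^bsub>M\<^esub> \<beta> i)"
      by (rule M.M.finsum_reindex[OF _ \<beta>(1)]) (use \<alpha> \<beta>T \<beta>M in auto)
    also have "\<dots> = (\<Oplus>\<^bsub>M\<^esub>i\<in>{..<?k}. (\<lambda>i\<in>{..<?k}. \<alpha> (\<beta> i)) i \<odot>\<^bsub>M\<^esub> \<beta> i)"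
      by (rule M.M.finsum_cong'[OF refl]) (use \<alpha> \<beta>T \<beta>M in auto)
    also have "\<dots> = c (\<lambda>i\<in>{..<?k}. \<alpha> (\<beta> i))" by (rule c_sum[OF xF, symmetric])
    finally show ?thesis .
  qed
  have span: "c ` carrier (free_rank R ?k) = carrier M"
  proof (rule X(3))
    show "submodule (c ` carrier (free_rank R ?k)) R M"
      by (rule submodule_image[OF free_module_is_module M c submodule_carrier[OF free_module_is_module]])
    show "X \<subseteq> c ` carrier (free_rank R ?k)"
    proof
      fix x assume x: "x \<in> X"
      have "\<forall>b\<in>B. \<exists>a. a \<in> carrier R \<and> \<Phi> x b = I +> a" using \<Phi>(1)[OF x] unfolding quot_free_mem by blast
      from bchoice[OF this] obtain \<alpha> where \<alpha>: "\<And>b. b \<in> B \<Longrightarrow> \<alpha> b \<in> carrier R" "\<And>b. b \<in> B \<Longrightarrow> \<Phi> x b = I +> \<alpha> b" by blast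
      have \<alpha>T: "\<alpha> b \<in> carrier R" "\<Phi> x b = I +> \<alpha> b" if "b \<in> T" for b using \<alpha> that T(2) by auto
      have "quot_sum (\<Phi> x) B = (\<Oplus>\<^bsub>M\<^esub>b\<in>T. \<alpha> b \<odot>\<^bsub>M\<^esub> b)"
        by (rule quot_sum_eq[OF T(1) _ T(2) B \<alpha>T]) (use x in \<open>auto simp: T_def\<close>)
      then have "x = c (\<lambda>i\<in>{..<?k}. \<alpha> (\<beta> i))" using \<Phi>(2)[OF x] sum_T[OF \<alpha>T(1)] by simp
      moreover have "(\<lambda>i\<in>{..<?k}. \<alpha> (\<beta> i)) \<in> carrier (free_rank R ?k)" using \<alpha>T(1) \<beta>T by (auto simp: free_rank_mem)
      ultimately show "x \<in> c ` carrier (free_rank R ?k)" by (rule image_eqI)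
    qed
  qed
  have indep: "x i \<in> I" if x: "x \<in> carrier (free_rank R ?k)" "c x = \<zero>\<^bsub>M\<^esub>" and i: "i < ?k" for x i
  proof -
    have xR: "x i \<in> carrier R" if "i < ?k" for i using free_module_coord[OF x(1)] that by simp
    define \<alpha> where "\<alpha> b = x (the_inv_into {..<?k} \<beta> b)" for b
    have \<alpha>\<beta>: "\<alpha> (\<beta> i) = x i" if "i < ?k" for i unfolding \<alpha>_def using the_inv_into_f_f[OF \<beta>(1)] that by simp
    have \<alpha>R: "\<alpha> b \<in> carrier R" if "b \<in> T" for b
    proof -
      obtain i where "i < ?k" "b = \<beta> i" using \<open>b \<in> T\<close> \<beta>(2) by auto
      then show ?thesis using \<alpha>\<beta> xR by simp
    qed
    define \<phi> where "\<phi> = (\<lambda>b\<in>B. if b \<in> T then I +> \<alpha> b else I)"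
    have I0: "I +> \<zero> = I" using coset_zero_iff[OF zero_closed] I.zero_closed by simp
    have "\<phi> \<in> carrier (free_module (R Quot I) B)"
      unfolding quot_free_mem
    proof (intro conjI ballI)
      show "\<phi> \<in> extensional B" by (simp add: \<phi>_def)
      fix b assume b: "b \<in> B"
      show "\<exists>a\<in>carrier R. \<phi> b = I +> a"
      proof (cases "b \<in> T")
        case True
        then show ?thesis using \<alpha>R b by (intro bexI[of _ "\<alpha> b"]) (simp_all add: \<phi>_def)
      next
        case False
        then show ?thesis using b I0 by (intro bexI[of _ \<zero>]) (simp_all add: \<phi>_def)
      qed
    next
      show "finite {b \<in> B. \<phi> b \<noteq> I}" by (rule finite_subset[OF _ T(1)]) (auto simp: \<phi>_def split: if_splits)
    qed
    moreover have "(\<lambda>b\<in>B. I) \<in> carrier (free_module (R Quot I) B)"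
      unfolding quot_free_mem using I0 by (auto intro!: bexI[of _ \<zero>])
    moreover have "quot_sum \<phi> B = quot_sum (\<lambda>b\<in>B. I) B"
    proof -
      have "quot_sum \<phi> B = (\<Oplus>\<^bsub>M\<^esub>b\<in>T. \<alpha> b \<odot>\<^bsub>M\<^esub> b)"
        by (rule quot_sum_eq[OF T(1) _ T(2) B \<alpha>R]) (use T(2) in \<open>auto simp: \<phi>_def split: if_splits\<close>)
      also have "\<dots> = c (\<lambda>i\<in>{..<?k}. \<alpha> (\<beta> i))" by (rule sum_T[OF \<alpha>R])
      also have "(\<lambda>i\<in>{..<?k}. \<alpha> (\<beta> i)) = x"
        by (rule free_module_eqI[of _ R "{..<?k}"]) (use xR x(1) in \<open>auto simp: free_rank_mem \<alpha>\<beta>\<close>)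
      also have "c x = \<zero>\<^bsub>M\<^esub>" by (rule x(2))
      also have "\<dots> = quot_sum (\<lambda>b\<in>B. I) B"
        using quot_sum_eq[of "{}" B "\<lambda>b\<in>B. I" "\<lambda>_. \<zero>"] B by simp
      finally show ?thesis .
    qed
    ultimately have "\<phi> = (\<lambda>b\<in>B. I)" using bij unfolding bij_betw_def inj_on_def by blast
    then have "\<phi> (\<beta> i) = (\<lambda>b\<in>B. I) (\<beta> i)" by simp
    then have "I +> x i = I" using \<beta>T[OF i] T(2) \<alpha>\<beta>[OF i] by (auto simp: \<phi>_def)
    then show ?thesis using coset_zero_iff[OF xR[OF i]] by simp
  qed
  show thesis by (rule that[OF c span]) (rule indep)
qed

text \<open>A basis over R/I gives a cover \<open>b\<close> whose kernel consists of the vectors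
  with coordinates in \<open>I\<close>. Because \<open>I\<close> lies in \<open>mx\<close> this
  cover is minimal, so it agrees with \<open>e\<close> up to a bijection of free modules. In this
  way facts about \<open>I\<close> are transferred to \<open>U\<close>, and from there to
  \<open>J\<close>.\<close>

lemma Ext_separated:
  assumes cov: "min_cover R M n e" and fg: "fin_gen R M"
    and fr: "is_free (R Quot I) (over_quot R M)" and ext: "zero_module (Ext R 1 M M)"
  shows separated
proof (rule separatedI)
  fix p assume p: "minimal_prime R p" "primeideal p R" and IJ: "I \<subseteq> p" "J \<subseteq> p"
  note FF = free_module_is_module
  obtain k b where b: "b \<in> lin_maps R (free_rank R k) M" "b ` carrier (free_rank R k) = carrier M"
    and indep: "\<And>x i. x \<in> carrier (free_rank R k) \<Longrightarrow> b x = \<zero>\<^bsub>M\<^esub> \<Longrightarrow> i < k \<Longrightarrow> x i \<in> I"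
    by (rule free_basis[OF fr fg]) (rule that)
  let ?Fk = "free_rank R k"
  interpret Fk: module R ?Fk by (rule FF)
  have bker: "b x = \<zero>\<^bsub>M\<^esub>" if x: "x \<in> carrier ?Fk" and xI: "\<And>i. i < k \<Longrightarrow> x i \<in> I" for x
  proof -
    have "b x = (\<Oplus>\<^bsub>M\<^esub>i\<in>{..<k}. x i \<odot>\<^bsub>M\<^esub> b (basis_vec R {..<k} i))" by (rule lin_expand[OF M b(1) x]) simp
    also have "\<dots> = (\<Oplus>\<^bsub>M\<^esub>i\<in>{..<k}. \<zero>\<^bsub>M\<^esub>)"
      by (rule M.M.finsum_cong'[OF refl])
        (use xI lin_closed[OF b(1) basis_vec_closed] in \<open>auto intro!: I_smult\<close>)
    finally show ?thesis by simp
  qed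
  have I_mx: "a \<in> mx" if a: "a \<in> I" for a
  proof (rule ccontr)
    assume "a \<notin> mx"
    then have u: "a \<in> Units R" by (rule unit_of_notin_mx[OF I_carrier[OF a]])
    from I.I_l_closed[OF a Units_inv_closed[OF u]] have "\<one> \<in> I" unfolding Units_l_inv[OF u] .
    with one_notin_I show False by (rule notE)
  qed
  have "min_cover R M k b"
    unfolding min_cover_def
  proof (intro conjI b ballI allI impI)
    fix x i assume "x \<in> a_kernel ?Fk M b" and i: "i < k"
    then have "x \<in> carrier ?Fk" "b x = \<zero>\<^bsub>M\<^esub>" unfolding a_kernel_iff by simp_all
    from indep[OF this i] show "x i \<in> mx" by (rule I_mx)
  qed
  then obtain g where g: "g \<in> lin_maps R F ?Fk"
    "bij_betw g (carrier F) (carrier ?Fk)" "\<And>x. x \<in> carrier F \<Longrightarrow> b (g x) = e x"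
    by (rule min_cover_lift_bij[OF M cov]) (rule that)
  have k_pos: "0 < k"
  proof (rule ccontr)
    assume "\<not> 0 < k"
    then have "x = \<zero>\<^bsub>?Fk\<^esub>" if "x \<in> carrier ?Fk" for x
      by (intro free_module_eqI[OF that Fk.M.zero_closed]) simp
    then have "m = \<zero>\<^bsub>M\<^esub>" if "m \<in> carrier M" for m
      using that lin_zero[OF FF M b(1)] unfolding b(2)[symmetric] by auto
    then have "carrier M = {\<zero>\<^bsub>M\<^esub>}" using M.M.zero_closed by blast
    then show False using M_nz by (simp add: zero_module_def)
  qed
  \<comment> \<open>If \<open>s\<close> killed \<open>I\<close>, it would kill the kernel of
    \<open>b\<close> and, through \<open>g\<close>, also \<open>U\<close>; then it would lie in
    \<open>J\<close> and hence in \<open>p\<close>.\<close>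
  have nz: "\<exists>a\<in>I. s \<otimes> a \<noteq> \<zero>" if s: "s \<in> carrier R - p" for s
  proof (rule ccontr)
    assume no: "\<not> (\<exists>a\<in>I. s \<otimes> a \<noteq> \<zero>)"
    have sR: "s \<in> carrier R" using s by simp
    have "s \<in> J"
    proof (rule J_iff[OF sR])
      fix u i assume u: "u \<in> U" and i: "i < n"
      have guF: "g u \<in> carrier ?Fk" by (rule lin_closed[OF g(1) UF[OF u]])
      have bgu: "b (g u) = \<zero>\<^bsub>M\<^esub>" using g(3)[OF UF[OF u]] u by (simp add: a_kernel_iff)
      have "s \<odot>\<^bsub>?Fk\<^esub> g u = \<zero>\<^bsub>?Fk\<^esub>"
        by (rule free_module_eqI[OF Fk.smult_closed[OF sR guF] Fk.M.zero_closed])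
          (use no indep[OF guF bgu] in simp)
      then have "g (s \<odot>\<^bsub>F\<^esub> u) = g \<zero>\<^bsub>F\<^esub>"
        using lin_smult[OF g(1) sR UF[OF u]] lin_zero[OF FF FF g(1)] by simp
      then have "s \<odot>\<^bsub>F\<^esub> u = \<zero>\<^bsub>F\<^esub>"
        using inj_onD[OF bij_betw_imp_inj_on[OF g(2)]] F.smult_closed[OF sR UF[OF u]] F.M.zero_closed by blast
      from fun_cong[OF this, of i] show "s \<otimes> u i = \<zero>" using i by simp
    qed
    then show False using s IJ(2) by blast
  qed
  have "p \<in> Ass R M" by (rule minimal_prime_in_Ass[OF M e p(1) IJ(1)])
  then obtain m where m: "m \<in> carrier M" "p = {a \<in> carrier R. a \<odot>\<^bsub>M\<^esub> m = \<zero>\<^bsub>M\<^esub>}" unfolding Ass_def by blast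
  obtain \<phi> a where \<phi>: "\<phi> \<in> lin_maps R (ideal_module R I) M" and a: "a \<in> I" "\<phi> a \<noteq> \<zero>\<^bsub>M\<^esub>"
    by (rule nonzero_hom_to_prime_quotient[OF p(1) I_ideal M m nz]) (assumption, rule that)
  obtain r d where sr: "some_resolution R M = (r, d)" by (metis prod.exhaust)
  note res = some_resolution_free[OF M fg sr]
  from free_resolutionD(3)[OF res] obtain c where c: "c \<in> lin_maps R (free_rank R (r 0)) M"
    "c ` carrier (free_rank R (r 0)) = carrier M"
    and ker: "d 0 ` carrier (free_rank R (r 1)) = a_kernel (free_rank R (r 0)) M c" by (elim exE conjE)
  let ?F' = "free_rank R (r 0)" let ?U' = "a_kernel ?F' M c"
  have A: "c (basis_vec R {..<r 0} s) \<in> b ` carrier ?Fk" for s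
    unfolding b(2) by (rule lin_closed[OF c(1) basis_vec_closed])
  have B: "b (basis_vec R {..<k} s) \<in> c ` carrier ?F'" for s
    unfolding c(2) by (rule lin_closed[OF b(1) basis_vec_closed])
  obtain g1 where g1: "g1 \<in> lin_maps R ?F' ?Fk" "\<And>x. x \<in> carrier ?F' \<Longrightarrow> b (g1 x) = c x"
    by (rule free_lift[OF FF M c(1) b(1) A]) (rule that)
  obtain g2 where g2: "g2 \<in> lin_maps R ?Fk ?F'" "\<And>x. x \<in> carrier ?Fk \<Longrightarrow> c (g2 x) = b x"
    by (rule free_lift[OF FF M b(1) c(1) B]) (rule that)
  let ?K = "a_kernel ?Fk M b"
  have KI: "x i \<in> I" if "x \<in> ?K" "i < k" for x i using indep that by (simp add: a_kernel_iff)
  \<comment> \<open>Kernel vectors have their coordinates in \<open>I\<close>, so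
    \<open>\<phi>\<close> can be applied to the first one.\<close>
  define \<psi> where "\<psi> x = \<phi> (x 0)" for x :: "nat \<Rightarrow> 'a"
  have \<psi>: "\<psi> \<in> lin_maps R (?Fk\<lparr>carrier := ?K\<rparr>) M"
    unfolding \<psi>_def
    by (rule lin_mapsI)
      (use KI k_pos lin_closed[OF \<phi>] lin_add[OF \<phi>] lin_smult[OF \<phi>] in auto)
  have g1K: "g1 x \<in> ?K" if "x \<in> ?U'" for x
    using that g1(2) lin_closed[OF g1(1)] by (simp add: a_kernel_iff)
  have g1l: "g1 \<in> lin_maps R (?F'\<lparr>carrier := ?U'\<rparr>) (?Fk\<lparr>carrier := ?K\<rparr>)"
    by (rule lin_mapsI) (use g1K lin_add[OF g1(1)] lin_smult[OF g1(1)] in \<open>auto simp: a_kernel_iff\<close>)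
  from bspec[OF ext[unfolded zero_Ext_iff[OF M sr res M c(1) ker]] lin_comp[OF g1l \<psi>]]
  obtain \<theta> where \<theta>: "\<theta> \<in> lin_maps R ?F' M" "\<And>x. x \<in> ?U' \<Longrightarrow> \<theta> x = \<psi> (g1 x)" by (elim bexE) (erule that, erule bspec)
  have g12: "(\<lambda>x. g1 (g2 x)) \<in> lin_maps R ?Fk ?Fk" by (rule lin_comp[OF g2(1) g1(1)])
  define D where "D x = x \<ominus>\<^bsub>?Fk\<^esub> g1 (g2 x)" for x
  have D: "D \<in> lin_maps R ?Fk ?Fk" unfolding D_def by (rule lin_diff[OF FF FF lin_id g12])
  have DK: "D x \<in> ?K" if x: "x \<in> carrier ?Fk" for x
    using lin_minus[OF FF M b(1) x lin_closed[OF g12 x]] lin_closed[OF D x] g1(2)[OF lin_closed[OF g2(1) x]] g2(2)[OF x]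
      lin_closed[OF b(1) x]
    by (simp add: a_kernel_iff D_def M.M.minus_eq_zero_iff)
  have D': "D \<in> lin_maps R ?Fk (?Fk\<lparr>carrier := ?K\<rparr>)"
    by (rule lin_mapsI) (simp_all add: DK lin_add[OF D] lin_smult[OF D])
  \<comment> \<open>Vanishing of Ext extends the map only on the cover of the resolution. Pulled
    back along \<open>g2\<close>, that extension misses \<open>\<psi>\<close> by its value on
    \<open>D x\<close>, since g1 g2 need not be the identity; adding this value gives a map on the
    whole of \<open>free_rank R k\<close> that extends \<open>\<psi>\<close>.\<close>
  define \<eta> where "\<eta> x = \<theta> (g2 x) \<oplus>\<^bsub>M\<^esub> \<psi> (D x)" for x
  have \<eta>: "\<eta> \<in> lin_maps R ?Fk M"
    unfolding \<eta>_def by (rule lin_plus[OF M FF lin_comp[OF g2(1) \<theta>(1)] lin_comp[OF D' \<psi>]])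
  have \<eta>\<psi>: "\<eta> x = \<psi> x" if x: "x \<in> ?K" for x
  proof -
    have xF: "x \<in> carrier ?Fk" using x by (simp add: a_kernel_iff)
    have g2U: "g2 x \<in> ?U'" using g2(2)[OF xF] lin_closed[OF g2(1) xF] x by (simp add: a_kernel_iff)
    have sum: "g1 (g2 x) \<oplus>\<^bsub>?Fk\<^esub> D x = x"
      using xF lin_closed[OF g12 xF]
      by (simp add: D_def a_minus_def Fk.M.a_lcomm[of _ x] Fk.M.r_neg)
    have "\<eta> x = \<psi> (g1 (g2 x)) \<oplus>\<^bsub>M\<^esub> \<psi> (D x)" unfolding \<eta>_def using \<theta>(2)[OF g2U] by simp
    also have "\<dots> = \<psi> (g1 (g2 x) \<oplus>\<^bsub>?Fk\<^esub> D x)"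
      using lin_add[OF \<psi>, of "g1 (g2 x)" "D x"] g1K[OF g2U] DK[OF xF] by simp
    finally show ?thesis unfolding sum .
  qed
  \<comment> \<open>The vector a e_0 tests the extension: \<open>\<psi>\<close> takes it to the
    nonzero element \<open>\<phi> a\<close>, whereas linearity makes its image a multiple by
    \<open>a\<close> of an element of \<open>M\<close>, which is zero.\<close>
  define x where "x = a \<odot>\<^bsub>?Fk\<^esub> basis_vec R {..<k} 0"
  have aR: "a \<in> carrier R" by (rule I_carrier[OF a(1)])
  have xF: "x \<in> carrier ?Fk" unfolding x_def by (rule Fk.smult_closed[OF aR basis_vec_closed])
  have x0: "x 0 = a" using aR k_pos by (simp add: x_def basis_vec_def)
  have "x \<in> ?K"
  proof -
    have "x i \<in> I" if "i < k" for i using aR a(1) that by (simp add: x_def basis_vec_def)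
    then show ?thesis using bker[OF xF] xF by (simp add: a_kernel_iff)
  qed
  from \<eta>\<psi>[OF this] have "\<eta> x = \<phi> a" by (simp add: \<psi>_def x0)
  moreover have "\<eta> x = a \<odot>\<^bsub>M\<^esub> \<eta> (basis_vec R {..<k} 0)"
    unfolding x_def by (rule lin_smult[OF \<eta> aR basis_vec_closed])
  moreover have "\<dots> = \<zero>\<^bsub>M\<^esub>" by (rule I_smult[OF a(1) lin_closed[OF \<eta> basis_vec_closed]])
  ultimately show False using a(2) by simp
qed

end

theorem theorem1p2:
  fixes R :: "('a, 'r) ring_scheme" and M :: "('a, 'b, 'm) module_scheme" and d :: nat
  assumes "local_noetherian_ring R"
    and "generically_gorenstein R"
    and "unmixed R"
    and "krull_dim R = enat d" and "d \<ge> 1"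
    and "module R M" and "fin_gen R M"
    and "horizontally_linked R M"
  shows "(Ass R M \<inter> Ass R (lambda_mod R M) = {}
           \<longleftrightarrow> geometrically_linked R (Ann R M) (Ann R (lambda_mod R M)))
       \<and> (geometrically_linked R (Ann R M) (Ann R (lambda_mod R M))
           \<longleftrightarrow> linked R (Ann R M) (Ann R (lambda_mod R M))
               \<and> zero_module (Tor R 1 M (lambda_mod R M)))
       \<and> (linked R (Ann R M) (Ann R (lambda_mod R M))
               \<and> zero_module (Tor R 1 M (lambda_mod R M))
           \<longleftrightarrow> is_free (R Quot (Ann R M)) (over_quot R M)
               \<and> zero_module (Ext R 1 M M))"
proof -
  have "comm_noetherian_ring R" "\<exists>!I. maximalideal I R"
    using assms(1) by (simp_all add: local_noetherian_ring_def comm_noetherian_ring_def)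
  then interpret local_noeth R by (rule local_noeth.intro[OF _ local_noeth_axioms.intro])
  note FF = free_module_is_module
  let ?N = "lambda_mod R M"
  obtain n e f where cov: "min_cover R M n e" and f: "f \<in> lin_maps R (free_rank R n) ?N"
    "f ` carrier (free_rank R n) = carrier ?N"
    and V: "a_kernel (free_rank R n) ?N f = perp n (a_kernel (free_rank R n) M e)" and N: "module R ?N"
    by (rule lambda_structure[OF assms(6,7)]) (rule that)
  note eD = min_coverD[OF cov]
  have fgN: "fin_gen R ?N" by (rule fin_gen_of_surj[OF N f])
  \<comment> \<open>By linkage \<open>M\<close> is isomorphic to \<open>lambda_mod R ?N\<close>,
    which lies in a free module. The resulting embedding of \<open>M\<close> makes the kernel of its
    cover equal to its double complement.\<close>
  obtain n' e' f' k where e': "min_cover R ?N n' e'" and f': "f' \<in> lin_maps R (free_rank R n') (lambda_mod R ?N)"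
    "f' ` carrier (free_rank R n') = carrier (lambda_mod R ?N)"
    and L: "module R (lambda_mod R ?N)" and incl: "(\<lambda>x. x) \<in> lin_maps R (lambda_mod R ?N) (free_rank R k)"
    by (rule lambda_structure[OF N fgN]) (rule that)
  obtain j where j: "j \<in> lin_maps R M (lambda_mod R ?N)" "bij_betw j (carrier M) (carrier (lambda_mod R ?N))"
    and M_nz: "\<not> zero_module M"
    using assms(8) unfolding horizontally_linked_def mod_iso_def by blast
  have U: "a_kernel (free_rank R n) M e = perp n (a_kernel (free_rank R n) ?N f)"
    unfolding V
    by (rule submodule_kernel_torsionless[OF assms(6) eD(1) lin_comp[OF j(1) incl]])
      (use j(2) in \<open>simp add: bij_betw_def\<close>)
  \<comment> \<open>A minimal cover of the zero module has rank zero. Then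
    \<open>lambda_mod R ?N\<close>, an image of that free module, would vanish, and \<open>M\<close>
    with it.\<close>
  have N_nz: "\<not> zero_module ?N"
  proof
    assume z: "zero_module ?N"
    have "n' = 0"
    proof (rule ccontr)
      assume "n' \<noteq> 0"
      have "e' (basis_vec R {..<n'} 0) = \<zero>\<^bsub>?N\<^esub>"
        using lin_closed[OF min_coverD(1)[OF e'] basis_vec_closed] z by (simp add: zero_module_def)
      from min_coverD(3)[OF e' basis_vec_closed this, of 0] show False
        using \<open>n' \<noteq> 0\<close> one_notin_mx by (simp add: basis_vec_def)
    qed
    then have "x = \<zero>\<^bsub>free_rank R n'\<^esub>" if "x \<in> carrier (free_rank R n')" for x
      using free_module_eqI[OF that submodule_mem(2)[OF submodule_carrier[OF FF] FF]] by simp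
    then have L0: "y = \<zero>\<^bsub>lambda_mod R ?N\<^esub>" if "y \<in> carrier (lambda_mod R ?N)" for y
      using that lin_zero[OF FF L f'(1)] unfolding f'(2)[symmetric] by auto
    interpret M: module R M by fact
    have "x = \<zero>\<^bsub>M\<^esub>" if "x \<in> carrier M" for x
      using L0[OF lin_closed[OF j(1) that]] L0[OF lin_closed[OF j(1) M.M.zero_closed]]
        inj_onD[OF bij_betw_imp_inj_on[OF j(2)] _ that M.M.zero_closed] by simp
    then have "carrier M = {\<zero>\<^bsub>M\<^esub>}" using M.M.zero_closed by blast
    then show False using M_nz by (simp add: zero_module_def)
  qed
  interpret linked_pair R n M ?N e f
    by (rule linked_pair.intro[OF local_noeth_axioms linked_pair_axioms.intro[OF assms(6) N eD(1,2) f V U M_nz N_nz assms(3)]])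
  show ?thesis
    \<comment> \<open>Each condition is equivalent to \<open>separated\<close>; the way back uses
      linkage together with Tor in one case, and freeness together with Ext in the other.\<close>
    using separated_iff_Ass separated_iff_geometrically_linked separated_linked separated_Tor[OF _ assms(7)]
      Tor_separated[OF assms(2,7)] separated_free separated_Ext[OF _ assms(7)] Ext_separated[OF cov assms(7)]
    by blast
qed

end
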